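(* Let $0<H<\frac12$ and $0<T<\infty$. Any fractional Brownian motion $B_H$ with exponent $H$ on the time interval $[0,T]$ can be represented by $\Lambda_HB$ for a real-valued standard Brownian motion $B$; that is, there is a standard Brownian motion $B$ such that $B_H(t)=(\Lambda_HB)(t)$, $0\le t\le T$, almost surely, where $$(\Lambda_HB)(t)=\int_0^t[B(t)-B(s)]\,\partial_sK_{H,1}(t,s)\,ds-\int_0^t\partial_sK_{H,2}(t,s)B(s)\,ds .$$
   Context: Fractional Brownian motion (FBM) with Hurst exponent $H\in(0,1)$ is the continuous zero mean Gaussian process with covariance $\mathbb{E}[B_H(t)B_H(s)]=\frac12[s^{2H}+t^{2H}-|t-s|^{2H}]$. Kernels: for $0<H<\frac12$ and $0<s<t$, $$K_{H,1}(t,s):=c_H t^{H-\frac12}s^{\frac12-H}(t-s)^{H-\frac12},\qquad K_{H,2}(t,s):=c_H\Big(\tfrac12-H\Big)s^{\frac12-H}\int_s^t u^{H-\frac32}(u-s)^{H-\frac12}du,$$ and $K_H:=K_{H,1}+K_{H,2}$, where $c_H>0$ is the constant for which $\int_0^tK_H(t,s)\,dB(s)$, $0\le t\le T$, is an FBM with exponent $H$ when $B$ is a standard Brownian motion. It is a well-known fact that any FBM with exponent $H$ on $[0,T]$ can be represented as $\int_0^tK_H(t,s)\,dB(s)$ for some standard Brownian motion $B$. With $\theta_H(t,s):=\int_1^{t/s}v^{H-\frac32}(v-1)^{H-\frac12}dv$ one has, for $0<s<t$, $$\partial_sK_{H,1}(t,s)=c_H\Big(\tfrac12-H\Big)\Big[t^{H-\frac12}s^{-\frac12-H}(t-s)^{H-\frac12}+t^{H-\frac12}s^{\frac12-H}(t-s)^{H-\frac32}\Big],$$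 $$\partial_sK_{H,2}(t,s)=c_H\Big(\tfrac12-H\Big)\Big[-t^{H-\frac12}s^{-\frac12-H}(t-s)^{H-\frac12}+\Big(H-\tfrac12\Big)s^{H-\frac32}\theta_H(t,s)\Big].$$ The operator $\Lambda_H$ is defined on functions $f:[0,T]\to\mathbb{R}$ with $f(0)=0$ that are Hölder continuous of order $\lambda$ for some $\frac12-H<\lambda<\frac12$, by the displayed formula with $f$ in place of $B$; it is applied pathwise to $B$. *)

theory Defs
  imports "HOL-Probability.Probability"
begin

(* Constants count as Gaussian, with variance zero: the value at time 0 of the processes below
   is degenerate. *)
definition gaussian_rv :: "'a measure \<Rightarrow> ('a \<Rightarrow> real) \<Rightarrow> bool" where
  "gaussian_rv M Y \<longleftrightarrow> Y \<in> borel_measurable M \<and>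
     ((\<exists>\<mu> \<sigma>. \<sigma> > 0 \<and> distributed M lborel Y (\<lambda>x. ennreal (normal_density \<mu> \<sigma> x))) \<or>
      (\<exists>\<mu>. AE \<omega> in M. Y \<omega> = \<mu>))"

definition gaussian_process :: "'a measure \<Rightarrow> real set \<Rightarrow> (real \<Rightarrow> 'a \<Rightarrow> real) \<Rightarrow> bool" where
  "gaussian_process M I X \<longleftrightarrow>
     (\<forall>F a. finite F \<longrightarrow> F \<subseteq> I \<longrightarrow> gaussian_rv M (\<lambda>\<omega>. \<Sum>t\<in>F. a t * X t \<omega>))"

(* Almost all paths are continuous; R is the covariance function.  Only the values X t with
   t in [0,T] matter. *)
definition centered_gaussian_process ::
  "'a measure \<Rightarrow> real \<Rightarrow> (real \<Rightarrow> real \<Rightarrow> real) \<Rightarrow> (real \<Rightarrow> 'a \<Rightarrow> real) \<Rightarrow> bool" where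
  "centered_gaussian_process M T R X \<longleftrightarrow>
     gaussian_process M {0..T} X \<and>
     (AE \<omega> in M. continuous_on {0..T} (\<lambda>t. X t \<omega>)) \<and>
     (\<forall>t\<in>{0..T}. (LINT \<omega>|M. X t \<omega>) = 0) \<and>
     (\<forall>s\<in>{0..T}. \<forall>t\<in>{0..T}. (LINT \<omega>|M. X t \<omega> * X s \<omega>) = R t s)"

definition fractional_brownian_motion ::
  "'a measure \<Rightarrow> real \<Rightarrow> real \<Rightarrow> (real \<Rightarrow> 'a \<Rightarrow> real) \<Rightarrow> bool" where
  "fractional_brownian_motion M H T X \<longleftrightarrow>
     centered_gaussian_process M T
       (\<lambda>t s. (s powr (2 * H) + t powr (2 * H) - \<bar>t - s\<bar> powr (2 * H)) / 2) X"

definition standard_brownian_motion ::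
  "'a measure \<Rightarrow> real \<Rightarrow> (real \<Rightarrow> 'a \<Rightarrow> real) \<Rightarrow> bool" where
  "standard_brownian_motion M T B \<longleftrightarrow> centered_gaussian_process M T (\<lambda>t s. min t s) B"

lemma standard_brownian_motion_eq_fbm:
  "standard_brownian_motion M T B \<longleftrightarrow> fractional_brownian_motion M (1/2) T B"
proof -
  have "(s powr (2 * (1/2)) + t powr (2 * (1/2)) - \<bar>t - s\<bar> powr (2 * (1/2))) / 2 = min t s"
    if "s \<in> {0..T}" "t \<in> {0..T}" for s t :: real
    using that by (auto simp: min_def abs_if)
  then show ?thesis
    unfolding standard_brownian_motion_def fractional_brownian_motion_def
      centered_gaussian_process_def by simp
qed

(* Y is (a version of) the integral over [0,t] of the deterministic function f with respect to B:
   the limit in mean square of the elementary integrals of step functions that converge to f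
   in the space of square integrable functions on [0,t]. *)
definition has_wiener_integral ::
  "'a measure \<Rightarrow> (real \<Rightarrow> 'a \<Rightarrow> real) \<Rightarrow> real \<Rightarrow> (real \<Rightarrow> real) \<Rightarrow> ('a \<Rightarrow> real) \<Rightarrow> bool" where
  "has_wiener_integral M B t f Y \<longleftrightarrow>
     set_borel_measurable lborel {0..t} f \<and> Y \<in> borel_measurable M \<and>
     (\<exists>(k :: nat \<Rightarrow> nat) (a :: nat \<Rightarrow> nat \<Rightarrow> real) (u :: nat \<Rightarrow> nat \<Rightarrow> real).
        (\<forall>n. \<forall>i\<le>k n. u n i \<in> {0..t}) \<and>
        (\<forall>n. \<forall>i<k n. u n i \<le> u n (Suc i)) \<and>
        (\<lambda>n. \<integral>\<^sup>+ s\<in>{0..t}.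
              ennreal ((f s - (\<Sum>i<k n. a n i * indicator {u n i<..u n (Suc i)} s))\<^sup>2) \<partial>lborel)
          \<longlonglongrightarrow> 0 \<and>
        (\<lambda>n. \<integral>\<^sup>+ \<omega>.
              ennreal ((Y \<omega> - (\<Sum>i<k n. a n i * (B (u n (Suc i)) \<omega> - B (u n i) \<omega>)))\<^sup>2) \<partial>M)
          \<longlonglongrightarrow> 0)"

(* The two parts of the kernel with an arbitrary constant c in place of c_H. *)
definition kernel1 :: "real \<Rightarrow> real \<Rightarrow> real \<Rightarrow> real \<Rightarrow> real" where
  "kernel1 c H t s = c * t powr (H - 1/2) * s powr (1/2 - H) * (t - s) powr (H - 1/2)"

definition kernel2 :: "real \<Rightarrow> real \<Rightarrow> real \<Rightarrow> real \<Rightarrow> real" where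
  "kernel2 c H t s = c * (1/2 - H) * s powr (1/2 - H) *
     (LBINT u:{s<..<t}. u powr (H - 3/2) * (u - s) powr (H - 1/2))"

(* The constant c_H.  The Wiener integral fixes X t only up to null sets for each t, so
   "is a fractional Brownian motion" means that some version of the process is one.  The sample
   space nat => real is rich enough to carry a Brownian motion, so the condition is not vacuous. *)
definition fbm_const :: "real \<Rightarrow> real" where
  "fbm_const H = (THE c. c > 0 \<and>
     (\<forall>T>0. \<forall>(M :: (nat \<Rightarrow> real) measure) B.
        prob_space M \<longrightarrow> standard_brownian_motion M T B \<longrightarrow>
        (\<exists>X. fractional_brownian_motion M H T X \<and>
             (\<forall>t\<in>{0..T}. has_wiener_integral M B t (\<lambda>s. kernel1 c H t s + kernel2 c H t s) (X t)))))"

definition K1 :: "real \<Rightarrow> real \<Rightarrow> real \<Rightarrow> real" where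
  "K1 H = kernel1 (fbm_const H) H"

definition K2 :: "real \<Rightarrow> real \<Rightarrow> real \<Rightarrow> real" where
  "K2 H = kernel2 (fbm_const H) H"

definition holder_on :: "real \<Rightarrow> real set \<Rightarrow> (real \<Rightarrow> real) \<Rightarrow> bool" where
  "holder_on \<alpha> S f \<longleftrightarrow> (\<exists>C. \<forall>x\<in>S. \<forall>y\<in>S. \<bar>f x - f y\<bar> \<le> C * \<bar>x - y\<bar> powr \<alpha>)"

definition Lambda_dom :: "real \<Rightarrow> real \<Rightarrow> (real \<Rightarrow> real) set" where
  "Lambda_dom H T = {f. f 0 = 0 \<and> (\<exists>\<alpha>. 1/2 - H < \<alpha> \<and> \<alpha> < 1/2 \<and> holder_on \<alpha> {0..T} f)}"

(* For f in the domain both integrals converge absolutely. *)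
definition Lambda :: "real \<Rightarrow> (real \<Rightarrow> real) \<Rightarrow> real \<Rightarrow> real" where
  "Lambda H f t =
     (LBINT s:{0<..<t}. (f t - f s) * deriv (\<lambda>s. K1 H t s) s) -
     (LBINT s:{0<..<t}. deriv (\<lambda>s. K2 H t s) s * f s)"

end

theory Submission
  imports Defs
begin

text \<open>
  Put \<open>a = 1/2 - H\<close> and let \<open>L\<close> and \<open>k\<close> be \<open>\<Lambda>\<^sub>H\<close> and \<open>K\<^sub>H\<close> without the factor \<open>c\<^sub>H\<close>. Integration by
  parts turns \<open>L f t\<close> into the integral of \<open>f' u * k t u\<close> for absolutely continuous \<open>f\<close>. The
  operator \<open>L\<close> has an explicit right inverse \<open>A0\<close>, a difference of two weighted averages of the values
  \<open>g (t * x)\<close>, \<open>0 < x < 1\<close>: for absolutely continuous \<open>g\<close> the identity \<open>L (A0 g) = g\<close> follows from Fubini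
  and Beta integrals. Both operators are homogeneous under scaling and hence compatible with
  the formation of running means. A continuous path \<open>g\<close> with \<open>g s = O(s powr \<delta>)\<close> has an absolutely continuous running
  mean, so that \<open>L (A0 g)\<close> and \<open>g\<close> have the same running means and therefore agree, as soon as \<open>A0 g\<close>
  is Hoelder continuous of an order above \<open>a\<close>.

  For a fractional Brownian motion \<open>X\<close> the process \<open>B = A0 X / c\<^sub>H\<close> is Gaussian with continuous paths, and
  its covariance is \<open>min t s\<close> because \<open>A0\<close> maps \<open>s \<mapsto> k s u\<close> to the indicator of \<open>u < t\<close> and the
  integral of \<open>k s u * k t u\<close> over \<open>u\<close> is a multiple of the covariance of \<open>X\<close>. Kolmogorov's criterion provides
  the Hoelder continuity, so that \<open>\<Lambda>\<^sub>H B = L (A0 X) = X\<close>.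

  It remains to identify \<open>c\<^sub>H\<close>. For a Brownian motion \<open>B\<close> the process \<open>L B\<close> is the Wiener integral of \<open>k\<close>,
  which shows that \<open>1 / sqrt kappa\<close> has the defining property; the isometry shows that no other
  constant has it, applied to the Brownian motion just constructed, after the sample space has been mapped
  to \<open>nat \<Rightarrow> real\<close> by evaluation at rational times.
\<close>

section \<open>Beta integrals\<close>

text \<open>The obstacle is that \<open>D1 t s\<close>, which behaves like
  \<open>(t - s) powr (- a - 1)\<close> at \<open>t\<close>, is not integrable. Hence
  \<open>L f\<close> exists only through Hoelder regularity of \<open>f\<close>, and Fubini cannot
  be applied to \<open>L (A0 X)\<close> on a single path of \<open>X\<close>. Running means remove
  the roughness, and homogeneity returns from the means to the path. The analytic identities are
  computed in extended nonnegative integrals, where an exchange of integrals needs only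
  measurability; signed functions enter as differences of increasing ones. The inverse originates in
  a relation between the two parts of the kernel: \<open>kb\<close> is a weighted mean in time of
  \<open>k\<close> itself, so \<open>ka\<close> is \<open>k\<close> minus a mean of
  \<open>k\<close>, and \<open>ka\<close> is inverted by a Beta integral. The covariance identity,
  and with it \<open>kappa\<close>, comes from a second description of \<open>k t u\<close>: up to
  the factor \<open>u powr a\<close> it is a fractional integral over \<open>x < u\<close> of
  \<open>x powr a * (x powr (- 2 * a) + (t - x) powr (- 2 * a))\<close>. Integration against
  \<open>k s u\<close> inverts that fractional integral, and an elementary integral remains.\<close>

lemma LINT_Beta:
  fixes p q :: real
  assumes "0 < p" "0 < q"
  shows "set_integrable lborel {0<..<1} (\<lambda>x. x powr (p - 1) * (1 - x) powr (q - 1))"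
    and "(LBINT x:{0<..<1}. x powr (p - 1) * (1 - x) powr (q - 1)) = Beta p q"
    and "(\<integral>\<^sup>+x\<in>{0<..<1}. ennreal (x powr (p - 1) * (1 - x) powr (q - 1)) \<partial>lborel) = ennreal (Beta p q)"
proof -
  let ?f = "\<lambda>x::real. x powr (p - 1) * (1 - x) powr (q - 1)"
  have hi: "(?f has_integral Beta p q) {0<..<1}"
    using has_integral_Beta_real[OF assms] by (simp add: has_integral_Icc_iff_Ioo)
  have nn: "0 \<le> Beta p q"
    by (rule has_integral_nonneg[OF hi]) auto
  have "(\<integral>\<^sup>+x. ennreal (?f x * indicator {0<..<1} x) \<partial>lborel) = ennreal (Beta p q)"
  proof (rule nn_integral_has_integral_lborel)
    show "((\<lambda>x. ?f x * indicator {0<..<1} x) has_integral Beta p q) UNIV"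
      using has_integral_restrict_UNIV[THEN iffD2, OF hi]
      by (rule has_integral_eq[rotated]) auto
  qed auto
  then show nnI: "(\<integral>\<^sup>+x\<in>{0<..<1}. ennreal (?f x) \<partial>lborel) = ennreal (Beta p q)"
    by (simp add: ennreal_mult' ennreal_indicator mult.commute)
  have "has_bochner_integral lborel (\<lambda>x. ?f x * indicator {0<..<1} x) (Beta p q)"
    by (rule has_bochner_integral_nn_integral)
      (use nnI nn in \<open>auto simp: ennreal_mult' ennreal_indicator mult.commute\<close>)
  then show "set_integrable lborel {0<..<1} ?f" "(LBINT x:{0<..<1}. ?f x) = Beta p q"
    unfolding set_integrable_def set_lebesgue_integral_def
    by (auto simp: has_bochner_integral_iff mult.commute)
qed

lemma Beta_pos:
  fixes p q :: real
  assumes "0 < p" "0 < q"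
  shows "0 < Beta p q"
  using assms by (simp add: Beta_def Gamma_real_pos)

lemma nn_set_integral_eq:
  fixes f :: "real \<Rightarrow> real"
  assumes "set_integrable lborel S f" "\<And>x. x \<in> S \<Longrightarrow> 0 \<le> f x"
  shows "(\<integral>\<^sup>+x\<in>S. ennreal (f x) \<partial>lborel) = ennreal (LBINT x:S. f x)"
proof -
  have "(\<integral>\<^sup>+x\<in>S. ennreal (f x) \<partial>lborel) = (\<integral>\<^sup>+x. ennreal (indicator S x *\<^sub>R f x) \<partial>lborel)"
    by (rule nn_integral_cong) (auto split: split_indicator)
  also have "\<dots> = ennreal (LINT x|lborel. indicator S x *\<^sub>R f x)"
    using assms by (intro nn_integral_eq_integral)
      (auto simp: set_integrable_def split: split_indicator)
  finally show ?thesis by (simp add: set_lebesgue_integral_def)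
qed

text \<open>The way back from extended nonnegative integrals: the kernel identities are computed
  there, and a finite value then yields Bochner integrability together with the real value.\<close>

lemma set_integral_eq_nn:
  fixes f :: "real \<Rightarrow> real"
  assumes "(\<lambda>x. indicator S x * f x) \<in> borel_measurable borel" "\<And>x. x \<in> S \<Longrightarrow> 0 \<le> f x"
    and "(\<integral>\<^sup>+x\<in>S. ennreal (f x) \<partial>lborel) = ennreal r" "0 \<le> r"
  shows "set_integrable lborel S f" "(LBINT x:S. f x) = r"
proof -
  have "(\<integral>\<^sup>+x. ennreal (indicator S x * f x) \<partial>lborel) = (\<integral>\<^sup>+x\<in>S. ennreal (f x) \<partial>lborel)"
    by (rule nn_integral_cong) (auto split: split_indicator)
  then have "has_bochner_integral lborel (\<lambda>x. indicator S x * f x) r"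
    using assms by (intro has_bochner_integral_nn_integral) (auto split: split_indicator)
  then show "set_integrable lborel S f" "(LBINT x:S. f x) = r"
    unfolding set_integrable_def set_lebesgue_integral_def
    by (auto simp: has_bochner_integral_iff)
qed

text \<open>Only one-sided limits of \<open>F\<close> are demanded, which leaves room for integrands
  that blow up at an end point.\<close>

lemma FTC_nonneg_Ioo:
  fixes F f :: "real \<Rightarrow> real"
  assumes "a < b"
    and "\<And>x. a < x \<Longrightarrow> x < b \<Longrightarrow> (F has_real_derivative f x) (at x)"
    and "\<And>x. a < x \<Longrightarrow> x < b \<Longrightarrow> isCont f x"
    and "\<And>x. a < x \<Longrightarrow> x < b \<Longrightarrow> 0 \<le> f x"
    and "(F \<longlongrightarrow> A) (at_right a)" "(F \<longlongrightarrow> B) (at_left b)"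
  shows "set_integrable lborel {a<..<b} f" "(LBINT x:{a<..<b}. f x) = B - A"
    and "(\<integral>\<^sup>+x\<in>{a<..<b}. ennreal (f x) \<partial>lborel) = ennreal (B - A)"
proof -
  have A: "((F \<circ> real_of_ereal) \<longlongrightarrow> A) (at_right (ereal a))"
    using assms(5) unfolding at_right_ereal ereal_tendsto_simps
    by (simp add: filterlim_filtermap comp_def)
  have B: "((F \<circ> real_of_ereal) \<longlongrightarrow> B) (at_left (ereal b))"
    using assms(6) by (simp add: ereal_tendsto_simps)
  have *: "set_integrable lborel (einterval (ereal a) (ereal b)) f"
    "(LBINT x=ereal a..ereal b. f x) = B - A"
    using interval_integral_FTC_nonneg[of "ereal a" "ereal b" F f A B] assms A B by auto
  show 1: "set_integrable lborel {a<..<b} f" using *(1) by simp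
  show 2: "(LBINT x:{a<..<b}. f x) = B - A"
    using *(2) \<open>a < b\<close> by (simp add: interval_lebesgue_integral_def)
  show "(\<integral>\<^sup>+x\<in>{a<..<b}. ennreal (f x) \<partial>lborel) = ennreal (B - A)"
    using nn_set_integral_eq[OF 1] 2 assms by auto
qed

lemma nn_integral_Icc_Ioo:
  fixes f :: "real \<Rightarrow> ennreal"
  shows "(\<integral>\<^sup>+x. f x * indicator {a..b} x \<partial>lborel) = (\<integral>\<^sup>+x. f x * indicator {a<..<b} x \<partial>lborel)"
proof (rule nn_integral_cong_AE)
  have "AE x in lborel. x \<noteq> a \<and> x \<noteq> b"
    using AE_lborel_singleton[of a] AE_lborel_singleton[of b] by eventually_elim auto
  then show "AE x in lborel. f x * indicator {a..b} x = f x * indicator {a<..<b} x"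
    by eventually_elim (auto split: split_indicator)
qed

lemma nn_substitution_Ioo:
  fixes f g g' :: "real \<Rightarrow> real"
  assumes "a < b"
    and "\<And>x. a \<le> x \<Longrightarrow> x \<le> b \<Longrightarrow> (g has_real_derivative g' x) (at x)"
    and "continuous_on {a..b} g'"
    and "\<And>x. a \<le> x \<Longrightarrow> x \<le> b \<Longrightarrow> 0 \<le> g' x"
    and [measurable]: "f \<in> borel_measurable borel"
    and "c = g a" "d = g b"
  shows "(\<integral>\<^sup>+y\<in>{c<..<d}. ennreal (f y) \<partial>lborel) =
         (\<integral>\<^sup>+x\<in>{a<..<b}. ennreal (f (g x) * g' x) \<partial>lborel)"
proof -
  have "(\<integral>\<^sup>+x. f x * indicator {g a..g b} x \<partial>lborel) =
             (\<integral>\<^sup>+x. f (g x) * g' x * indicator {a..b} x \<partial>lborel)"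
    using assms(1-4) by (intro nn_integral_substitution) (auto simp: set_borel_measurable_def)
  moreover have "ennreal (v * indicator S x) = ennreal v * indicator S x" for v x and S :: "real set"
    by (auto split: split_indicator)
  ultimately show ?thesis
    using assms(6,7) by (simp add: nn_integral_Icc_Ioo)
qed

lemma nn_scale_Ioo:
  fixes f :: "real \<Rightarrow> ennreal"
  assumes "0 < c" and [measurable]: "f \<in> borel_measurable borel"
  shows "(\<integral>\<^sup>+y\<in>{c*p<..<c*q}. f y \<partial>lborel) = ennreal c * (\<integral>\<^sup>+x\<in>{p<..<q}. f (c * x) \<partial>lborel)"
proof -
  have "(\<integral>\<^sup>+y\<in>{c*p<..<c*q}. f y \<partial>lborel)
      = \<bar>c\<bar> * (\<integral>\<^sup>+x. f (0 + c * x) * indicator {c*p<..<c*q} (0 + c * x) \<partial>lborel)"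
    using assms by (intro nn_integral_real_affine) auto
  also have "\<dots> = ennreal c * (\<integral>\<^sup>+x\<in>{p<..<q}. f (c * x) \<partial>lborel)"
    using assms by (auto intro!: arg_cong[where f="\<lambda>x. ennreal c * x"] nn_integral_cong split: split_indicator)
  finally show ?thesis .
qed

lemma nn_beta_interval:
  fixes p q u v :: real
  assumes "0 < p" "0 < q" "u < v"
  shows "(\<integral>\<^sup>+x\<in>{u<..<v}. ennreal ((x - u) powr (p - 1) * (v - x) powr (q - 1)) \<partial>lborel)
       = ennreal (Beta p q * (v - u) powr (p + q - 1))"
proof -
  have "ennreal (Beta p q * (v - u) powr (p + q - 1)) =
      ennreal ((v - u) powr (p + q - 1)) * (\<integral>\<^sup>+x\<in>{0<..<1}. ennreal (x powr (p - 1) * (1 - x) powr (q - 1)) \<partial>lborel)"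
    using Beta_pos[OF assms(1,2)] by (subst LINT_Beta(3)[OF assms(1,2)]) (simp add: ennreal_mult mult_ac)
  also have "(\<integral>\<^sup>+x\<in>{0<..<1}. ennreal (x powr (p - 1) * (1 - x) powr (q - 1)) \<partial>lborel) =
      (\<integral>\<^sup>+x\<in>{u<..<v}. ennreal ((((x - u)/(v - u)) powr (p - 1) * (1 - (x - u)/(v - u)) powr (q - 1)) * (1 / (v - u))) \<partial>lborel)"
    using assms by (intro nn_substitution_Ioo) (auto intro!: derivative_eq_intros continuous_intros)
  also have "ennreal ((v - u) powr (p + q - 1)) * \<dots> =
     (\<integral>\<^sup>+x\<in>{u<..<v}. ennreal ((v - u) powr (p + q - 1)) * ennreal ((((x - u)/(v - u)) powr (p - 1) * (1 - (x - u)/(v - u)) powr (q - 1)) * (1 / (v - u))) \<partial>lborel)"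
    by (subst nn_integral_cmult[symmetric]) (auto simp: mult.assoc)
  also have "\<dots> = (\<integral>\<^sup>+x\<in>{u<..<v}. ennreal ((x - u) powr (p - 1) * (v - x) powr (q - 1)) \<partial>lborel)"
  proof (rule nn_integral_cong)
    fix x :: real
    have "(v - u) powr (p + q - 1) * ((((x - u)/(v - u)) powr (p - 1) * (1 - (x - u)/(v - u)) powr (q - 1)) * (1 / (v - u)))
        = (x - u) powr (p - 1) * (v - x) powr (q - 1)" if "u < x" "x < v"
    proof -
      have 1: "1 - (x - u)/(v - u) = (v - x) / (v - u)" using assms by (simp add: field_simps)
      have 2: "(v - u) powr (p + q - 1) = (v - u) powr (p - 1) * (v - u) powr (q - 1) * (v - u)"
        using assms powr_add[of "v - u" "p - 1" "q - 1"] powr_add[of "v - u" "p - 1 + (q - 1)" 1]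
        by (simp add: algebra_simps)
      show ?thesis unfolding 1 2 using that assms by (simp add: powr_divide field_simps)
    qed
    then show "ennreal ((v - u) powr (p + q - 1)) * ennreal ((((x - u)/(v - u)) powr (p - 1) * (1 - (x - u)/(v - u)) powr (q - 1)) * (1 / (v - u))) * indicator {u<..<v} x
       = ennreal ((x - u) powr (p - 1) * (v - x) powr (q - 1)) * indicator {u<..<v} x"
      by (auto split: split_indicator simp flip: ennreal_mult')
  qed
  finally show ?thesis by simp
qed

text \<open>The three exponents add up to \<open>- 2\<close>, so the integrand is compatible with
  Moebius maps. The map \<open>x * (t - s) / (s * (t - x))\<close> fixes \<open>0\<close>, sends
  \<open>s\<close> to \<open>1\<close> and \<open>t\<close> to infinity, and thereby turns the three
  factors into the two of a Beta integral.\<close>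

lemma nn_beta_moebius:
  fixes p q s t :: real
  assumes "0 < p" "0 < q" "0 < s" "s < t"
  shows "(\<integral>\<^sup>+x\<in>{0<..<s}. ennreal (x powr (p - 1) * (s - x) powr (q - 1) * (t - x) powr (- p - q)) \<partial>lborel)
       = ennreal (Beta p q * s powr (p + q - 1) * t powr (- q) * (t - s) powr (- p))"
proof -
  let ?g = "\<lambda>x. x * (t - s) / (s * (t - x))"
  let ?g' = "\<lambda>x. (t - s) * t / (s * (t - x)\<^sup>2)"
  let ?c = "s powr (p + q - 1) * t powr (- q) * (t - s) powr (- p)"
  let ?f = "\<lambda>x. x powr (p - 1) * (1 - x) powr (q - 1)"
  have "ennreal (Beta p q * s powr (p + q - 1) * t powr (- q) * (t - s) powr (- p)) =
      ennreal ?c * (\<integral>\<^sup>+x\<in>{0<..<1}. ennreal (?f x) \<partial>lborel)"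
    using Beta_pos[OF assms(1,2)] by (subst LINT_Beta(3)[OF assms(1,2)]) (simp add: ennreal_mult mult_ac)
  also have "(\<integral>\<^sup>+x\<in>{0<..<1}. ennreal (?f x) \<partial>lborel) =
      (\<integral>\<^sup>+x\<in>{0<..<s}. ennreal (?f (?g x) * ?g' x) \<partial>lborel)"
  proof (rule nn_substitution_Ioo)
    fix x assume x: "0 \<le> x" "x \<le> s"
    have "((\<lambda>x. x * (t - s) / (s * (t - x))) has_real_derivative
        ((t - s) * (s * (t - x)) - x * (t - s) * (- s)) / (s * (t - x))\<^sup>2) (at x)"
      using x assms by (auto intro!: derivative_eq_intros simp: power2_eq_square)
    also have "((t - s) * (s * (t - x)) - x * (t - s) * (- s)) / (s * (t - x))\<^sup>2 = ?g' x"
      using x assms by (simp add: divide_simps) (simp add: algebra_simps power2_eq_square)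
    finally show "(?g has_real_derivative ?g' x) (at x)" .
    show "0 \<le> ?g' x" using x assms by auto
  next
    show "continuous_on {0..s} ?g'" using assms by (auto intro!: continuous_intros)
  qed (use assms in auto)
  also have "ennreal ?c * \<dots> = (\<integral>\<^sup>+x\<in>{0<..<s}. ennreal ?c * ennreal (?f (?g x) * ?g' x) \<partial>lborel)"
    by (subst nn_integral_cmult[symmetric]) (auto simp: mult.assoc)
  also have "\<dots> = (\<integral>\<^sup>+x\<in>{0<..<s}. ennreal (x powr (p - 1) * (s - x) powr (q - 1) * (t - x) powr (- p - q)) \<partial>lborel)"
  proof (rule nn_integral_cong)
    fix x :: real
    have "?c * (?f (?g x) * ?g' x) = x powr (p - 1) * (s - x) powr (q - 1) * (t - x) powr (- p - q)" if x: "0 < x" "x < s"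
    proof -
      have 1: "1 - ?g x = t * (s - x) / (s * (t - x))" using x assms by (simp add: field_simps)
      have pos: "0 < t - x" "0 < t - s" "0 < s - x" "0 < t" using x assms by auto
      \<comment> \<open>Every factor is written as an exponential of logarithms, which turns the
        identity between powers into a linear identity between exponents.\<close>
      have 2: "?g' x = exp (ln (t - s) + ln t - ln s - 2 * ln (t - x))"
      proof -
        have "ln (?g' x) = ln (t - s) + ln t - ln s - 2 * ln (t - x)"
          using pos assms by (simp add: ln_mult ln_div ln_realpow)
        moreover have "0 < ?g' x" using pos assms by simp
        ultimately show ?thesis by (metis exp_ln)
      qed
      have 3: "?g x powr (p - 1) = exp ((p - 1) * (ln x + ln (t - s) - ln s - ln (t - x)))"
        using pos assms x by (simp add: powr_def ln_mult ln_div)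
      have 4: "(t * (s - x) / (s * (t - x))) powr (q - 1) = exp ((q - 1) * (ln t + ln (s - x) - ln s - ln (t - x)))"
        using pos assms x by (simp add: powr_def ln_mult ln_div)
      have 5: "y powr r = exp (r * ln y)" if "0 < y" for y r :: real
        using that by (simp add: powr_def)
      show ?thesis
        unfolding 1 2 3 4 5[OF pos(1)] 5[OF pos(2)] 5[OF pos(3)] 5[OF pos(4)] 5[OF x(1)] 5[OF assms(3)]
          mult_exp_exp
        by (rule arg_cong[where f=exp]) (simp add: algebra_simps)
    qed
    then show "ennreal ?c * ennreal (?f (?g x) * ?g' x) * indicator {0<..<s} x
       = ennreal (x powr (p - 1) * (s - x) powr (q - 1) * (t - x) powr (- p - q)) * indicator {0<..<s} x"
      using assms by (auto split: split_indicator simp flip: ennreal_mult')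
  qed
  finally show ?thesis by simp
qed

text \<open>Both sides integrate over the triangle \<open>p < y < x < q\<close>, the shape that
  arises because all kernels here vanish on one side of the diagonal.\<close>

lemma nn_triangle:
  fixes F :: "real \<Rightarrow> real \<Rightarrow> ennreal"
  assumes [measurable]: "case_prod F \<in> borel_measurable (borel \<Otimes>\<^sub>M borel)"
  shows "(\<integral>\<^sup>+x\<in>{p<..<q}. (\<integral>\<^sup>+y\<in>{p<..<x}. F x y \<partial>lborel) \<partial>lborel)
       = (\<integral>\<^sup>+y\<in>{p<..<q}. (\<integral>\<^sup>+x\<in>{y<..<q}. F x y \<partial>lborel) \<partial>lborel)"
proof -
  have "(\<integral>\<^sup>+x\<in>{p<..<q}. (\<integral>\<^sup>+y\<in>{p<..<x}. F x y \<partial>lborel) \<partial>lborel)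
     = (\<integral>\<^sup>+x. (\<integral>\<^sup>+y. F x y * (if p < y \<and> y < x \<and> x < q then 1 else 0) \<partial>lborel) \<partial>lborel)"
    by (subst nn_integral_multc[symmetric], measurable)
       (auto intro!: nn_integral_cong split: split_indicator)
  also have "\<dots> = (\<integral>\<^sup>+y. (\<integral>\<^sup>+x. F x y * (if p < y \<and> y < x \<and> x < q then 1 else 0) \<partial>lborel) \<partial>lborel)"
    by (rule lborel_pair.Fubini'[symmetric]) measurable
  also have "\<dots> = (\<integral>\<^sup>+y\<in>{p<..<q}. (\<integral>\<^sup>+x\<in>{y<..<q}. F x y \<partial>lborel) \<partial>lborel)"
    by (subst nn_integral_multc[symmetric], measurable)
       (auto intro!: nn_integral_cong split: split_indicator)
  finally show ?thesis .
qed

text \<open>The incomplete Beta function. For \<open>z < 1\<close> the parameter \<open>q\<close>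
  may be zero or negative; the value \<open>q = 0\<close> occurs in the weight
  \<open>w2\<close>.\<close>

definition ibeta :: "real \<Rightarrow> real \<Rightarrow> real \<Rightarrow> real" where
  "ibeta p q z = (LBINT y:{0<..<z}. y powr (p - 1) * (1 - y) powr (q - 1))"

lemma ibeta_integrable:
  fixes p q z :: real
  assumes "0 < p" "z < 1 \<or> (z \<le> 1 \<and> 0 < q)"
  shows "set_integrable lborel {0<..<z} (\<lambda>y. y powr (p - 1) * (1 - y) powr (q - 1))"
proof (cases "0 < q")
  case True
  then show ?thesis using assms
    by (intro set_integrable_subset[OF LINT_Beta(1)[of p q]]) auto
next
  case False
  then have z: "z < 1" using assms by auto
  \<comment> \<open>For \<open>q \<le> 0\<close> the second factor is bounded by its value at
    \<open>z\<close>. The factor \<open>(1 - y) powr (1 - 1)\<close> is kept so that the bound is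
    literally a Beta integrand with second parameter \<open>1\<close>.\<close>
  have "set_integrable lborel {0<..<z} (\<lambda>y. (1 - z) powr (q - 1) * (y powr (p - 1) * (1 - y) powr (1 - 1)))"
    using z assms by (intro set_integrable_mult_right set_integrable_subset[OF LINT_Beta(1)[of p 1]]) auto
  then show ?thesis
  proof (rule set_integrable_bound)
    show "set_borel_measurable lborel {0<..<z} (\<lambda>y. y powr (p - 1) * (1 - y) powr (q - 1))"
      by (auto simp: set_borel_measurable_def)
    show "AE x in lborel. x \<in> {0<..<z} \<longrightarrow>
        norm (x powr (p - 1) * (1 - x) powr (q - 1))
        \<le> norm ((1 - z) powr (q - 1) * (x powr (p - 1) * (1 - x) powr (1 - 1)))"
    proof (rule AE_I2, rule impI)
      fix x assume "x \<in> {0<..<z}"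
      then have "(1 - x) powr (q - 1) \<le> (1 - z) powr (q - 1)"
        using z False by (intro powr_mono2') auto
      with \<open>x \<in> _\<close> z show "norm (x powr (p - 1) * (1 - x) powr (q - 1))
        \<le> norm ((1 - z) powr (q - 1) * (x powr (p - 1) * (1 - x) powr (1 - 1)))"
        by (simp add: abs_mult mult.commute mult_left_mono)
    qed
  qed
qed

lemma ibeta_nonneg: "0 \<le> ibeta p q z"
  unfolding ibeta_def set_lebesgue_integral_def by (intro Bochner_Integration.integral_nonneg) auto

lemma ibeta_nn:
  assumes "0 < p" "z < 1 \<or> (z \<le> 1 \<and> 0 < q)"
  shows "(\<integral>\<^sup>+y\<in>{0<..<z}. ennreal (y powr (p - 1) * (1 - y) powr (q - 1)) \<partial>lborel) = ennreal (ibeta p q z)"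
  using nn_set_integral_eq[OF ibeta_integrable[OF assms]] by (simp add: ibeta_def)

lemma ibeta_1: "0 < p \<Longrightarrow> 0 < q \<Longrightarrow> ibeta p q 1 = Beta p q"
  by (simp add: ibeta_def LINT_Beta)

lemma ibeta_le_Beta:
  assumes "0 < p" "0 < q" "z \<le> 1"
  shows "ibeta p q z \<le> Beta p q"
proof -
  have "ennreal (ibeta p q z) \<le> ennreal (Beta p q)"
    unfolding ibeta_nn[symmetric, of p z q, OF assms(1) disjI2[OF conjI[OF assms(3,2)]]] LINT_Beta(3)[OF assms(1,2), symmetric]
    using assms by (intro nn_integral_mono) (auto split: split_indicator)
  then show ?thesis using Beta_pos[OF assms(1,2)] by (simp add: ennreal_le_iff2)
qed

lemma ibeta_eq_integral:
  assumes "0 < p" "z < 1 \<or> (z \<le> 1 \<and> 0 < q)"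
  shows "(\<lambda>y. y powr (p - 1) * (1 - y) powr (q - 1)) integrable_on {0..z}"
    and "ibeta p q z = integral {0..z} (\<lambda>y. y powr (p - 1) * (1 - y) powr (q - 1))"
proof -
  have *: "((\<lambda>y. y powr (p - 1) * (1 - y) powr (q - 1)) has_integral ibeta p q z) {0<..<z}"
    unfolding ibeta_def has_integral_iff
    using set_borel_integral_eq_integral[OF ibeta_integrable[OF assms]] by simp
  then have "((\<lambda>y. y powr (p - 1) * (1 - y) powr (q - 1)) has_integral ibeta p q z) {0..z}"
    by (simp add: has_integral_Icc_iff_Ioo)
  then show "(\<lambda>y. y powr (p - 1) * (1 - y) powr (q - 1)) integrable_on {0..z}"
    "ibeta p q z = integral {0..z} (\<lambda>y. y powr (p - 1) * (1 - y) powr (q - 1))"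
    by (auto simp: has_integral_iff)
qed

lemma ibeta_continuous:
  assumes "0 < p" "z < 1 \<or> (z \<le> 1 \<and> 0 < q)"
  shows "continuous_on {0..z} (ibeta p q)"
proof -
  have "continuous_on {0..z} (\<lambda>x. integral {0..x} (\<lambda>y. y powr (p - 1) * (1 - y) powr (q - 1)))"
    by (rule indefinite_integral_continuous_1[OF ibeta_eq_integral(1)[OF assms]])
  then show ?thesis
    by (rule continuous_on_eq) (use assms in \<open>auto simp: ibeta_eq_integral(2)\<close>)
qed

lemma ibeta_tendsto_1:
  assumes "0 < p" "0 < q"
  shows "(ibeta p q \<longlongrightarrow> Beta p q) (at_left 1)"
proof -
  have "continuous_on {0..1} (ibeta p q)" using assms by (intro ibeta_continuous) auto
  then have "(ibeta p q \<longlongrightarrow> ibeta p q 1) (at 1 within {0..1})" by (auto simp: continuous_on_def)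
  then show ?thesis using assms by (simp add: at_within_Icc_at_left ibeta_1)
qed

lemma ibeta_deriv:
  assumes "0 < p" "0 < z" "z < 1"
  shows "(ibeta p q has_real_derivative z powr (p - 1) * (1 - z) powr (q - 1)) (at z)"
proof -
  \<comment> \<open>On \<open>{0..b}\<close> with \<open>b < 1\<close> the integrand is integrable
    for every \<open>q\<close>, so the primitive can be differentiated there without a condition on
    \<open>q\<close>.\<close>
  obtain b where b: "z < b" "b < 1" using assms dense by blast
  let ?f = "\<lambda>y. y powr (p - 1) * (1 - y) powr (q - 1)"
  have "continuous (at z) ?f" using assms by (intro continuous_intros) auto
  then have "continuous (at z within {0..b}) ?f" by (rule continuous_at_imp_continuous_at_within)
  then have "((\<lambda>u. integral {0..u} ?f) has_vector_derivative ?f z) (at z within {0..b})"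
    using assms b ibeta_eq_integral(1)[of p b q]
    by (intro integral_has_vector_derivative_continuous_at[where S="{}", simplified]) auto
  then have "((\<lambda>u. integral {0..u} ?f) has_real_derivative ?f z) (at z)"
    using assms b by (simp add: has_real_derivative_iff_has_vector_derivative at_within_Icc_at)
  then show ?thesis
  proof (rule DERIV_cong_ev[THEN iffD1, rotated -1, OF _ refl _ refl])
    have "\<forall>\<^sub>F u in nhds z. u \<in> {0<..<1}" using assms by (intro eventually_nhds_in_open) auto
    then show "\<forall>\<^sub>F u in nhds z. integral {0..u} ?f = ibeta p q u"
      by eventually_elim (use assms in \<open>auto simp: ibeta_eq_integral(2)\<close>)
  qed
qed

lemma ibeta_measurable [measurable]: "ibeta p q \<in> borel_measurable borel"
proof -
  have "ibeta p q = (\<lambda>z. LINT y|lborel. (if 0 < y \<and> y < z then y powr (p - 1) * (1 - y) powr (q - 1) else 0))"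
    unfolding ibeta_def set_lebesgue_integral_def
    by (auto intro!: ext Bochner_Integration.integral_cong split: split_indicator)
  then show ?thesis by simp
qed

text \<open>The substitution \<open>y = 1 - s / u\<close> removes the scale. With
  \<open>p = 1 - a\<close> and \<open>q = 2 * a\<close> it evaluates the integral in the second
  kernel; with \<open>p = a\<close> and \<open>q = 0\<close> it evaluates the primitive of the
  density of \<open>A0 g\<close>.\<close>

lemma nn_ibeta_ratio:
  fixes p q s t :: real
  assumes "0 < p" "0 < s" "s < t"
  shows "(\<integral>\<^sup>+u\<in>{s<..<t}. ennreal (u powr (- p - q) * (u - s) powr (p - 1)) \<partial>lborel)
       = ennreal (s powr (- q) * ibeta p q (1 - s / t))"
proof -
  let ?f = "\<lambda>y. y powr (p - 1) * (1 - y) powr (q - 1)"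
  have "ennreal (s powr (- q) * ibeta p q (1 - s / t)) =
      ennreal (s powr (-q)) * (\<integral>\<^sup>+x\<in>{0<..<1 - s/t}. ennreal (?f x) \<partial>lborel)"
    using assms by (subst ibeta_nn) (auto simp: ennreal_mult')
  also have "(\<integral>\<^sup>+x\<in>{0<..<1 - s/t}. ennreal (?f x) \<partial>lborel) =
      (\<integral>\<^sup>+x\<in>{s<..<t}. ennreal (?f (1 - s / x) * (s / x\<^sup>2)) \<partial>lborel)"
  proof (rule nn_substitution_Ioo)
    fix x assume x: "s \<le> x" "x \<le> t"
    show "((\<lambda>x. 1 - s / x) has_real_derivative s / x\<^sup>2) (at x)"
      using x assms by (auto intro!: derivative_eq_intros simp: power2_eq_square)
    show "0 \<le> s / x\<^sup>2" using x assms by auto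
  next
    show "continuous_on {s..t} (\<lambda>x. s / x\<^sup>2)" using assms by (auto intro!: continuous_intros)
  qed (use assms in auto)
  also have "ennreal (s powr (-q)) * \<dots> = (\<integral>\<^sup>+x\<in>{s<..<t}. ennreal (s powr (-q)) * ennreal (?f (1 - s / x) * (s / x\<^sup>2)) \<partial>lborel)"
    by (subst nn_integral_cmult[symmetric]) (auto simp: mult.assoc)
  also have "\<dots> = (\<integral>\<^sup>+u\<in>{s<..<t}. ennreal (u powr (- p - q) * (u - s) powr (p - 1)) \<partial>lborel)"
  proof (rule nn_integral_cong)
    fix x :: real
    have "s powr (-q) * (?f (1 - s / x) * (s / x\<^sup>2)) = x powr (- p - q) * (x - s) powr (p - 1)" if x: "s < x" "x < t"
    proof -
      have 1: "1 - s / x = (x - s) / x" using x assms by (simp add: field_simps)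
      have 2: "1 - (x - s) / x = s / x" using x assms by (simp add: field_simps)
      have pos: "0 < x" "0 < x - s" using x assms by auto
      have 3: "s / x\<^sup>2 = exp (ln s - 2 * ln x)"
      proof -
        have "ln (s / x\<^sup>2) = ln s - 2 * ln x"
          using pos assms by (simp add: ln_div ln_realpow)
        moreover have "0 < s / x\<^sup>2" using pos assms by simp
        ultimately show ?thesis by (metis exp_ln)
      qed
      have 4: "((x - s) / x) powr (p - 1) = exp ((p - 1) * (ln (x - s) - ln x))"
        "(1 - (x - s) / x) powr (q - 1) = exp ((q - 1) * (ln s - ln x))"
        unfolding 2 using pos assms by (simp_all add: powr_def ln_div)
      have 5: "y powr r = exp (r * ln y)" if "0 < y" for y r :: real
        using that by (simp add: powr_def)
      show ?thesis
        unfolding 1 3 4 5[OF pos(1)] 5[OF pos(2)] 5[OF assms(2)] mult_exp_exp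
        by (rule arg_cong[where f=exp]) (simp add: algebra_simps)
    qed
    then show "ennreal (s powr (-q)) * ennreal (?f (1 - s / x) * (s / x\<^sup>2)) * indicator {s<..<t} x
       = ennreal (x powr (- p - q) * (x - s) powr (p - 1)) * indicator {s<..<t} x"
      using assms by (auto split: split_indicator simp flip: ennreal_mult')
  qed
  finally show ?thesis by simp
qed

section \<open>The kernel and its covariance\<close>

lemma set_nn_cong:
  fixes f g :: "'b \<Rightarrow> ennreal"
  shows "(\<And>x. x \<in> S \<Longrightarrow> f x = g x) \<Longrightarrow> (\<integral>\<^sup>+x\<in>S. f x \<partial>M) = (\<integral>\<^sup>+x\<in>S. g x \<partial>M)"
  by (intro nn_integral_cong) (auto split: split_indicator)

lemma set_nn_cmult:
  fixes f :: "real \<Rightarrow> ennreal"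
  assumes [measurable]: "f \<in> borel_measurable borel" "S \<in> sets borel"
  shows "(\<integral>\<^sup>+x\<in>S. c * f x \<partial>lborel) = c * (\<integral>\<^sup>+x\<in>S. f x \<partial>lborel)"
  by (subst nn_integral_cmult[symmetric]) (auto simp: mult.assoc)

lemma set_nn_add:
  fixes f g :: "real \<Rightarrow> ennreal"
  assumes [measurable]: "f \<in> borel_measurable borel" "g \<in> borel_measurable borel" "S \<in> sets borel"
  shows "(\<integral>\<^sup>+x\<in>S. f x + g x \<partial>lborel) = (\<integral>\<^sup>+x\<in>S. f x \<partial>lborel) + (\<integral>\<^sup>+x\<in>S. g x \<partial>lborel)"
  by (subst nn_integral_add[symmetric]) (auto simp: distrib_right)

lemma nn_FTC_Icc:
  fixes f F :: "real \<Rightarrow> real"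
  assumes "a < b" "\<And>x. a \<le> x \<Longrightarrow> x \<le> b \<Longrightarrow> (F has_real_derivative f x) (at x)"
    "\<And>x. a \<le> x \<Longrightarrow> x \<le> b \<Longrightarrow> 0 \<le> f x" "f \<in> borel_measurable borel"
  shows "(\<integral>\<^sup>+x\<in>{a<..<b}. ennreal (f x) \<partial>lborel) = ennreal (F b - F a)"
proof -
  have "(\<integral>\<^sup>+x\<in>{a..b}. ennreal (f x) \<partial>lborel) = ennreal (F b - F a)"
    using assms by (intro nn_integral_FTC_Icc) auto
  then show ?thesis by (simp add: nn_integral_Icc_Ioo)
qed

locale fbm_kernel =
  fixes a :: real
  assumes a0: "0 < a" and a1: "a < 1/2"
begin

text \<open>
  With \<open>a = 1/2 - H\<close>, these are \<open>K\<^sub>H\<^sub>,\<^sub>1\<close>, \<open>K\<^sub>H\<^sub>,\<^sub>2\<close> and \<open>K\<^sub>H\<close> without the factor \<open>c\<^sub>H\<close>, extended by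
  zero; the integral in \<open>K\<^sub>H\<^sub>,\<^sub>2\<close> becomes an incomplete Beta integral.
\<close>

definition ka :: "real \<Rightarrow> real \<Rightarrow> real" where
  "ka t s = (if 0 < s \<and> s < t then t powr (- a) * s powr a * (t - s) powr (- a) else 0)"

definition kb :: "real \<Rightarrow> real \<Rightarrow> real" where
  "kb t s = (if 0 < s \<and> s < t then a * s powr (- a) * ibeta (1 - a) (2 * a) (1 - s / t) else 0)"

definition k :: "real \<Rightarrow> real \<Rightarrow> real" where
  "k t s = ka t s + kb t s"

text \<open>\<open>betaa\<close> appears whenever a fractional integral of order \<open>a\<close> is
  inverted and equals \<open>pi / sin (pi * a)\<close>; \<open>betab\<close> is the constant of the
  Moebius Beta integral behind \<open>k_core\<close>.\<close>

definition betaa :: real where "betaa = Beta a (1 - a)"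
definition betab :: real where "betab = Beta (a + 1) a"

text \<open>The covariance of fractional Brownian motion, since \<open>1 - 2 * a = 2 * H\<close> for
  \<open>a = 1/2 - H\<close>.\<close>

definition R :: "real \<Rightarrow> real \<Rightarrow> real" where
  "R t s = (s powr (1 - 2 * a) + t powr (1 - 2 * a) - \<bar>t - s\<bar> powr (1 - 2 * a)) / 2"

text \<open>The value that makes \<open>\<integral> k s u * k t u du = kappa * R t s\<close>, so that \<open>c\<^sub>H = 1 / sqrt kappa\<close>.\<close>

definition kappa :: real where "kappa = betaa / ((1 - 2 * a) * betab)"

lemma betaa_pos: "0 < betaa" and betab_pos: "0 < betab" and kappa_pos: "0 < kappa"
  using a0 a1 by (auto simp: betaa_def betab_def kappa_def intro!: Beta_pos divide_pos_pos mult_pos_pos)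

lemma ka_nonneg: "0 \<le> ka t s" and kb_nonneg: "0 \<le> kb t s" and k_nonneg: "0 \<le> k t s"
  using a0 by (auto simp: ka_def kb_def k_def ibeta_nonneg)

lemma ka_meas [measurable]: "case_prod ka \<in> borel_measurable (borel \<Otimes>\<^sub>M borel)"
  unfolding ka_def by measurable
lemma kb_meas [measurable]: "case_prod kb \<in> borel_measurable (borel \<Otimes>\<^sub>M borel)"
  unfolding kb_def by measurable
lemma k_meas [measurable]: "case_prod k \<in> borel_measurable (borel \<Otimes>\<^sub>M borel)"
  unfolding k_def by measurable

text \<open>Undoes the incomplete Beta form: with the integral restored, \<open>kb\<close> can take
  part in exchanges of integrals.\<close>

lemma kb_nn:
  assumes "0 < s" "s < t"
  shows "ennreal (kb t s) = ennreal (a * s powr a) * (\<integral>\<^sup>+u\<in>{s<..<t}. ennreal (u powr (- 1 - a) * (u - s) powr (- a)) \<partial>lborel)"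
proof -
  have "s powr a * s powr (- (2 * a)) = s powr (- a)"
    using assms by (simp flip: powr_add)
  then have "kb t s = a * s powr a * (s powr (- (2 * a)) * ibeta (1 - a) (2 * a) (1 - s / t))"
    using assms by (simp add: kb_def mult.assoc[symmetric])
  also have "ennreal \<dots> = ennreal (a * s powr a) * ennreal (s powr (- (2 * a)) * ibeta (1 - a) (2 * a) (1 - s / t))"
    using a0 by (intro ennreal_mult') auto
  also have "ennreal (s powr (- (2 * a)) * ibeta (1 - a) (2 * a) (1 - s / t)) =
     (\<integral>\<^sup>+u\<in>{s<..<t}. ennreal (u powr (- (1 - a) - 2 * a) * (u - s) powr (1 - a - 1)) \<partial>lborel)"
    using nn_ibeta_ratio[of "1 - a" s t "2 * a"] a0 a1 assms by simp
  finally show ?thesis by (simp add: algebra_simps)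
qed

text \<open>The end points are included because \<open>0 powr x = 0\<close> for every exponent
  \<open>x\<close>, negative ones too, which agrees with the extension of \<open>ka\<close> by
  zero.\<close>

lemma kernel1_eq:
  assumes "0 \<le> s" "s \<le> t"
  shows "kernel1 c (1/2 - a) t s = c * ka t s"
  using assms by (auto simp: kernel1_def ka_def)

lemma kernel2_eq:
  assumes "0 \<le> s" "s \<le> t"
  shows "kernel2 c (1/2 - a) t s = c * kb t s"
proof (cases "0 < s \<and> s < t")
  case True
  let ?f = "\<lambda>u. u powr (- 1 - a) * (u - s) powr (- a)"
  have "(\<integral>\<^sup>+u\<in>{s<..<t}. ennreal (?f u) \<partial>lborel) = ennreal (s powr (- (2 * a)) * ibeta (1 - a) (2 * a) (1 - s / t))"
    using nn_ibeta_ratio[of "1 - a" s t "2 * a"] a0 a1 True by (simp add: algebra_simps)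
  from set_integral_eq_nn(2)[OF _ _ this]
  have "(LBINT u:{s<..<t}. ?f u) = s powr (- (2 * a)) * ibeta (1 - a) (2 * a) (1 - s / t)"
    by (simp add: ibeta_nonneg)
  moreover have "s powr a * s powr (- (2 * a)) = s powr (- a)"
    using True by (simp flip: powr_add)
  ultimately show ?thesis using True
    by (simp add: kernel2_def kb_def algebra_simps)
next
  case False
  \<comment> \<open>At \<open>s = 0\<close> the factor \<open>s powr a\<close> is zero; at
    \<open>s = t\<close> the integral runs over the empty interval.\<close>
  then have "s = 0 \<or> s = t" using assms by auto
  then show ?thesis using a0
    by (auto simp: kernel2_def kb_def set_lebesgue_integral_def)
qed

lemma powr_integral_neg:
  assumes "0 < x" "x < t"
  shows "(\<integral>\<^sup>+v\<in>{x<..<t}. ennreal (a * v powr (- 1 - a)) \<partial>lborel) = ennreal (x powr (- a) - t powr (- a))"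
proof -
  have "(\<integral>\<^sup>+v\<in>{x<..<t}. ennreal (a * v powr (- a - 1)) \<partial>lborel) = ennreal (- (t powr (- a)) - - (x powr (-a)))"
    using a0 assms
    by (intro nn_FTC_Icc[where F="\<lambda>v. - (v powr (-a))"])
       (auto intro!: derivative_eq_intros simp: algebra_simps)
  moreover have "- a - 1 = - 1 - a" by simp
  ultimately show ?thesis by simp
qed

lemma powr_integral_pos:
  assumes "0 < x" "x < t"
  shows "(\<integral>\<^sup>+v\<in>{x<..<t}. ennreal (a * v powr (a - 1)) \<partial>lborel) = ennreal (t powr a - x powr a)"
  using a0 assms
  by (intro nn_FTC_Icc[where F="\<lambda>v. v powr a"])
     (auto intro!: derivative_eq_intros simp: algebra_simps)

text \<open>An inversion of Abel type. In both parts the inner integral is a Beta integral with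
  exponents \<open>a - 1\<close> and \<open>- a\<close>, whose value \<open>betaa\<close> does not
  depend on the interval. The part \<open>ka\<close> contributes
  \<open>betaa * t powr (- a)\<close>; the part \<open>kb\<close> contributes \<open>betaa\<close>
  times the integral of \<open>a * v powr (- 1 - a)\<close> over \<open>{x<..<t}\<close>, and the
  dependence on \<open>t\<close> cancels in the sum.\<close>

lemma k_inverse:
  assumes x: "0 < x" "x < t"
  shows "(\<integral>\<^sup>+u\<in>{x<..<t}. ennreal (k t u * u powr (- a) * (u - x) powr (a - 1)) \<partial>lborel)
       = ennreal (betaa * x powr (- a))"
proof -
  have 1: "(\<integral>\<^sup>+u\<in>{x<..<t}. ennreal (ka t u * u powr (- a) * (u - x) powr (a - 1)) \<partial>lborel)
      = ennreal (betaa * t powr (- a))"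
  proof -
    have "(\<integral>\<^sup>+u\<in>{x<..<t}. ennreal (ka t u * u powr (- a) * (u - x) powr (a - 1)) \<partial>lborel)
       = (\<integral>\<^sup>+u\<in>{x<..<t}. ennreal (t powr (- a)) * ennreal ((u - x) powr (a - 1) * (t - u) powr (1 - a - 1)) \<partial>lborel)"
    proof (rule set_nn_cong)
      fix u assume u: "u \<in> {x<..<t}"
      then have "u powr a * u powr (- a) = 1" using x by (simp flip: powr_add)
      then have "ka t u * u powr (- a) * (u - x) powr (a - 1) = t powr (- a) * ((u - x) powr (a - 1) * (t - u) powr (1 - a - 1))"
        using u x by (simp add: ka_def algebra_simps)
      then show "ennreal (ka t u * u powr (- a) * (u - x) powr (a - 1)) =
        ennreal (t powr (- a)) * ennreal ((u - x) powr (a - 1) * (t - u) powr (1 - a - 1))"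
        by (simp only:) (rule ennreal_mult', simp)
    qed
    also have "\<dots> = ennreal (t powr (- a)) * (\<integral>\<^sup>+u\<in>{x<..<t}. ennreal ((u - x) powr (a - 1) * (t - u) powr (1 - a - 1)) \<partial>lborel)"
      by (rule set_nn_cmult) auto
    also have "\<dots> = ennreal (t powr (- a)) * ennreal betaa"
      using a0 a1 x by (subst nn_beta_interval) (auto simp: betaa_def)
    finally show ?thesis using betaa_pos by (simp add: ennreal_mult mult.commute)
  qed
  let ?g = "\<lambda>u v. ennreal (a * v powr (- 1 - a)) * ennreal ((u - x) powr (a - 1) * (v - u) powr (1 - a - 1))"
  have "(\<integral>\<^sup>+u\<in>{x<..<t}. ennreal (kb t u * u powr (- a) * (u - x) powr (a - 1)) \<partial>lborel)
     = (\<integral>\<^sup>+u\<in>{x<..<t}. (\<integral>\<^sup>+v\<in>{u<..<t}. ?g u v \<partial>lborel) \<partial>lborel)"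
  proof (rule set_nn_cong)
    fix u assume u: "u \<in> {x<..<t}"
    have uu: "u powr a * u powr (- a) = 1" using x u by (simp flip: powr_add)
    have "ennreal (kb t u * u powr (- a) * (u - x) powr (a - 1)) =
      ennreal (u powr (- a) * (u - x) powr (a - 1)) * ennreal (kb t u)"
      by (simp add: kb_nonneg ennreal_mult mult_ac)
    also have "\<dots> = ennreal (u powr (- a) * (u - x) powr (a - 1) * (a * u powr a)) * (\<integral>\<^sup>+v\<in>{u<..<t}. ennreal (v powr (- 1 - a) * (v - u) powr (- a)) \<partial>lborel)"
      using x u a0 by (subst kb_nn) (auto simp: ennreal_mult mult_ac)
    also have "u powr (- a) * (u - x) powr (a - 1) * (a * u powr a) = a * (u - x) powr (a - 1)"
      using uu by (simp add: algebra_simps)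
    also have "ennreal (a * (u - x) powr (a - 1)) * (\<integral>\<^sup>+v\<in>{u<..<t}. ennreal (v powr (- 1 - a) * (v - u) powr (- a)) \<partial>lborel)
        = (\<integral>\<^sup>+v\<in>{u<..<t}. ennreal (a * (u - x) powr (a - 1)) * ennreal (v powr (- 1 - a) * (v - u) powr (- a)) \<partial>lborel)"
      by (rule set_nn_cmult[symmetric]) auto
    also have "\<dots> = (\<integral>\<^sup>+v\<in>{u<..<t}. ?g u v \<partial>lborel)"
      using a0 by (intro set_nn_cong) (auto simp: mult_ac simp flip: ennreal_mult)
    finally show "ennreal (kb t u * u powr (- a) * (u - x) powr (a - 1)) = (\<integral>\<^sup>+v\<in>{u<..<t}. ?g u v \<partial>lborel)" .
  qed
  also have "\<dots> = (\<integral>\<^sup>+v\<in>{x<..<t}. (\<integral>\<^sup>+u\<in>{x<..<v}. ?g u v \<partial>lborel) \<partial>lborel)"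
    by (rule nn_triangle[symmetric]) measurable
  also have "\<dots> = (\<integral>\<^sup>+v\<in>{x<..<t}. ennreal betaa * ennreal (a * v powr (- 1 - a)) \<partial>lborel)"
  proof (rule set_nn_cong)
    fix v assume v: "v \<in> {x<..<t}"
    have "(\<integral>\<^sup>+u\<in>{x<..<v}. ?g u v \<partial>lborel) = ennreal (a * v powr (- 1 - a)) *
       (\<integral>\<^sup>+u\<in>{x<..<v}. ennreal ((u - x) powr (a - 1) * (v - u) powr (1 - a - 1)) \<partial>lborel)"
      by (rule set_nn_cmult) auto
    also have "\<dots> = ennreal (a * v powr (- 1 - a)) * ennreal betaa"
      using a0 a1 v by (subst nn_beta_interval) (auto simp: betaa_def)
    finally show "(\<integral>\<^sup>+u\<in>{x<..<v}. ?g u v \<partial>lborel) = ennreal betaa * ennreal (a * v powr (- 1 - a))"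
      by (simp add: mult.commute)
  qed
  also have "\<dots> = ennreal betaa * ennreal (x powr (- a) - t powr (- a))"
    using powr_integral_neg[OF x] by (subst set_nn_cmult) auto
  finally have 2: "(\<integral>\<^sup>+u\<in>{x<..<t}. ennreal (kb t u * u powr (- a) * (u - x) powr (a - 1)) \<partial>lborel)
      = ennreal (betaa * (x powr (- a) - t powr (- a)))"
    using betaa_pos by (simp add: ennreal_mult')
  have "(\<integral>\<^sup>+u\<in>{x<..<t}. ennreal (k t u * u powr (- a) * (u - x) powr (a - 1)) \<partial>lborel)
     = (\<integral>\<^sup>+u\<in>{x<..<t}. ennreal (ka t u * u powr (- a) * (u - x) powr (a - 1)) +
            ennreal (kb t u * u powr (- a) * (u - x) powr (a - 1)) \<partial>lborel)"
    by (rule set_nn_cong) (simp add: k_def ka_nonneg kb_nonneg distrib_right)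
  also have "\<dots> = ennreal (betaa * t powr (- a)) + ennreal (betaa * (x powr (- a) - t powr (- a)))"
    by (subst set_nn_add) (use 1 2 in auto)
  also have "\<dots> = ennreal (betaa * x powr (- a))"
    using betaa_pos x a0 powr_mono2'[of "-a" x t]
    by (subst ennreal_plus[symmetric]) (auto simp: algebra_simps)
  finally show ?thesis .
qed

text \<open>A derivative in the time argument. The term with \<open>r powr (- a - 1)\<close> is
  cancelled by the derivative of \<open>kb\<close>, so that the time derivative of \<open>k\<close>
  is the single product
  \<open>- a * s powr a * r powr (- a) * (r - s) powr (- a - 1)\<close>.\<close>

lemma ka_deriv1:
  assumes "0 < s" "s < r"
  shows "((\<lambda>r. ka r s) has_real_derivative
     - a * s powr a * (r powr (- a - 1) * (r - s) powr (- a) + r powr (- a) * (r - s) powr (- a - 1))) (at r)"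
proof -
  have "((\<lambda>r. r powr (- a) * s powr a * (r - s) powr (- a)) has_real_derivative
     - a * s powr a * (r powr (- a - 1) * (r - s) powr (- a) + r powr (- a) * (r - s) powr (- a - 1))) (at r)"
    using assms by (auto intro!: derivative_eq_intros simp: algebra_simps)
  then show ?thesis
  proof (rule DERIV_cong_ev[THEN iffD1, rotated -1, OF _ refl _ refl])
    have "\<forall>\<^sub>F u in nhds r. u \<in> {s<..}" using assms by (intro eventually_nhds_in_open) auto
    then show "\<forall>\<^sub>F r in nhds r. r powr (- a) * s powr a * (r - s) powr (- a) = ka r s"
      by eventually_elim (use assms in \<open>auto simp: ka_def\<close>)
  qed
qed

lemma kb_deriv1:
  assumes "0 < s" "s < r"
  shows "((\<lambda>r. kb r s) has_real_derivative a * s powr a * (r powr (- a - 1) * (r - s) powr (- a))) (at r)"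
proof -
  have z: "0 < 1 - s / r" "1 - s / r < 1" using assms by auto
  have "((\<lambda>r. ibeta (1 - a) (2 * a) (1 - s / r)) has_real_derivative
     ((1 - s / r) powr (1 - a - 1) * (1 - (1 - s / r)) powr (2 * a - 1)) * (s / r\<^sup>2)) (at r)"
    using assms z a0 a1
    by (intro DERIV_chain2[OF ibeta_deriv]) (auto intro!: derivative_eq_intros simp: power2_eq_square)
  then have "((\<lambda>r. a * s powr (- a) * ibeta (1 - a) (2 * a) (1 - s / r)) has_real_derivative
     a * s powr (- a) * (((1 - s / r) powr (1 - a - 1) * (1 - (1 - s / r)) powr (2 * a - 1)) * (s / r\<^sup>2))) (at r)"
    by (rule DERIV_cmult)
  also have "a * s powr (- a) * (((1 - s / r) powr (1 - a - 1) * (1 - (1 - s / r)) powr (2 * a - 1)) * (s / r\<^sup>2))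
     = a * s powr a * (r powr (- a - 1) * (r - s) powr (- a))"
  proof -
    have pos: "0 < r" "0 < r - s" using assms by auto
    have 1: "1 - s / r = (r - s) / r" using assms by (simp add: field_simps)
    have 2: "s / r\<^sup>2 = exp (ln s - 2 * ln r)"
    proof -
      have "ln (s / r\<^sup>2) = ln s - 2 * ln r" using pos assms by (simp add: ln_div ln_realpow)
      moreover have "0 < s / r\<^sup>2" using pos assms by simp
      ultimately show ?thesis by (metis exp_ln)
    qed
    have 3: "(1 - s / r) powr (1 - a - 1) = exp ((- a) * (ln (r - s) - ln r))"
       "(1 - (1 - s / r)) powr (2 * a - 1) = exp ((2 * a - 1) * (ln s - ln r))"
    proof -
      show "(1 - s / r) powr (1 - a - 1) = exp ((- a) * (ln (r - s) - ln r))"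
        unfolding 1 using pos assms by (simp add: powr_def ln_div)
      have "1 - (1 - s / r) = s / r" by simp
      then show "(1 - (1 - s / r)) powr (2 * a - 1) = exp ((2 * a - 1) * (ln s - ln r))"
        using pos assms by (simp add: powr_def ln_div)
    qed
    have 5: "y powr r = exp (r * ln y)" if "0 < y" for y r :: real
      using that by (simp add: powr_def)
    have "s powr (- a) * (((1 - s / r) powr (1 - a - 1) * (1 - (1 - s / r)) powr (2 * a - 1)) * (s / r\<^sup>2))
     = s powr a * (r powr (- a - 1) * (r - s) powr (- a))"
      unfolding 2 3 5[OF pos(1)] 5[OF pos(2)] 5[OF assms(1)] mult_exp_exp
      by (rule arg_cong[where f=exp]) (simp add: algebra_simps)
    then show ?thesis by (simp only: mult.assoc)
  qed
  finally have "((\<lambda>r. a * s powr (- a) * ibeta (1 - a) (2 * a) (1 - s / r)) has_real_derivative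
     a * s powr a * (r powr (- a - 1) * (r - s) powr (- a))) (at r)" .
  then show ?thesis
  proof (rule DERIV_cong_ev[THEN iffD1, rotated -1, OF _ refl _ refl])
    have "\<forall>\<^sub>F u in nhds r. u \<in> {s<..}" using assms by (intro eventually_nhds_in_open) auto
    then show "\<forall>\<^sub>F r in nhds r. a * s powr (- a) * ibeta (1 - a) (2 * a) (1 - s / r) = kb r s"
      by eventually_elim (use assms in \<open>auto simp: kb_def\<close>)
  qed
qed

text \<open>The constant of integration when \<open>k\<close> is recovered from its time derivative
  on a half-line: \<open>ka\<close> dies out and the incomplete Beta integral becomes
  complete.\<close>

lemma k_tendsto_at_top:
  assumes "0 < s"
  shows "((\<lambda>r. k r s) \<longlongrightarrow> a * s powr (- a) * Beta (1 - a) (2 * a)) at_top"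
proof -
  have "((\<lambda>r. r powr (- a) * s powr a * (r - s) powr (- a) + a * s powr (- a) * ibeta (1 - a) (2 * a) (1 - s / r))
     \<longlongrightarrow> 0 * s powr a * 0 + a * s powr (- a) * Beta (1 - a) (2 * a)) at_top"
  proof (intro tendsto_intros)
    show "((\<lambda>r. r powr (- a)) \<longlongrightarrow> 0) at_top" using a0 by (intro tendsto_neg_powr filterlim_ident) auto
    have "filterlim (\<lambda>r. - s + r) at_top at_top"
      by (rule filterlim_tendsto_add_at_top[OF tendsto_const filterlim_ident])
    then show "((\<lambda>r. (r - s) powr (- a)) \<longlongrightarrow> 0) at_top"
      using a0 by (intro tendsto_neg_powr) auto
    have "filterlim (\<lambda>r. 1 - s / r) (at_left 1) at_top"
    proof (rule tendsto_imp_filterlim_at_left)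
      have "((\<lambda>r. 1 - s * inverse r) \<longlongrightarrow> 1 - s * 0) at_top"
        by (intro tendsto_intros tendsto_inverse_0_at_top filterlim_ident)
      then show "((\<lambda>r. 1 - s / r) \<longlongrightarrow> 1) at_top" by (simp add: divide_inverse)
      show "\<forall>\<^sub>F r in at_top. 1 - s / r < 1"
        using eventually_gt_at_top[of 0] by eventually_elim (use assms in auto)
    qed
    then show "((\<lambda>r. ibeta (1 - a) (2 * a) (1 - s / r)) \<longlongrightarrow> Beta (1 - a) (2 * a)) at_top"
      using a0 a1 by (intro filterlim_compose[OF ibeta_tendsto_1]) auto
  qed
  moreover have "\<forall>\<^sub>F r in at_top. r powr (- a) * s powr a * (r - s) powr (- a) + a * s powr (- a) * ibeta (1 - a) (2 * a) (1 - s / r) = k r s"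
    using eventually_gt_at_top[of s] by eventually_elim (use assms in \<open>auto simp: k_def ka_def kb_def\<close>)
  ultimately show ?thesis by (simp add: tendsto_cong)
qed

text \<open>Comparison through Gamma functions. It matches the limit of \<open>k\<close> at infinity
  with the constant term of \<open>k_core\<close>.\<close>

lemma Beta_identity: "2 * betab * a * Beta (1 - a) (2 * a) = Beta (1 - a) a"
proof -
  have G: "Gamma (a + 1) = a * Gamma a" "Gamma (2 * a + 1) = 2 * a * Gamma (2 * a)"
    using a0 Gamma_plus1[of a] Gamma_plus1[of "2 * a"] by (auto simp: nonpos_Ints_def)
  have nz: "Gamma a > 0" "Gamma (2 * a) > 0" "Gamma (1 - a) > 0" "Gamma (1 + a) > 0" using a0 a1 by auto
  have nz': "Gamma a \<noteq> 0" "Gamma (2 * a) \<noteq> 0" "Gamma (1 - a) \<noteq> 0" "Gamma (1 + a) \<noteq> 0"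
    using nz by auto
  have e: "a + 1 + a = 2 * a + 1" "1 - a + 2 * a = a + 1" "1 - a + a = 1" by auto
  show ?thesis
    unfolding betab_def Beta_def e using G a0 nz' by (simp add: divide_simps)
qed

text \<open>Here \<open>t\<close> enters the right-hand side only through
  \<open>(t - x) powr (- 2 * a)\<close>. Writing this power as an integral over
  \<open>r \<ge> t\<close> and exchanging integrals leaves a Moebius Beta integral in
  \<open>x\<close>; its value is \<open>2 * betab * s powr a\<close> times the negative time
  derivative of \<open>k r s\<close>, so the integral over \<open>r\<close> is elementary.\<close>

lemma k_core:
  assumes s: "0 < s" "s < t"
  shows "ennreal (2 * betab * s powr a * k t s) = ennreal (Beta (1 - a) a) +
      (\<integral>\<^sup>+x\<in>{0<..<s}. ennreal (x powr a * (s - x) powr (a - 1) * (t - x) powr (- 2 * a)) \<partial>lborel)"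
proof -
  let ?h = "\<lambda>x r. ennreal (x powr a * (s - x) powr (a - 1)) * ennreal (2 * a * (r - x) powr (- 2 * a - 1))"
  have "(\<integral>\<^sup>+x\<in>{0<..<s}. ennreal (x powr a * (s - x) powr (a - 1) * (t - x) powr (- 2 * a)) \<partial>lborel)
     = (\<integral>\<^sup>+x\<in>{0<..<s}. (\<integral>\<^sup>+r\<in>{t..}. ?h x r \<partial>lborel) \<partial>lborel)"
  proof (rule set_nn_cong)
    fix x assume x: "x \<in> {0<..<s}"
    have "(\<integral>\<^sup>+r\<in>{t..}. ennreal (2 * a * (r - x) powr (- 2 * a - 1)) \<partial>lborel) = 0 - - ((t - x) powr (- 2 * a))"
    proof (rule nn_integral_FTC_atLeast)
      fix r assume "t \<le> r"
      then show "((\<lambda>r. - ((r - x) powr (- 2 * a))) has_real_derivative 2 * a * (r - x) powr (- 2 * a - 1)) (at r)"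
        using x s by (auto intro!: derivative_eq_intros)
      show "0 \<le> 2 * a * (r - x) powr (- 2 * a - 1)" using a0 by auto
    next
      have "filterlim (\<lambda>r. - x + r) at_top at_top"
        by (rule filterlim_tendsto_add_at_top[OF tendsto_const filterlim_ident])
      then have "((\<lambda>r. (r - x) powr (- 2 * a)) \<longlongrightarrow> 0) at_top"
        using a0 by (intro tendsto_neg_powr) auto
      from tendsto_minus[OF this] show "((\<lambda>r. - ((r - x) powr (- 2 * a))) \<longlongrightarrow> 0) at_top" by simp
    qed auto
    then have "ennreal (x powr a * (s - x) powr (a - 1) * (t - x) powr (- 2 * a)) =
      ennreal (x powr a * (s - x) powr (a - 1)) * (\<integral>\<^sup>+r\<in>{t..}. ennreal (2 * a * (r - x) powr (- 2 * a - 1)) \<partial>lborel)"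
      by (simp add: ennreal_mult')
    then show "ennreal (x powr a * (s - x) powr (a - 1) * (t - x) powr (- 2 * a)) = (\<integral>\<^sup>+r\<in>{t..}. ?h x r \<partial>lborel)"
      by (subst set_nn_cmult) auto
  qed
  also have "\<dots> = (\<integral>\<^sup>+x. (\<integral>\<^sup>+r. ?h x r * indicator {t..} r * indicator {0<..<s} x \<partial>lborel) \<partial>lborel)"
    by (subst nn_integral_multc[symmetric]) auto
  also have "\<dots> = (\<integral>\<^sup>+r. (\<integral>\<^sup>+x. ?h x r * indicator {t..} r * indicator {0<..<s} x \<partial>lborel) \<partial>lborel)"
    by (rule lborel_pair.Fubini'[symmetric]) measurable
  also have "\<dots> = (\<integral>\<^sup>+r\<in>{t..}. (\<integral>\<^sup>+x\<in>{0<..<s}. ?h x r \<partial>lborel) \<partial>lborel)"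
    by (subst nn_integral_multc[symmetric]) (auto simp: mult_ac)
  also have "\<dots> = (\<integral>\<^sup>+r\<in>{t..}. ennreal (2 * betab * s powr a) * ennreal (a * s powr a * r powr (- a) * (r - s) powr (- a - 1)) \<partial>lborel)"
  proof (rule set_nn_cong)
    fix r assume r: "r \<in> {t..}"
    have "(\<integral>\<^sup>+x\<in>{0<..<s}. ?h x r \<partial>lborel) =
      (\<integral>\<^sup>+x\<in>{0<..<s}. ennreal (2 * a) * ennreal (x powr (a + 1 - 1) * (s - x) powr (a - 1) * (r - x) powr (- (a + 1) - a)) \<partial>lborel)"
      using a0 by (intro set_nn_cong) (auto simp: mult_ac simp flip: ennreal_mult)
    also have "\<dots> = ennreal (2 * a) * ennreal (betab * s powr (a + 1 + a - 1) * r powr (- a) * (r - s) powr (- (a + 1)))"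
      using a0 s r by (subst set_nn_cmult, simp, simp, subst nn_beta_moebius) (auto simp: betab_def)
    also have "\<dots> = ennreal (2 * a * (betab * s powr (a + 1 + a - 1) * r powr (- a) * (r - s) powr (- (a + 1))))"
      using a0 by (simp add: ennreal_mult')
    also have "2 * a * (betab * s powr (a + 1 + a - 1) * r powr (- a) * (r - s) powr (- (a + 1)))
       = (2 * betab * s powr a) * (a * s powr a * r powr (- a) * (r - s) powr (- a - 1))"
    proof -
      have "s powr (a + 1 + a - 1) = s powr a * s powr a" "- (a + 1) = - a - 1"
        by (auto simp flip: powr_add)
      then show ?thesis by (simp only: mult_ac)
    qed
    also have "ennreal \<dots> = ennreal (2 * betab * s powr a) * ennreal (a * s powr a * r powr (- a) * (r - s) powr (- a - 1))"
      using betab_pos by (intro ennreal_mult') auto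
    finally show "(\<integral>\<^sup>+x\<in>{0<..<s}. ?h x r \<partial>lborel) = ennreal (2 * betab * s powr a) * ennreal (a * s powr a * r powr (- a) * (r - s) powr (- a - 1))" .
  qed
  also have "\<dots> = ennreal (2 * betab * s powr a) * (\<integral>\<^sup>+r\<in>{t..}. ennreal (a * s powr a * r powr (- a) * (r - s) powr (- a - 1)) \<partial>lborel)"
    by (rule set_nn_cmult) auto
  also have "(\<integral>\<^sup>+r\<in>{t..}. ennreal (a * s powr a * r powr (- a) * (r - s) powr (- a - 1)) \<partial>lborel)
     = ennreal (- (a * s powr (- a) * Beta (1 - a) (2 * a)) - - k t s)"
  proof (rule nn_integral_FTC_atLeast)
    fix r assume "t \<le> r"
    with s have r: "s < r" by simp
    show "((\<lambda>r. - k r s) has_real_derivative a * s powr a * r powr (- a) * (r - s) powr (- a - 1)) (at r)"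
      unfolding k_def using ka_deriv1[OF s(1) r] kb_deriv1[OF s(1) r]
      by (auto intro!: derivative_eq_intros simp: algebra_simps)
    show "0 \<le> a * s powr a * r powr (- a) * (r - s) powr (- a - 1)" using a0 by auto
  next
    show "((\<lambda>r. - k r s) \<longlongrightarrow> - (a * s powr (- a) * Beta (1 - a) (2 * a))) at_top"
      by (intro tendsto_minus k_tendsto_at_top s)
  qed auto
  finally have *: "(\<integral>\<^sup>+x\<in>{0<..<s}. ennreal (x powr a * (s - x) powr (a - 1) * (t - x) powr (- 2 * a)) \<partial>lborel)
     = ennreal (2 * betab * s powr a * (k t s - a * s powr (- a) * Beta (1 - a) (2 * a)))"
    using betab_pos by (simp add: ennreal_mult')
  \<comment> \<open>Since \<open>k r s\<close> decreases in \<open>r\<close>, it stays above its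
    limit. The sign matters because \<open>ennreal\<close> sends negative numbers to
    \<open>0\<close>, so that the two summands could not be merged otherwise.\<close>
  have "k t s \<ge> a * s powr (- a) * Beta (1 - a) (2 * a)"
  proof (rule tendsto_upperbound[OF k_tendsto_at_top[OF s(1)]])
    show "\<forall>\<^sub>F r in at_top. k r s \<le> k t s"
      using eventually_ge_at_top[of t]
    proof eventually_elim
      fix r assume "t \<le> r"
      then show "k r s \<le> k t s"
      proof (rule DERIV_nonpos_imp_nonincreasing)
        fix x assume "t \<le> x" "x \<le> r"
        with s have x: "s < x" by simp
        show "\<exists>y. ((\<lambda>r. k r s) has_real_derivative y) (at x) \<and> y \<le> 0"
          unfolding k_def using ka_deriv1[OF s(1) x] kb_deriv1[OF s(1) x] a0
          by (intro exI conjI) (rule derivative_eq_intros refl | assumption | simp add: algebra_simps)+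
      qed
    qed
  qed simp
  then have "ennreal (Beta (1 - a) a) + ennreal (2 * betab * s powr a * (k t s - a * s powr (- a) * Beta (1 - a) (2 * a)))
     = ennreal (Beta (1 - a) a + 2 * betab * s powr a * (k t s - a * s powr (- a) * Beta (1 - a) (2 * a)))"
    using betab_pos a0 a1 Beta_pos[of "1 - a" a] by (intro ennreal_plus[symmetric]) auto
  also have "Beta (1 - a) a + 2 * betab * s powr a * (k t s - a * s powr (- a) * Beta (1 - a) (2 * a)) = 2 * betab * s powr a * k t s"
  proof -
    have "s powr a * s powr (- a) = 1" using s by (simp flip: powr_add)
    then have "2 * betab * s powr a * (a * s powr (- a) * Beta (1 - a) (2 * a)) = 2 * betab * a * Beta (1 - a) (2 * a)"
      by (simp add: algebra_simps)
    then show ?thesis using Beta_identity by (simp add: right_diff_distrib)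
  qed
  finally show ?thesis using * by simp
qed

end

lemma FTC_nonneg_cont:
  fixes F f :: "real \<Rightarrow> real"
  assumes "a < b"
    and "\<And>x. a < x \<Longrightarrow> x < b \<Longrightarrow> (F has_real_derivative f x) (at x)"
    and "\<And>x. a < x \<Longrightarrow> x < b \<Longrightarrow> isCont f x"
    and "\<And>x. a < x \<Longrightarrow> x < b \<Longrightarrow> 0 \<le> f x"
    and "continuous_on {a..b} F"
  shows "set_integrable lborel {a<..<b} f" "(LBINT x:{a<..<b}. f x) = F b - F a"
    and "(\<integral>\<^sup>+x\<in>{a<..<b}. ennreal (f x) \<partial>lborel) = ennreal (F b - F a)"
proof -
  have A: "(F \<longlongrightarrow> F a) (at_right a)" and B: "(F \<longlongrightarrow> F b) (at_left b)"
    using assms(1,5) by (auto simp: continuous_on_Icc_at_rightD continuous_on_Icc_at_leftD)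
  show "set_integrable lborel {a<..<b} f" "(LBINT x:{a<..<b}. f x) = F b - F a"
    "(\<integral>\<^sup>+x\<in>{a<..<b}. ennreal (f x) \<partial>lborel) = ennreal (F b - F a)"
    using FTC_nonneg_Ioo[OF assms(1-4) A B] by auto
qed

lemma nn_reflect:
  fixes f :: "real \<Rightarrow> ennreal"
  assumes [measurable]: "f \<in> borel_measurable borel"
  shows "(\<integral>\<^sup>+y\<in>{u<..<v}. f y \<partial>lborel) = (\<integral>\<^sup>+x\<in>{c - v<..<c - u}. f (c - x) \<partial>lborel)"
proof -
  have "(\<integral>\<^sup>+y\<in>{u<..<v}. f y \<partial>lborel)
      = \<bar>- 1 :: real\<bar> * (\<integral>\<^sup>+x. f (c + (- 1) * x) * indicator {u<..<v} (c + (- 1) * x) \<partial>lborel)"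
    by (intro nn_integral_real_affine) auto
  also have "\<dots> = (\<integral>\<^sup>+x\<in>{c - v<..<c - u}. f (c - x) \<partial>lborel)"
    by (auto intro!: nn_integral_cong split: split_indicator)
  finally show ?thesis .
qed

section \<open>The covariance of the kernel and the weights of the inverse\<close>

context fbm_kernel
begin

lemma k_outside: "s \<le> 0 \<or> t \<le> s \<Longrightarrow> k t s = 0"
  by (auto simp: k_def ka_def kb_def)

text \<open>The place where the covariance emerges: the increment of
  \<open>x powr (1 - 2 * a) - (t - x) powr (1 - 2 * a)\<close> over \<open>{0..s}\<close> is exactly
  \<open>2 * R t s\<close>.\<close>

lemma nn_powr_neg2a:
  assumes s: "0 < s" "s \<le> t"
  shows "(\<integral>\<^sup>+x\<in>{0<..<s}. ennreal (x powr (- 2 * a) + (t - x) powr (- 2 * a)) \<partial>lborel) = ennreal (2 * R t s / (1 - 2 * a))"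
proof -
  let ?F = "\<lambda>x. (x powr (1 - 2 * a) - (t - x) powr (1 - 2 * a)) / (1 - 2 * a)"
  have "(\<integral>\<^sup>+x\<in>{0<..<s}. ennreal (x powr (- 2 * a) + (t - x) powr (- 2 * a)) \<partial>lborel) = ennreal (?F s - ?F 0)"
  proof (rule FTC_nonneg_cont)
    fix x assume x: "0 < x" "x < s"
    have "((\<lambda>x. x powr (1 - 2 * a) - (t - x) powr (1 - 2 * a)) has_real_derivative
       (1 - 2 * a) * (x powr (- 2 * a) + (t - x) powr (- 2 * a))) (at x)"
      using x s by (auto intro!: derivative_eq_intros simp: algebra_simps)
    from DERIV_cdivide[OF this, of "1 - 2 * a"]
    show "(?F has_real_derivative x powr (- 2 * a) + (t - x) powr (- 2 * a)) (at x)" using a1 by simp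
    show "isCont (\<lambda>x. x powr (- 2 * a) + (t - x) powr (- 2 * a)) x"
      using x s by (intro continuous_intros) auto
  next
    show "continuous_on {0..s} ?F" using s a1 by (intro continuous_intros continuous_on_powr') auto
  qed (use s in auto)
  also have "?F s - ?F 0 = 2 * R t s / (1 - 2 * a)"
  proof -
    have "(s powr (1 - 2 * a) - (t - s) powr (1 - 2 * a)) - (0 powr (1 - 2 * a) - (t - 0) powr (1 - 2 * a)) = 2 * R t s"
      using s by (simp add: R_def)
    then show ?thesis unfolding diff_divide_distrib[symmetric] by (simp only:)
  qed
  finally show ?thesis .
qed

text \<open>The kernel \<open>k t u\<close> is expanded by \<open>k_core\<close> into an integral
  over \<open>x < u\<close>. After the exchange, \<open>k s u\<close> is integrated against
  \<open>u powr (- a) * (u - x) powr (a - 1)\<close>, which \<open>k_inverse\<close> evaluates. The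
  factors \<open>x powr a\<close> and \<open>x powr (- a)\<close> cancel,
  \<open>nn_powr_neg2a\<close> remains, and the constants collect into \<open>kappa\<close>.\<close>

lemma nn_k_k:
  assumes s: "0 < s" "s \<le> t"
  shows "(\<integral>\<^sup>+u\<in>{0<..<s}. ennreal (k s u * k t u) \<partial>lborel) = ennreal (kappa * R t s)"
proof -
  let ?r = "\<lambda>x. x powr (- 2 * a) + (t - x) powr (- 2 * a)"
  let ?G = "\<lambda>u x. ennreal (k s u * u powr (- a) * (u - x) powr (a - 1)) * ennreal (x powr a * ?r x / (2 * betab))"
  have "(\<integral>\<^sup>+u\<in>{0<..<s}. ennreal (k s u * k t u) \<partial>lborel)
    = (\<integral>\<^sup>+u\<in>{0<..<s}. (\<integral>\<^sup>+x\<in>{0<..<u}. ?G u x \<partial>lborel) \<partial>lborel)"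
  proof (rule set_nn_cong)
    fix u assume u: "u \<in> {0<..<s}"
    with s have ut: "0 < u" "u < t" by auto
    have "ennreal (2 * betab * u powr a * k t u) = ennreal (Beta (1 - a) a) +
      (\<integral>\<^sup>+x\<in>{0<..<u}. ennreal (x powr a * (u - x) powr (a - 1) * (t - x) powr (- 2 * a)) \<partial>lborel)"
      by (rule k_core[OF ut])
    \<comment> \<open>The constant is itself a Beta integral over \<open>{0<..<u}\<close>, with
      exponents \<open>- a\<close> and \<open>a - 1\<close>; it supplies the summand
      \<open>x powr (- 2 * a)\<close> of \<open>?r x\<close>.\<close>
    also have "ennreal (Beta (1 - a) a) = (\<integral>\<^sup>+x\<in>{0<..<u}. ennreal ((x - 0) powr (1 - a - 1) * (u - x) powr (a - 1)) \<partial>lborel)"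
      using a0 a1 ut by (subst nn_beta_interval) auto
    also have "\<dots> + (\<integral>\<^sup>+x\<in>{0<..<u}. ennreal (x powr a * (u - x) powr (a - 1) * (t - x) powr (- 2 * a)) \<partial>lborel)
       = (\<integral>\<^sup>+x\<in>{0<..<u}. ennreal ((x - 0) powr (1 - a - 1) * (u - x) powr (a - 1)) + ennreal (x powr a * (u - x) powr (a - 1) * (t - x) powr (- 2 * a)) \<partial>lborel)"
      by (rule set_nn_add[symmetric]) auto
    also have "\<dots> = (\<integral>\<^sup>+x\<in>{0<..<u}. ennreal ((u - x) powr (a - 1) * (x powr a * ?r x)) \<partial>lborel)"
    proof (rule set_nn_cong)
      fix x assume x: "x \<in> {0<..<u}"
      have "x powr a * x powr (- 2 * a) = x powr (- a)" by (simp flip: powr_add)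
      then have "(x - 0) powr (1 - a - 1) * (u - x) powr (a - 1) + x powr a * (u - x) powr (a - 1) * (t - x) powr (- 2 * a)
         = (u - x) powr (a - 1) * (x powr a * ?r x)"
        by (simp add: algebra_simps)
      then show "ennreal ((x - 0) powr (1 - a - 1) * (u - x) powr (a - 1)) + ennreal (x powr a * (u - x) powr (a - 1) * (t - x) powr (- 2 * a))
         = ennreal ((u - x) powr (a - 1) * (x powr a * ?r x))"
        by (subst ennreal_plus[symmetric]) auto
    qed
    finally have *: "ennreal (2 * betab * u powr a * k t u) = (\<integral>\<^sup>+x\<in>{0<..<u}. ennreal ((u - x) powr (a - 1) * (x powr a * ?r x)) \<partial>lborel)" .
    have "u powr (- a) * u powr a = 1" using u by (simp flip: powr_add)
    then have "k s u * k t u = (k s u * u powr (- a) / (2 * betab)) * (2 * betab * u powr a * k t u)"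
      using betab_pos by (simp add: mult_ac)
    then have "ennreal (k s u * k t u) = ennreal (k s u * u powr (- a) / (2 * betab)) * ennreal (2 * betab * u powr a * k t u)"
      using betab_pos k_nonneg by (simp flip: ennreal_mult')
    also have "\<dots> = (\<integral>\<^sup>+x\<in>{0<..<u}. ennreal (k s u * u powr (- a) / (2 * betab)) * ennreal ((u - x) powr (a - 1) * (x powr a * ?r x)) \<partial>lborel)"
      unfolding * by (rule set_nn_cmult[symmetric]) auto
    also have "\<dots> = (\<integral>\<^sup>+x\<in>{0<..<u}. ?G u x \<partial>lborel)"
      using betab_pos by (intro set_nn_cong) (auto simp: k_nonneg mult_ac simp flip: ennreal_mult)
    finally show "ennreal (k s u * k t u) = (\<integral>\<^sup>+x\<in>{0<..<u}. ?G u x \<partial>lborel)" .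
  qed
  also have "\<dots> = (\<integral>\<^sup>+x\<in>{0<..<s}. (\<integral>\<^sup>+u\<in>{x<..<s}. ?G u x \<partial>lborel) \<partial>lborel)"
    by (rule nn_triangle) measurable
  also have "\<dots> = (\<integral>\<^sup>+x\<in>{0<..<s}. ennreal (betaa / (2 * betab)) * ennreal (?r x) \<partial>lborel)"
  proof (rule set_nn_cong)
    fix x assume x: "x \<in> {0<..<s}"
    have "(\<integral>\<^sup>+u\<in>{x<..<s}. ?G u x \<partial>lborel) = ennreal (x powr a * ?r x / (2 * betab)) *
      (\<integral>\<^sup>+u\<in>{x<..<s}. ennreal (k s u * u powr (- a) * (u - x) powr (a - 1)) \<partial>lborel)"
      by (subst set_nn_cmult[symmetric]) (auto simp: mult_ac)
    also have "\<dots> = ennreal (x powr a * ?r x / (2 * betab)) * ennreal (betaa * x powr (- a))"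
      using x by (subst k_inverse) auto
    also have "\<dots> = ennreal (x powr a * ?r x / (2 * betab) * (betaa * x powr (- a)))"
      using betab_pos by (intro ennreal_mult'[symmetric]) auto
    also have "x powr a * ?r x / (2 * betab) * (betaa * x powr (- a)) = betaa / (2 * betab) * ?r x * (x powr a * x powr (- a))"
      by (simp only: times_divide_eq_left times_divide_eq_right mult_ac)
    also have "x powr a * x powr (- a) = 1" using x by (simp flip: powr_add)
    finally show "(\<integral>\<^sup>+u\<in>{x<..<s}. ?G u x \<partial>lborel) = ennreal (betaa / (2 * betab)) * ennreal (?r x)"
      using betaa_pos betab_pos ennreal_mult'[of "betaa / (2 * betab)" "?r x"] by simp
  qed
  also have "\<dots> = ennreal (betaa / (2 * betab)) * ennreal (2 * R t s / (1 - 2 * a))"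
    using nn_powr_neg2a[OF s] by (subst set_nn_cmult) auto
  also have "\<dots> = ennreal (kappa * R t s)"
    using betaa_pos betab_pos a1 by (simp add: kappa_def mult_ac flip: ennreal_mult')
  finally show ?thesis .
qed

text \<open>The relation on which the inverse rests: it makes \<open>ka\<close> equal to
  \<open>k\<close> minus a mean of \<open>k\<close>. On the right, \<open>ka\<close> contributes the
  weight \<open>x powr a\<close> and \<open>kb\<close>, after an exchange of integrals, the weight
  \<open>s powr a - x powr a\<close> against the same function \<open>?j\<close>; their sum is the
  constant \<open>s powr a\<close>.\<close>

lemma kb_mean:
  assumes "0 < u" "0 < s"
  shows "ennreal (kb s u) = ennreal (s powr (- a)) * (\<integral>\<^sup>+x\<in>{0<..<s}. ennreal (a * x powr (a - 1) * k x u) \<partial>lborel)"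
proof (cases "u < s")
  case False
  have "(\<integral>\<^sup>+x\<in>{0<..<s}. ennreal (a * x powr (a - 1) * k x u) \<partial>lborel) = (\<integral>\<^sup>+x\<in>{0<..<s}. 0 \<partial>lborel)"
    using False by (intro set_nn_cong) (auto simp: k_outside)
  then show ?thesis using False by (auto simp: kb_def)
next
  case True
  let ?j = "\<lambda>v. v powr (- 1 - a) * (v - u) powr (- a)"
  have "(\<integral>\<^sup>+x\<in>{0<..<s}. ennreal (a * x powr (a - 1) * k x u) \<partial>lborel) = (\<integral>\<^sup>+x\<in>{u<..<s}. ennreal (a * x powr (a - 1) * k x u) \<partial>lborel)"
    using assms by (intro nn_integral_cong) (auto simp: k_outside split: split_indicator)
  also have "\<dots> = (\<integral>\<^sup>+x\<in>{u<..<s}. ennreal (a * x powr (a - 1) * ka x u) + ennreal (a * x powr (a - 1) * kb x u) \<partial>lborel)"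
    using a0 by (intro set_nn_cong) (auto simp: k_def ka_nonneg kb_nonneg distrib_left simp flip: ennreal_plus)
  also have "\<dots> = (\<integral>\<^sup>+x\<in>{u<..<s}. ennreal (a * x powr (a - 1) * ka x u) \<partial>lborel) + (\<integral>\<^sup>+x\<in>{u<..<s}. ennreal (a * x powr (a - 1) * kb x u) \<partial>lborel)"
    by (rule set_nn_add) auto
  also have "(\<integral>\<^sup>+x\<in>{u<..<s}. ennreal (a * x powr (a - 1) * ka x u) \<partial>lborel) =
     (\<integral>\<^sup>+x\<in>{u<..<s}. ennreal (a * u powr a * x powr a) * ennreal (?j x) \<partial>lborel)"
  proof (rule set_nn_cong)
    fix x assume x: "x \<in> {u<..<s}"
    have "x powr (a - 1) * x powr (- a) = x powr a * x powr (- 1 - a)" by (simp flip: powr_add)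
    then have "a * x powr (a - 1) * ka x u = a * u powr a * x powr a * ?j x"
      using x assms by (simp add: ka_def algebra_simps)
    then show "ennreal (a * x powr (a - 1) * ka x u) = ennreal (a * u powr a * x powr a) * ennreal (?j x)"
      using a0 by (simp only:) (rule ennreal_mult', simp)
  qed
  also have "(\<integral>\<^sup>+x\<in>{u<..<s}. ennreal (a * x powr (a - 1) * kb x u) \<partial>lborel) =
     (\<integral>\<^sup>+x\<in>{u<..<s}. (\<integral>\<^sup>+v\<in>{u<..<x}. ennreal (a * x powr (a - 1)) * (ennreal (a * u powr a) * ennreal (?j v)) \<partial>lborel) \<partial>lborel)"
  proof (rule set_nn_cong)
    fix x assume x: "x \<in> {u<..<s}"
    have "ennreal (a * x powr (a - 1) * kb x u) = ennreal (a * x powr (a - 1)) * ennreal (kb x u)"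
      using a0 by (intro ennreal_mult') auto
    also have "ennreal (kb x u) = ennreal (a * u powr a) * (\<integral>\<^sup>+v\<in>{u<..<x}. ennreal (?j v) \<partial>lborel)"
      using x assms by (intro kb_nn) auto
    finally show "ennreal (a * x powr (a - 1) * kb x u) = (\<integral>\<^sup>+v\<in>{u<..<x}. ennreal (a * x powr (a - 1)) * (ennreal (a * u powr a) * ennreal (?j v)) \<partial>lborel)"
      by (simp add: set_nn_cmult)
  qed
  also have "\<dots> = (\<integral>\<^sup>+v\<in>{u<..<s}. (\<integral>\<^sup>+x\<in>{v<..<s}. ennreal (a * x powr (a - 1)) * (ennreal (a * u powr a) * ennreal (?j v)) \<partial>lborel) \<partial>lborel)"
    by (rule nn_triangle) measurable
  also have "\<dots> = (\<integral>\<^sup>+v\<in>{u<..<s}. ennreal (a * u powr a * (s powr a - v powr a)) * ennreal (?j v) \<partial>lborel)"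
  proof (rule set_nn_cong)
    fix v assume v: "v \<in> {u<..<s}"
    have "(\<integral>\<^sup>+x\<in>{v<..<s}. ennreal (a * x powr (a - 1)) * (ennreal (a * u powr a) * ennreal (?j v)) \<partial>lborel)
      = (ennreal (a * u powr a) * ennreal (?j v)) * (\<integral>\<^sup>+x\<in>{v<..<s}. ennreal (a * x powr (a - 1)) \<partial>lborel)"
      by (subst set_nn_cmult[symmetric]) (auto simp: mult_ac)
    also have "\<dots> = (ennreal (a * u powr a) * ennreal (?j v)) * ennreal (s powr a - v powr a)"
      using v assms by (subst powr_integral_pos) auto
    finally show "(\<integral>\<^sup>+x\<in>{v<..<s}. ennreal (a * x powr (a - 1)) * (ennreal (a * u powr a) * ennreal (?j v)) \<partial>lborel) = 
       ennreal (a * u powr a * (s powr a - v powr a)) * ennreal (?j v)"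
      using a0 v assms by (simp add: ennreal_mult' mult_ac)
  qed
  also have "(\<integral>\<^sup>+x\<in>{u<..<s}. ennreal (a * u powr a * x powr a) * ennreal (?j x) \<partial>lborel) + \<dots>
     = (\<integral>\<^sup>+x\<in>{u<..<s}. ennreal (a * u powr a * x powr a) * ennreal (?j x) + ennreal (a * u powr a * (s powr a - x powr a)) * ennreal (?j x) \<partial>lborel)"
    by (rule set_nn_add[symmetric]) auto
  also have "\<dots> = (\<integral>\<^sup>+x\<in>{u<..<s}. ennreal (a * u powr a * s powr a) * ennreal (?j x) \<partial>lborel)"
  proof (rule set_nn_cong)
    fix x assume x: "x \<in> {u<..<s}"
    have "0 \<le> a * u powr a * (s powr a - x powr a)"
      using a0 x assms powr_mono2[of a x s] by auto
    then have "ennreal (a * u powr a * x powr a) + ennreal (a * u powr a * (s powr a - x powr a)) = ennreal (a * u powr a * s powr a)"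
      using a0 by (subst ennreal_plus[symmetric]) (auto simp: algebra_simps)
    then show "ennreal (a * u powr a * x powr a) * ennreal (?j x) + ennreal (a * u powr a * (s powr a - x powr a)) * ennreal (?j x)
      = ennreal (a * u powr a * s powr a) * ennreal (?j x)"
      by (simp flip: distrib_right)
  qed
  also have "\<dots> = ennreal (s powr a) * (ennreal (a * u powr a) * (\<integral>\<^sup>+x\<in>{u<..<s}. ennreal (?j x) \<partial>lborel))"
    using a0 by (subst set_nn_cmult) (auto simp: ennreal_mult mult_ac)
  also have "\<dots> = ennreal (s powr a) * ennreal (kb s u)"
    by (subst kb_nn[OF assms(1) True, symmetric]) simp
  finally have "(\<integral>\<^sup>+x\<in>{0<..<s}. ennreal (a * x powr (a - 1) * k x u) \<partial>lborel) = ennreal (s powr a) * ennreal (kb s u)" .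
  moreover have "ennreal (s powr (- a)) * ennreal (s powr a) = 1"
    using assms by (simp flip: ennreal_mult' powr_add)
  ultimately show ?thesis by (simp add: mult.assoc[symmetric])
qed

lemma kb_mean_unit:
  assumes "0 < u" "0 < t" "0 < x"
  shows "ennreal (kb (t * x) u) = ennreal (x powr (- a)) * (\<integral>\<^sup>+z\<in>{0<..<x}. ennreal (a * z powr (a - 1) * k (t * z) u) \<partial>lborel)"
proof -
  have "ennreal (kb (t * x) u) = ennreal ((t * x) powr (- a)) * (\<integral>\<^sup>+z\<in>{t * 0<..<t * x}. ennreal (a * z powr (a - 1) * k z u) \<partial>lborel)"
    using assms by (subst kb_mean) auto
  also have "(\<integral>\<^sup>+z\<in>{t * 0<..<t * x}. ennreal (a * z powr (a - 1) * k z u) \<partial>lborel) =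
     ennreal t * (\<integral>\<^sup>+z\<in>{0<..<x}. ennreal (a * (t * z) powr (a - 1) * k (t * z) u) \<partial>lborel)"
    using assms by (intro nn_scale_Ioo) auto
  also have "(\<integral>\<^sup>+z\<in>{0<..<x}. ennreal (a * (t * z) powr (a - 1) * k (t * z) u) \<partial>lborel) =
     (\<integral>\<^sup>+z\<in>{0<..<x}. ennreal (t powr (a - 1)) * ennreal (a * z powr (a - 1) * k (t * z) u) \<partial>lborel)"
    using assms by (intro set_nn_cong) (auto simp: powr_mult mult_ac simp flip: ennreal_mult')
  also have "\<dots> = ennreal (t powr (a - 1)) * (\<integral>\<^sup>+z\<in>{0<..<x}. ennreal (a * z powr (a - 1) * k (t * z) u) \<partial>lborel)"
    by (rule set_nn_cmult) auto
  also have "ennreal ((t * x) powr (- a)) * (ennreal t * (ennreal (t powr (a - 1)) * (\<integral>\<^sup>+z\<in>{0<..<x}. ennreal (a * z powr (a - 1) * k (t * z) u) \<partial>lborel)))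
     = ennreal ((t * x) powr (- a) * (t * t powr (a - 1))) * (\<integral>\<^sup>+z\<in>{0<..<x}. ennreal (a * z powr (a - 1) * k (t * z) u) \<partial>lborel)"
    using assms by (simp add: ennreal_mult mult_ac)
  also have "(t * x) powr (- a) * (t * t powr (a - 1)) = x powr (- a)"
  proof -
    have "t * t powr (a - 1) = t powr a" using assms by (simp add: powr_mult_base)
    moreover have "t powr (- a) * t powr a = 1" using assms by (simp flip: powr_add)
    ultimately show ?thesis using assms by (simp add: powr_mult mult_ac)
  qed
  finally show ?thesis .
qed

definition w1 :: "real \<Rightarrow> real" where "w1 x = x powr (a - 1) * (1 - x) powr (a - 1)"
text \<open>At \<open>z\<close> this is \<open>a * z powr (a - 1)\<close> times the integral of
  \<open>w1 x * x powr (- a)\<close> over \<open>{z<..<1}\<close>: the weight obtained when the mean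
  in \<open>kb_mean_unit\<close> is integrated against \<open>w1\<close> and the integrals are
  exchanged.\<close>

definition w2 :: "real \<Rightarrow> real" where "w2 x = a * x powr (a - 1) * ibeta a 0 (1 - x)"

lemma w_meas [measurable]: "w1 \<in> borel_measurable borel" "w2 \<in> borel_measurable borel"
  unfolding w1_def w2_def by measurable

lemma w_nonneg: "0 \<le> w1 x" "0 \<le> w2 x"
  using a0 by (auto simp: w1_def w2_def ibeta_nonneg)

lemma w2_nn:
  assumes "0 < z"
  shows "ennreal (w2 z) = (\<integral>\<^sup>+x\<in>{z<..<1}. ennreal (a * z powr (a - 1)) * ennreal ((1 - x) powr (a - 1) * x powr (- 1)) \<partial>lborel)"
proof -
  have "ennreal (w2 z) = ennreal (a * z powr (a - 1)) * ennreal (ibeta a 0 (1 - z))"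
    using a0 by (simp add: w2_def ennreal_mult')
  also have "ennreal (ibeta a 0 (1 - z)) = (\<integral>\<^sup>+y\<in>{0<..<1 - z}. ennreal (y powr (a - 1) * (1 - y) powr (0 - 1)) \<partial>lborel)"
    using a0 assms by (intro ibeta_nn[symmetric]) auto
  also have "\<dots> = (\<integral>\<^sup>+x\<in>{z<..<1}. ennreal ((1 - x) powr (a - 1) * x powr (- 1)) \<partial>lborel)"
    by (subst nn_reflect[where c=1]) auto
  finally show ?thesis by (subst set_nn_cmult) auto
qed

lemma powr_minus_one_mult: "0 < x \<Longrightarrow> x powr (- 1) * x powr a = x powr (a - 1)" for x :: real
  using powr_add[of x "- 1" a] by (simp only: add.commute[of "- 1" a] uminus_add_conv_diff add_uminus_conv_diff)

text \<open>Replaces \<open>kb\<close> by its mean and moves the averaging from the kernel to the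
  weight. Consequently the difference of the two weights sees only the part
  \<open>ka\<close>.\<close>

lemma nn_w1_kb:
  assumes "0 < u" "0 < t"
  shows "(\<integral>\<^sup>+x\<in>{0<..<1}. ennreal (w1 x * kb (t * x) u) \<partial>lborel) = (\<integral>\<^sup>+x\<in>{0<..<1}. ennreal (w2 x * k (t * x) u) \<partial>lborel)"
proof -
  let ?G = "\<lambda>x z. ennreal ((1 - x) powr (a - 1) * x powr (- 1)) * ennreal (a * z powr (a - 1) * k (t * z) u)"
  have "(\<integral>\<^sup>+x\<in>{0<..<1}. ennreal (w1 x * kb (t * x) u) \<partial>lborel) = (\<integral>\<^sup>+x\<in>{0<..<1}. (\<integral>\<^sup>+z\<in>{0<..<x}. ?G x z \<partial>lborel) \<partial>lborel)"
  proof (rule set_nn_cong)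
    fix x :: real assume x: "x \<in> {0<..<1}"
    have "ennreal (w1 x * kb (t * x) u) = ennreal (w1 x) * ennreal (kb (t * x) u)"
      by (intro ennreal_mult') (auto simp: w_nonneg)
    also have "\<dots> = ennreal (w1 x * x powr (- a)) * (\<integral>\<^sup>+z\<in>{0<..<x}. ennreal (a * z powr (a - 1) * k (t * z) u) \<partial>lborel)"
      using x assms by (subst kb_mean_unit) (auto simp: ennreal_mult w_nonneg mult_ac)
    also have "w1 x * x powr (- a) = (1 - x) powr (a - 1) * x powr (- 1)"
    proof -
      have "x powr (a - 1) * x powr (- a) = x powr (- 1)" by (simp only: powr_add[symmetric]) simp
      moreover have "w1 x * x powr (- a) = (1 - x) powr (a - 1) * (x powr (a - 1) * x powr (- a))"
        by (simp add: w1_def)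
      ultimately show ?thesis by (simp only:)
    qed
    finally show "ennreal (w1 x * kb (t * x) u) = (\<integral>\<^sup>+z\<in>{0<..<x}. ?G x z \<partial>lborel)"
      by (subst set_nn_cmult) auto
  qed
  also have "\<dots> = (\<integral>\<^sup>+z\<in>{0<..<1}. (\<integral>\<^sup>+x\<in>{z<..<1}. ?G x z \<partial>lborel) \<partial>lborel)"
    by (rule nn_triangle) measurable
  also have "\<dots> = (\<integral>\<^sup>+x\<in>{0<..<1}. ennreal (w2 x * k (t * x) u) \<partial>lborel)"
  proof (rule set_nn_cong)
    fix z :: real assume z: "z \<in> {0<..<1}"
    have "ennreal (w2 z * k (t * z) u) = ennreal (k (t * z) u) * ennreal (w2 z)"
      by (simp add: ennreal_mult w_nonneg k_nonneg mult.commute)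
    also have "\<dots> = (\<integral>\<^sup>+x\<in>{z<..<1}. ennreal (k (t * z) u) * (ennreal (a * z powr (a - 1)) * ennreal ((1 - x) powr (a - 1) * x powr (- 1))) \<partial>lborel)"
      using z by (subst w2_nn, simp, subst set_nn_cmult[symmetric]) auto
    also have "\<dots> = (\<integral>\<^sup>+x\<in>{z<..<1}. ?G x z \<partial>lborel)"
      using a0 by (intro set_nn_cong) (auto simp: k_nonneg ennreal_mult mult_ac)
    finally show "(\<integral>\<^sup>+x\<in>{z<..<1}. ?G x z \<partial>lborel) = ennreal (w2 z * k (t * z) u)" ..
  qed
  finally show ?thesis .
qed

text \<open>The powers of \<open>r\<close> combine to \<open>r powr (- 1)\<close>, which after the
  reflection \<open>r = t - x\<close> is the exponent that the Moebius Beta integral with parameters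
  \<open>a\<close> and \<open>1 - a\<close> asks for. The powers of \<open>u\<close> then cancel; a
  value independent of \<open>u < t\<close> is what makes an indicator function appear.\<close>

lemma nn_w1_ka:
  assumes "0 < u" "u < t"
  shows "(\<integral>\<^sup>+x\<in>{0<..<1}. ennreal (w1 x * ka (t * x) u) \<partial>lborel) = ennreal (betaa * t powr (- a))"
proof -
  have t: "0 < t" using assms by simp
  let ?g = "\<lambda>r. (t - r) powr (a - 1) * r powr (a - 1) * ka r u"
  have "(\<integral>\<^sup>+r\<in>{0<..<t}. ennreal (?g r) \<partial>lborel) = (\<integral>\<^sup>+r\<in>{u<..<t}. ennreal (?g r) \<partial>lborel)"
    using assms by (intro nn_integral_cong) (auto simp: ka_def split: split_indicator)
  also have "\<dots> = (\<integral>\<^sup>+r\<in>{u<..<t}. ennreal (u powr a) * ennreal ((t - r) powr (a - 1) * (r - u) powr (- a) * r powr (- 1)) \<partial>lborel)"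
  proof (rule set_nn_cong)
    fix r assume r: "r \<in> {u<..<t}"
    have "r powr (a - 1) * r powr (- a) = r powr (- 1)" by (simp only: powr_add[symmetric]) simp
    moreover have "?g r = u powr a * ((t - r) powr (a - 1) * (r - u) powr (- a) * (r powr (a - 1) * r powr (- a)))"
      using r assms by (simp add: ka_def)
    ultimately have "?g r = u powr a * ((t - r) powr (a - 1) * (r - u) powr (- a) * r powr (- 1))"
      by (simp only:)
    then show "ennreal (?g r) = ennreal (u powr a) * ennreal ((t - r) powr (a - 1) * (r - u) powr (- a) * r powr (- 1))"
      by (simp only:) (rule ennreal_mult', simp)
  qed
  also have "\<dots> = ennreal (u powr a) * (\<integral>\<^sup>+r\<in>{u<..<t}. ennreal ((t - r) powr (a - 1) * (r - u) powr (- a) * r powr (- 1)) \<partial>lborel)"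
    by (rule set_nn_cmult) auto
  also have "(\<integral>\<^sup>+r\<in>{u<..<t}. ennreal ((t - r) powr (a - 1) * (r - u) powr (- a) * r powr (- 1)) \<partial>lborel)
     = (\<integral>\<^sup>+x\<in>{0<..<t - u}. ennreal (x powr (a - 1) * (t - u - x) powr (1 - a - 1) * (t - x) powr (- a - (1 - a))) \<partial>lborel)"
    by (subst nn_reflect[where c=t]) (auto simp: algebra_simps)
  also have "\<dots> = ennreal (betaa * t powr (- (1 - a)) * u powr (- a))"
    using assms a0 a1 by (subst nn_beta_moebius) (auto simp: betaa_def)
  also have "ennreal (u powr a) * \<dots> = ennreal (betaa * t powr (a - 1))"
  proof -
    have "u powr a * u powr (- a) = 1" using assms by (simp flip: powr_add)
    then have "u powr a * (betaa * t powr (- (1 - a)) * u powr (- a)) = betaa * t powr (a - 1)" by (simp add: mult_ac)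
    then show ?thesis by (metis ennreal_mult' powr_ge_zero)
  qed
  finally have *: "(\<integral>\<^sup>+r\<in>{0<..<t}. ennreal (?g r) \<partial>lborel) = ennreal (betaa * t powr (a - 1))" .
  have "ennreal t * (\<integral>\<^sup>+x\<in>{0<..<1}. ennreal (?g (t * x)) \<partial>lborel) = (\<integral>\<^sup>+r\<in>{t * 0<..<t * 1}. ennreal (?g r) \<partial>lborel)"
    using t by (intro nn_scale_Ioo[symmetric]) auto
  also have "\<dots> = ennreal (betaa * t powr (a - 1))" using * by simp
  finally have **: "ennreal t * (\<integral>\<^sup>+x\<in>{0<..<1}. ennreal (?g (t * x)) \<partial>lborel) = ennreal (betaa * t powr (a - 1))" .
  have "(\<integral>\<^sup>+x\<in>{0<..<1}. ennreal (w1 x * ka (t * x) u) \<partial>lborel) = (\<integral>\<^sup>+x\<in>{0<..<1}. ennreal (t powr (2 - 2 * a)) * ennreal (?g (t * x)) \<partial>lborel)"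
  proof (rule set_nn_cong)
    fix x :: real assume x: "x \<in> {0<..<1}"
    have "t - t * x = t * (1 - x)" by (simp add: algebra_simps)
    then have "?g (t * x) = t powr (a - 1) * t powr (a - 1) * (w1 x * ka (t * x) u)"
      using x t by (simp add: w1_def powr_mult)
    moreover have "t powr (2 - 2 * a) * (t powr (a - 1) * t powr (a - 1)) = 1"
      using t by (simp flip: powr_add)
    ultimately have "t powr (2 - 2 * a) * ?g (t * x) = w1 x * ka (t * x) u"
      by (metis mult.assoc mult_1)
    then show "ennreal (w1 x * ka (t * x) u) = ennreal (t powr (2 - 2 * a)) * ennreal (?g (t * x))"
      by (metis ennreal_mult' powr_ge_zero)
  qed
  also have "\<dots> = ennreal (t powr (2 - 2 * a)) * (\<integral>\<^sup>+x\<in>{0<..<1}. ennreal (?g (t * x)) \<partial>lborel)"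
    by (rule set_nn_cmult) auto
  also have "\<dots> = ennreal (t powr (1 - 2 * a)) * (ennreal t * (\<integral>\<^sup>+x\<in>{0<..<1}. ennreal (?g (t * x)) \<partial>lborel))"
  proof -
    have "t powr (2 - 2 * a) = t powr (1 - 2 * a) * t" using t powr_add[of t "1 - 2 * a" 1] by simp
    then show ?thesis using t by (simp add: ennreal_mult mult.assoc)
  qed
  also have "\<dots> = ennreal (t powr (1 - 2 * a) * (betaa * t powr (a - 1)))"
    unfolding ** by (rule ennreal_mult'[symmetric]) simp
  also have "t powr (1 - 2 * a) * (betaa * t powr (a - 1)) = betaa * t powr (- a)"
    by (simp flip: powr_add)
  finally show ?thesis .
qed

text \<open>The term with \<open>w2\<close> stands on the right because subtraction in
  \<open>ennreal\<close> is truncated.\<close>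

lemma nn_w_k:
  assumes "0 < u" "0 < t" "u \<noteq> t"
  shows "(\<integral>\<^sup>+x\<in>{0<..<1}. ennreal (w1 x * k (t * x) u) \<partial>lborel) =
     ennreal (betaa * t powr (- a)) * indicator {0<..<t} u + (\<integral>\<^sup>+x\<in>{0<..<1}. ennreal (w2 x * k (t * x) u) \<partial>lborel)"
proof -
  have "(\<integral>\<^sup>+x\<in>{0<..<1}. ennreal (w1 x * k (t * x) u) \<partial>lborel) = (\<integral>\<^sup>+x\<in>{0<..<1}. ennreal (w1 x * ka (t * x) u) + ennreal (w1 x * kb (t * x) u) \<partial>lborel)"
    by (intro set_nn_cong) (auto simp: k_def distrib_left w_nonneg ka_nonneg kb_nonneg)
  also have "\<dots> = (\<integral>\<^sup>+x\<in>{0<..<1}. ennreal (w1 x * ka (t * x) u) \<partial>lborel) + (\<integral>\<^sup>+x\<in>{0<..<1}. ennreal (w1 x * kb (t * x) u) \<partial>lborel)"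
    by (rule set_nn_add) auto
  also have "(\<integral>\<^sup>+x\<in>{0<..<1}. ennreal (w1 x * ka (t * x) u) \<partial>lborel) = ennreal (betaa * t powr (- a)) * indicator {0<..<t} u"
  proof (cases "u < t")
    case True then show ?thesis using assms nn_w1_ka[of u t] by simp
  next
    case False
    have "(\<integral>\<^sup>+x\<in>{0<..<1}. ennreal (w1 x * ka (t * x) u) \<partial>lborel) = (\<integral>\<^sup>+x\<in>{0<..<1::real}. 0 \<partial>lborel)"
    proof (rule set_nn_cong)
      fix x :: real assume "x \<in> {0<..<1}"
      then have "t * x < t * 1" using assms by (intro mult_strict_left_mono) auto
      then show "ennreal (w1 x * ka (t * x) u) = 0" using False by (simp add: ka_def)
    qed
    then show ?thesis using False by simp
  qed
  finally show ?thesis using nn_w1_kb[OF assms(1,2)] by simp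
qed

text \<open>Superposes \<open>nn_w_k\<close> with the density \<open>\<phi>\<close>, so that
  \<open>A0\<close> can be evaluated on any function of \<open>s\<close> that is an integral of
  \<open>k s u * \<phi> u\<close> over \<open>u\<close>.\<close>

lemma nn_w_transform:
  fixes \<phi> :: "real \<Rightarrow> ennreal"
  assumes [measurable]: "\<phi> \<in> borel_measurable borel" and t: "0 < t"
  shows "(\<integral>\<^sup>+x\<in>{0<..<1}. ennreal (w1 x) * (\<integral>\<^sup>+u\<in>{0<..}. ennreal (k (t * x) u) * \<phi> u \<partial>lborel) \<partial>lborel) =
     ennreal (betaa * t powr (- a)) * (\<integral>\<^sup>+u\<in>{0<..<t}. \<phi> u \<partial>lborel) +
     (\<integral>\<^sup>+x\<in>{0<..<1}. ennreal (w2 x) * (\<integral>\<^sup>+u\<in>{0<..}. ennreal (k (t * x) u) * \<phi> u \<partial>lborel) \<partial>lborel)"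
proof -
  have swap: "(\<integral>\<^sup>+x\<in>{0<..<1}. ennreal (w x) * (\<integral>\<^sup>+u\<in>{0<..}. ennreal (k (t * x) u) * \<phi> u \<partial>lborel) \<partial>lborel)
     = (\<integral>\<^sup>+u\<in>{0<..}. \<phi> u * (\<integral>\<^sup>+x\<in>{0<..<1}. ennreal (w x * k (t * x) u) \<partial>lborel) \<partial>lborel)"
    if [measurable]: "w \<in> borel_measurable borel" and w: "\<And>x. 0 \<le> w x" for w :: "real \<Rightarrow> real"
  proof -
    have "(\<integral>\<^sup>+x\<in>{0<..<1}. ennreal (w x) * (\<integral>\<^sup>+u\<in>{0<..}. ennreal (k (t * x) u) * \<phi> u \<partial>lborel) \<partial>lborel)
      = (\<integral>\<^sup>+x. (\<integral>\<^sup>+u. ennreal (w x) * ennreal (k (t * x) u) * \<phi> u * indicator {0<..} u * indicator {0<..<1} x \<partial>lborel) \<partial>lborel)"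
      by (subst nn_integral_cmult[symmetric], measurable, subst nn_integral_multc[symmetric], measurable)
         (simp add: mult_ac)
    also have "\<dots> = (\<integral>\<^sup>+u. (\<integral>\<^sup>+x. ennreal (w x) * ennreal (k (t * x) u) * \<phi> u * indicator {0<..} u * indicator {0<..<1} x \<partial>lborel) \<partial>lborel)"
      by (rule lborel_pair.Fubini'[symmetric]) measurable
    also have "\<dots> = (\<integral>\<^sup>+u\<in>{0<..}. \<phi> u * (\<integral>\<^sup>+x\<in>{0<..<1}. ennreal (w x * k (t * x) u) \<partial>lborel) \<partial>lborel)"
      by (subst nn_integral_cmult[symmetric], measurable, subst nn_integral_multc[symmetric], measurable)
         (simp add: mult_ac ennreal_mult w k_nonneg)
    finally show ?thesis .
  qed
  have "(\<integral>\<^sup>+u\<in>{0<..}. \<phi> u * (\<integral>\<^sup>+x\<in>{0<..<1}. ennreal (w1 x * k (t * x) u) \<partial>lborel) \<partial>lborel)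
    = (\<integral>\<^sup>+u\<in>{0<..}. ennreal (betaa * t powr (- a)) * (\<phi> u * indicator {0<..<t} u) + \<phi> u * (\<integral>\<^sup>+x\<in>{0<..<1}. ennreal (w2 x * k (t * x) u) \<partial>lborel) \<partial>lborel)"
  proof (rule nn_integral_cong_AE)
    show "AE u in lborel. \<phi> u * (\<integral>\<^sup>+x\<in>{0<..<1}. ennreal (w1 x * k (t * x) u) \<partial>lborel) * indicator {0<..} u =
      (ennreal (betaa * t powr (- a)) * (\<phi> u * indicator {0<..<t} u) + \<phi> u * (\<integral>\<^sup>+x\<in>{0<..<1}. ennreal (w2 x * k (t * x) u) \<partial>lborel)) * indicator {0<..} u"
      using AE_lborel_singleton[of t]
    proof eventually_elim
      case (elim u)
      show ?case
      proof (cases "0 < u")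
        case True
        show ?thesis unfolding nn_w_k[OF True t elim] using True
          by (simp add: distrib_left mult_ac)
      qed simp
    qed
  qed
  also have "\<dots> = (\<integral>\<^sup>+u\<in>{0<..}. ennreal (betaa * t powr (- a)) * (\<phi> u * indicator {0<..<t} u) \<partial>lborel) +
      (\<integral>\<^sup>+u\<in>{0<..}. \<phi> u * (\<integral>\<^sup>+x\<in>{0<..<1}. ennreal (w2 x * k (t * x) u) \<partial>lborel) \<partial>lborel)"
    by (rule set_nn_add) measurable
  also have "(\<integral>\<^sup>+u\<in>{0<..}. ennreal (betaa * t powr (- a)) * (\<phi> u * indicator {0<..<t} u) \<partial>lborel)
      = ennreal (betaa * t powr (- a)) * (\<integral>\<^sup>+u\<in>{0<..<t}. \<phi> u \<partial>lborel)"
    by (subst set_nn_cmult) (auto intro!: arg_cong[where f="\<lambda>x. _ * x"] nn_integral_cong split: split_indicator)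
  finally show ?thesis using swap[OF w_meas(1)] swap[OF w_meas(2)] by (simp add: w_nonneg)
qed

text \<open>Averaging a function with density \<open>g1\<close> against a weight means integrating
  \<open>g1\<close> against the tails of the weight, so the difference of tails is the kernel of
  \<open>A0\<close> on such functions. With
  \<open>j x = (1 - x) powr (a - 1) * x powr (- 1)\<close>, the tails are the integrals of
  \<open>x powr a * j x\<close> and of \<open>(x powr a - z powr a) * j x\<close>.\<close>

lemma nn_w_tail:
  assumes z: "0 < z" "z < 1"
  shows "(\<integral>\<^sup>+x\<in>{z<..<1}. ennreal (w1 x) \<partial>lborel) = ennreal (z powr a * ibeta a 0 (1 - z)) + (\<integral>\<^sup>+x\<in>{z<..<1}. ennreal (w2 x) \<partial>lborel)"
proof -
  let ?j = "\<lambda>x. (1 - x) powr (a - 1) * x powr (- 1)"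
  have 1: "(\<integral>\<^sup>+x\<in>{z<..<1}. ennreal (w2 x) \<partial>lborel) = (\<integral>\<^sup>+r\<in>{z<..<1}. ennreal (r powr a - z powr a) * ennreal (?j r) \<partial>lborel)"
  proof -
    have "(\<integral>\<^sup>+x\<in>{z<..<1}. ennreal (w2 x) \<partial>lborel) = (\<integral>\<^sup>+x\<in>{z<..<1}. (\<integral>\<^sup>+r\<in>{x<..<1}. ennreal (a * x powr (a - 1)) * ennreal (?j r) \<partial>lborel) \<partial>lborel)"
      using z by (intro set_nn_cong w2_nn) auto
    also have "\<dots> = (\<integral>\<^sup>+r\<in>{z<..<1}. (\<integral>\<^sup>+x\<in>{z<..<r}. ennreal (a * x powr (a - 1)) * ennreal (?j r) \<partial>lborel) \<partial>lborel)"
      by (rule nn_triangle[symmetric]) measurable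
    also have "\<dots> = (\<integral>\<^sup>+r\<in>{z<..<1}. ennreal (r powr a - z powr a) * ennreal (?j r) \<partial>lborel)"
    proof (rule set_nn_cong)
      fix r assume r: "r \<in> {z<..<1}"
      have "(\<integral>\<^sup>+x\<in>{z<..<r}. ennreal (a * x powr (a - 1)) * ennreal (?j r) \<partial>lborel)
         = ennreal (?j r) * (\<integral>\<^sup>+x\<in>{z<..<r}. ennreal (a * x powr (a - 1)) \<partial>lborel)"
        by (subst set_nn_cmult[symmetric]) (auto simp: mult_ac)
      also have "(\<integral>\<^sup>+x\<in>{z<..<r}. ennreal (a * x powr (a - 1)) \<partial>lborel) = ennreal (r powr a - z powr a)"
        using z r by (intro powr_integral_pos) auto
      finally show "(\<integral>\<^sup>+x\<in>{z<..<r}. ennreal (a * x powr (a - 1)) * ennreal (?j r) \<partial>lborel) = ennreal (r powr a - z powr a) * ennreal (?j r)"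
        by (simp only: mult.commute)
    qed
    finally show ?thesis .
  qed
  have 2: "ennreal (z powr a * ibeta a 0 (1 - z)) = (\<integral>\<^sup>+r\<in>{z<..<1}. ennreal (z powr a) * ennreal (?j r) \<partial>lborel)"
  proof -
    have "ennreal (ibeta a 0 (1 - z)) = (\<integral>\<^sup>+y\<in>{0<..<1 - z}. ennreal (y powr (a - 1) * (1 - y) powr (0 - 1)) \<partial>lborel)"
      using a0 z by (intro ibeta_nn[symmetric]) auto
    also have "\<dots> = (\<integral>\<^sup>+x\<in>{z<..<1}. ennreal (?j x) \<partial>lborel)"
      by (subst nn_reflect[where c=1]) auto
    finally show ?thesis by (subst set_nn_cmult) (auto simp: ennreal_mult')
  qed
  show ?thesis unfolding 1 2
  proof (subst set_nn_add[symmetric], measurable, rule set_nn_cong)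
    fix x assume x: "x \<in> {z<..<1}"
    have "ennreal (z powr a) + ennreal (x powr a - z powr a) = ennreal (x powr a)"
      using x z a0 powr_mono2[of a z x] by (subst ennreal_plus[symmetric]) auto
    moreover have "ennreal (w1 x) = ennreal (x powr a) * ennreal (?j x)"
    proof -
      have "w1 x = (x powr (- 1) * x powr a) * (1 - x) powr (a - 1)"
        using x z by (subst powr_minus_one_mult) (auto simp: w1_def)
      then have "w1 x = x powr a * ?j x" by (simp only: mult_ac)
      then show ?thesis by (simp only:) (rule ennreal_mult', simp)
    qed
    ultimately show "ennreal (w1 x) = ennreal (z powr a) * ennreal (?j x) + ennreal (x powr a - z powr a) * ennreal (?j x)"
      by (simp only: distrib_right[symmetric])
  qed
qed

end

section \<open>The operator and its right inverse\<close>

lemma set_LINT_measurable [measurable]: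
  fixes h :: "real \<Rightarrow> real"
  assumes [measurable]: "h \<in> borel_measurable borel"
  shows "(\<lambda>s. LBINT u:{0<..<s}. h u) \<in> borel_measurable borel"
proof -
  have "(\<lambda>s. LBINT u:{0<..<s}. h u) = (\<lambda>s. LINT u|lborel. (if 0 < u \<and> u < s then h u else 0))"
    unfolding set_lebesgue_integral_def
    by (auto intro!: ext Bochner_Integration.integral_cong split: split_indicator)
  then show ?thesis by simp
qed

lemma set_integral_split:
  fixes h :: "real \<Rightarrow> real"
  assumes h: "set_integrable lborel {p<..<r} h" and "p < q" "q < r"
  shows "(LBINT u:{p<..<r}. h u) = (LBINT u:{p<..<q}. h u) + (LBINT u:{q<..<r}. h u)"
proof -
  have "(LBINT u:{p<..<q} \<union> {q..<r}. h u) = (LBINT u:{p<..<q}. h u) + (LBINT u:{q..<r}. h u)"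
    using assms by (intro set_integral_Un set_integrable_subset[OF h]) auto
  moreover have "{p<..<q} \<union> {q..<r} = {p<..<r}" using assms by auto
  moreover have "(LBINT u:{q..<r}. h u) = (LBINT u:{q<..<r}. h u)"
    unfolding set_lebesgue_integral_def
  proof (rule integral_discrete_difference[of "{q}"])
    show "\<And>x. x \<in> space lborel \<Longrightarrow> x \<notin> {q} \<Longrightarrow> indicator {q..<r} x *\<^sub>R h x = indicator {q<..<r} x *\<^sub>R h x"
      by (auto split: split_indicator)
  qed auto
  ultimately show ?thesis by simp
qed

lemma set_integrable_mult_bounded:
  fixes w g :: "real \<Rightarrow> real"
  assumes w: "set_integrable lborel {0<..<1} w" and [measurable]: "w \<in> borel_measurable borel"
    and g: "set_borel_measurable borel {0<..<1} g" and b: "\<And>x. 0 < x \<Longrightarrow> x < 1 \<Longrightarrow> \<bar>g x\<bar> \<le> C"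
  shows "set_integrable lborel {0<..<1} (\<lambda>x. w x * g x)"
proof -
  have "set_integrable lborel {0<..<1} (\<lambda>x. C * w x)" using w by (rule set_integrable_mult_right)
  then show ?thesis
  proof (rule set_integrable_bound)
    have "(\<lambda>x. w x * (indicator {0<..<1} x *\<^sub>R g x)) \<in> borel_measurable borel"
      using g unfolding set_borel_measurable_def by measurable
    then show "set_borel_measurable lborel {0<..<1} (\<lambda>x. w x * g x)"
      unfolding set_borel_measurable_def by (simp add: mult_ac)
    show "AE x in lborel. x \<in> {0<..<1} \<longrightarrow> norm (w x * g x) \<le> norm (C * w x)"
    proof (intro AE_I2 impI)
      fix x :: real assume "x \<in> {0<..<1}"
      then have "\<bar>g x\<bar> \<le> \<bar>C\<bar>" using b[of x] by auto
      then show "norm (w x * g x) \<le> norm (C * w x)"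
        by (simp add: abs_mult mult.commute mult_right_mono)
    qed
  qed
qed

section \<open>Derivatives of the kernels and integration by parts\<close>

context fbm_kernel
begin

text \<open>\<open>D1 t\<close> and \<open>- D2 t\<close> are the derivatives of \<open>ka t\<close> and \<open>kb t\<close>, and \<open>L\<close> is \<open>\<Lambda>\<^sub>H\<close> without the factor \<open>c\<^sub>H\<close>.\<close>

definition D1 :: "real \<Rightarrow> real \<Rightarrow> real" where
  "D1 t s = a * t powr (1 - a) * s powr (a - 1) * (t - s) powr (- a - 1)"

definition D2 :: "real \<Rightarrow> real \<Rightarrow> real" where
  "D2 t s = a * (a * s powr (- a - 1) * ibeta (1 - a) (2 * a) (1 - s / t) + t powr (- a) * s powr (a - 1) * (t - s) powr (- a))"

definition L :: "(real \<Rightarrow> real) \<Rightarrow> real \<Rightarrow> real" where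
  "L f t = (LBINT s:{0<..<t}. (f t - f s) * D1 t s) + (LBINT s:{0<..<t}. f s * D2 t s)"

lemma D_meas [measurable]:
  "(\<lambda>s. D1 t s) \<in> borel_measurable borel" "(\<lambda>s. D2 t s) \<in> borel_measurable borel"
  unfolding D1_def D2_def by measurable

lemma D_nonneg: "0 \<le> D1 t s" "0 \<le> D2 t s"
  using a0 by (auto simp: D1_def D2_def ibeta_nonneg)

lemma ka_formula_deriv2:
  assumes "0 < s" "s < t"
  shows "((\<lambda>s. t powr (- a) * s powr a * (t - s) powr (- a)) has_real_derivative D1 t s) (at s)"
proof -
  have "((\<lambda>s. t powr (- a) * s powr a * (t - s) powr (- a)) has_real_derivative
     t powr (- a) * (a * s powr (a - 1) * (t - s) powr (- a) + s powr a * (a * (t - s) powr (- a - 1)))) (at s)"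
    using assms by (auto intro!: derivative_eq_intros simp: algebra_simps)
  \<comment> \<open>The two terms of the product rule merge because
    \<open>(t - s) + s = t\<close>.\<close>
  moreover have "t powr (- a) * (a * s powr (a - 1) * (t - s) powr (- a) + s powr a * (a * (t - s) powr (- a - 1))) = D1 t s"
  proof -
    have 1: "(t - s) powr (- a) = (t - s) * (t - s) powr (- a - 1)"
      using assms powr_mult_base[of "t - s" "- a - 1"] by simp
    have 2: "s powr a = s * s powr (a - 1)" using assms powr_mult_base[of s "a - 1"] by simp
    have 3: "t powr (1 - a) = t * t powr (- a)" using assms powr_mult_base[of t "- a"] by simp
    show ?thesis unfolding D1_def 1 2 3 by (simp add: algebra_simps)
  qed
  ultimately show ?thesis by simp
qed

lemma kb_formula_deriv2:
  assumes "0 < s" "s < t"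
  shows "((\<lambda>s. a * s powr (- a) * ibeta (1 - a) (2 * a) (1 - s / t)) has_real_derivative - D2 t s) (at s)"
proof -
  let ?z = "1 - s / t"
  have z: "0 < ?z" "?z < 1" using assms by auto
  have i: "((\<lambda>s. ibeta (1 - a) (2 * a) (1 - s / t)) has_real_derivative
     (?z powr (1 - a - 1) * (1 - ?z) powr (2 * a - 1)) * (- 1 / t)) (at s)"
    using assms z a0 a1
    by (intro DERIV_chain2[OF ibeta_deriv]) (auto intro!: derivative_eq_intros)
  have "((\<lambda>s. a * s powr (- a)) has_real_derivative a * (- a * s powr (- a - 1))) (at s)"
    using assms by (auto intro!: derivative_eq_intros)
  from DERIV_mult[OF this i]
  have "((\<lambda>s. a * s powr (- a) * ibeta (1 - a) (2 * a) (1 - s / t)) has_real_derivative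
     a * (- a * s powr (- a - 1)) * ibeta (1 - a) (2 * a) ?z +
     (?z powr (1 - a - 1) * (1 - ?z) powr (2 * a - 1)) * (- 1 / t) * (a * s powr (- a))) (at s)" .
  moreover have "(?z powr (1 - a - 1) * (1 - ?z) powr (2 * a - 1)) * (- 1 / t) * (a * s powr (- a))
      = - (a * (t powr (- a) * s powr (a - 1) * (t - s) powr (- a)))"
  proof -
    have pos: "0 < t" "0 < t - s" using assms by auto
    have 1: "?z = (t - s) / t" using pos by (simp add: field_simps)
    have 2: "1 / t = exp (- ln t)" using pos by (simp add: exp_minus inverse_eq_divide)
    have 3: "?z powr (1 - a - 1) = exp ((- a) * (ln (t - s) - ln t))"
      unfolding 1 using pos assms by (simp add: powr_def ln_div)
    have "1 - ?z = s / t" by simp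
    then have 4: "(1 - ?z) powr (2 * a - 1) = exp ((2 * a - 1) * (ln s - ln t))"
      using pos assms by (simp add: powr_def ln_div)
    have 5: "y powr r = exp (r * ln y)" if "0 < y" for y r :: real
      using that by (simp add: powr_def)
    have "(?z powr (1 - a - 1) * (1 - ?z) powr (2 * a - 1)) * (1 / t) * (s powr (- a))
      = t powr (- a) * s powr (a - 1) * (t - s) powr (- a)"
      unfolding 2 3 4 5[OF pos(1)] 5[OF pos(2)] 5[OF assms(1)] mult_exp_exp
      by (rule arg_cong[where f=exp]) (simp add: algebra_simps)
    then have "- a * ((?z powr (1 - a - 1) * (1 - ?z) powr (2 * a - 1)) * (1 / t) * (s powr (- a)))
      = - (a * (t powr (- a) * s powr (a - 1) * (t - s) powr (- a)))" by simp
    then show ?thesis by (simp add: mult_ac)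
  qed
  moreover have "a * (- a * s powr (- a - 1)) * ibeta (1 - a) (2 * a) ?z + - (a * (t powr (- a) * s powr (a - 1) * (t - s) powr (- a)))
     = - D2 t s" by (simp add: D2_def algebra_simps)
  ultimately show ?thesis by (simp only:)
qed

lemma ka_deriv2:
  assumes "0 < s" "s < t"
  shows "((\<lambda>s. ka t s) has_real_derivative D1 t s) (at s)"
  using ka_formula_deriv2[OF assms]
proof (rule DERIV_cong_ev[THEN iffD1, rotated -1, OF _ refl _ refl])
  have "\<forall>\<^sub>F u in nhds s. u \<in> {0<..<t}" using assms by (intro eventually_nhds_in_open) auto
  then show "\<forall>\<^sub>F s in nhds s. t powr (- a) * s powr a * (t - s) powr (- a) = ka t s"
    by eventually_elim (auto simp: ka_def)
qed

lemma kb_deriv2: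
  assumes "0 < s" "s < t"
  shows "((\<lambda>s. kb t s) has_real_derivative - D2 t s) (at s)"
  using kb_formula_deriv2[OF assms]
proof (rule DERIV_cong_ev[THEN iffD1, rotated -1, OF _ refl _ refl])
  have "\<forall>\<^sub>F u in nhds s. u \<in> {0<..<t}" using assms by (intro eventually_nhds_in_open) auto
  then show "\<forall>\<^sub>F s in nhds s. a * s powr (- a) * ibeta (1 - a) (2 * a) (1 - s / t) = kb t s"
    by eventually_elim (auto simp: kb_def)
qed

text \<open>The primitive vanishes at \<open>0\<close>, whereas \<open>kb t\<close> vanishes at
  \<open>t\<close>. The two derivatives are therefore integrated over opposite sides of
  \<open>u\<close>, and no boundary terms occur.\<close>

lemma nn_D1:
  assumes "0 < u" "u < t"
  shows "(\<integral>\<^sup>+s\<in>{0<..<u}. ennreal (D1 t s) \<partial>lborel) = ennreal (ka t u)"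
proof -
  let ?F = "\<lambda>s. t powr (- a) * s powr a * (t - s) powr (- a)"
  have "(\<integral>\<^sup>+s\<in>{0<..<u}. ennreal (D1 t s) \<partial>lborel) = ennreal (?F u - ?F 0)"
  proof (rule FTC_nonneg_cont)
    fix s assume s: "0 < s" "s < u"
    show "(?F has_real_derivative D1 t s) (at s)" using s assms by (intro ka_formula_deriv2) auto
    show "isCont (\<lambda>s. D1 t s) s" unfolding D1_def using s assms by (intro continuous_intros) auto
    show "0 \<le> D1 t s" by (rule D_nonneg)
  next
    show "continuous_on {0..u} ?F"
      using assms a0 by (intro continuous_intros continuous_on_powr') auto
  qed (use assms in auto)
  then show ?thesis using assms a0 by (simp add: ka_def)
qed

lemma isCont_D2:
  assumes "0 < s" "s < t"
  shows "isCont (\<lambda>s. D2 t s) s"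
proof -
  have z: "0 < 1 - s / t" "1 - s / t < 1" using assms by auto
  have "isCont (ibeta (1 - a) (2 * a)) (1 - s / t)"
    using ibeta_deriv[OF _ z, of "1 - a" "2 * a"] a1 a0 by (auto intro: DERIV_isCont)
  then have "isCont (\<lambda>s. ibeta (1 - a) (2 * a) (1 - s / t)) s"
    by (rule isCont_o2[rotated]) (use assms in \<open>auto intro!: continuous_intros\<close>)
  then show ?thesis unfolding D2_def using assms by (intro continuous_intros) auto
qed

lemma nn_D2:
  assumes "0 < u" "u < t"
  shows "(\<integral>\<^sup>+s\<in>{u<..<t}. ennreal (D2 t s) \<partial>lborel) = ennreal (kb t u)"
proof -
  let ?F = "\<lambda>s. - (a * s powr (- a) * ibeta (1 - a) (2 * a) (1 - s / t))"
  have "(\<integral>\<^sup>+s\<in>{u<..<t}. ennreal (D2 t s) \<partial>lborel) = ennreal (?F t - ?F u)"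
  proof (rule FTC_nonneg_cont)
    fix s assume s: "u < s" "s < t"
    show "(?F has_real_derivative D2 t s) (at s)"
      using DERIV_minus[OF kb_formula_deriv2, of s t] s assms by simp
    show "isCont (\<lambda>s. D2 t s) s" using s assms by (intro isCont_D2) auto
    show "0 \<le> D2 t s" by (rule D_nonneg)
  next
    have "continuous_on {0..1 - u / t} (ibeta (1 - a) (2 * a))"
      using a0 a1 assms by (intro ibeta_continuous) auto
    then have "continuous_on {u..t} (\<lambda>s. ibeta (1 - a) (2 * a) (1 - s / t))"
      by (rule continuous_on_compose2) (use assms in \<open>auto intro!: continuous_intros divide_right_mono\<close>)
    then show "continuous_on {u..t} ?F"
      using assms by (intro continuous_intros) auto
  qed (use assms in auto)
  then show ?thesis using assms by (simp add: kb_def ibeta_def set_lebesgue_integral_def)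
qed

text \<open>The increment \<open>f t - f s\<close> integrates \<open>h\<close> over
  \<open>{s<..<t}\<close>, and \<open>f s\<close> integrates it over \<open>{0<..<s}\<close>. After
  the exchange \<open>D1\<close> is integrated over \<open>{0<..<u}\<close> and \<open>D2\<close>
  over \<open>{u<..<t}\<close>, which gives \<open>ka t u\<close> and \<open>kb t u\<close>.
  Nonnegativity of \<open>h\<close> makes Tonelli sufficient, and integrability of the singular
  integrands comes out as a result.\<close>

lemma L_by_parts:
  fixes h f :: "real \<Rightarrow> real"
  assumes t: "0 < t"
    and [measurable]: "h \<in> borel_measurable borel"
    and h0: "\<And>u. 0 < u \<Longrightarrow> u < t \<Longrightarrow> 0 \<le> h u"
    and h: "set_integrable lborel {0<..<t} h"
    and hk: "set_integrable lborel {0<..<t} (\<lambda>u. h u * k t u)"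
    and f: "\<And>s. 0 < s \<Longrightarrow> s \<le> t \<Longrightarrow> f s = (LBINT u:{0<..<s}. h u)"
  shows "set_integrable lborel {0<..<t} (\<lambda>s. (f t - f s) * D1 t s)"
    and "set_integrable lborel {0<..<t} (\<lambda>s. f s * D2 t s)"
    and "L f t = (LBINT u:{0<..<t}. h u * k t u)"
proof -
  define F where "F = (\<lambda>s. LBINT u:{0<..<s}. h u)"
  have [measurable]: "F \<in> borel_measurable borel" unfolding F_def by measurable
  have fF: "f s = F s" if "0 < s" "s \<le> t" for s using f that by (simp add: F_def)
  have nnF: "ennreal (F s) = (\<integral>\<^sup>+u\<in>{0<..<s}. ennreal (h u) \<partial>lborel)" "0 \<le> F s" if "0 < s" "s \<le> t" for s
  proof -
    show "ennreal (F s) = (\<integral>\<^sup>+u\<in>{0<..<s}. ennreal (h u) \<partial>lborel)"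
      unfolding F_def using that h0 by (intro nn_set_integral_eq[symmetric] set_integrable_subset[OF h]) auto
    show "0 \<le> F s" unfolding F_def set_lebesgue_integral_def
      using that h0 by (intro Bochner_Integration.integral_nonneg) (auto split: split_indicator)
  qed
  have diffF: "F t - F s = (LBINT u:{s<..<t}. h u)" if "0 < s" "s < t" for s
    unfolding F_def using set_integral_split[OF h that] by simp
  have nnFt: "ennreal (F t - F s) = (\<integral>\<^sup>+u\<in>{s<..<t}. ennreal (h u) \<partial>lborel)" "0 \<le> F t - F s" if "0 < s" "s < t" for s
  proof -
    show "ennreal (F t - F s) = (\<integral>\<^sup>+u\<in>{s<..<t}. ennreal (h u) \<partial>lborel)"
      unfolding diffF[OF that] using that h0 by (intro nn_set_integral_eq[symmetric] set_integrable_subset[OF h]) auto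
    show "0 \<le> F t - F s" unfolding diffF[OF that] set_lebesgue_integral_def
      using that h0 by (intro Bochner_Integration.integral_nonneg) (auto split: split_indicator)
  qed
  have int: "set_integrable lborel {0<..<t} (\<lambda>u. h u * kk u)"
    if [measurable]: "kk \<in> borel_measurable borel" and "\<And>u. 0 \<le> kk u" "\<And>u. kk u \<le> k t u" for kk
    using hk
  proof (rule set_integrable_bound)
    show "set_borel_measurable lborel {0<..<t} (\<lambda>u. h u * kk u)" by (simp add: set_borel_measurable_def)
    show "AE x in lborel. x \<in> {0<..<t} \<longrightarrow> norm (h x * kk x) \<le> norm (h x * k t x)"
      using that(2,3) k_nonneg by (intro AE_I2) (auto simp: abs_mult intro!: mult_left_mono)
  qed
  have ia: "set_integrable lborel {0<..<t} (\<lambda>u. h u * ka t u)"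
    and ib: "set_integrable lborel {0<..<t} (\<lambda>u. h u * kb t u)"
    by (auto intro!: int simp: ka_nonneg kb_nonneg k_def)
  have nonneg: "0 \<le> (LBINT u:{0<..<t}. h u * ka t u)" "0 \<le> (LBINT u:{0<..<t}. h u * kb t u)"
    unfolding set_lebesgue_integral_def using h0 ka_nonneg kb_nonneg
    by (auto intro!: Bochner_Integration.integral_nonneg split: split_indicator)
  have "(\<integral>\<^sup>+s\<in>{0<..<t}. ennreal ((F t - F s) * D1 t s) \<partial>lborel) =
     (\<integral>\<^sup>+s\<in>{0<..<t}. (\<integral>\<^sup>+u\<in>{s<..<t}. ennreal (D1 t s) * ennreal (h u) \<partial>lborel) \<partial>lborel)"
  proof (rule set_nn_cong)
    fix s assume s: "s \<in> {0<..<t}"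
    have "ennreal ((F t - F s) * D1 t s) = ennreal (D1 t s) * ennreal (F t - F s)"
      by (subst mult.commute) (rule ennreal_mult', rule D_nonneg)
    then show "ennreal ((F t - F s) * D1 t s) = (\<integral>\<^sup>+u\<in>{s<..<t}. ennreal (D1 t s) * ennreal (h u) \<partial>lborel)"
      using s nnFt(1)[of s] by (subst set_nn_cmult) auto
  qed
  also have "\<dots> = (\<integral>\<^sup>+u\<in>{0<..<t}. (\<integral>\<^sup>+s\<in>{0<..<u}. ennreal (D1 t s) * ennreal (h u) \<partial>lborel) \<partial>lborel)"
    by (rule nn_triangle[symmetric]) measurable
  also have "\<dots> = (\<integral>\<^sup>+u\<in>{0<..<t}. ennreal (h u * ka t u) \<partial>lborel)"
  proof (rule set_nn_cong)
    fix u assume u: "u \<in> {0<..<t}"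
    have "(\<integral>\<^sup>+s\<in>{0<..<u}. ennreal (D1 t s) * ennreal (h u) \<partial>lborel) = ennreal (h u) * (\<integral>\<^sup>+s\<in>{0<..<u}. ennreal (D1 t s) \<partial>lborel)"
      by (subst set_nn_cmult[symmetric]) (auto simp: mult.commute)
    then show "(\<integral>\<^sup>+s\<in>{0<..<u}. ennreal (D1 t s) * ennreal (h u) \<partial>lborel) = ennreal (h u * ka t u)"
      using u h0 by (simp add: nn_D1 ennreal_mult ka_nonneg)
  qed
  also have "\<dots> = ennreal (LBINT u:{0<..<t}. h u * ka t u)"
    using h0 ka_nonneg by (intro nn_set_integral_eq ia) auto
  finally have A: "(\<integral>\<^sup>+s\<in>{0<..<t}. ennreal ((F t - F s) * D1 t s) \<partial>lborel) = ennreal (LBINT u:{0<..<t}. h u * ka t u)" .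
  have "(\<integral>\<^sup>+s\<in>{0<..<t}. ennreal (F s * D2 t s) \<partial>lborel) =
     (\<integral>\<^sup>+s\<in>{0<..<t}. (\<integral>\<^sup>+u\<in>{0<..<s}. ennreal (D2 t s) * ennreal (h u) \<partial>lborel) \<partial>lborel)"
  proof (rule set_nn_cong)
    fix s assume s: "s \<in> {0<..<t}"
    have "ennreal (F s * D2 t s) = ennreal (D2 t s) * ennreal (F s)"
      by (subst mult.commute) (rule ennreal_mult', rule D_nonneg)
    then show "ennreal (F s * D2 t s) = (\<integral>\<^sup>+u\<in>{0<..<s}. ennreal (D2 t s) * ennreal (h u) \<partial>lborel)"
      using s nnF(1)[of s] by (subst set_nn_cmult) auto
  qed
  also have "\<dots> = (\<integral>\<^sup>+u\<in>{0<..<t}. (\<integral>\<^sup>+s\<in>{u<..<t}. ennreal (D2 t s) * ennreal (h u) \<partial>lborel) \<partial>lborel)"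
    by (rule nn_triangle) measurable
  also have "\<dots> = (\<integral>\<^sup>+u\<in>{0<..<t}. ennreal (h u * kb t u) \<partial>lborel)"
  proof (rule set_nn_cong)
    fix u assume u: "u \<in> {0<..<t}"
    have "(\<integral>\<^sup>+s\<in>{u<..<t}. ennreal (D2 t s) * ennreal (h u) \<partial>lborel) = ennreal (h u) * (\<integral>\<^sup>+s\<in>{u<..<t}. ennreal (D2 t s) \<partial>lborel)"
      by (subst set_nn_cmult[symmetric]) (auto simp: mult.commute)
    then show "(\<integral>\<^sup>+s\<in>{u<..<t}. ennreal (D2 t s) * ennreal (h u) \<partial>lborel) = ennreal (h u * kb t u)"
      using u h0 by (simp add: nn_D2 ennreal_mult kb_nonneg)
  qed
  also have "\<dots> = ennreal (LBINT u:{0<..<t}. h u * kb t u)"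
    using h0 kb_nonneg by (intro nn_set_integral_eq ib) auto
  finally have B: "(\<integral>\<^sup>+s\<in>{0<..<t}. ennreal (F s * D2 t s) \<partial>lborel) = ennreal (LBINT u:{0<..<t}. h u * kb t u)" .
  have A': "set_integrable lborel {0<..<t} (\<lambda>s. (F t - F s) * D1 t s)"
      "(LBINT s:{0<..<t}. (F t - F s) * D1 t s) = (LBINT u:{0<..<t}. h u * ka t u)"
    using nnFt D_nonneg nonneg by (auto intro!: set_integral_eq_nn[OF _ _ A])
  have B': "set_integrable lborel {0<..<t} (\<lambda>s. F s * D2 t s)"
      "(LBINT s:{0<..<t}. F s * D2 t s) = (LBINT u:{0<..<t}. h u * kb t u)"
    using nnF D_nonneg nonneg by (auto intro!: set_integral_eq_nn[OF _ _ B])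
  have cA: "(f t - f s) * D1 t s = (F t - F s) * D1 t s" and cB: "f s * D2 t s = F s * D2 t s" if "s \<in> {0<..<t}" for s
    using that t fF[of s] fF[of t] by auto
  show "set_integrable lborel {0<..<t} (\<lambda>s. (f t - f s) * D1 t s)"
    using A'(1) cA by (subst set_integrable_cong[OF refl refl]) auto
  show "set_integrable lborel {0<..<t} (\<lambda>s. f s * D2 t s)"
    using B'(1) cB by (subst set_integrable_cong[OF refl refl]) auto
  have "L f t = (LBINT s:{0<..<t}. (F t - F s) * D1 t s) + (LBINT s:{0<..<t}. F s * D2 t s)"
    unfolding L_def using cA cB by (auto intro!: arg_cong2[where f="(+)"] set_lebesgue_integral_cong)
  also have "\<dots> = (LBINT u:{0<..<t}. h u * ka t u + h u * kb t u)"
    using A'(2) B'(2) ia ib by (simp add: set_integral_add)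
  finally show "L f t = (LBINT u:{0<..<t}. h u * k t u)"
    by (simp add: k_def distrib_left)
qed

text \<open>The weight \<open>w2\<close> has the same total mass as \<open>w1\<close>: integrating
  \<open>a * z powr (a - 1)\<close> over \<open>z < x\<close> gives \<open>x powr a\<close>, and
  \<open>x powr a * x powr (- 1) * (1 - x) powr (a - 1)\<close> is \<open>w1 x\<close>.\<close>

lemma w_integrable: "set_integrable lborel {0<..<1} w1" "set_integrable lborel {0<..<1} w2"
proof -
  show 1: "set_integrable lborel {0<..<1} w1"
    using LINT_Beta(1)[OF a0 a0] unfolding w1_def by simp
  have "(\<integral>\<^sup>+z\<in>{0<..<1}. ennreal (w2 z) \<partial>lborel) =
     (\<integral>\<^sup>+z\<in>{0<..<1}. (\<integral>\<^sup>+x\<in>{z<..<1}. ennreal (a * z powr (a - 1)) * ennreal ((1 - x) powr (a - 1) * x powr (- 1)) \<partial>lborel) \<partial>lborel)"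
    by (intro set_nn_cong w2_nn) auto
  also have "\<dots> = (\<integral>\<^sup>+x\<in>{0<..<1}. (\<integral>\<^sup>+z\<in>{0<..<x}. ennreal (a * z powr (a - 1)) * ennreal ((1 - x) powr (a - 1) * x powr (- 1)) \<partial>lborel) \<partial>lborel)"
    by (rule nn_triangle[symmetric]) measurable
  also have "\<dots> = (\<integral>\<^sup>+x\<in>{0<..<1}. ennreal (w1 x) \<partial>lborel)"
  proof (rule set_nn_cong)
    fix x :: real assume x: "x \<in> {0<..<1}"
    have "(\<integral>\<^sup>+z\<in>{0<..<x}. ennreal (a * z powr (a - 1)) * ennreal ((1 - x) powr (a - 1) * x powr (- 1)) \<partial>lborel)
      = ennreal ((1 - x) powr (a - 1) * x powr (- 1)) * (\<integral>\<^sup>+z\<in>{0<..<x}. ennreal (a * z powr (a - 1)) \<partial>lborel)"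
      by (subst set_nn_cmult[symmetric]) (auto simp: mult_ac)
    also have "(\<integral>\<^sup>+z\<in>{0<..<x}. ennreal (a * z powr (a - 1)) \<partial>lborel) = ennreal (x powr a - 0 powr a)"
      using x a0 by (intro FTC_nonneg_cont[where F="\<lambda>z. z powr a"] continuous_on_powr' continuous_intros)
         (auto intro!: derivative_eq_intros continuous_intros)
    also have "ennreal ((1 - x) powr (a - 1) * x powr (- 1)) * ennreal (x powr a - 0 powr a) = ennreal ((1 - x) powr (a - 1) * x powr (- 1) * (x powr a))"
      by (subst ennreal_mult') auto
    also have "(1 - x) powr (a - 1) * x powr (- 1) * (x powr a) = w1 x"
    proof -
      have "0 < x" using x by simp
      from powr_minus_one_mult[OF this] show ?thesis unfolding w1_def by (simp only: mult.assoc) (rule mult.commute)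
    qed
    finally show "(\<integral>\<^sup>+z\<in>{0<..<x}. ennreal (a * z powr (a - 1)) * ennreal ((1 - x) powr (a - 1) * x powr (- 1)) \<partial>lborel) = ennreal (w1 x)" .
  qed
  also have "\<dots> = ennreal (LBINT x:{0<..<1}. w1 x)"
    by (rule nn_set_integral_eq[OF 1]) (simp add: w_nonneg)
  finally have "(\<integral>\<^sup>+z\<in>{0<..<1}. ennreal (w2 z) \<partial>lborel) = ennreal (LBINT x:{0<..<1}. w1 x)" .
  from set_integral_eq_nn(1)[OF _ _ this]
  show "set_integrable lborel {0<..<1} w2"
    by (auto simp: w_nonneg set_lebesgue_integral_def intro!: Bochner_Integration.integral_nonneg)
qed

text \<open>
  The weights are chosen such that \<open>A0\<close> maps \<open>\<lambda>s. k s u\<close> to the function of \<open>t\<close> that is \<open>1\<close> for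
  \<open>u < t\<close> and \<open>0\<close> otherwise.
\<close>

definition A0 :: "(real \<Rightarrow> real) \<Rightarrow> real \<Rightarrow> real" where
  "A0 g t = t powr a / betaa * ((LBINT x:{0<..<1}. w1 x * g (t * x)) - (LBINT x:{0<..<1}. w2 x * g (t * x)))"

end

section \<open>Parameter integrals over intervals\<close>

lemma LBINT_scale:
  fixes f :: "real \<Rightarrow> real"
  assumes "0 < c"
  shows "(LBINT y:{0<..<c*q}. f y) = c * (LBINT x:{0<..<q}. f (c * x))"
proof -
  have "(LBINT y:{0<..<c*q}. f y) = \<bar>c\<bar> *\<^sub>R (LINT x|lborel. indicator {0<..<c*q} (0 + c * x) *\<^sub>R f (0 + c * x))"
    unfolding set_lebesgue_integral_def using assms by (intro lborel_integral_real_affine) auto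
  also have "(LINT x|lborel. indicator {0<..<c*q} (0 + c * x) *\<^sub>R f (0 + c * x)) = (LBINT x:{0<..<q}. f (c * x))"
    unfolding set_lebesgue_integral_def using assms
    by (intro Bochner_Integration.integral_cong) (auto split: split_indicator simp: zero_less_mult_iff)
  finally show ?thesis using assms by simp
qed

lemma LBINT_abs_bound:
  fixes f :: "real \<Rightarrow> real"
  assumes "0 \<le> s" "\<And>x. 0 < x \<Longrightarrow> x < s \<Longrightarrow> \<bar>f x\<bar> \<le> C" "0 \<le> C"
  shows "\<bar>LBINT x:{0<..<s}. f x\<bar> \<le> C * s"
proof (cases "set_integrable lborel {0<..<s} f")
  case True
  have "norm (LINT x|lborel. indicator {0<..<s} x *\<^sub>R f x) \<le> (LINT x|lborel. indicator {0<..<s} x * C)"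
  proof (rule Bochner_Integration.integral_norm_bound_integral)
    show "integrable lborel (\<lambda>x. indicator {0<..<s} x *\<^sub>R f x)" using True by (simp add: set_integrable_def)
    show "integrable lborel (\<lambda>x. indicator {0<..<s} x * C)"
      using assms by (intro integrable_mult_left integrable_real_indicator) (auto simp: emeasure_lborel_Ioo)
    show "norm (indicator {0<..<s} x *\<^sub>R f x) \<le> indicator {0<..<s} x * C" for x
      using assms by (auto split: split_indicator)
  qed
  also have "\<dots> = C * s" using assms by (simp add: mult.commute measure_def emeasure_lborel_Ioo)
  finally show ?thesis by (simp add: set_lebesgue_integral_def)
next
  case False
  then show ?thesis using assms by (simp add: set_lebesgue_integral_def set_integrable_def not_integrable_integral_eq)
qed

text \<open>Fubini in the form suited to scaled integrands, where the bound factors into an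
  integrable function of \<open>x\<close> and one of \<open>y\<close>.\<close>

lemma set_LINT_swap:
  fixes F :: "real \<Rightarrow> real \<Rightarrow> real" and G H :: "real \<Rightarrow> real"
  assumes [measurable]: "case_prod F \<in> borel_measurable (borel \<Otimes>\<^sub>M borel)"
    and [measurable]: "G \<in> borel_measurable borel" "H \<in> borel_measurable borel"
    and G: "set_integrable lborel S G" and H: "set_integrable lborel S H"
    and [measurable]: "S \<in> sets borel"
    and b: "\<And>x y. x \<in> S \<Longrightarrow> y \<in> S \<Longrightarrow> \<bar>F x y\<bar> \<le> G x * H y"
  shows "(LBINT x:S. LBINT y:S. F x y) = (LBINT y:S. LBINT x:S. F x y)"
    and "set_integrable lborel S (\<lambda>x. LBINT y:S. F x y)"
    and "set_integrable lborel S (\<lambda>y. LBINT x:S. F x y)"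
proof -
  let ?F = "\<lambda>x y. indicator S x *\<^sub>R (indicator S y *\<^sub>R F x y)"
  let ?g = "\<lambda>x. indicator S x * \<bar>G x\<bar>" and ?h = "\<lambda>y. indicator S y * \<bar>H y\<bar>"
  have Gi: "integrable lborel ?g" and Hi: "integrable lborel ?h"
    using integrable_abs[OF G[unfolded set_integrable_def]] integrable_abs[OF H[unfolded set_integrable_def]]
    by (simp_all add: abs_mult)
  have int: "integrable (lborel \<Otimes>\<^sub>M lborel) (case_prod ?F)"
  proof (rule integrableI_bounded)
    show "case_prod ?F \<in> borel_measurable (lborel \<Otimes>\<^sub>M lborel)" by measurable
    have "(\<integral>\<^sup>+ z. ennreal (norm (case_prod ?F z)) \<partial>(lborel \<Otimes>\<^sub>M lborel))
       \<le> (\<integral>\<^sup>+ z. ennreal (?g (fst z)) * ennreal (?h (snd z)) \<partial>(lborel \<Otimes>\<^sub>M lborel))"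
    proof (rule nn_integral_mono)
      fix z :: "real \<times> real"
      have "\<bar>F (fst z) (snd z)\<bar> \<le> \<bar>G (fst z)\<bar> * \<bar>H (snd z)\<bar>" if "fst z \<in> S" "snd z \<in> S"
        using order_trans[OF b[OF that] abs_ge_self] by (simp add: abs_mult)
      then have "norm (case_prod ?F z) \<le> ?g (fst z) * ?h (snd z)"
        by (auto simp: case_prod_beta split: split_indicator)
      then show "ennreal (norm (case_prod ?F z)) \<le> ennreal (?g (fst z)) * ennreal (?h (snd z))"
        by (subst ennreal_mult[symmetric]) (auto intro!: ennreal_leI)
    qed
    also have "\<dots> = (\<integral>\<^sup>+ x. \<integral>\<^sup>+ y. ennreal (?g x) * ennreal (?h y) \<partial>lborel \<partial>lborel)"
      by (subst lborel.nn_integral_fst[symmetric]) auto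
    also have "\<dots> = (\<integral>\<^sup>+ x. ennreal (?g x) \<partial>lborel) * (\<integral>\<^sup>+ y. ennreal (?h y) \<partial>lborel)"
      by (simp add: nn_integral_cmult nn_integral_multc)
    also have "\<dots> < \<infinity>"
      using Gi Hi by (auto simp: integrable_iff_bounded ennreal_mult_less_top abs_mult)
    finally show "(\<integral>\<^sup>+ z. ennreal (norm (case_prod ?F z)) \<partial>(lborel \<Otimes>\<^sub>M lborel)) < \<infinity>" .
  qed
  have 1: "(LINT y|lborel. ?F x y) = indicator S x *\<^sub>R (LBINT y:S. F x y)" for x
    by (simp add: set_lebesgue_integral_def)
  have 2: "(LINT x|lborel. ?F x y) = indicator S y *\<^sub>R (LBINT x:S. F x y)" for y
  proof -
    have "(LINT x|lborel. ?F x y) = (LINT x|lborel. indicator S y *\<^sub>R (indicator S x *\<^sub>R F x y))"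
      by (intro Bochner_Integration.integral_cong) (auto simp: mult_ac)
    then show ?thesis by (simp add: set_lebesgue_integral_def)
  qed
  show "(LBINT x:S. LBINT y:S. F x y) = (LBINT y:S. LBINT x:S. F x y)"
    using lborel_pair.Fubini_integral[OF int] unfolding 1 2 by (simp add: set_lebesgue_integral_def)
  show "set_integrable lborel S (\<lambda>x. LBINT y:S. F x y)"
    using lborel_pair.integrable_fst[OF int] unfolding 1 by (simp add: set_integrable_def)
  show "set_integrable lborel S (\<lambda>y. LBINT x:S. F x y)"
    using lborel_pair.integrable_snd[OF int] unfolding 2 by (simp add: set_integrable_def)
qed

lemma scale_le: "0 \<le> s \<Longrightarrow> s \<le> t \<Longrightarrow> x \<le> 1 \<Longrightarrow> s * x \<le> t" for s t x :: real
  using mult_left_mono[of x 1 s] by simp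

lemma nn_Ioo_measurable [measurable]:
  fixes F :: "real \<Rightarrow> real \<Rightarrow> ennreal"
  assumes [measurable]: "case_prod F \<in> borel_measurable (borel \<Otimes>\<^sub>M borel)"
  shows "(\<lambda>u. \<integral>\<^sup>+y\<in>{0<..<u}. F u y \<partial>lborel) \<in> borel_measurable borel"
proof -
  have "(\<lambda>u. \<integral>\<^sup>+y\<in>{0<..<u}. F u y \<partial>lborel) = (\<lambda>u. \<integral>\<^sup>+y. (if 0 < y \<and> y < u then F u y else 0) \<partial>lborel)"
    by (auto intro!: ext nn_integral_cong split: split_indicator)
  then show ?thesis by simp
qed

lemma nn_Ioo_measurable':
  fixes F :: "real \<Rightarrow> real \<Rightarrow> ennreal"
  assumes [measurable]: "case_prod F \<in> borel_measurable (borel \<Otimes>\<^sub>M borel)"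
  shows "(\<lambda>u. \<integral>\<^sup>+y\<in>{u<..<q}. F u y \<partial>lborel) \<in> borel_measurable borel"
proof -
  have "(\<lambda>u. \<integral>\<^sup>+y\<in>{u<..<q}. F u y \<partial>lborel) = (\<lambda>u. \<integral>\<^sup>+y. (if u < y \<and> y < q then F u y else 0) \<partial>lborel)"
    by (auto intro!: ext nn_integral_cong split: split_indicator)
  then show ?thesis by simp
qed

lemma continuous_on_set_LINT:
  fixes F :: "real \<Rightarrow> real \<Rightarrow> real" and G :: "real \<Rightarrow> real"
  assumes cont: "\<And>x. x \<in> A \<Longrightarrow> continuous_on S (\<lambda>t. F t x)"
    and meas: "\<And>t. t \<in> S \<Longrightarrow> set_borel_measurable lborel A (F t)"
    and G: "set_integrable lborel A G"
    and b: "\<And>t x. t \<in> S \<Longrightarrow> x \<in> A \<Longrightarrow> \<bar>F t x\<bar> \<le> G x"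
  shows "continuous_on S (\<lambda>t. LBINT x:A. F t x)"
  unfolding continuous_on_sequentially comp_def set_lebesgue_integral_def
proof (intro allI ballI impI, elim conjE)
  fix u t assume t: "t \<in> S" and u: "\<forall>n. u n \<in> S" "u \<longlonglongrightarrow> t"
  show "(\<lambda>n. LINT x|lborel. indicator A x *\<^sub>R F (u n) x) \<longlonglongrightarrow> (LINT x|lborel. indicator A x *\<^sub>R F t x)"
  proof (rule integral_dominated_convergence[where w="\<lambda>x. indicator A x *\<^sub>R G x"])
    show "integrable lborel (\<lambda>x. indicator A x *\<^sub>R G x)" using G by (simp add: set_integrable_def)
    show "(\<lambda>x. indicator A x *\<^sub>R F t x) \<in> borel_measurable lborel"
      "\<And>n. (\<lambda>x. indicator A x *\<^sub>R F (u n) x) \<in> borel_measurable lborel"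
      using meas t u by (auto simp: set_borel_measurable_def)
    show "AE x in lborel. (\<lambda>n. indicator A x *\<^sub>R F (u n) x) \<longlonglongrightarrow> indicator A x *\<^sub>R F t x"
    proof (rule AE_I2)
      fix x
      show "(\<lambda>n. indicator A x *\<^sub>R F (u n) x) \<longlonglongrightarrow> indicator A x *\<^sub>R F t x"
      proof (cases "x \<in> A")
        case True
        then show ?thesis using cont[OF True] t u
          unfolding continuous_on_sequentially comp_def by auto
      qed simp
    qed
    show "AE x in lborel. norm (indicator A x *\<^sub>R F (u n) x) \<le> indicator A x *\<^sub>R G x" for n
      using b u by (auto split: split_indicator)
  qed
qed

section \<open>The right inverse on functions with a nonnegative density\<close>

context fbm_kernel
begin

lemma A0_meas [measurable]:
  assumes [measurable]: "g \<in> borel_measurable borel"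
  shows "A0 g \<in> borel_measurable borel"
  unfolding A0_def set_lebesgue_integral_def by measurable

text \<open>The function \<open>A0 g\<close> again has a density, namely \<open>\<Psi>\<close>, so
  \<open>L_by_parts\<close> applies to it. Integrating \<open>\<Psi>\<close> against
  \<open>k t\<close> and exchanging integrals leaves the integral of \<open>k_inverse\<close>, whose
  value \<open>betaa * y powr (- a)\<close> cancels the weight attached to \<open>g1 y\<close>; what
  remains is the integral of \<open>g1\<close>.\<close>

lemma L_A0_absolutely_continuous:
  fixes g g1 :: "real \<Rightarrow> real"
  assumes t: "0 < t"
    and [measurable]: "g1 \<in> borel_measurable borel" "g \<in> borel_measurable borel"
    and g1: "\<And>u. 0 \<le> g1 u"
    and int: "set_integrable lborel {0<..<t} g1"
    and g: "\<And>s. 0 < s \<Longrightarrow> s \<le> t \<Longrightarrow> g s = (LBINT u:{0<..<s}. g1 u)"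
  shows "set_integrable lborel {0<..<t} (\<lambda>s. (A0 g t - A0 g s) * D1 t s)"
    and "set_integrable lborel {0<..<t} (\<lambda>s. A0 g s * D2 t s)"
    and "L (A0 g) t = g t"
proof -
  \<comment> \<open>The density of \<open>A0 g\<close>: up to a constant,
    \<open>u powr (- a)\<close> times the fractional integral of order \<open>a\<close> of
    \<open>g1 y * y powr a\<close>. Its primitive is \<open>N\<close>.\<close>
  define \<Psi> where "\<Psi> u = (\<integral>\<^sup>+y\<in>{0<..<u}. ennreal (g1 y * y powr a / betaa) * ennreal (u powr (- a) * (u - y) powr (a - 1)) \<partial>lborel)" for u
  have [measurable]: "\<Psi> \<in> borel_measurable borel" unfolding \<Psi>_def by (rule nn_Ioo_measurable) measurable
  define N where "N s = (\<integral>\<^sup>+y\<in>{0<..<s}. ennreal (g1 y * y powr a / betaa) * ennreal (ibeta a 0 (1 - y / s)) \<partial>lborel)" for s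
  have gnn: "ennreal (g s) = (\<integral>\<^sup>+u\<in>{0<..<s}. ennreal (g1 u) \<partial>lborel)" "0 \<le> g s" if "0 < s" "s \<le> t" for s
  proof -
    show "ennreal (g s) = (\<integral>\<^sup>+u\<in>{0<..<s}. ennreal (g1 u) \<partial>lborel)"
      using that g1 g by (subst nn_set_integral_eq) (auto intro!: set_integrable_subset[OF int])
    show "0 \<le> g s" using g[OF that] g1
      by (auto simp: set_lebesgue_integral_def intro!: Bochner_Integration.integral_nonneg split: split_indicator)
  qed
  have gle: "g s \<le> g t" if "0 < s" "s \<le> t" for s
  proof -
    have "ennreal (g s) \<le> ennreal (g t)"
      using that t by (subst (1 2) gnn(1)) (auto intro!: nn_integral_mono split: split_indicator)
    then show ?thesis using gnn(2)[of t] t by (simp add: ennreal_le_iff2) (use gnn(2)[OF that] in linarith)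
  qed
  have Psi_N: "(\<integral>\<^sup>+u\<in>{0<..<s}. \<Psi> u \<partial>lborel) = N s" if s: "0 < s" for s
  proof -
    have "(\<integral>\<^sup>+u\<in>{0<..<s}. \<Psi> u \<partial>lborel) =
      (\<integral>\<^sup>+y\<in>{0<..<s}. (\<integral>\<^sup>+u\<in>{y<..<s}. ennreal (g1 y * y powr a / betaa) * ennreal (u powr (- a) * (u - y) powr (a - 1)) \<partial>lborel) \<partial>lborel)"
      unfolding \<Psi>_def by (rule nn_triangle) measurable
    also have "\<dots> = N s"
      unfolding N_def
    proof (rule set_nn_cong)
      fix y assume y: "y \<in> {0<..<s}"
      have "(\<integral>\<^sup>+u\<in>{y<..<s}. ennreal (u powr (- a) * (u - y) powr (a - 1)) \<partial>lborel) = ennreal (ibeta a 0 (1 - y / s))"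
        using nn_ibeta_ratio[of a y s 0] y a0 by simp
      then show "(\<integral>\<^sup>+u\<in>{y<..<s}. ennreal (g1 y * y powr a / betaa) * ennreal (u powr (- a) * (u - y) powr (a - 1)) \<partial>lborel)
         = ennreal (g1 y * y powr a / betaa) * ennreal (ibeta a 0 (1 - y / s))"
        by (subst set_nn_cmult) auto
    qed
    finally show ?thesis .
  qed
  have swap: "(\<integral>\<^sup>+x\<in>{0<..<1}. ennreal (w x) * ennreal (g (s * x)) \<partial>lborel) =
     (\<integral>\<^sup>+z\<in>{0<..<1}. ennreal (s * g1 (s * z)) * (\<integral>\<^sup>+x\<in>{z<..<1}. ennreal (w x) \<partial>lborel) \<partial>lborel)"
    if s: "0 < s" "s \<le> t" and [measurable]: "w \<in> borel_measurable borel" for s and w :: "real \<Rightarrow> real"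
  proof -
    have "(\<integral>\<^sup>+x\<in>{0<..<1}. ennreal (w x) * ennreal (g (s * x)) \<partial>lborel) =
       (\<integral>\<^sup>+x\<in>{0<..<1}. (\<integral>\<^sup>+z\<in>{0<..<x}. ennreal (w x) * ennreal (s * g1 (s * z)) \<partial>lborel) \<partial>lborel)"
    proof (rule set_nn_cong)
      fix x :: real assume x: "x \<in> {0<..<1}"
      have sx: "0 < s * x" "s * x \<le> t" using s x by (auto intro: scale_le)
      have "ennreal (g (s * x)) = (\<integral>\<^sup>+u\<in>{s * 0<..<s * x}. ennreal (g1 u) \<partial>lborel)" using gnn(1)[OF sx] by simp
      also have "\<dots> = ennreal s * (\<integral>\<^sup>+z\<in>{0<..<x}. ennreal (g1 (s * z)) \<partial>lborel)"
        using s by (intro nn_scale_Ioo) auto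
      also have "\<dots> = (\<integral>\<^sup>+z\<in>{0<..<x}. ennreal s * ennreal (g1 (s * z)) \<partial>lborel)"
        by (subst set_nn_cmult) auto
      also have "\<dots> = (\<integral>\<^sup>+z\<in>{0<..<x}. ennreal (s * g1 (s * z)) \<partial>lborel)"
        using s by (intro set_nn_cong) (auto simp: ennreal_mult')
      finally show "ennreal (w x) * ennreal (g (s * x)) = (\<integral>\<^sup>+z\<in>{0<..<x}. ennreal (w x) * ennreal (s * g1 (s * z)) \<partial>lborel)"
        by (subst set_nn_cmult) auto
    qed
    also have "\<dots> = (\<integral>\<^sup>+z\<in>{0<..<1}. (\<integral>\<^sup>+x\<in>{z<..<1}. ennreal (w x) * ennreal (s * g1 (s * z)) \<partial>lborel) \<partial>lborel)"
      by (rule nn_triangle) measurable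
    also have "\<dots> = (\<integral>\<^sup>+z\<in>{0<..<1}. ennreal (s * g1 (s * z)) * (\<integral>\<^sup>+x\<in>{z<..<1}. ennreal (w x) \<partial>lborel) \<partial>lborel)"
      by (subst set_nn_cmult[symmetric]) (auto simp: mult_ac)
    finally show ?thesis .
  qed
  \<comment> \<open>The difference of the two weighted means, written without subtraction.
    Finiteness of \<open>N s\<close> is read off from this equation, and only then can
    \<open>N s\<close> be identified with \<open>A0 g s\<close>.\<close>
  have main: "(\<integral>\<^sup>+x\<in>{0<..<1}. ennreal (w1 x) * ennreal (g (s * x)) \<partial>lborel) =
     ennreal (s powr (- a) * betaa) * N s + (\<integral>\<^sup>+x\<in>{0<..<1}. ennreal (w2 x) * ennreal (g (s * x)) \<partial>lborel)"
    if s: "0 < s" "s \<le> t" for s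
  proof -
    have "(\<integral>\<^sup>+x\<in>{0<..<1}. ennreal (w1 x) * ennreal (g (s * x)) \<partial>lborel) =
       (\<integral>\<^sup>+z\<in>{0<..<1}. ennreal (s * g1 (s * z)) * ennreal (z powr a * ibeta a 0 (1 - z)) + ennreal (s * g1 (s * z)) * (\<integral>\<^sup>+x\<in>{z<..<1}. ennreal (w2 x) \<partial>lborel) \<partial>lborel)"
      unfolding swap[OF s w_meas(1)] by (intro set_nn_cong) (auto simp: nn_w_tail distrib_left)
    also have "\<dots> = (\<integral>\<^sup>+z\<in>{0<..<1}. ennreal (s * g1 (s * z)) * ennreal (z powr a * ibeta a 0 (1 - z)) \<partial>lborel) +
       (\<integral>\<^sup>+x\<in>{0<..<1}. ennreal (w2 x) * ennreal (g (s * x)) \<partial>lborel)"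
    proof -
      have [measurable]: "(\<lambda>z. \<integral>\<^sup>+x\<in>{z<..<1}. ennreal (w2 x) \<partial>lborel) \<in> borel_measurable borel"
        by (rule nn_Ioo_measurable') measurable
      show ?thesis unfolding swap[OF s w_meas(2)] by (rule set_nn_add) auto
    qed
    also have "(\<integral>\<^sup>+z\<in>{0<..<1}. ennreal (s * g1 (s * z)) * ennreal (z powr a * ibeta a 0 (1 - z)) \<partial>lborel)
      = ennreal (s powr (- a) * betaa) * N s"
    proof -
      have "N s = (\<integral>\<^sup>+y\<in>{s * 0<..<s * 1}. ennreal (g1 y * y powr a / betaa) * ennreal (ibeta a 0 (1 - y / s)) \<partial>lborel)"
        by (simp add: N_def)
      also have "\<dots> = ennreal s * (\<integral>\<^sup>+z\<in>{0<..<1}. ennreal (g1 (s * z) * (s * z) powr a / betaa) * ennreal (ibeta a 0 (1 - s * z / s)) \<partial>lborel)"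
        using s by (intro nn_scale_Ioo) auto
      finally have N1: "N s = ennreal s * (\<integral>\<^sup>+z\<in>{0<..<1}. ennreal (g1 (s * z) * (s * z) powr a / betaa) * ennreal (ibeta a 0 (1 - s * z / s)) \<partial>lborel)" .
      have "ennreal (s powr (- a) * betaa) * N s = (\<integral>\<^sup>+z\<in>{0<..<1}. ennreal (s powr (- a) * betaa * s) * (ennreal (g1 (s * z) * (s * z) powr a / betaa) * ennreal (ibeta a 0 (1 - s * z / s))) \<partial>lborel)"
        unfolding N1 using s betaa_pos by (subst set_nn_cmult) (auto simp: ennreal_mult mult_ac)
      also have "\<dots> = (\<integral>\<^sup>+z\<in>{0<..<1}. ennreal (s * g1 (s * z)) * ennreal (z powr a * ibeta a 0 (1 - z)) \<partial>lborel)"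
      proof (rule set_nn_cong)
        fix z :: real assume z: "z \<in> {0<..<1}"
        have "s powr (- a) * s powr a = 1" using s by (simp flip: powr_add)
        then have "s powr (- a) * betaa * s * (g1 (s * z) * (s * z) powr a / betaa * ibeta a 0 (1 - s * z / s))
           = s * g1 (s * z) * (z powr a * ibeta a 0 (1 - z))"
          using s z betaa_pos by (simp add: powr_mult mult_ac)
        moreover have "ennreal (s powr (- a) * betaa * s) * (ennreal (g1 (s * z) * (s * z) powr a / betaa) * ennreal (ibeta a 0 (1 - s * z / s)))
           = ennreal (s powr (- a) * betaa * s * (g1 (s * z) * (s * z) powr a / betaa * ibeta a 0 (1 - s * z / s)))"
          using g1 s betaa_pos ibeta_nonneg by (simp only: ennreal_mult'[symmetric] mult_nonneg_nonneg divide_nonneg_pos powr_ge_zero less_imp_le)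
        moreover have "ennreal (s * g1 (s * z)) * ennreal (z powr a * ibeta a 0 (1 - z)) = ennreal (s * g1 (s * z) * (z powr a * ibeta a 0 (1 - z)))"
          using g1 s by (intro ennreal_mult'[symmetric]) auto
        ultimately show "ennreal (s powr (- a) * betaa * s) * (ennreal (g1 (s * z) * (s * z) powr a / betaa) * ennreal (ibeta a 0 (1 - s * z / s)))
          = ennreal (s * g1 (s * z)) * ennreal (z powr a * ibeta a 0 (1 - z))" by (simp only:)
      qed
      finally show ?thesis ..
    qed
    finally show ?thesis .
  qed
  have wg: "set_integrable lborel {0<..<1} (\<lambda>x. w x * g (s * x))"
    if s: "0 < s" "s \<le> t" and w: "set_integrable lborel {0<..<1} w" and [measurable]: "w \<in> borel_measurable borel" for s w
  proof (rule set_integrable_mult_bounded[OF w])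
    show "set_borel_measurable borel {0<..<1} (\<lambda>x. g (s * x))" by (simp add: set_borel_measurable_def)
    fix x :: real assume x: "0 < x" "x < 1"
    have sx: "0 < s * x" "s * x \<le> t" using s x by (auto intro: scale_le)
    show "\<bar>g (s * x)\<bar> \<le> g t" using gnn(2)[OF sx] gle[OF sx] by simp
  qed simp
  have wgnn: "(\<integral>\<^sup>+x\<in>{0<..<1}. ennreal (w x) * ennreal (g (s * x)) \<partial>lborel) = ennreal (LBINT x:{0<..<1}. w x * g (s * x))"
     "0 \<le> (LBINT x:{0<..<1}. w x * g (s * x))"
    if s: "0 < s" "s \<le> t" and w: "set_integrable lborel {0<..<1} w" and [measurable]: "w \<in> borel_measurable borel"
      and w0: "\<And>x. 0 \<le> w x" for s w
  proof -
    have g0: "0 \<le> g (s * x)" if "x \<in> {0<..<1}" for x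
      using s that by (intro gnn(2)) (auto intro: scale_le)
    have "(\<integral>\<^sup>+x\<in>{0<..<1}. ennreal (w x) * ennreal (g (s * x)) \<partial>lborel) = (\<integral>\<^sup>+x\<in>{0<..<1}. ennreal (w x * g (s * x)) \<partial>lborel)"
      by (intro set_nn_cong) (auto simp: ennreal_mult' w0)
    also have "\<dots> = ennreal (LBINT x:{0<..<1}. w x * g (s * x))"
      using g0 w0 by (intro nn_set_integral_eq wg[OF s w]) auto
    finally show "(\<integral>\<^sup>+x\<in>{0<..<1}. ennreal (w x) * ennreal (g (s * x)) \<partial>lborel) = ennreal (LBINT x:{0<..<1}. w x * g (s * x))" .
    show "0 \<le> (LBINT x:{0<..<1}. w x * g (s * x))"
      unfolding set_lebesgue_integral_def using g0 w0
      by (intro Bochner_Integration.integral_nonneg) (auto split: split_indicator)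
  qed
  have AN: "N s = ennreal (A0 g s)" "0 \<le> A0 g s" if s: "0 < s" "s \<le> t" for s
  proof -
    let ?W1 = "LBINT x:{0<..<1}. w1 x * g (s * x)" and ?W2 = "LBINT x:{0<..<1}. w2 x * g (s * x)"
    have e: "ennreal ?W1 = ennreal (s powr (- a) * betaa) * N s + ennreal ?W2"
      using main[OF s] wgnn(1)[OF s w_integrable(1)] wgnn(1)[OF s w_integrable(2)] by (simp add: w_nonneg)
    have pos: "0 < s powr (- a) * betaa" using s betaa_pos by simp
    have "ennreal (s powr (- a) * betaa) * N s < \<infinity>"
      using e by (metis ennreal_add_eq_top ennreal_less_top infinity_ennreal_def less_top)
    then have "N s < \<infinity>" using pos by (auto simp: ennreal_mult_less_top)
    then obtain n where n: "N s = ennreal n" "0 \<le> n" by (cases "N s") auto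
    have W2: "0 \<le> ?W2" using wgnn(2)[OF s w_integrable(2)] by (simp add: w_nonneg)
    have W1: "0 \<le> ?W1" using wgnn(2)[OF s w_integrable(1)] by (simp add: w_nonneg)
    have "ennreal ?W1 = ennreal (s powr (- a) * betaa * n + ?W2)"
      using e n pos W2 by (simp add: ennreal_mult' ennreal_plus)
    then have "?W1 = s powr (- a) * betaa * n + ?W2"
      using W1 W2 n pos by (subst (asm) ennreal_inj) (auto intro!: add_nonneg_nonneg mult_nonneg_nonneg)
    then have "?W1 - ?W2 = s powr (- a) * betaa * n" by simp
    moreover have "s powr a * s powr (- a) = 1" using s by (simp flip: powr_add)
    ultimately have "A0 g s = n" unfolding A0_def using betaa_pos by simp
    then show "N s = ennreal (A0 g s)" "0 \<le> A0 g s" using n by auto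
  qed
  \<comment> \<open>\<open>\<Psi>\<close> may be infinite on a null set, whereas
    \<open>L_by_parts\<close> asks for a real density.\<close>
  define \<psi> where "\<psi> u = enn2real (\<Psi> u)" for u
  have [measurable]: "\<psi> \<in> borel_measurable borel" unfolding \<psi>_def by measurable
  have psi0: "0 \<le> \<psi> u" for u by (simp add: \<psi>_def)
  have fin: "AE u in lborel. u \<in> {0<..<t} \<longrightarrow> \<Psi> u \<noteq> \<infinity>"
  proof -
    have "(\<integral>\<^sup>+u\<in>{0<..<t}. \<Psi> u \<partial>lborel) \<noteq> \<infinity>" using t by (simp add: Psi_N AN)
    then have "AE u in lborel. \<Psi> u * indicator {0<..<t} u \<noteq> \<infinity>"
      by (intro nn_integral_PInf_AE) auto
    then show ?thesis by eventually_elim auto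
  qed
  have \<psi>\<Psi>: "AE u in lborel. u \<in> {0<..<t} \<longrightarrow> ennreal (\<psi> u) = \<Psi> u"
    using fin by eventually_elim (auto simp: \<psi>_def less_top)
  have psi_int: "set_integrable lborel {0<..<s} \<psi>" "(LBINT u:{0<..<s}. \<psi> u) = A0 g s" if s: "0 < s" "s \<le> t" for s
  proof -
    have "(\<integral>\<^sup>+u\<in>{0<..<s}. ennreal (\<psi> u) \<partial>lborel) = (\<integral>\<^sup>+u\<in>{0<..<s}. \<Psi> u \<partial>lborel)"
    proof (rule nn_integral_cong_AE)
      show "AE u in lborel. ennreal (\<psi> u) * indicator {0<..<s} u = \<Psi> u * indicator {0<..<s} u"
        using \<psi>\<Psi> by eventually_elim (use s in \<open>auto split: split_indicator\<close>)
    qed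
    also have "\<dots> = ennreal (A0 g s)" using s by (simp add: Psi_N AN)
    finally have *: "(\<integral>\<^sup>+u\<in>{0<..<s}. ennreal (\<psi> u) \<partial>lborel) = ennreal (A0 g s)" .
    show "set_integrable lborel {0<..<s} \<psi>" "(LBINT u:{0<..<s}. \<psi> u) = A0 g s"
      using set_integral_eq_nn[OF _ _ * AN(2)[OF s]] psi0 by auto
  qed
  have "(\<integral>\<^sup>+u\<in>{0<..<t}. ennreal (\<psi> u * k t u) \<partial>lborel) = (\<integral>\<^sup>+u\<in>{0<..<t}. \<Psi> u * ennreal (k t u) \<partial>lborel)"
  proof (rule nn_integral_cong_AE)
    show "AE u in lborel. ennreal (\<psi> u * k t u) * indicator {0<..<t} u = \<Psi> u * ennreal (k t u) * indicator {0<..<t} u"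
      using \<psi>\<Psi> by eventually_elim (auto split: split_indicator simp: ennreal_mult'' k_nonneg)
  qed
  also have "\<dots> = (\<integral>\<^sup>+u\<in>{0<..<t}. (\<integral>\<^sup>+y\<in>{0<..<u}. ennreal (g1 y * y powr a / betaa) * ennreal (k t u * u powr (- a) * (u - y) powr (a - 1)) \<partial>lborel) \<partial>lborel)"
  proof (rule set_nn_cong)
    fix u
    have "\<Psi> u * ennreal (k t u) = (\<integral>\<^sup>+y\<in>{0<..<u}. ennreal (k t u) * (ennreal (g1 y * y powr a / betaa) * ennreal (u powr (- a) * (u - y) powr (a - 1))) \<partial>lborel)"
      unfolding \<Psi>_def by (subst set_nn_cmult) (auto simp: mult.commute)
    also have "\<dots> = (\<integral>\<^sup>+y\<in>{0<..<u}. ennreal (g1 y * y powr a / betaa) * ennreal (k t u * u powr (- a) * (u - y) powr (a - 1)) \<partial>lborel)"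
      by (intro set_nn_cong) (auto simp: ennreal_mult k_nonneg mult_ac)
    finally show "\<Psi> u * ennreal (k t u) = (\<integral>\<^sup>+y\<in>{0<..<u}. ennreal (g1 y * y powr a / betaa) * ennreal (k t u * u powr (- a) * (u - y) powr (a - 1)) \<partial>lborel)" .
  qed
  also have "\<dots> = (\<integral>\<^sup>+y\<in>{0<..<t}. (\<integral>\<^sup>+u\<in>{y<..<t}. ennreal (g1 y * y powr a / betaa) * ennreal (k t u * u powr (- a) * (u - y) powr (a - 1)) \<partial>lborel) \<partial>lborel)"
    by (rule nn_triangle) measurable
  also have "\<dots> = (\<integral>\<^sup>+y\<in>{0<..<t}. ennreal (g1 y) \<partial>lborel)"
  proof (rule set_nn_cong)
    fix y assume y: "y \<in> {0<..<t}"
    have "(\<integral>\<^sup>+u\<in>{y<..<t}. ennreal (g1 y * y powr a / betaa) * ennreal (k t u * u powr (- a) * (u - y) powr (a - 1)) \<partial>lborel)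
       = ennreal (g1 y * y powr a / betaa) * ennreal (betaa * y powr (- a))"
      using y by (subst set_nn_cmult) (auto simp: k_inverse)
    also have "\<dots> = ennreal (g1 y * y powr a / betaa * (betaa * y powr (- a)))"
      using g1 betaa_pos by (intro ennreal_mult'[symmetric]) auto
    also have "g1 y * y powr a / betaa * (betaa * y powr (- a)) = g1 y"
    proof -
      have "y powr a * y powr (- a) = 1" using y by (simp flip: powr_add)
      then show ?thesis using betaa_pos by (simp add: mult.assoc)
    qed
    finally show "(\<integral>\<^sup>+u\<in>{y<..<t}. ennreal (g1 y * y powr a / betaa) * ennreal (k t u * u powr (- a) * (u - y) powr (a - 1)) \<partial>lborel) = ennreal (g1 y)" .
  qed
  also have "\<dots> = ennreal (g t)" using gnn(1)[of t] t by simp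
  finally have *: "(\<integral>\<^sup>+u\<in>{0<..<t}. ennreal (\<psi> u * k t u) \<partial>lborel) = ennreal (g t)" .
  have pk: "set_integrable lborel {0<..<t} (\<lambda>u. \<psi> u * k t u)" "(LBINT u:{0<..<t}. \<psi> u * k t u) = g t"
    using set_integral_eq_nn[OF _ _ * gnn(2)[of t]] t k_nonneg psi0 by auto
  note bp = L_by_parts[OF t \<open>\<psi> \<in> borel_measurable borel\<close> _ psi_int(1)[OF t order_refl] pk(1), of "A0 g"]
  show "set_integrable lborel {0<..<t} (\<lambda>s. (A0 g t - A0 g s) * D1 t s)"
    "set_integrable lborel {0<..<t} (\<lambda>s. A0 g s * D2 t s)"
    "L (A0 g) t = g t"
    using bp psi_int(2) pk(2) psi0 by auto
qed

end

text \<open>A bound of order \<open>\<alpha> > a\<close> outweighs the singular factor at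
  \<open>0\<close>. Because of \<open>0 powr (- a) = 0\<close> the product takes there the value
  \<open>0\<close>, which is its limit.\<close>

lemma continuous_on_powr_neg_mult:
  fixes v :: "real \<Rightarrow> real"
  assumes "continuous_on {0..T} v" "a < \<alpha>"
    and v: "\<And>t. 0 \<le> t \<Longrightarrow> t \<le> T \<Longrightarrow> \<bar>v t\<bar> \<le> K * t powr \<alpha>"
  shows "continuous_on {0..T} (\<lambda>t. t powr (- a) * v t)"
  unfolding continuous_on_eq_continuous_within
proof
  fix t assume t: "t \<in> {0..T}"
  show "continuous (at t within {0..T}) (\<lambda>t. t powr (- a) * v t)"
  proof (cases "t = 0")
    case False
    have "continuous (at t within {0..T}) v" using assms(1) t by (auto simp: continuous_on_eq_continuous_within)
    then show ?thesis using t False by (intro continuous_intros) auto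
  next
    case True
    have "((\<lambda>t. t powr (- a) * v t) \<longlongrightarrow> 0) (at 0 within {0..T})"
    proof (rule Lim_null_comparison)
      show "\<forall>\<^sub>F t in at 0 within {0..T}. norm (t powr (- a) * v t) \<le> K * t powr (\<alpha> - a)"
        unfolding eventually_at_filter
      proof (intro always_eventually allI impI)
        fix t :: real assume t: "t \<noteq> 0" "t \<in> {0..T}"
        have "t powr (\<alpha> - a) = t powr (- a) * t powr \<alpha>" by (simp flip: powr_add)
        then show "norm (t powr (- a) * v t) \<le> K * t powr (\<alpha> - a)"
          using v[of t] t by (simp add: abs_mult mult.left_commute mult_left_mono)
      qed
      have "((\<lambda>t. K * t powr (\<alpha> - a)) \<longlongrightarrow> K * 0 powr (\<alpha> - a)) (at 0 within {0..T})"
        using assms(2) by (intro tendsto_intros tendsto_powr') (auto simp: eventually_at_filter)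
      then show "((\<lambda>t. K * t powr (\<alpha> - a)) \<longlongrightarrow> 0) (at 0 within {0..T})" by simp
    qed
    then show ?thesis using True by (simp add: continuous_within)
  qed
qed

lemma set_integrable_powr: "0 < p \<Longrightarrow> set_integrable lborel {0<..<1} (\<lambda>x. x powr (p - 1))" for p :: real
proof -
  assume "0 < p"
  then have "set_integrable lborel {0<..<1} (\<lambda>x. x powr (p - 1) * (1 - x) powr (1 - 1))"
    by (intro LINT_Beta) auto
  moreover have "set_integrable lborel {0<..<1} (\<lambda>x. x powr (p - 1) * (1 - x) powr (1 - 1)) \<longleftrightarrow> set_integrable lborel {0<..<1} (\<lambda>x. x powr (p - 1))"
    by (intro set_integrable_cong) auto
  ultimately show ?thesis by simp
qed

section \<open>Scaling, running means and rough paths\<close>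

context fbm_kernel
begin

text \<open>Both functions are jointly homogeneous of degree \<open>- a - 1\<close> in
  \<open>t\<close> and \<open>s\<close>; the additional factor \<open>t\<close> is the one produced
  by the substitution \<open>s = t * x\<close>.\<close>

lemma D_scale:
  assumes "0 < t" "0 < x" "x < 1"
  shows "t * D1 t (t * x) = t powr (- a) * D1 1 x" "t * D2 t (t * x) = t powr (- a) * D2 1 x"
proof -
  have e: "t - t * x = t * (1 - x)" by (simp add: algebra_simps)
  have 0: "t powr (1 - a) * t powr (a - 1) * t powr (- a - 1) = t powr (- a - 1)"
    "t powr (- a) * t powr (a - 1) * t powr (- a) = t powr (- a - 1)"
    by (simp only: powr_add[symmetric], rule arg_cong[where f="(powr) t"], simp)+
  have 1: "t * (t powr (1 - a) * t powr (a - 1) * t powr (- a - 1)) = t powr (- a)"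
    unfolding 0 using assms powr_mult_base[of t "- a - 1"] by simp
  have "t * D1 t (t * x) = t * (t powr (1 - a) * t powr (a - 1) * t powr (- a - 1)) * (a * x powr (a - 1) * (1 - x) powr (- a - 1))"
    using assms unfolding D1_def e by (simp add: powr_mult mult_ac)
  then show "t * D1 t (t * x) = t powr (- a) * D1 1 x" unfolding 1 by (simp add: D1_def)
  have 2: "t * t powr (- a - 1) = t powr (- a)" using assms powr_mult_base[of t "- a - 1"] by simp
  have 3: "t * (t powr (- a) * t powr (a - 1) * t powr (- a)) = t powr (- a)"
    unfolding 0 by (rule 2)
  have "t * D2 t (t * x) = a * (a * (t * t powr (- a - 1)) * x powr (- a - 1) * ibeta (1 - a) (2 * a) (1 - x) +
     (t * (t powr (- a) * t powr (a - 1) * t powr (- a))) * x powr (a - 1) * (1 - x) powr (- a))"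
  proof -
    have "(t * (1 - x)) powr (- a) = t powr (- a) * (1 - x) powr (- a)"
      "(t * x) powr (- a - 1) = t powr (- a - 1) * x powr (- a - 1)"
      "(t * x) powr (a - 1) = t powr (a - 1) * x powr (a - 1)" "1 - t * x / t = 1 - x"
      using assms by (simp_all add: powr_mult)
    then show ?thesis unfolding D2_def e by (simp only:) (simp add: algebra_simps)
  qed
  then show "t * D2 t (t * x) = t powr (- a) * D2 1 x" unfolding 2 3 by (simp add: D2_def algebra_simps)
qed

text \<open>On the fixed interval the singular weights no longer depend on \<open>t\<close>, so that
  one dominating function serves all times.\<close>

lemma L_scaled:
  assumes "0 \<le> t"
  shows "L f t = t powr (- a) * ((LBINT x:{0<..<1}. (f t - f (t * x)) * D1 1 x) + (LBINT x:{0<..<1}. f (t * x) * D2 1 x))"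
proof (cases "t = 0")
  case True
  then show ?thesis by (simp add: L_def set_lebesgue_integral_def)
next
  case False
  with assms have t: "0 < t" by simp
  have "(LBINT s:{0<..<t * 1}. (f t - f s) * D1 t s) = t * (LBINT x:{0<..<1}. (f t - f (t * x)) * D1 t (t * x))"
    by (rule LBINT_scale[OF t])
  also have "\<dots> = (LBINT x:{0<..<1}. (f t - f (t * x)) * (t * D1 t (t * x)))"
    by (simp add: mult.left_commute flip: set_integral_mult_right)
  also have "\<dots> = (LBINT x:{0<..<1}. t powr (- a) * ((f t - f (t * x)) * D1 1 x))"
    using t by (intro set_lebesgue_integral_cong) (auto simp: D_scale)
  finally have 1: "(LBINT s:{0<..<t}. (f t - f s) * D1 t s) = t powr (- a) * (LBINT x:{0<..<1}. (f t - f (t * x)) * D1 1 x)"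
    by simp
  have "(LBINT s:{0<..<t * 1}. f s * D2 t s) = t * (LBINT x:{0<..<1}. f (t * x) * D2 t (t * x))"
    by (rule LBINT_scale[OF t])
  also have "\<dots> = (LBINT x:{0<..<1}. f (t * x) * (t * D2 t (t * x)))"
    by (simp add: mult.left_commute flip: set_integral_mult_right)
  also have "\<dots> = (LBINT x:{0<..<1}. t powr (- a) * (f (t * x) * D2 1 x))"
    using t by (intro set_lebesgue_integral_cong) (auto simp: D_scale)
  finally have 2: "(LBINT s:{0<..<t}. f s * D2 t s) = t powr (- a) * (LBINT x:{0<..<1}. f (t * x) * D2 1 x)"
    by simp
  show ?thesis unfolding L_def 1 2 by (simp add: distrib_left)
qed

text \<open>The singularity \<open>(1 - x) powr (- a - 1)\<close> at \<open>1\<close> is not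
  integrable by itself; a Hoelder increment of order \<open>\<alpha> > a\<close> supplies the
  compensating factor.\<close>

lemma D1_weight_integrable:
  assumes "a < \<alpha>"
  shows "set_integrable lborel {0<..<1} (\<lambda>x. (1 - x) powr \<alpha> * D1 1 x)"
proof -
  have "set_integrable lborel {0<..<1} (\<lambda>x. a * (x powr (a - 1) * (1 - x) powr (\<alpha> - a - 1)))"
    using a0 assms by (intro set_integrable_mult_right LINT_Beta) auto
  moreover have "a * (x powr (a - 1) * (1 - x) powr (\<alpha> - a - 1)) = (1 - x) powr \<alpha> * D1 1 x" for x
  proof -
    have "(1 - x) powr (\<alpha> - a - 1) = (1 - x) powr \<alpha> * (1 - x) powr (- a - 1)"
      by (simp only: powr_add[symmetric] add_diff_eq add_uminus_conv_diff)
    then show ?thesis by (simp add: D1_def)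
  qed
  ultimately show ?thesis by simp
qed

text \<open>The singularity to be compensated is \<open>x powr (- a - 1)\<close> at
  \<open>0\<close>; the incomplete Beta function in \<open>D2\<close> is bounded by the complete
  one.\<close>

lemma D2_weight_integrable:
  assumes "a < \<alpha>"
  shows "set_integrable lborel {0<..<1} (\<lambda>x. x powr \<alpha> * D2 1 x)"
proof -
  let ?B = "Beta (1 - a) (2 * a)"
  have "set_integrable lborel {0<..<1} (\<lambda>x. a * (a * ?B * x powr (\<alpha> - a - 1) + x powr (\<alpha> + a - 1) * (1 - x) powr (1 - a - 1)))"
    using a0 a1 assms by (intro set_integrable_mult_right set_integral_add LINT_Beta set_integrable_powr) auto
  then show ?thesis
  proof (rule set_integrable_bound)
    show "set_borel_measurable lborel {0<..<1} (\<lambda>x. x powr \<alpha> * D2 1 x)" by (simp add: set_borel_measurable_def)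
    show "AE x in lborel. x \<in> {0<..<1} \<longrightarrow> norm (x powr \<alpha> * D2 1 x)
        \<le> norm (a * (a * ?B * x powr (\<alpha> - a - 1) + x powr (\<alpha> + a - 1) * (1 - x) powr (1 - a - 1)))"
    proof (intro AE_I2 impI)
      fix x :: real assume x: "x \<in> {0<..<1}"
      have 1: "x powr (\<alpha> - a - 1) = x powr \<alpha> * x powr (- a - 1)" "x powr (\<alpha> + a - 1) = x powr \<alpha> * x powr (a - 1)"
        by (simp_all add: algebra_simps flip: powr_add)
      have "x powr \<alpha> * D2 1 x = a * (a * ibeta (1 - a) (2 * a) (1 - x) * x powr (\<alpha> - a - 1) + x powr (\<alpha> + a - 1) * (1 - x) powr (1 - a - 1))"
        unfolding 1 D2_def by (simp add: algebra_simps)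
      also have "\<dots> \<le> a * (a * ?B * x powr (\<alpha> - a - 1) + x powr (\<alpha> + a - 1) * (1 - x) powr (1 - a - 1))"
        using a0 a1 x by (intro mult_left_mono add_right_mono mult_right_mono ibeta_le_Beta) auto
      finally show "norm (x powr \<alpha> * D2 1 x) \<le> norm (a * (a * ?B * x powr (\<alpha> - a - 1) + x powr (\<alpha> + a - 1) * (1 - x) powr (1 - a - 1)))"
        using D_nonneg(2)[of 1 x] by simp
    qed
  qed
qed

lemma continuous_on_compose_scale:
  fixes f :: "real \<Rightarrow> real"
  assumes "continuous_on {0..T} f" "0 \<le> x" "x \<le> 1"
  shows "continuous_on {0..T} (\<lambda>t. f (t * x))"
  by (rule continuous_on_compose2[OF assms(1)]) (use assms(2,3) in \<open>auto intro!: continuous_intros scale_le\<close>)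

text \<open>Dominated convergence in the scaled form: \<open>t powr (- a) * t powr \<alpha>\<close>
  stays below \<open>T powr (\<alpha> - a)\<close>. Continuity of the integrands at
  \<open>t = 0\<close> is the content of \<open>continuous_on_powr_neg_mult\<close>.\<close>

lemma L_continuous:
  fixes f :: "real \<Rightarrow> real"
  assumes \<alpha>: "a < \<alpha>" and [measurable]: "f \<in> borel_measurable borel"
    and C: "\<And>x y. x \<in> {0..T} \<Longrightarrow> y \<in> {0..T} \<Longrightarrow> \<bar>f x - f y\<bar> \<le> C * \<bar>x - y\<bar> powr \<alpha>"
    and f0: "f 0 = 0" and T: "0 < T"
  shows "continuous_on {0..T} (L f)"
proof -
  have C0: "0 \<le> C"
  proof -
    have "0 \<le> C * \<bar>T - 0\<bar> powr \<alpha>" using C[of T 0] T by (meson abs_ge_zero atLeastAtMost_iff order_trans order_refl less_imp_le)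
    then show ?thesis using T by (simp add: zero_le_mult_iff)
  qed
  have cf: "continuous_on {0..T} f"
  proof -
    have "((\<lambda>y. f y) \<longlongrightarrow> f x) (at x within {0..T})" if x: "x \<in> {0..T}" for x
    proof (rule LIM_zero_cancel)
      have "((\<lambda>y. C * \<bar>y - x\<bar> powr \<alpha>) \<longlongrightarrow> C * \<bar>x - x\<bar> powr \<alpha>) (at x within {0..T})"
        using \<alpha> a0 by (intro tendsto_intros tendsto_powr') auto
      then have "((\<lambda>y. C * \<bar>y - x\<bar> powr \<alpha>) \<longlongrightarrow> 0) (at x within {0..T})" by simp
      then show "((\<lambda>y. f y - f x) \<longlongrightarrow> 0) (at x within {0..T})"
      proof (rule Lim_null_comparison[rotated])
        show "\<forall>\<^sub>F y in at x within {0..T}. norm (f y - f x) \<le> C * \<bar>y - x\<bar> powr \<alpha>"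
          unfolding eventually_at_filter using C[OF _ x] by (intro always_eventually) auto
      qed
    qed
    then show ?thesis by (simp add: continuous_on_def)
  qed
  have fb: "\<bar>f s\<bar> \<le> C * s powr \<alpha>" if "0 \<le> s" "s \<le> T" for s
    using C[of s 0] that f0 T by simp
  have tx: "0 \<le> t * x" "t * x \<le> T" "\<bar>t - t * x\<bar> = t * (1 - x)" if "t \<in> {0..T}" "x \<in> {0<..<1}" for t x
    using that scale_le[of t T x] scale_le[of t t x] by (auto simp: algebra_simps)
  have mono: "t powr (- a) * t powr \<alpha> \<le> T powr (\<alpha> - a)" if "t \<in> {0..T}" for t
    using that \<alpha> by (simp add: powr_mono2 flip: powr_add)
  have dif: "\<bar>f t - f (t * x)\<bar> \<le> C * (t powr \<alpha> * (1 - x) powr \<alpha>)" if "t \<in> {0..T}" "x \<in> {0<..<1}" for t x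
    using C[of t "t * x"] tx[OF that] that by (simp add: powr_mult)
  have "continuous_on {0..T} (\<lambda>t. (LBINT x:{0<..<1}. t powr (- a) * (f t - f (t * x)) * D1 1 x))"
  proof (rule continuous_on_set_LINT[where G="\<lambda>x. C * T powr (\<alpha> - a) * ((1 - x) powr \<alpha> * D1 1 x)"])
    show "set_integrable lborel {0<..<1} (\<lambda>x. C * T powr (\<alpha> - a) * ((1 - x) powr \<alpha> * D1 1 x))"
      by (intro set_integrable_mult_right D1_weight_integrable \<alpha>)
    fix x :: real assume x: "x \<in> {0<..<1}"
    have "continuous_on {0..T} (\<lambda>t. t powr (- a) * (f t - f (t * x)))"
    proof (rule continuous_on_powr_neg_mult[OF _ \<alpha>])
      show "continuous_on {0..T} (\<lambda>t. f t - f (t * x))"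
        using x by (intro continuous_intros cf continuous_on_compose_scale) auto
      show "\<bar>f t - f (t * x)\<bar> \<le> (C * (1 - x) powr \<alpha>) * t powr \<alpha>" if "0 \<le> t" "t \<le> T" for t
        using dif[of t x] that x by (simp add: mult_ac)
    qed
    then show "continuous_on {0..T} (\<lambda>t. t powr (- a) * (f t - f (t * x)) * D1 1 x)"
      by (rule continuous_on_mult_right)
  next
    fix t x :: real assume t: "t \<in> {0..T}" and x: "x \<in> {0<..<1}"
    have "\<bar>t powr (- a) * (f t - f (t * x)) * D1 1 x\<bar> = t powr (- a) * \<bar>f t - f (t * x)\<bar> * D1 1 x"
      by (simp add: abs_mult D_nonneg)
    also have "\<dots> \<le> t powr (- a) * (C * (t powr \<alpha> * (1 - x) powr \<alpha>)) * D1 1 x"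
      by (intro mult_right_mono mult_left_mono dif t x D_nonneg) auto
    also have "\<dots> = (t powr (- a) * t powr \<alpha>) * (C * ((1 - x) powr \<alpha> * D1 1 x))" by (simp add: mult_ac)
    also have "\<dots> \<le> T powr (\<alpha> - a) * (C * ((1 - x) powr \<alpha> * D1 1 x))"
      by (intro mult_right_mono mono t mult_nonneg_nonneg C0 D_nonneg) auto
    finally show "\<bar>t powr (- a) * (f t - f (t * x)) * D1 1 x\<bar> \<le> C * T powr (\<alpha> - a) * ((1 - x) powr \<alpha> * D1 1 x)"
      by (simp add: mult_ac)
  qed (simp add: set_borel_measurable_def)
  moreover have "continuous_on {0..T} (\<lambda>t. (LBINT x:{0<..<1}. t powr (- a) * f (t * x) * D2 1 x))"
  proof (rule continuous_on_set_LINT[where G="\<lambda>x. C * T powr (\<alpha> - a) * (x powr \<alpha> * D2 1 x)"])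
    show "set_integrable lborel {0<..<1} (\<lambda>x. C * T powr (\<alpha> - a) * (x powr \<alpha> * D2 1 x))"
      by (intro set_integrable_mult_right D2_weight_integrable \<alpha>)
    fix x :: real assume x: "x \<in> {0<..<1}"
    have "continuous_on {0..T} (\<lambda>t. t powr (- a) * f (t * x))"
    proof (rule continuous_on_powr_neg_mult[OF _ \<alpha>])
      show "continuous_on {0..T} (\<lambda>t. f (t * x))"
        using x by (intro cf continuous_on_compose_scale) auto
      show "\<bar>f (t * x)\<bar> \<le> (C * x powr \<alpha>) * t powr \<alpha>" if "0 \<le> t" "t \<le> T" for t
        using fb[of "t * x"] tx[of t x] that x by (simp add: powr_mult mult_ac)
    qed
    then show "continuous_on {0..T} (\<lambda>t. t powr (- a) * f (t * x) * D2 1 x)"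
      by (rule continuous_on_mult_right)
  next
    fix t x :: real assume t: "t \<in> {0..T}" and x: "x \<in> {0<..<1}"
    have "\<bar>t powr (- a) * f (t * x) * D2 1 x\<bar> = t powr (- a) * \<bar>f (t * x)\<bar> * D2 1 x"
      by (simp add: abs_mult D_nonneg)
    also have "\<dots> \<le> t powr (- a) * (C * (t powr \<alpha> * x powr \<alpha>)) * D2 1 x"
      using fb[of "t * x"] tx[OF t x] t x by (intro mult_right_mono mult_left_mono D_nonneg) (auto simp: powr_mult)
    also have "\<dots> = (t powr (- a) * t powr \<alpha>) * (C * (x powr \<alpha> * D2 1 x))" by (simp add: mult_ac)
    also have "\<dots> \<le> T powr (\<alpha> - a) * (C * (x powr \<alpha> * D2 1 x))"
      by (intro mult_right_mono mono t mult_nonneg_nonneg C0 D_nonneg) auto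
    finally show "\<bar>t powr (- a) * f (t * x) * D2 1 x\<bar> \<le> C * T powr (\<alpha> - a) * (x powr \<alpha> * D2 1 x)"
      by (simp add: mult_ac)
  qed (simp add: set_borel_measurable_def)
  ultimately have "continuous_on {0..T} (\<lambda>t. (LBINT x:{0<..<1}. t powr (- a) * (f t - f (t * x)) * D1 1 x) + (LBINT x:{0<..<1}. t powr (- a) * f (t * x) * D2 1 x))"
    by (rule continuous_on_add)
  then show ?thesis
    by (rule continuous_on_eq) (simp add: L_scaled distrib_left mult.assoc flip: set_integral_mult_right)
qed

text \<open>Applied to \<open>f (s * y)\<close> as a function of \<open>s\<close>, the operator
  gives \<open>y powr a * L f (t * y)\<close>. The weight \<open>y powr (- a)\<close> in
  \<open>F\<close> compensates this factor, and a plain mean of \<open>L f\<close> results. The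
  Hoelder bound on \<open>f\<close> provides the domination that Fubini requires.\<close>

lemma L_mean:
  fixes f :: "real \<Rightarrow> real"
  assumes \<alpha>: "a < \<alpha>" and [measurable]: "f \<in> borel_measurable borel"
    and C: "\<And>x y. x \<in> {0..T} \<Longrightarrow> y \<in> {0..T} \<Longrightarrow> \<bar>f x - f y\<bar> \<le> C * \<bar>x - y\<bar> powr \<alpha>"
    and f0: "f 0 = 0" and t: "0 < t" "t \<le> T"
    and F: "\<And>s. 0 < s \<Longrightarrow> s \<le> T \<Longrightarrow> F s = (LBINT y:{0<..<1}. y powr (- a) * f (s * y))"
  shows "L F t = (LBINT y:{0<..<1}. L f (t * y))"
proof -
  have T: "0 < T" using t by simp
  have C0: "0 \<le> C"
  proof -
    have "0 \<le> C * \<bar>T - 0\<bar> powr \<alpha>" using C[of T 0] T by (meson abs_ge_zero atLeastAtMost_iff order_trans order_refl less_imp_le)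
    then show ?thesis using T by (simp add: zero_le_mult_iff)
  qed
  have fb: "\<bar>f s\<bar> \<le> C * s powr \<alpha>" if "0 \<le> s" "s \<le> T" for s
    using C[of s 0] that f0 T by simp
  have pa: "set_integrable lborel {0<..<1} (\<lambda>y. y powr (- a))"
    using set_integrable_powr[of "1 - a"] a1 by simp
  have paf: "set_integrable lborel {0<..<1} (\<lambda>y. y powr (- a) * f (s * y))" if s: "0 < s" "s \<le> T" for s
  proof (rule set_integrable_mult_bounded[OF pa])
    show "set_borel_measurable borel {0<..<1} (\<lambda>x. f (s * x))" by (simp add: set_borel_measurable_def)
    fix x :: real assume x: "0 < x" "x < 1"
    have sx: "0 < s * x" "s * x \<le> T" using s x by (auto intro: scale_le)
    have "\<bar>f (s * x)\<bar> \<le> C * (s * x) powr \<alpha>" using sx by (intro fb) auto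
    also have "\<dots> \<le> C * T powr \<alpha>" using sx \<alpha> a0 C0 by (intro mult_left_mono powr_mono2) auto
    finally show "\<bar>f (s * x)\<bar> \<le> C * T powr \<alpha>" .
  qed simp
  have py: "set_integrable lborel {0<..<1} (\<lambda>y. y powr (\<alpha> - a))"
    using set_integrable_powr[of "\<alpha> - a + 1"] \<alpha> by simp
  let ?P = "\<lambda>x y. y powr (- a) * (f (t * y) - f (t * x * y)) * D1 1 x"
  let ?Q = "\<lambda>x y. y powr (- a) * f (t * x * y) * D2 1 x"
  have e: "y powr (- a) * y powr \<alpha> = y powr (\<alpha> - a)" for y :: real by (simp flip: powr_add)
  have txy: "0 < t * y" "t * y \<le> T" "0 < t * x * y" "t * x * y \<le> T" "\<bar>t * y - t * x * y\<bar> = t * y * (1 - x)"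
    if "x \<in> {0<..<1}" "y \<in> {0<..<1}" for x y
  proof -
    show "0 < t * y" "0 < t * x * y" using t that by auto
    show 1: "t * y \<le> T" using t that by (intro scale_le) auto
    have "t * x \<le> T" using t that by (intro scale_le) auto
    then show "t * x * y \<le> T" using t that by (intro scale_le) auto
    have "t * y - t * x * y = t * y * (1 - x)" by (simp add: algebra_simps)
    then show "\<bar>t * y - t * x * y\<bar> = t * y * (1 - x)" using t that by simp
  qed
  have P: "(LBINT x:{0<..<1}. LBINT y:{0<..<1}. ?P x y) = (LBINT y:{0<..<1}. LBINT x:{0<..<1}. ?P x y)"
    "set_integrable lborel {0<..<1} (\<lambda>y. LBINT x:{0<..<1}. ?P x y)"
  proof -
    have b: "\<bar>?P x y\<bar> \<le> (C * t powr \<alpha> * ((1 - x) powr \<alpha> * D1 1 x)) * y powr (\<alpha> - a)"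
      if xy: "x \<in> {0<..<1}" "y \<in> {0<..<1}" for x y
    proof -
      have "\<bar>?P x y\<bar> = y powr (- a) * \<bar>f (t * y) - f (t * x * y)\<bar> * D1 1 x" by (simp add: abs_mult D_nonneg)
      also have "\<dots> \<le> y powr (- a) * (C * (t * y * (1 - x)) powr \<alpha>) * D1 1 x"
        using C[of "t * y" "t * x * y"] txy[OF xy] by (intro mult_right_mono mult_left_mono D_nonneg) auto
      also have "(t * y * (1 - x)) powr \<alpha> = t powr \<alpha> * y powr \<alpha> * (1 - x) powr \<alpha>"
        using t xy by (simp add: powr_mult)
      also have "y powr (- a) * (C * (t powr \<alpha> * y powr \<alpha> * (1 - x) powr \<alpha>)) * D1 1 x
         = (C * t powr \<alpha> * ((1 - x) powr \<alpha> * D1 1 x)) * (y powr (- a) * y powr \<alpha>)" by (simp only: mult_ac)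
      finally show ?thesis unfolding e .
    qed
    have i: "set_integrable lborel {0<..<1} (\<lambda>x. C * t powr \<alpha> * ((1 - x) powr \<alpha> * D1 1 x))"
      by (intro set_integrable_mult_right D1_weight_integrable \<alpha>)
    show "(LBINT x:{0<..<1}. LBINT y:{0<..<1}. ?P x y) = (LBINT y:{0<..<1}. LBINT x:{0<..<1}. ?P x y)"
      by (rule set_LINT_swap(1)[OF _ _ _ i py _ b]) measurable
    show "set_integrable lborel {0<..<1} (\<lambda>y. LBINT x:{0<..<1}. ?P x y)"
      by (rule set_LINT_swap(3)[OF _ _ _ i py _ b]) measurable
  qed
  have Q: "(LBINT x:{0<..<1}. LBINT y:{0<..<1}. ?Q x y) = (LBINT y:{0<..<1}. LBINT x:{0<..<1}. ?Q x y)"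
    "set_integrable lborel {0<..<1} (\<lambda>y. LBINT x:{0<..<1}. ?Q x y)"
  proof -
    have b: "\<bar>?Q x y\<bar> \<le> (C * t powr \<alpha> * (x powr \<alpha> * D2 1 x)) * y powr (\<alpha> - a)"
      if xy: "x \<in> {0<..<1}" "y \<in> {0<..<1}" for x y
    proof -
      have "\<bar>?Q x y\<bar> = y powr (- a) * \<bar>f (t * x * y)\<bar> * D2 1 x" by (simp add: abs_mult D_nonneg)
      also have "\<dots> \<le> y powr (- a) * (C * (t * x * y) powr \<alpha>) * D2 1 x"
        using fb[of "t * x * y"] txy[OF xy] by (intro mult_right_mono mult_left_mono D_nonneg) auto
      also have "(t * x * y) powr \<alpha> = t powr \<alpha> * x powr \<alpha> * y powr \<alpha>"
        using t xy by (simp add: powr_mult)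
      also have "y powr (- a) * (C * (t powr \<alpha> * x powr \<alpha> * y powr \<alpha>)) * D2 1 x
         = (C * t powr \<alpha> * (x powr \<alpha> * D2 1 x)) * (y powr (- a) * y powr \<alpha>)" by (simp only: mult_ac)
      finally show ?thesis unfolding e .
    qed
    have i: "set_integrable lborel {0<..<1} (\<lambda>x. C * t powr \<alpha> * (x powr \<alpha> * D2 1 x))"
      by (intro set_integrable_mult_right D2_weight_integrable \<alpha>)
    show "(LBINT x:{0<..<1}. LBINT y:{0<..<1}. ?Q x y) = (LBINT y:{0<..<1}. LBINT x:{0<..<1}. ?Q x y)"
      by (rule set_LINT_swap(1)[OF _ _ _ i py _ b]) measurable
    show "set_integrable lborel {0<..<1} (\<lambda>y. LBINT x:{0<..<1}. ?Q x y)"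
      by (rule set_LINT_swap(3)[OF _ _ _ i py _ b]) measurable
  qed
  have 1: "(LBINT x:{0<..<1}. (F t - F (t * x)) * D1 1 x) = (LBINT x:{0<..<1}. LBINT y:{0<..<1}. ?P x y)"
  proof (rule set_lebesgue_integral_cong)
    show "\<forall>x. x \<in> {0<..<1} \<longrightarrow> (F t - F (t * x)) * D1 1 x = (LBINT y:{0<..<1}. ?P x y)"
    proof (intro allI impI)
      fix x :: real assume x: "x \<in> {0<..<1}"
      have tx: "0 < t * x" "t * x \<le> T" using t x by (auto intro: scale_le)
      have "F t - F (t * x) = (LBINT y:{0<..<1}. y powr (- a) * f (t * y) - y powr (- a) * f (t * x * y))"
        unfolding F[OF t] F[OF tx] by (rule set_integral_diff(2)[symmetric]) (intro paf t tx)+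
      then show "(F t - F (t * x)) * D1 1 x = (LBINT y:{0<..<1}. ?P x y)"
        by (simp add: right_diff_distrib flip: set_integral_mult_left)
    qed
  qed simp
  have 2: "(LBINT x:{0<..<1}. F (t * x) * D2 1 x) = (LBINT x:{0<..<1}. LBINT y:{0<..<1}. ?Q x y)"
  proof (rule set_lebesgue_integral_cong)
    show "\<forall>x. x \<in> {0<..<1} \<longrightarrow> F (t * x) * D2 1 x = (LBINT y:{0<..<1}. ?Q x y)"
    proof (intro allI impI)
      fix x :: real assume x: "x \<in> {0<..<1}"
      have tx: "0 < t * x" "t * x \<le> T" using t x by (auto intro: scale_le)
      show "F (t * x) * D2 1 x = (LBINT y:{0<..<1}. ?Q x y)"
        unfolding F[OF tx] by (simp flip: set_integral_mult_left)
    qed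
  qed simp
  have "L F t = t powr (- a) * ((LBINT y:{0<..<1}. LBINT x:{0<..<1}. ?P x y) + (LBINT y:{0<..<1}. LBINT x:{0<..<1}. ?Q x y))"
    unfolding L_scaled[OF less_imp_le[OF t(1)]] 1 2 P(1) Q(1) ..
  also have "\<dots> = (LBINT y:{0<..<1}. t powr (- a) * ((LBINT x:{0<..<1}. ?P x y) + (LBINT x:{0<..<1}. ?Q x y)))"
    using P(2) Q(2) by (simp add: set_integral_add(2))
  also have "\<dots> = (LBINT y:{0<..<1}. L f (t * y))"
  proof (rule set_lebesgue_integral_cong)
    show "\<forall>y. y \<in> {0<..<1} \<longrightarrow> t powr (- a) * ((LBINT x:{0<..<1}. ?P x y) + (LBINT x:{0<..<1}. ?Q x y)) = L f (t * y)"
    proof (intro allI impI)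
      fix y :: real assume y: "y \<in> {0<..<1}"
      have "(LBINT x:{0<..<1}. ?P x y) = y powr (- a) * (LBINT x:{0<..<1}. (f (t * y) - f (t * y * x)) * D1 1 x)"
        by (simp add: mult_ac flip: set_integral_mult_right)
      moreover have "(LBINT x:{0<..<1}. ?Q x y) = y powr (- a) * (LBINT x:{0<..<1}. f (t * y * x) * D2 1 x)"
        by (simp add: mult_ac flip: set_integral_mult_right)
      ultimately show "t powr (- a) * ((LBINT x:{0<..<1}. ?P x y) + (LBINT x:{0<..<1}. ?Q x y)) = L f (t * y)"
        using t y by (subst L_scaled) (auto simp: powr_mult algebra_simps)
    qed
  qed simp
  finally show ?thesis .
qed

text \<open>\<open>A0\<close> has the opposite homogeneity: applied to \<open>g (s * y)\<close> as a
  function of \<open>s\<close> it gives \<open>y powr (- a) * A0 g (s * y)\<close>. A plain mean of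
  \<open>g\<close> thus becomes the weighted mean that \<open>L_mean\<close> expects.\<close>

lemma A0_mean:
  fixes g :: "real \<Rightarrow> real"
  assumes [measurable]: "g \<in> borel_measurable borel"
    and b: "\<And>s. 0 \<le> s \<Longrightarrow> s \<le> T \<Longrightarrow> \<bar>g s\<bar> \<le> C"
    and s: "0 < s" "s \<le> T"
    and F: "\<And>s. 0 < s \<Longrightarrow> s \<le> T \<Longrightarrow> F s = (LBINT y:{0<..<1}. g (s * y))"
  shows "A0 F s = (LBINT y:{0<..<1}. y powr (- a) * A0 g (s * y))"
proof -
  have one: "set_integrable lborel {0<..<1::real} (\<lambda>y. C)"
    unfolding set_integrable_def by (intro integrable_scaleR_left integrable_real_indicator) auto
  have sw: "(LBINT x:{0<..<1}. w x * F (s * x)) = (LBINT y:{0<..<1}. LBINT x:{0<..<1}. w x * g (s * y * x))"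
    "set_integrable lborel {0<..<1} (\<lambda>y. LBINT x:{0<..<1}. w x * g (s * y * x))"
    if w: "set_integrable lborel {0<..<1} w" and [measurable]: "w \<in> borel_measurable borel" and w0: "\<And>x. 0 \<le> w x" for w
  proof -
    have 1: "(LBINT x:{0<..<1}. w x * F (s * x)) = (LBINT x:{0<..<1}. LBINT y:{0<..<1}. w x * g (s * y * x))"
    proof (rule set_lebesgue_integral_cong)
      show "\<forall>x. x \<in> {0<..<1} \<longrightarrow> w x * F (s * x) = (LBINT y:{0<..<1}. w x * g (s * y * x))"
      proof (intro allI impI)
        fix x :: real assume x: "x \<in> {0<..<1}"
        have sx: "0 < s * x" "s * x \<le> T" using s x by (auto intro: scale_le)
        have "g (s * x * y) = g (s * y * x)" for y by (simp add: mult_ac)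
        then show "w x * F (s * x) = (LBINT y:{0<..<1}. w x * g (s * y * x))"
          unfolding F[OF sx] by simp
      qed
    qed simp
    have 3: "(LBINT x:{0<..<1}. LBINT y:{0<..<1}. w x * g (s * y * x)) = (LBINT y:{0<..<1}. LBINT x:{0<..<1}. w x * g (s * y * x))"
      and 2: "set_integrable lborel {0<..<1} (\<lambda>y. LBINT x:{0<..<1}. w x * g (s * y * x))"
    proof -
      have bd: "\<bar>w x * g (s * y * x)\<bar> \<le> w x * C" if xy: "x \<in> {0<..<1}" "y \<in> {0<..<1}" for x y
      proof -
        have "s * y \<le> T" using s xy by (intro scale_le) auto
        then have "s * y * x \<le> T" using s xy by (intro scale_le) auto
        then have "\<bar>g (s * y * x)\<bar> \<le> C" using s xy by (intro b) auto
        then show ?thesis using w0[of x] by (simp add: abs_mult mult_left_mono)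
      qed
      show "(LBINT x:{0<..<1}. LBINT y:{0<..<1}. w x * g (s * y * x)) = (LBINT y:{0<..<1}. LBINT x:{0<..<1}. w x * g (s * y * x))"
        by (rule set_LINT_swap(1)[OF _ _ _ w one _ bd]) measurable
      show "set_integrable lborel {0<..<1} (\<lambda>y. LBINT x:{0<..<1}. w x * g (s * y * x))"
        by (rule set_LINT_swap(3)[OF _ _ _ w one _ bd]) measurable
    qed
    show "(LBINT x:{0<..<1}. w x * F (s * x)) = (LBINT y:{0<..<1}. LBINT x:{0<..<1}. w x * g (s * y * x))"
      unfolding 1 3 ..
    show "set_integrable lborel {0<..<1} (\<lambda>y. LBINT x:{0<..<1}. w x * g (s * y * x))" by (rule 2)
  qed
  note sw1 = sw[OF w_integrable(1) w_meas(1) w_nonneg(1)] and sw2 = sw[OF w_integrable(2) w_meas(2) w_nonneg(2)]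
  have "A0 F s = s powr a / betaa * (LBINT y:{0<..<1}. (LBINT x:{0<..<1}. w1 x * g (s * y * x)) - (LBINT x:{0<..<1}. w2 x * g (s * y * x)))"
    unfolding A0_def sw1(1) sw2(1) using set_integral_diff(2)[OF sw1(2) sw2(2)] by simp
  also have "\<dots> = (LBINT y:{0<..<1}. s powr a / betaa * ((LBINT x:{0<..<1}. w1 x * g (s * y * x)) - (LBINT x:{0<..<1}. w2 x * g (s * y * x))))"
    by simp
  also have "\<dots> = (LBINT y:{0<..<1}. y powr (- a) * A0 g (s * y))"
  proof (rule set_lebesgue_integral_cong)
    show "\<forall>y. y \<in> {0<..<1} \<longrightarrow> s powr a / betaa * ((LBINT x:{0<..<1}. w1 x * g (s * y * x)) - (LBINT x:{0<..<1}. w2 x * g (s * y * x)))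
        = y powr (- a) * A0 g (s * y)"
    proof (intro allI impI)
      fix y :: real assume y: "y \<in> {0<..<1}"
      have "y powr (- a) * y powr a = 1" using y by (simp flip: powr_add)
      then have "y powr (- a) * (s * y) powr a = s powr a" using s y by (simp add: powr_mult)
      then have "y powr (- a) * ((s * y) powr a / betaa) = s powr a / betaa" by simp
      then show "s powr a / betaa * ((LBINT x:{0<..<1}. w1 x * g (s * y * x)) - (LBINT x:{0<..<1}. w2 x * g (s * y * x)))
        = y powr (- a) * A0 g (s * y)" unfolding A0_def mult.assoc[symmetric] by (simp only:)
    qed
  qed simp
  finally show ?thesis .
qed

lemma A0_linear:
  fixes f1 f2 :: "real \<Rightarrow> real"
  assumes [measurable]: "f1 \<in> borel_measurable borel" "f2 \<in> borel_measurable borel"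
    and b: "\<And>s. 0 \<le> s \<Longrightarrow> s \<le> T \<Longrightarrow> \<bar>f1 s\<bar> \<le> C1" "\<And>s. 0 \<le> s \<Longrightarrow> s \<le> T \<Longrightarrow> \<bar>f2 s\<bar> \<le> C2"
    and s: "0 < s" "s \<le> T"
  shows "A0 (\<lambda>s. f1 s - f2 s) s = A0 f1 s - A0 f2 s"
proof -
  have i: "set_integrable lborel {0<..<1} (\<lambda>x. w x * f (s * x))"
    if "set_integrable lborel {0<..<1} w" and [measurable]: "w \<in> borel_measurable borel" "f \<in> borel_measurable borel"
      and "\<And>s. 0 \<le> s \<Longrightarrow> s \<le> T \<Longrightarrow> \<bar>f s\<bar> \<le> C" for w f :: "real \<Rightarrow> real" and C
  proof (rule set_integrable_mult_bounded[OF that(1,2)])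
    show "set_borel_measurable borel {0<..<1} (\<lambda>x. f (s * x))" by (simp add: set_borel_measurable_def)
    show "\<bar>f (s * x)\<bar> \<le> C" if "0 < x" "x < 1" for x
      using that s by (intro \<open>\<And>s. 0 \<le> s \<Longrightarrow> s \<le> T \<Longrightarrow> \<bar>f s\<bar> \<le> C\<close>) (auto intro: scale_le)
  qed
  have "(LBINT x:{0<..<1}. w x * (f1 (s * x) - f2 (s * x))) = (LBINT x:{0<..<1}. w x * f1 (s * x)) - (LBINT x:{0<..<1}. w x * f2 (s * x))"
    if w: "set_integrable lborel {0<..<1} w" and [measurable]: "w \<in> borel_measurable borel" for w :: "real \<Rightarrow> real"
    using set_integral_diff(2)[OF i[OF w \<open>w \<in> borel_measurable borel\<close> assms(1), of C1] i[OF w \<open>w \<in> borel_measurable borel\<close> assms(2), of C2]] b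
    by (simp add: right_diff_distrib)
  note e = this[OF w_integrable(1) w_meas(1)] this[OF w_integrable(2) w_meas(2)]
  show ?thesis unfolding A0_def e by (simp add: right_diff_distrib diff_divide_distrib)
qed

text \<open>Away from \<open>0\<close> the running mean has the derivative
  \<open>(g s - S s) / s\<close>, and the bound on \<open>g\<close> makes it integrable at
  \<open>0\<close>. The derivative is signed, so \<open>S\<close> is written as the difference of
  \<open>q\<close> and \<open>p\<close>, to each of which \<open>L_A0_absolutely_continuous\<close>
  applies.\<close>

lemma L_A0_mean_path:
  fixes g :: "real \<Rightarrow> real"
  assumes g: "continuous_on UNIV g" and \<delta>: "0 < \<delta>"
    and C: "\<And>s. 0 \<le> s \<Longrightarrow> s \<le> T \<Longrightarrow> \<bar>g s\<bar> \<le> C * s powr \<delta>" and t: "0 < t" "t \<le> T"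
  defines "S \<equiv> \<lambda>s. (LBINT u:{0<..<s}. g u) / s"
  shows "L (A0 S) t = S t"
proof -
  have [measurable]: "g \<in> borel_measurable borel" using g by (simp add: borel_measurable_continuous_onI)
  define G where "G s = (LBINT u:{0<..<s}. g u)" for s
  have [measurable]: "G \<in> borel_measurable borel" unfolding G_def by measurable
  have [measurable]: "S \<in> borel_measurable borel" unfolding S_def by measurable
  have C0: "0 \<le> C"
  proof -
    have "0 \<le> C * T powr \<delta>" using C[of T] t by (auto intro: order_trans[OF abs_ge_zero])
    then show ?thesis using t by (simp add: zero_le_mult_iff)
  qed
  have Gi: "G s = integral {0..s} g" if "0 \<le> s" for s
  proof -
    have "set_integrable lborel {0<..<s} g"
      by (rule set_integrable_subset[OF borel_integrable_atLeastAtMost'[of 0 s g]])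
         (auto intro: continuous_on_subset[OF g])
    from set_borel_integral_eq_integral(2)[OF this] show ?thesis
      by (simp add: G_def integral_open_interval_real)
  qed
  have Gd: "(G has_real_derivative g s) (at s)" if s: "0 < s" for s
  proof -
    have "((\<lambda>u. integral {0..u} g) has_real_derivative g s) (at s within {0..s + 1})"
      using s by (intro integral_has_real_derivative) (auto intro: continuous_on_subset[OF g])
    then have "((\<lambda>u. integral {0..u} g) has_real_derivative g s) (at s)"
      using s by (simp add: at_within_Icc_at)
    then show ?thesis
    proof (rule DERIV_cong_ev[THEN iffD1, rotated -1, OF _ refl _ refl])
      have "\<forall>\<^sub>F u in nhds s. u \<in> {0<..}" using s by (intro eventually_nhds_in_open) auto
      then show "\<forall>\<^sub>F u in nhds s. integral {0..u} g = G u" by eventually_elim (auto simp: Gi)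
    qed
  qed
  have Gb: "\<bar>S s\<bar> \<le> C * s powr \<delta>" if s: "0 \<le> s" "s \<le> T" for s
  proof (cases "s = 0")
    case False
    have "\<bar>G s\<bar> \<le> C * s powr \<delta> * s"
      unfolding G_def
    proof (rule LBINT_abs_bound)
      fix x assume x: "0 < x" "x < s"
      have "\<bar>g x\<bar> \<le> C * x powr \<delta>" using x s by (intro C) auto
      also have "\<dots> \<le> C * s powr \<delta>" using x \<delta> C0 by (intro mult_left_mono powr_mono2) auto
      finally show "\<bar>g x\<bar> \<le> C * s powr \<delta>" .
    qed (use s C0 in auto)
    then show ?thesis using s False by (simp add: S_def G_def[symmetric] abs_divide pos_divide_le_eq)
  qed (simp add: S_def)
  \<comment> \<open>The slope of \<open>S\<close> at \<open>s\<close> is at least \<open>- 2 * C * s powr (\<delta> - 1)\<close>, so that adding \<open>M * s powr \<delta>\<close> makes it increasing.\<close>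
  define M where "M = 2 * C / \<delta>"
  have M0: "0 \<le> M" using C0 \<delta> by (simp add: M_def)
  define p where "p s = M * s powr \<delta>" for s :: real
  define p1 where "p1 s = indicator {0<..<T} s * (M * \<delta> * s powr (\<delta> - 1))" for s :: real
  define q where "q s = S s + M * s powr \<delta>" for s :: real
  define q1 where "q1 s = indicator {0<..<T} s * ((g s - S s) / s + M * \<delta> * s powr (\<delta> - 1))" for s :: real
  have [measurable]: "p \<in> borel_measurable borel" "p1 \<in> borel_measurable borel"
    "q \<in> borel_measurable borel" "q1 \<in> borel_measurable borel"
    unfolding p_def p1_def q_def q1_def by measurable
  have p1n: "0 \<le> p1 s" for s using M0 \<delta> by (auto simp: p1_def split: split_indicator)
  have q1n: "0 \<le> q1 s" for s
  proof (cases "s \<in> {0<..<T}")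
    case True
    have "\<bar>g s - S s\<bar> \<le> 2 * C * s powr \<delta>" using C[of s] Gb[of s] True by auto
    then have "\<bar>g s - S s\<bar> / s \<le> 2 * C * s powr \<delta> / s" using True by (intro divide_right_mono) auto
    moreover have "s powr \<delta> / s = s powr (\<delta> - 1)" using True by (simp add: powr_diff)
    moreover have "- (\<bar>g s - S s\<bar> / s) \<le> (g s - S s) / s"
    proof -
      have "- (\<bar>g s - S s\<bar> / s) = (- \<bar>g s - S s\<bar>) / s" by simp
      also have "\<dots> \<le> (g s - S s) / s" using True by (intro divide_right_mono) auto
      finally show ?thesis .
    qed
    ultimately have "- (2 * C * s powr (\<delta> - 1)) \<le> (g s - S s) / s"
      by (metis (no_types) neg_le_iff_le order_trans times_divide_eq_right)
    moreover have "q1 s = (g s - S s) / s + 2 * C * s powr (\<delta> - 1)" using True \<delta> by (simp add: q1_def M_def)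
    ultimately show ?thesis by linarith
  qed (simp add: q1_def)
  have lim0: "((\<lambda>s. K * s powr \<delta>) \<longlongrightarrow> 0) (at 0 within {0..r})" for r K :: real
  proof -
    have "((\<lambda>s. K * s powr \<delta>) \<longlongrightarrow> K * 0 powr \<delta>) (at 0 within {0..r})"
      using \<delta> by (intro tendsto_intros tendsto_powr') (auto simp: eventually_at_filter)
    then show ?thesis by simp
  qed
  have pF: "set_integrable lborel {0<..<s} p1" "p s = (LBINT u:{0<..<s}. p1 u)" if s: "0 < s" "s \<le> T" for s
  proof -
    have d: "(p has_real_derivative p1 x) (at x)" and c: "isCont p1 x" if x: "0 < x" "x < s" for x
    proof -
      from x show "(p has_real_derivative p1 x) (at x)"
        unfolding p_def using s by (auto intro!: derivative_eq_intros simp: p1_def)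
      have "isCont (\<lambda>x. M * \<delta> * x powr (\<delta> - 1)) x" using x by (intro continuous_intros) auto
      then show "isCont p1 x"
      proof (rule isCont_cong[THEN iffD1, rotated])
        have "\<forall>\<^sub>F u in nhds x. u \<in> {0<..<T}" using x s by (intro eventually_nhds_in_open) auto
        then show "\<forall>\<^sub>F u in nhds x. M * \<delta> * u powr (\<delta> - 1) = p1 u" by eventually_elim (auto simp: p1_def)
      qed
    qed
    have cc: "continuous_on {0..s} p" unfolding p_def using \<delta> by (intro continuous_intros continuous_on_powr') auto
    show "set_integrable lborel {0<..<s} p1" "p s = (LBINT u:{0<..<s}. p1 u)"
      using FTC_nonneg_cont(1,2)[OF s(1) d c p1n cc] by (auto simp: p_def)
  qed
  have Sd: "(S has_real_derivative (g s - S s) / s) (at s)" if s: "0 < s" for s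
  proof -
    have "((\<lambda>s. G s / s) has_real_derivative (g s * s - G s * 1) / (s * s)) (at s)"
      using s by (intro DERIV_divide Gd) auto
    moreover have "(g s * s - G s * 1) / (s * s) = (g s - S s) / s" using s by (simp add: S_def G_def[symmetric] field_simps)
    ultimately show ?thesis by (simp add: S_def G_def)
  qed
  have qF: "set_integrable lborel {0<..<s} q1" "q s = (LBINT u:{0<..<s}. q1 u)" if s: "0 < s" "s \<le> T" for s
  proof -
    have d: "(q has_real_derivative q1 x) (at x)" and c: "isCont q1 x" if x: "0 < x" "x < s" for x
    proof -
      have "(q has_real_derivative ((g x - S x) / x + M * \<delta> * x powr (\<delta> - 1))) (at x)"
        unfolding q_def using x by (auto intro!: derivative_eq_intros Sd)
      then show "(q has_real_derivative q1 x) (at x)" using x s by (simp add: q1_def)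
      have "isCont S x" using Sd[OF x(1)] by (rule DERIV_isCont)
      moreover have "isCont g x" using g by (simp add: continuous_on_eq_continuous_at)
      ultimately have "isCont (\<lambda>x. (g x - S x) / x + M * \<delta> * x powr (\<delta> - 1)) x" using x by (intro continuous_intros) auto
      then show "isCont q1 x"
      proof (rule isCont_cong[THEN iffD1, rotated])
        have "\<forall>\<^sub>F u in nhds x. u \<in> {0<..<T}" using x s by (intro eventually_nhds_in_open) auto
        then show "\<forall>\<^sub>F u in nhds x. (g u - S u) / u + M * \<delta> * u powr (\<delta> - 1) = q1 u" by eventually_elim (auto simp: q1_def)
      qed
    qed
    have cc: "continuous_on {0..s} q"
        unfolding continuous_on_eq_continuous_within
      proof
        fix x assume x: "x \<in> {0..s}"
        show "continuous (at x within {0..s}) q"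
        proof (cases "x = 0")
          case False
          then have "(q has_real_derivative ((g x - S x) / x + M * \<delta> * x powr (\<delta> - 1))) (at x)"
            unfolding q_def using x by (auto intro!: derivative_eq_intros Sd)
          then show ?thesis by (auto intro: continuous_at_imp_continuous_at_within DERIV_isCont)
        next
          case True
          have "(q \<longlongrightarrow> 0) (at 0 within {0..s})"
          proof (rule Lim_null_comparison[OF _ lim0[of "C + M"]])
            show "\<forall>\<^sub>F u in at 0 within {0..s}. norm (q u) \<le> (C + M) * u powr \<delta>"
              unfolding eventually_at_filter
            proof (intro always_eventually allI impI)
              fix u :: real assume u: "u \<noteq> 0" "u \<in> {0..s}"
              have "\<bar>S u\<bar> \<le> C * u powr \<delta>" using u s by (intro Gb) auto
              then show "norm (q u) \<le> (C + M) * u powr \<delta>"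
                using M0 by (auto simp: q_def distrib_right intro!: abs_triangle_ineq[THEN order_trans])
            qed
          qed
          then show ?thesis using True by (simp add: continuous_within q_def S_def)
        qed
      qed
    show "set_integrable lborel {0<..<s} q1" "q s = (LBINT u:{0<..<s}. q1 u)"
      using FTC_nonneg_cont(1,2)[OF s(1) d c q1n cc] by (auto simp: q_def S_def)
  qed
  note Lp = L_A0_absolutely_continuous[OF t(1) _ _ p1n pF(1)[OF t], of p]
  note Lq = L_A0_absolutely_continuous[OF t(1) _ _ q1n qF(1)[OF t], of q]
  have Lp': "set_integrable lborel {0<..<t} (\<lambda>s. (A0 p t - A0 p s) * D1 t s)"
    "set_integrable lborel {0<..<t} (\<lambda>s. A0 p s * D2 t s)" "L (A0 p) t = p t"
    using Lp pF(2) t by auto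
  have Lq': "set_integrable lborel {0<..<t} (\<lambda>s. (A0 q t - A0 q s) * D1 t s)"
    "set_integrable lborel {0<..<t} (\<lambda>s. A0 q s * D2 t s)" "L (A0 q) t = q t"
    using Lq qF(2) t by auto
  have AS: "A0 S s = A0 q s - A0 p s" if s: "0 < s" "s \<le> T" for s
  proof -
    have "A0 (\<lambda>s. q s - p s) s = A0 q s - A0 p s"
    proof (rule A0_linear[OF _ _ _ _ s])
      fix s :: real assume s: "0 \<le> s" "s \<le> T"
      have pw: "s powr \<delta> \<le> T powr \<delta>" using s \<delta> by (intro powr_mono2) auto
      show "\<bar>p s\<bar> \<le> M * T powr \<delta>" using pw M0 by (simp add: p_def abs_mult mult_left_mono)
      have "\<bar>q s\<bar> \<le> C * s powr \<delta> + M * s powr \<delta>"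
        using Gb[OF s] M0 by (auto simp: q_def abs_mult intro!: abs_triangle_ineq[THEN order_trans])
      also have "\<dots> \<le> C * T powr \<delta> + M * T powr \<delta>" using pw M0 C0 by (intro add_mono mult_left_mono) auto
      finally show "\<bar>q s\<bar> \<le> C * T powr \<delta> + M * T powr \<delta>" .
    qed auto
    then show ?thesis by (simp add: q_def p_def)
  qed
  have "(LBINT s:{0<..<t}. (A0 S t - A0 S s) * D1 t s) = (LBINT s:{0<..<t}. (A0 q t - A0 q s) * D1 t s - (A0 p t - A0 p s) * D1 t s)"
    using AS[OF t] AS t by (intro set_lebesgue_integral_cong) (auto simp: left_diff_distrib)
  also have "\<dots> = (LBINT s:{0<..<t}. (A0 q t - A0 q s) * D1 t s) - (LBINT s:{0<..<t}. (A0 p t - A0 p s) * D1 t s)"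
    by (rule set_integral_diff(2)[OF Lq'(1) Lp'(1)])
  finally have 1: "(LBINT s:{0<..<t}. (A0 S t - A0 S s) * D1 t s) = (LBINT s:{0<..<t}. (A0 q t - A0 q s) * D1 t s) - (LBINT s:{0<..<t}. (A0 p t - A0 p s) * D1 t s)" .
  have "(LBINT s:{0<..<t}. A0 S s * D2 t s) = (LBINT s:{0<..<t}. A0 q s * D2 t s - A0 p s * D2 t s)"
    using AS t by (intro set_lebesgue_integral_cong) (auto simp: left_diff_distrib)
  also have "\<dots> = (LBINT s:{0<..<t}. A0 q s * D2 t s) - (LBINT s:{0<..<t}. A0 p s * D2 t s)"
    by (rule set_integral_diff(2)[OF Lq'(2) Lp'(2)])
  finally have 2: "(LBINT s:{0<..<t}. A0 S s * D2 t s) = (LBINT s:{0<..<t}. A0 q s * D2 t s) - (LBINT s:{0<..<t}. A0 p s * D2 t s)" .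
  have "L (A0 S) t = L (A0 q) t - L (A0 p) t"
    unfolding L_def 1 2 by simp
  then show ?thesis using Lp'(3) Lq'(3) by (simp add: q_def p_def)
qed

text \<open>Hoelder continuity of \<open>A0 g\<close> is assumed rather than derived from
  \<open>g\<close>: in the application it holds because \<open>A0 g\<close> is a multiple of a
  Brownian path. It makes \<open>L (A0 g)\<close> continuous, so that equality of the integrals over
  all \<open>{0..s}\<close> can be differentiated to equality at each point.\<close>

theorem L_A0_path:
  fixes g :: "real \<Rightarrow> real"
  assumes g: "continuous_on UNIV g" and \<delta>: "0 < \<delta>"
    and C: "\<And>s. 0 \<le> s \<Longrightarrow> s \<le> T \<Longrightarrow> \<bar>g s\<bar> \<le> C * s powr \<delta>"
    and \<alpha>: "a < \<alpha>"
    and H: "\<And>x y. x \<in> {0..T} \<Longrightarrow> y \<in> {0..T} \<Longrightarrow> \<bar>A0 g x - A0 g y\<bar> \<le> C' * \<bar>x - y\<bar> powr \<alpha>"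
    and T: "0 < T" and t: "t \<in> {0..T}"
  shows "L (A0 g) t = g t"
proof (cases "t = 0")
  case True
  then show ?thesis using C[of 0] T by (simp add: L_def set_lebesgue_integral_def)
next
  case False
  have [measurable]: "g \<in> borel_measurable borel" using g by (simp add: borel_measurable_continuous_onI)
  define f where "f = A0 g"
  have [measurable]: "f \<in> borel_measurable borel" unfolding f_def by measurable
  have f0: "f 0 = 0" by (simp add: f_def A0_def)
  define S where "S s = (LBINT u:{0<..<s}. g u) / s" for s
  have Lc: "continuous_on {0..T} (L f)"
    using H f0 T by (intro L_continuous[OF \<alpha>, of _ _ C']) (auto simp: f_def)
  have C0: "0 \<le> C"
  proof -
    have "0 \<le> C * T powr \<delta>" using C[of T] T by (auto intro: order_trans[OF abs_ge_zero])
    then show ?thesis using T by (simp add: zero_le_mult_iff)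
  qed
  have S_scale: "S s = (LBINT y:{0<..<1}. g (s * y))" if "0 < s" for s
    using LBINT_scale[OF that, of 1 g] that by (simp add: S_def)
  have gb: "\<bar>g s\<bar> \<le> C * T powr \<delta>" if "0 \<le> s" "s \<le> T" for s
    using C[OF that] that \<delta> C0 by (auto intro!: order_trans[OF C[OF that]] mult_left_mono powr_mono2)
  have AS: "A0 S s = (LBINT y:{0<..<1}. y powr (- a) * f (s * y))" if "0 < s" "s \<le> T" for s
    unfolding f_def using that gb S_scale by (intro A0_mean[of g T "C * T powr \<delta>"]) auto
  have eq: "(LBINT y:{0<..<1}. L f (s * y)) = (LBINT y:{0<..<1}. g (s * y))" if s: "0 < s" "s \<le> T" for s
  proof -
    have "L (A0 S) s = (LBINT y:{0<..<1}. L f (s * y))"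
      using H f0 AS s by (intro L_mean[OF \<alpha>, of f T C']) (auto simp: f_def)
    moreover have "L (A0 S) s = S s"
      unfolding S_def using L_A0_mean_path[OF g \<delta> C s] by simp
    ultimately show ?thesis using S_scale[OF s(1)] by simp
  qed
  have int_eq: "integral {0..s} (L f) = integral {0..s} g" if s: "0 \<le> s" "s \<le> T" for s
  proof (cases "s = 0")
    case False
    with s have s': "0 < s" by simp
    have *: "(LBINT u:{0<..<s}. h u) = integral {0..s} h" if "continuous_on {0..s} h" for h :: "real \<Rightarrow> real"
    proof -
      have "set_integrable lborel {0<..<s} h"
        by (rule set_integrable_subset[OF borel_integrable_atLeastAtMost'[OF that]]) auto
      from set_borel_integral_eq_integral(2)[OF this] show ?thesis
        by (simp add: integral_open_interval_real)
    qed
    have "(LBINT u:{0<..<s}. L f u) = (LBINT u:{0<..<s}. g u)"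
      using eq[OF s' s(2)] LBINT_scale[OF s', of 1 "L f"] LBINT_scale[OF s', of 1 g] by simp
    then show ?thesis
      using s continuous_on_subset[OF Lc, of "{0..s}"] continuous_on_subset[OF g, of "{0..s}"]
      by (simp add: *)
  qed simp
  have "((\<lambda>u. integral {0..u} (L f)) has_real_derivative L f t) (at t within {0..T})"
    by (rule integral_has_real_derivative[OF Lc t])
  moreover have "((\<lambda>u. integral {0..u} (L f)) has_real_derivative g t) (at t within {0..T})"
  proof (rule has_field_derivative_transform_within[OF integral_has_real_derivative[of 0 T g t], of 1])
    show "continuous_on {0..T} g" by (rule continuous_on_subset[OF g]) simp
    show "integral {0..u} g = integral {0..u} (L f)" if "u \<in> {0..T}" for u
      using int_eq that by simp
  qed (use t in auto)
  ultimately have "L f t = g t"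
    using T t by (intro has_field_derivative_unique) (auto simp: trivial_limit_within islimpt_Icc)
  then show ?thesis by (simp add: f_def)
qed

end

section \<open>Gaussian spaces\<close>

text \<open>The characteristic function treats the degenerate case \<open>\<sigma> = 0\<close>
  uniformly and passes to limits, which densities do not.\<close>

definition centered_gaussian :: "'a measure \<Rightarrow> real \<Rightarrow> ('a \<Rightarrow> real) \<Rightarrow> bool" where
  "centered_gaussian M \<sigma> Y \<longleftrightarrow> Y \<in> borel_measurable M \<and> 0 \<le> \<sigma> \<and>
     (\<forall>\<theta>. char (distr M borel Y) \<theta> = complex_of_real (exp (- (\<sigma> * \<theta>)\<^sup>2 / 2)))"

context prob_space
begin

lemma char_distr_cmult:
  assumes [measurable]: "Y \<in> borel_measurable M"
  shows "char (distr M borel (\<lambda>\<omega>. c * Y \<omega>)) \<theta> = char (distr M borel Y) (\<theta> * c)"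
  unfolding char_def by (simp add: integral_distr mult_ac)

lemma char_distr_AE_cong:
  assumes [measurable]: "Y \<in> borel_measurable M" "Z \<in> borel_measurable M" and "AE \<omega> in M. Y \<omega> = Z \<omega>"
  shows "distr M borel Y = distr M borel Z"
  using assms(3) by (intro distr_cong_AE) auto

text \<open>The even moments are recorded at the same time because Kolmogorov's criterion needs
  arbitrarily high ones; in this form they also cover the degenerate case.\<close>

lemma gaussian_rv_centered:
  assumes Y: "gaussian_rv M Y" and E: "expectation Y = 0"
  shows "\<exists>\<sigma>. centered_gaussian M \<sigma> Y \<and>
    (\<forall>m. integrable M (\<lambda>\<omega>. Y \<omega> ^ (2 * m)) \<and>
         expectation (\<lambda>\<omega>. Y \<omega> ^ (2 * m)) = fact (2 * m) / (2 ^ m * fact m) * (\<sigma>\<^sup>2) ^ m)"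
proof -
  have [measurable]: "Y \<in> borel_measurable M" using Y by (simp add: gaussian_rv_def)
  consider \<mu> \<sigma> where "\<sigma> > 0" "distributed M lborel Y (\<lambda>x. ennreal (normal_density \<mu> \<sigma> x))"
    | \<mu> where "AE \<omega> in M. Y \<omega> = \<mu>"
    using Y unfolding gaussian_rv_def by blast
  then show ?thesis
  proof cases
    case (1 \<mu> \<sigma>)
    have \<mu>: "\<mu> = 0" using normal_distributed_expectation[OF 1] E by simp
    note D = 1(2)[unfolded \<mu>]
    have "distributed M lborel (\<lambda>x. (Y x - 0) / \<sigma>) std_normal_density"
      using D normal_standard_normal_convert[OF 1(1), of Y 0] by simp
    then have "distr M lborel (\<lambda>x. Y x / \<sigma>) = std_normal_distribution"
      by (simp add: distributed_def)
    moreover have "distr M lborel (\<lambda>x. Y x / \<sigma>) = distr M borel (\<lambda>x. 1 / \<sigma> * Y x)"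
      by (intro distr_cong) auto
    ultimately have d: "distr M borel (\<lambda>x. 1 / \<sigma> * Y x) = std_normal_distribution" by simp
    have "char (distr M borel Y) \<theta> = complex_of_real (exp (- (\<sigma> * \<theta>)\<^sup>2 / 2))" for \<theta>
    proof -
      have "char (distr M borel Y) \<theta> = char (distr M borel Y) (\<sigma> * \<theta> * (1 / \<sigma>))" using 1 by simp
      also have "\<dots> = char std_normal_distribution (\<sigma> * \<theta>)"
        unfolding d[symmetric] by (rule char_distr_cmult[symmetric]) simp
      finally show ?thesis by (simp add: char_std_normal_distribution)
    qed
    moreover have "integrable M (\<lambda>\<omega>. Y \<omega> ^ (2 * m)) \<and>
         expectation (\<lambda>\<omega>. Y \<omega> ^ (2 * m)) = fact (2 * m) / (2 ^ m * fact m) * (\<sigma>\<^sup>2) ^ m" for m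
    proof -
      have h: "has_bochner_integral lborel (\<lambda>x. normal_density 0 \<sigma> x * (x - 0) ^ (2 * m)) (fact (2 * m) / ((2 / \<sigma>\<^sup>2)^m * fact m))"
        by (rule normal_moment_even[OF 1(1)])
      have "fact (2 * m) / ((2 / \<sigma>\<^sup>2)^m * fact m) = fact (2 * m) / (2 ^ m * fact m) * (\<sigma>\<^sup>2) ^ m"
        by (simp add: power_divide)
      with h show ?thesis
        using distributed_integrable[OF D, of "\<lambda>x. x ^ (2 * m)"] distributed_integral[OF D, of "\<lambda>x. x ^ (2 * m)"]
        by (simp add: has_bochner_integral_iff)
    qed
    ultimately show ?thesis using 1 by (intro exI[of _ \<sigma>]) (auto simp: centered_gaussian_def)
  next
    case (2 \<mu>)
    have "expectation Y = expectation (\<lambda>_. \<mu>)" using 2 by (intro integral_cong_AE) auto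
    with E have "\<mu> = 0" by (simp add: prob_space)
    with 2 have Y0: "AE \<omega> in M. Y \<omega> = 0" by simp
    have "char (distr M borel Y) \<theta> = 1" for \<theta>
    proof -
      have "distr M borel Y = distr M borel (\<lambda>_. 0 :: real)" using Y0 by (intro char_distr_AE_cong) auto
      then show ?thesis by (simp add: char_def integral_return)
    qed
    moreover have "integrable M (\<lambda>\<omega>. Y \<omega> ^ (2 * m)) \<and>
         expectation (\<lambda>\<omega>. Y \<omega> ^ (2 * m)) = fact (2 * m) / (2 ^ m * fact m) * (0\<^sup>2) ^ m" for m
    proof -
      have ae: "AE \<omega> in M. Y \<omega> ^ (2 * m) = 0 ^ (2 * m)" using Y0 by eventually_elim simp
      have "integrable M (\<lambda>\<omega>. Y \<omega> ^ (2 * m)) \<longleftrightarrow> integrable M (\<lambda>\<omega>. 0 ^ (2 * m) :: real)"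
        using ae by (intro integrable_cong_AE) auto
      moreover have "expectation (\<lambda>\<omega>. Y \<omega> ^ (2 * m)) = expectation (\<lambda>\<omega>. 0 ^ (2 * m) :: real)"
        using ae by (intro integral_cong_AE) auto
      ultimately show ?thesis by (cases m) (auto simp: prob_space)
    qed
    ultimately show ?thesis by (intro exI[of _ 0]) (auto simp: centered_gaussian_def)
  qed
qed

text \<open>The converse by Levy's uniqueness theorem: the law is compared with that of the constant
  \<open>0\<close> or, after division by \<open>\<sigma>\<close>, with the standard normal
  law.\<close>

lemma centered_gaussian_rv:
  assumes Y: "centered_gaussian M \<sigma> Y"
  shows "gaussian_rv M Y" and "expectation Y = 0"
proof -
  have [measurable]: "Y \<in> borel_measurable M" and \<sigma>: "0 \<le> \<sigma>"
    and c: "\<And>\<theta>. char (distr M borel Y) \<theta> = complex_of_real (exp (- (\<sigma> * \<theta>)\<^sup>2 / 2))"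
    using Y by (auto simp: centered_gaussian_def)
  have "gaussian_rv M Y \<and> expectation Y = 0"
  proof (cases "\<sigma> = 0")
    case True
    have "distr M borel Y = distr M borel (\<lambda>_. 0 :: real)"
    proof (rule Levy_uniqueness)
      show "char (distr M borel Y) = char (distr M borel (\<lambda>_. 0))"
        using c True by (intro ext) (simp add: char_def[of "return _ _"] integral_return)
      show "real_distribution (distr M borel (\<lambda>_. 0 :: real))" by (rule real_distribution_distr) simp
    qed auto
    then have "emeasure (distr M borel Y) {0} = emeasure (distr M borel (\<lambda>_. 0 :: real)) {0}" by simp
    then have "emeasure M {\<omega>\<in>space M. Y \<omega> = 0} = 1"
      by (simp add: emeasure_distr vimage_def Int_def conj_commute emeasure_space_1)
    then have "prob {\<omega>\<in>space M. Y \<omega> = 0} = 1" by (simp add: emeasure_eq_measure)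
    then have ae: "AE \<omega> in M. Y \<omega> = 0" by (subst prob_Collect_eq_1[symmetric]) auto
    then have "expectation Y = expectation (\<lambda>_. 0)" by (intro integral_cong_AE) auto
    then show ?thesis using ae by (auto simp: gaussian_rv_def)
  next
    case False
    with \<sigma> have \<sigma>: "0 < \<sigma>" by simp
    have "distr M borel (\<lambda>\<omega>. 1 / \<sigma> * Y \<omega>) = std_normal_distribution"
    proof (rule Levy_uniqueness)
      show "char (distr M borel (\<lambda>\<omega>. 1 / \<sigma> * Y \<omega>)) = char std_normal_distribution"
        using c \<sigma> by (intro ext) (simp add: char_distr_cmult char_std_normal_distribution del: times_divide_eq_left)
    qed (auto intro: real_dist_normal_dist)
    moreover have "distr M lborel (\<lambda>x. (Y x - 0) / \<sigma>) = distr M borel (\<lambda>x. 1 / \<sigma> * Y x)"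
      by (intro distr_cong) auto
    ultimately have "distributed M lborel (\<lambda>x. (Y x - 0) / \<sigma>) std_normal_density"
      by (simp add: distributed_def)
    then have D: "distributed M lborel Y (normal_density 0 \<sigma>)"
      using normal_standard_normal_convert[OF \<sigma>, of Y 0] by simp
    then show ?thesis using normal_distributed_expectation[OF \<sigma> D] \<sigma>
      by (auto simp: gaussian_rv_def)
  qed
  then show "gaussian_rv M Y" "expectation Y = 0" by auto
qed

definition cgauss :: "('a \<Rightarrow> real) \<Rightarrow> bool" where
  "cgauss Y \<longleftrightarrow> gaussian_rv M Y \<and> expectation Y = 0"

lemma cgauss_iff: "cgauss Y \<longleftrightarrow> (\<exists>\<sigma>. centered_gaussian M \<sigma> Y)"
  using gaussian_rv_centered centered_gaussian_rv unfolding cgauss_def by blast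

lemma cgauss_meas: "cgauss Y \<Longrightarrow> Y \<in> borel_measurable M"
  by (simp add: cgauss_def gaussian_rv_def)

lemma cgauss_moments:
  assumes "cgauss Y"
  shows "integrable M (\<lambda>\<omega>. Y \<omega> ^ (2 * m))"
    and "expectation (\<lambda>\<omega>. Y \<omega> ^ (2 * m)) = fact (2 * m) / (2 ^ m * fact m) * expectation (\<lambda>\<omega>. (Y \<omega>)\<^sup>2) ^ m"
proof -
  obtain \<sigma> where \<sigma>: "\<And>m. integrable M (\<lambda>\<omega>. Y \<omega> ^ (2 * m))"
     "\<And>m. expectation (\<lambda>\<omega>. Y \<omega> ^ (2 * m)) = fact (2 * m) / (2 ^ m * fact m) * (\<sigma>\<^sup>2) ^ m"
    using gaussian_rv_centered assms unfolding cgauss_def by blast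
  show "integrable M (\<lambda>\<omega>. Y \<omega> ^ (2 * m))" by (rule \<sigma>)
  have "expectation (\<lambda>\<omega>. (Y \<omega>)\<^sup>2) = \<sigma>\<^sup>2" using \<sigma>(2)[of 1] by simp
  then show "expectation (\<lambda>\<omega>. Y \<omega> ^ (2 * m)) = fact (2 * m) / (2 ^ m * fact m) * expectation (\<lambda>\<omega>. (Y \<omega>)\<^sup>2) ^ m"
    using \<sigma>(2) by simp
qed

lemma cgauss_square_integrable: "cgauss Y \<Longrightarrow> integrable M (\<lambda>\<omega>. (Y \<omega>)\<^sup>2)"
  using cgauss_moments(1)[of Y 1] by simp

lemma square_integrable_mult:
  fixes Y Z :: "'a \<Rightarrow> real"
  assumes [measurable]: "Y \<in> borel_measurable M" "Z \<in> borel_measurable M"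
    and "integrable M (\<lambda>\<omega>. (Y \<omega>)\<^sup>2)" "integrable M (\<lambda>\<omega>. (Z \<omega>)\<^sup>2)"
  shows "integrable M (\<lambda>\<omega>. Y \<omega> * Z \<omega>)"
proof (rule Bochner_Integration.integrable_bound)
  show "integrable M (\<lambda>\<omega>. (Y \<omega>)\<^sup>2 + (Z \<omega>)\<^sup>2)" using assms by auto
  show "(\<lambda>\<omega>. Y \<omega> * Z \<omega>) \<in> borel_measurable M" by simp
  show "AE \<omega> in M. norm (Y \<omega> * Z \<omega>) \<le> norm ((Y \<omega>)\<^sup>2 + (Z \<omega>)\<^sup>2)"
  proof (rule AE_I2)
    fix \<omega>
    have "0 \<le> (\<bar>Y \<omega>\<bar> - \<bar>Z \<omega>\<bar>)\<^sup>2" by simp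
    then have "2 * (\<bar>Y \<omega>\<bar> * \<bar>Z \<omega>\<bar>) \<le> (Y \<omega>)\<^sup>2 + (Z \<omega>)\<^sup>2" by (simp add: power2_diff)
    then show "norm (Y \<omega> * Z \<omega>) \<le> norm ((Y \<omega>)\<^sup>2 + (Z \<omega>)\<^sup>2)"
    proof -
      have "0 \<le> \<bar>Y \<omega>\<bar> * \<bar>Z \<omega>\<bar>" by simp
      with \<open>2 * _ \<le> _\<close> have "\<bar>Y \<omega>\<bar> * \<bar>Z \<omega>\<bar> \<le> (Y \<omega>)\<^sup>2 + (Z \<omega>)\<^sup>2" by linarith
      then show ?thesis by (simp add: abs_mult)
    qed
  qed
qed

lemma cgauss_AE_cong:
  assumes "cgauss Y" "AE \<omega> in M. Y \<omega> = Z \<omega>" and [measurable]: "Z \<in> borel_measurable M"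
  shows "cgauss Z"
proof -
  have [measurable]: "Y \<in> borel_measurable M" using assms(1) by (rule cgauss_meas)
  have "distr M borel Y = distr M borel Z" using assms by (intro char_distr_AE_cong) auto
  then show ?thesis using assms by (auto simp: cgauss_iff centered_gaussian_def)
qed

text \<open>The characteristic functions converge by dominated convergence, and the limit
  \<open>l\<close> at \<open>\<theta> = 1\<close> governs all other values. The case
  \<open>l = 0\<close> is the only danger: the limiting characteristic function would vanish off
  \<open>0\<close>, against its continuity at \<open>0\<close>, where it equals
  \<open>1\<close>.\<close>

lemma cgauss_limit:
  assumes Z: "\<And>n. cgauss (Z n)" and [measurable]: "Y \<in> borel_measurable M"
    and lim: "AE \<omega> in M. (\<lambda>n. Z n \<omega>) \<longlonglongrightarrow> Y \<omega>"
  shows "cgauss Y"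
proof -
  have [measurable]: "Z n \<in> borel_measurable M" for n using Z by (rule cgauss_meas)
  obtain \<sigma> where \<sigma>: "\<And>n. centered_gaussian M (\<sigma> n) (Z n)" using Z unfolding cgauss_iff by metis
  let ?\<phi> = "char (distr M borel Y)"
  interpret D: real_distribution "distr M borel Y" by (rule real_distribution_distr) simp
  have conv: "(\<lambda>n. complex_of_real (exp (- (\<sigma> n * \<theta>)\<^sup>2 / 2))) \<longlonglongrightarrow> ?\<phi> \<theta>" for \<theta>
  proof -
    have "(\<lambda>n. CLINT \<omega>|M. iexp (\<theta> * Z n \<omega>)) \<longlonglongrightarrow> (CLINT \<omega>|M. iexp (\<theta> * Y \<omega>))"
    proof (rule integral_dominated_convergence[where w="\<lambda>_. 1"])
      show "AE \<omega> in M. (\<lambda>n. iexp (\<theta> * Z n \<omega>)) \<longlonglongrightarrow> iexp (\<theta> * Y \<omega>)"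
        using lim by eventually_elim (auto intro!: tendsto_intros)
    qed auto
    then have "(\<lambda>n. char (distr M borel (Z n)) \<theta>) \<longlonglongrightarrow> ?\<phi> \<theta>"
      by (simp add: char_def integral_distr)
    then show ?thesis using \<sigma> by (simp add: centered_gaussian_def)
  qed
  have re: "(\<lambda>n. exp (- (\<sigma> n * \<theta>)\<^sup>2 / 2)) \<longlonglongrightarrow> Re (?\<phi> \<theta>)" and im: "Im (?\<phi> \<theta>) = 0" for \<theta>
  proof -
    show "(\<lambda>n. exp (- (\<sigma> n * \<theta>)\<^sup>2 / 2)) \<longlonglongrightarrow> Re (?\<phi> \<theta>)" using tendsto_Re[OF conv[of \<theta>]] by simp
    have "(\<lambda>n. 0) \<longlonglongrightarrow> Im (?\<phi> \<theta>)" using tendsto_Im[OF conv[of \<theta>]] by simp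
    then show "Im (?\<phi> \<theta>) = 0" by (simp add: LIMSEQ_const_iff)
  qed
  define l where "l = Re (?\<phi> 1)"
  have l: "(\<lambda>n. exp (- (\<sigma> n)\<^sup>2 / 2)) \<longlonglongrightarrow> l" using re[of 1] by (simp add: l_def)
  have l0: "0 \<le> l" by (rule LIMSEQ_le_const[OF l]) auto
  \<comment> \<open>Expresses the value at \<open>\<theta>\<close> as a power of the value at
    \<open>1\<close>.\<close>
  have ep: "exp (- (\<sigma> n * \<theta>)\<^sup>2 / 2) = exp (- (\<sigma> n)\<^sup>2 / 2) powr (\<theta>\<^sup>2)" for n \<theta>
    by (simp add: powr_def power_mult_distrib)
  have lnz: "l \<noteq> 0"
  proof
    assume "l = 0"
    have z: "?\<phi> \<theta> = 0" if "\<theta> \<noteq> 0" for \<theta>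
    proof -
      have "(\<lambda>n. exp (- (\<sigma> n)\<^sup>2 / 2) powr (\<theta>\<^sup>2)) \<longlonglongrightarrow> 0 powr (\<theta>\<^sup>2)"
        using l \<open>l = 0\<close> that by (intro tendsto_powr' tendsto_const) auto
      then have "Re (?\<phi> \<theta>) = 0" using re[of \<theta>] unfolding ep by (auto intro: LIMSEQ_unique)
      then show ?thesis using im by (simp add: complex_eq_iff)
    qed
    have "(?\<phi> \<longlongrightarrow> ?\<phi> 0) (at 0)" using D.isCont_char[of 0] by (simp add: isCont_def)
    moreover have "(?\<phi> \<longlongrightarrow> 0) (at 0)"
      by (rule tendsto_eventually) (auto simp: eventually_at_filter z)
    ultimately have "?\<phi> 0 = 0" by (rule tendsto_unique[rotated]) simp
    then show False by (simp add: D.char_zero)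
  qed
  with l0 have lpos: "0 < l" by simp
  have "l \<le> 1" by (rule LIMSEQ_le_const2[OF l]) auto
  then have ln: "ln l \<le> 0" using lpos by (simp add: ln_le_zero_iff)
  \<comment> \<open>The limiting variance is read off from \<open>l\<close> and is
    \<open>- 2 * ln l\<close>, which is nonnegative because \<open>l \<le> 1\<close>.\<close>
  have "?\<phi> \<theta> = complex_of_real (exp (- (sqrt (- 2 * ln l) * \<theta>)\<^sup>2 / 2))" for \<theta>
  proof -
    have "(\<lambda>n. exp (- (\<sigma> n)\<^sup>2 / 2) powr (\<theta>\<^sup>2)) \<longlonglongrightarrow> l powr (\<theta>\<^sup>2)"
      using l lpos by (intro tendsto_powr tendsto_const) auto
    then have "Re (?\<phi> \<theta>) = l powr (\<theta>\<^sup>2)" using re[of \<theta>] unfolding ep by (auto intro: LIMSEQ_unique)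
    also have "\<dots> = exp (- (sqrt (- 2 * ln l) * \<theta>)\<^sup>2 / 2)"
      using lpos ln by (simp add: powr_def power_mult_distrib)
    finally show ?thesis using im by (simp add: complex_eq_iff)
  qed
  then have "centered_gaussian M (sqrt (- 2 * ln l)) Y"
    using ln by (auto simp: centered_gaussian_def)
  then show ?thesis unfolding cgauss_iff by blast
qed

text \<open>Closure under linear combinations encodes joint Gaussianity: a family of variables taken
  from such a set is a Gaussian process.\<close>

definition gauss_space :: "('a \<Rightarrow> real) set \<Rightarrow> bool" where
  "gauss_space V \<longleftrightarrow> (\<lambda>_. 0) \<in> V \<and> (\<forall>Y\<in>V. cgauss Y) \<and>
     (\<forall>Y\<in>V. \<forall>Z\<in>V. \<forall>a b. (\<lambda>\<omega>. a * Y \<omega> + b * Z \<omega>) \<in> V)"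

text \<open>One step of almost sure sequential limits. A second limit calls for a second
  application, since no diagonal argument is built in.\<close>

definition lim_closure :: "('a \<Rightarrow> real) set \<Rightarrow> ('a \<Rightarrow> real) set" where
  "lim_closure V = {Y \<in> borel_measurable M. \<exists>Z. (\<forall>n. Z n \<in> V) \<and> (AE \<omega> in M. (\<lambda>n. Z n \<omega>) \<longlonglongrightarrow> Y \<omega>)}"

lemma gauss_space_lim_closure:
  assumes V: "gauss_space V"
  shows "gauss_space (lim_closure V)"
  unfolding gauss_space_def
proof (intro conjI ballI allI)
  show "(\<lambda>_. 0) \<in> lim_closure V"
    using V by (auto simp: lim_closure_def gauss_space_def intro!: exI[of _ "\<lambda>_ _. 0"])
  show "cgauss Y" if "Y \<in> lim_closure V" for Y
    using that V cgauss_limit unfolding lim_closure_def gauss_space_def by blast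
  fix Y Z a b assume "Y \<in> lim_closure V" "Z \<in> lim_closure V"
  then obtain Y' Z' where Y': "\<And>n. Y' n \<in> V" "AE \<omega> in M. (\<lambda>n. Y' n \<omega>) \<longlonglongrightarrow> Y \<omega>" and [measurable]: "Y \<in> borel_measurable M"
    and Z': "\<And>n. Z' n \<in> V" "AE \<omega> in M. (\<lambda>n. Z' n \<omega>) \<longlonglongrightarrow> Z \<omega>" "Z \<in> borel_measurable M"
    unfolding lim_closure_def by blast
  have "AE \<omega> in M. (\<lambda>n. a * Y' n \<omega> + b * Z' n \<omega>) \<longlonglongrightarrow> a * Y \<omega> + b * Z \<omega>"
    using Y'(2) Z'(2) by eventually_elim (auto intro!: tendsto_intros)
  moreover have "(\<lambda>\<omega>. a * Y' n \<omega> + b * Z' n \<omega>) \<in> V" for n using V Y' Z' by (auto simp: gauss_space_def)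
  ultimately show "(\<lambda>\<omega>. a * Y \<omega> + b * Z \<omega>) \<in> lim_closure V"
    using Z'(3) unfolding lim_closure_def by (auto intro!: exI[of _ "\<lambda>n \<omega>. a * Y' n \<omega> + b * Z' n \<omega>"])
qed

lemma lim_closure_superset:
  assumes "gauss_space V" "Y \<in> V"
  shows "Y \<in> lim_closure V"
  using assms by (auto simp: lim_closure_def gauss_space_def intro!: cgauss_meas exI[of _ "\<lambda>_. Y"])

lemma gauss_space_lin:
  "gauss_space V \<Longrightarrow> Y \<in> V \<Longrightarrow> Z \<in> V \<Longrightarrow> (\<lambda>\<omega>. a * Y \<omega> + b * Z \<omega>) \<in> V"
  by (simp add: gauss_space_def)

lemma gauss_space_sum:
  assumes V: "gauss_space V" and "finite F" "\<And>t. t \<in> F \<Longrightarrow> X t \<in> V"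
  shows "(\<lambda>\<omega>. \<Sum>t\<in>F. a t * X t \<omega>) \<in> V"
  using assms(2,3)
proof (induction F rule: finite_induct)
  case empty
  then show ?case using V by (simp add: gauss_space_def)
next
  case (insert t F)
  have "(\<lambda>\<omega>. a t * X t \<omega> + 1 * (\<Sum>t\<in>F. a t * X t \<omega>)) \<in> V"
    by (rule gauss_space_lin[OF V]) (use insert.IH insert.prems in auto)
  then show ?case using insert.hyps by simp
qed

lemma gauss_space_diff:
  assumes "gauss_space V" "Y \<in> V" "Z \<in> V"
  shows "(\<lambda>\<omega>. Y \<omega> - Z \<omega>) \<in> V"
proof -
  have "(\<lambda>\<omega>. 1 * Y \<omega> + (- 1) * Z \<omega>) \<in> V" by (rule gauss_space_lin[OF assms])
  then show ?thesis by simp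
qed

lemma gauss_space_cmult:
  assumes "gauss_space V" "Y \<in> V"
  shows "(\<lambda>\<omega>. c * Y \<omega>) \<in> V"
proof -
  have "(\<lambda>\<omega>. c * Y \<omega> + 0 * Y \<omega>) \<in> V" by (rule gauss_space_lin[OF assms(1,2,2)])
  then show ?thesis by simp
qed

lemma gauss_space_process:
  assumes V: "gauss_space V" and X: "\<And>t. t \<in> I \<Longrightarrow> X t \<in> V"
  shows "gaussian_process M I X" "\<And>t. t \<in> I \<Longrightarrow> expectation (X t) = 0"
proof -
  show "gaussian_process M I X"
    unfolding gaussian_process_def
  proof (intro allI impI)
    fix F and a :: "real \<Rightarrow> real" assume "finite F" "F \<subseteq> I"
    then have "(\<lambda>\<omega>. \<Sum>t\<in>F. a t * X t \<omega>) \<in> V" using X by (intro gauss_space_sum[OF V]) auto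
    then show "gaussian_rv M (\<lambda>\<omega>. \<Sum>t\<in>F. a t * X t \<omega>)" using V by (auto simp: gauss_space_def cgauss_def)
  qed
  show "expectation (X t) = 0" if "t \<in> I" for t using X[OF that] V by (auto simp: gauss_space_def cgauss_def)
qed

lemma cgauss_integrable: "cgauss Y \<Longrightarrow> integrable M Y"
  using square_integrable_mult[of Y "\<lambda>_. 1"] cgauss_square_integrable[of Y] cgauss_meas[of Y] by simp

definition lin_span :: "real set \<Rightarrow> (real \<Rightarrow> 'a \<Rightarrow> real) \<Rightarrow> ('a \<Rightarrow> real) set" where
  "lin_span I X = {Y. \<exists>F a. finite F \<and> F \<subseteq> I \<and> Y = (\<lambda>\<omega>. \<Sum>t\<in>F. a t * X t \<omega>)}"

lemma gauss_space_lin_span: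
  assumes g: "gaussian_process M I X" and E: "\<And>t. t \<in> I \<Longrightarrow> expectation (X t) = 0"
  shows "gauss_space (lin_span I X)" "\<And>t. t \<in> I \<Longrightarrow> X t \<in> lin_span I X"
proof -
  have rv: "gaussian_rv M (\<lambda>\<omega>. \<Sum>t\<in>F. a t * X t \<omega>)" if "finite F" "F \<subseteq> I" for F a
    using g that by (auto simp: gaussian_process_def)
  have cg1: "cgauss (X t)" if "t \<in> I" for t
    using rv[of "{t}" "\<lambda>_. 1"] that E[OF that] by (simp add: cgauss_def)
  have Es: "expectation (\<lambda>\<omega>. \<Sum>t\<in>F. a t * X t \<omega>) = 0" if "finite F" "F \<subseteq> I" for F a
  proof -
    have "expectation (\<lambda>\<omega>. \<Sum>t\<in>F. a t * X t \<omega>) = (\<Sum>t\<in>F. expectation (\<lambda>\<omega>. a t * X t \<omega>))"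
      using that cg1 by (intro Bochner_Integration.integral_sum) (auto intro!: cgauss_integrable)
    also have "\<dots> = 0" using that E by (intro sum.neutral) auto
    finally show ?thesis .
  qed
  show "gauss_space (lin_span I X)"
    unfolding gauss_space_def
  proof (intro conjI ballI allI)
    show "(\<lambda>_. 0) \<in> lin_span I X" by (auto simp: lin_span_def intro!: exI[of _ "{}"])
    show "cgauss Y" if "Y \<in> lin_span I X" for Y
      using that rv Es by (auto simp: lin_span_def cgauss_def)
    fix Y Z a b assume "Y \<in> lin_span I X" "Z \<in> lin_span I X"
    then obtain F G u v where F: "finite F" "F \<subseteq> I" "Y = (\<lambda>\<omega>. \<Sum>t\<in>F. u t * X t \<omega>)"
      and G: "finite G" "G \<subseteq> I" "Z = (\<lambda>\<omega>. \<Sum>t\<in>G. v t * X t \<omega>)"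
      unfolding lin_span_def by blast
    let ?c = "\<lambda>t. a * (if t \<in> F then u t else 0) + b * (if t \<in> G then v t else 0)"
    have "a * Y \<omega> + b * Z \<omega> = (\<Sum>t\<in>F \<union> G. ?c t * X t \<omega>)" for \<omega>
    proof -
      have "Y \<omega> = (\<Sum>t\<in>F \<union> G. (if t \<in> F then u t else 0) * X t \<omega>)"
        unfolding F(3) using F(1) G(1) by (intro sum.mono_neutral_cong_left) auto
      moreover have "Z \<omega> = (\<Sum>t\<in>F \<union> G. (if t \<in> G then v t else 0) * X t \<omega>)"
        unfolding G(3) using F(1) G(1) by (intro sum.mono_neutral_cong_left) auto
      ultimately show ?thesis by (simp add: sum_distrib_left sum.distrib distrib_right mult.assoc)
    qed
    then show "(\<lambda>\<omega>. a * Y \<omega> + b * Z \<omega>) \<in> lin_span I X"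
      using F G unfolding lin_span_def by (intro CollectI exI[of _ "F \<union> G"] exI[of _ ?c]) auto
  qed
  show "X t \<in> lin_span I X" if "t \<in> I" for t
    unfolding lin_span_def using that by (intro CollectI exI[of _ "{t}"] exI[of _ "\<lambda>_. 1"]) auto
qed

text \<open>On a null set the paths are replaced by \<open>0\<close>, and time is clamped to
  \<open>{0..T}\<close>. Every path is then continuous on the whole line, which is what joint
  measurability and integrals along paths are based on.\<close>

lemma continuous_modification:
  assumes X: "centered_gaussian_process M T R X" and T: "0 \<le> T"
  obtains X' where "\<And>t. X' t \<in> borel_measurable M" "\<And>\<omega>. continuous_on UNIV (\<lambda>t. X' t \<omega>)"
    "AE \<omega> in M. \<forall>t\<in>{0..T}. X' t \<omega> = X t \<omega>" "\<And>t \<omega>. X' t \<omega> = X' (max 0 (min T t)) \<omega>"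
    "centered_gaussian_process M T R X'"
proof -
  have cont: "AE \<omega> in M. continuous_on {0..T} (\<lambda>t. X t \<omega>)" using X by (simp add: centered_gaussian_process_def)
  then obtain N where N: "N \<in> sets M" "emeasure M N = 0" "\<And>\<omega>. \<omega> \<in> space M - N \<Longrightarrow> continuous_on {0..T} (\<lambda>t. X t \<omega>)"
    by (elim AE_E) blast
  define E where "E = space M - N"
  have [measurable]: "E \<in> sets M" using N by (auto simp: E_def)
  define X' where "X' t \<omega> = indicator E \<omega> * X (max 0 (min T t)) \<omega>" for t \<omega>
  have gp: "gaussian_process M {0..T} X" and E0: "\<And>t. t \<in> {0..T} \<Longrightarrow> expectation (X t) = 0"
    and cov: "\<And>s t. s \<in> {0..T} \<Longrightarrow> t \<in> {0..T} \<Longrightarrow> (LINT \<omega>|M. X t \<omega> * X s \<omega>) = R t s"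
    using X by (auto simp: centered_gaussian_process_def)
  have V: "gauss_space (lin_span {0..T} X)" "\<And>t. t \<in> {0..T} \<Longrightarrow> X t \<in> lin_span {0..T} X"
    using gauss_space_lin_span[OF gp] E0 by auto
  have Xm: "X t \<in> borel_measurable M" if "t \<in> {0..T}" for t
    using V(1) V(2)[OF that] by (auto simp: gauss_space_def intro: cgauss_meas)
  have clamp: "max 0 (min T t) \<in> {0..T}" for t using T by auto
  have m: "X' t \<in> borel_measurable M" for t
    unfolding X'_def using Xm[OF clamp[of t]] by measurable
  have c: "continuous_on UNIV (\<lambda>t. X' t \<omega>)" for \<omega>
  proof (cases "\<omega> \<in> E")
    case True
    then have "continuous_on {0..T} (\<lambda>t. X t \<omega>)" using N(3) by (simp add: E_def)
    then have "continuous_on UNIV (\<lambda>t. X (max 0 (min T t)) \<omega>)"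
      by (rule continuous_on_compose2) (use clamp in \<open>auto intro!: continuous_intros\<close>)
    then show ?thesis using True by (simp add: X'_def)
  qed (simp add: X'_def)
  have ae: "AE \<omega> in M. \<forall>t\<in>{0..T}. X' t \<omega> = X t \<omega>"
  proof (rule AE_I'[of N])
    show "N \<in> null_sets M" using N by auto
    show "{\<omega> \<in> space M. \<not> (\<forall>t\<in>{0..T}. X' t \<omega> = X t \<omega>)} \<subseteq> N"
      by (auto simp: X'_def E_def split: split_indicator)
  qed
  have "centered_gaussian_process M T R X'"
    unfolding centered_gaussian_process_def
  proof (intro conjI ballI)
    show "gaussian_process M {0..T} X'"
      unfolding gaussian_process_def
    proof (intro allI impI)
      fix F and a :: "real \<Rightarrow> real" assume F: "finite F" "F \<subseteq> {0..T}"
      have "cgauss (\<lambda>\<omega>. \<Sum>t\<in>F. a t * X t \<omega>)"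
      proof -
        have "(\<lambda>\<omega>. \<Sum>t\<in>F. a t * X t \<omega>) \<in> lin_span {0..T} X"
          by (rule gauss_space_sum[OF V(1) F(1)]) (use V(2) F in auto)
        then show ?thesis using V(1) by (simp add: gauss_space_def)
      qed
      then have "cgauss (\<lambda>\<omega>. \<Sum>t\<in>F. a t * X' t \<omega>)"
      proof (rule cgauss_AE_cong)
        show "AE \<omega> in M. (\<Sum>t\<in>F. a t * X t \<omega>) = (\<Sum>t\<in>F. a t * X' t \<omega>)"
          using ae by eventually_elim (use F in \<open>auto intro!: sum.cong\<close>)
        show "(\<lambda>\<omega>. \<Sum>t\<in>F. a t * X' t \<omega>) \<in> borel_measurable M" using m by measurable
      qed
      then show "gaussian_rv M (\<lambda>\<omega>. \<Sum>t\<in>F. a t * X' t \<omega>)" by (simp add: cgauss_def)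
    qed
    show "AE \<omega> in M. continuous_on {0..T} (\<lambda>t. X' t \<omega>)"
      using c by (auto intro: continuous_on_subset)
    show "expectation (X' t) = 0" if "t \<in> {0..T}" for t
    proof -
      have "expectation (X' t) = expectation (X t)"
        using ae that m Xm[OF that] by (intro integral_cong_AE) (auto elim: eventually_mono)
      then show ?thesis using E0[OF that] by simp
    qed
    show "expectation (\<lambda>\<omega>. X' t \<omega> * X' s \<omega>) = R t s" if "s \<in> {0..T}" "t \<in> {0..T}" for s t
    proof -
      have "expectation (\<lambda>\<omega>. X' t \<omega> * X' s \<omega>) = expectation (\<lambda>\<omega>. X t \<omega> * X s \<omega>)"
        using ae that m Xm[OF that(1)] Xm[OF that(2)] by (intro integral_cong_AE) (auto elim: eventually_mono)
      then show ?thesis using cov that by simp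
    qed
  qed
  moreover have "X' t \<omega> = X' (max 0 (min T t)) \<omega>" for t \<omega>
    unfolding X'_def using T by (simp add: max_def min_def)
  ultimately show thesis using that m c ae by blast
qed

end

text \<open>The process is the limit of copies of itself frozen at the largest multiple of
  \<open>1 / real (Suc n)\<close> not exceeding the time; each copy involves only countably many
  times.\<close>

lemma continuous_paths_measurable:
  fixes X :: "real \<Rightarrow> 'a \<Rightarrow> real"
  assumes m: "\<And>t. X t \<in> borel_measurable M" and c: "\<And>\<omega>. continuous_on UNIV (\<lambda>t. X t \<omega>)"
  shows "case_prod X \<in> borel_measurable (borel \<Otimes>\<^sub>M M)"
proof (rule borel_measurable_LIMSEQ_metric)
  fix n :: nat
  have [measurable]: "X t \<in> borel_measurable M" for t by (rule m)
  have "(\<lambda>z. (\<lambda>(i::int) z. X (real_of_int i / real (Suc n)) (snd z)) \<lfloor>real (Suc n) * fst z\<rfloor> z) \<in> borel_measurable (borel \<Otimes>\<^sub>M M)"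
    by (rule measurable_compose_countable) measurable
  then show "(\<lambda>z. X (real_of_int \<lfloor>real (Suc n) * fst z\<rfloor> / real (Suc n)) (snd z)) \<in> borel_measurable (borel \<Otimes>\<^sub>M M)" by simp
next
  fix z :: "real \<times> 'a"
  have "(\<lambda>n. real_of_int \<lfloor>real (Suc n) * fst z\<rfloor> / real (Suc n)) \<longlonglongrightarrow> fst z"
  proof (rule LIMSEQ_I)
    fix r :: real assume "0 < r"
    then obtain N where N: "inverse (real (Suc N)) < r" using reals_Archimedean by blast
    show "\<exists>no. \<forall>n\<ge>no. norm (real_of_int \<lfloor>real (Suc n) * fst z\<rfloor> / real (Suc n) - fst z) < r"
    proof (intro exI allI impI)
      fix n assume n: "N \<le> n"
      have "\<bar>real_of_int \<lfloor>real (Suc n) * fst z\<rfloor> - real (Suc n) * fst z\<bar> \<le> 1" by linarith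
      then have "\<bar>real_of_int \<lfloor>real (Suc n) * fst z\<rfloor> - real (Suc n) * fst z\<bar> / real (Suc n) \<le> 1 / real (Suc n)"
        by (intro divide_right_mono) auto
      moreover have "\<bar>real_of_int \<lfloor>real (Suc n) * fst z\<rfloor> - real (Suc n) * fst z\<bar> / real (Suc n)
         = \<bar>real_of_int \<lfloor>real (Suc n) * fst z\<rfloor> / real (Suc n) - fst z\<bar>"
        by (subst abs_of_pos[of "real (Suc n)", symmetric], simp, subst abs_divide[symmetric]) (simp add: diff_divide_distrib)
      moreover have "1 / real (Suc n) \<le> inverse (real (Suc N))" using n by (simp add: inverse_eq_divide frac_le)
      ultimately show "norm (real_of_int \<lfloor>real (Suc n) * fst z\<rfloor> / real (Suc n) - fst z) < r" using N by simp
    qed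
  qed
  then have "(\<lambda>n. X (real_of_int \<lfloor>real (Suc n) * fst z\<rfloor> / real (Suc n)) (snd z)) \<longlonglongrightarrow> X (fst z) (snd z)"
    by (rule continuous_on_tendsto_compose[OF c]) auto
  then show "(\<lambda>n. X (real_of_int \<lfloor>real (Suc n) * fst z\<rfloor> / real (Suc n)) (snd z)) \<longlonglongrightarrow> case_prod X z"
    by (simp add: case_prod_beta)
qed

section \<open>Paths of Gaussian processes\<close>

text \<open>Chaining: \<open>x\<close> is approached through the left ends \<open>p n x\<close> of
  the dyadic intervals containing it. From one level to the next the point moves by at most one
  dyadic step, so the error from level \<open>n\<close> on is bounded by a geometric series.\<close>

lemma dyadic_hoelder:
  fixes f :: "real \<Rightarrow> real"
  assumes cont: "continuous_on {0..1} f" and \<gamma>: "0 < \<gamma>" and M: "0 \<le> M"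
    and d: "\<And>n k. k < 2 ^ n \<Longrightarrow> \<bar>f (real (Suc k) / 2 ^ n) - f (real k / 2 ^ n)\<bar> \<le> M * (2 powr - \<gamma>) ^ n"
  shows "\<exists>C. \<forall>x\<in>{0..1}. \<forall>y\<in>{0..1}. \<bar>f x - f y\<bar> \<le> C * \<bar>x - y\<bar> powr \<gamma>"
proof -
  define r :: real where "r = 2 powr - \<gamma>"
  have r: "0 < r" "r < 1" using \<gamma> powr_less_mono[of "- \<gamma>" 0 2] by (auto simp: r_def)
  define N where "N n x = nat \<lfloor>2 ^ n * x\<rfloor>" for n and x :: real
  define p where "p n x = real (N n x) / 2 ^ n" for n and x :: real
  have N: "real (N n x) \<le> 2 ^ n * x" "2 ^ n * x < real (N n x) + 1" if "0 \<le> x" for n x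
    using that by (auto simp: N_def of_nat_nat)
  have N_le: "N n x \<le> 2 ^ n" if "0 \<le> x" "x \<le> 1" for n x
  proof -
    have "real (N n x) \<le> 2 ^ n * 1" using N(1)[OF that(1), of n] that by (meson mult_left_mono order_trans zero_le_numeral zero_le_power)
    then have "real (N n x) \<le> real (2 ^ n)" by simp
    then show ?thesis by (simp only: of_nat_le_iff)
  qed
  have p01: "p n x \<in> {0..1}" if "0 \<le> x" "x \<le> 1" for n x
  proof -
    have "real (N n x) \<le> real (2 ^ n)" using N_le[OF that, of n] by (simp only: of_nat_le_iff)
    then show ?thesis by (simp add: p_def)
  qed
  have step: "\<bar>f (p (Suc n) x) - f (p n x)\<bar> \<le> M * r ^ Suc n" if x: "0 \<le> x" "x \<le> 1" for n x
  proof -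
    have "real (2 * N n x) < real (N (Suc n) x) + 1" "real (N (Suc n) x) < real (2 * N n x + 2)"
      using N[OF x(1), of n] N[OF x(1), of "Suc n"] by auto
    then have "2 * N n x < N (Suc n) x + 1" "N (Suc n) x < 2 * N n x + 2" by linarith+
    then consider "N (Suc n) x = 2 * N n x" | "N (Suc n) x = Suc (2 * N n x)" by linarith
    then show ?thesis
    proof cases
      case 1
      then have "p (Suc n) x = p n x" by (simp add: p_def)
      then show ?thesis using M r by simp
    next
      case 2
      have e: "p n x = real (2 * N n x) / 2 ^ Suc n" by (simp add: p_def)
      have "2 * N n x < 2 ^ Suc n" using 2 N_le[OF x, of "Suc n"] by simp
      from d[OF this] show ?thesis unfolding e by (simp only: p_def 2 r_def)
    qed
  qed
  \<comment> \<open>The remaining tail of the geometric series is carried on the left-hand side so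
    that the induction closes.\<close>
  have tele: "\<bar>f (p (n + j) x) - f (p n x)\<bar> + M * r ^ Suc (n + j) / (1 - r) \<le> M * r ^ Suc n / (1 - r)"
    if x: "0 \<le> x" "x \<le> 1" for n j x
  proof (induction j)
    case (Suc j)
    have e: "M * r ^ Suc (n + j) + M * r ^ Suc (n + Suc j) / (1 - r) = M * r ^ Suc (n + j) / (1 - r)"
      using r by (simp add: field_simps)
    have "\<bar>f (p (n + Suc j) x) - f (p n x)\<bar> \<le> \<bar>f (p (n + j) x) - f (p n x)\<bar> + M * r ^ Suc (n + j)"
      using step[OF x, of "n + j"] by simp
    then show ?case using Suc e by simp
  qed simp
  have lim: "(\<lambda>j. p (n + j) x) \<longlonglongrightarrow> x" if x: "0 \<le> x" for n x
  proof (rule LIMSEQ_offset[of _ 0], rule tendsto_sandwich[of "\<lambda>j. x - (1/2) ^ (n + j)" _ _ "\<lambda>j. x"])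
    have b: "x - (1/2) ^ m \<le> p m x" "p m x \<le> x" for m
    proof -
      have "x * 2 ^ m - 1 \<le> real (N m x)" "real (N m x) \<le> x * 2 ^ m" using N[OF x, of m] by (auto simp: mult.commute)
      then have "(x * 2 ^ m - 1) / 2 ^ m \<le> p m x" "p m x \<le> x * 2 ^ m / 2 ^ m"
        unfolding p_def by (intro divide_right_mono; simp)+
      then show "x - (1/2) ^ m \<le> p m x" "p m x \<le> x"
        by (auto simp: diff_divide_distrib power_one_over)
    qed
    show "\<forall>\<^sub>F j in sequentially. x - (1/2) ^ (n + j) \<le> p (n + (j + 0)) x"
      "\<forall>\<^sub>F j in sequentially. p (n + (j + 0)) x \<le> x" using b by auto
    have "(\<lambda>j. x - (1/2) ^ n * (1/2) ^ j) \<longlonglongrightarrow> x - (1/2) ^ n * 0"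
      by (intro tendsto_intros LIMSEQ_power_zero) auto
    then show "(\<lambda>j. x - (1/2) ^ (n + j)) \<longlonglongrightarrow> x" by (simp add: power_add)
  qed auto
  have near: "\<bar>f x - f (p n x)\<bar> \<le> M * r ^ Suc n / (1 - r)" if x: "0 \<le> x" "x \<le> 1" for n x
  proof -
    have "(\<lambda>j. f (p (n + j) x)) \<longlonglongrightarrow> f x"
      using p01[OF x] x by (intro continuous_on_tendsto_compose[OF cont lim]) auto
    then have "(\<lambda>j. \<bar>f (p (n + j) x) - f (p n x)\<bar>) \<longlonglongrightarrow> \<bar>f x - f (p n x)\<bar>" by (intro tendsto_intros)
    moreover have "\<bar>f (p (n + j) x) - f (p n x)\<bar> \<le> M * r ^ Suc n / (1 - r)" for j
    proof -
      have "0 \<le> M * r ^ Suc (n + j) / (1 - r)" using M r by simp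
      then show ?thesis using tele[OF x, of n j] by linarith
    qed
    ultimately show ?thesis by (intro LIMSEQ_le_const2) auto
  qed
  define C where "C = M * (1 + 2 * r / (1 - r)) * 2 powr \<gamma>"
  have main: "\<bar>f x - f y\<bar> \<le> C * \<bar>x - y\<bar> powr \<gamma>" if x: "x \<in> {0..1}" and y: "y \<in> {0..1}" for x y
  proof (cases "x = y")
    case False
    define e where "e = \<bar>x - y\<bar>"
    have e: "0 < e" "e \<le> 1" using False x y by (auto simp: e_def)
    have ex: "\<exists>n. (1/2) ^ Suc n < e"
    proof -
      obtain n where "(1/2 :: real) ^ n < e" using real_arch_pow_inv[of e "1/2"] e by auto
      moreover have "(1/2 :: real) ^ Suc n \<le> (1/2) ^ n" by simp
      ultimately show ?thesis by (meson order_le_less_trans)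
    qed
    \<comment> \<open>The level that matches the distance:
      \<open>(1/2) ^ Suc n < e \<le> (1/2) ^ n\<close>, so that the dyadic intervals of
      \<open>x\<close> and \<open>y\<close> coincide or are neighbours.\<close>
    define n where "n = (LEAST n. (1/2 :: real) ^ Suc n < e)"
    have n1: "(1/2 :: real) ^ Suc n < e" unfolding n_def by (rule LeastI_ex[OF ex])
    have n2: "e \<le> (1/2) ^ n"
    proof (cases n)
      case (Suc m)
      then have "\<not> (1/2 :: real) ^ Suc m < e" using not_less_Least[of m "\<lambda>n. (1/2 :: real) ^ Suc n < e"] n_def by auto
      then show ?thesis using Suc by simp
    qed (use e in simp)
    have "\<bar>2 ^ n * x - 2 ^ n * y\<bar> = 2 ^ n * e" by (simp add: e_def abs_mult right_diff_distrib[symmetric])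
    also have "\<dots> \<le> 2 ^ n * (1/2) ^ n" using n2 by (intro mult_left_mono) auto
    also have "\<dots> = 1" by (simp flip: power_mult_distrib)
    finally have "\<bar>2 ^ n * x - 2 ^ n * y\<bar> \<le> 1" .
    then have "real (N n x) < real (N n y) + 2" "real (N n y) < real (N n x) + 2"
      using N[of x n] N[of y n] x y by auto
    then consider "N n x = N n y" | "N n x = Suc (N n y)" | "N n y = Suc (N n x)" by linarith
    then have mid: "\<bar>f (p n x) - f (p n y)\<bar> \<le> M * r ^ n"
    proof cases
      case 1 then show ?thesis using M r by (simp add: p_def)
    next
      case 2
      have "N n y < 2 ^ n" using 2 N_le[of x n] x by simp
      from d[OF this] show ?thesis unfolding p_def 2 r_def .
    next
      case 3
      have "N n x < 2 ^ n" using 3 N_le[of y n] y by simp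
      from d[OF this] show ?thesis unfolding p_def 3 r_def by (simp add: abs_minus_commute)
    qed
    have "\<bar>f x - f y\<bar> \<le> \<bar>f x - f (p n x)\<bar> + \<bar>f (p n x) - f (p n y)\<bar> + \<bar>f y - f (p n y)\<bar>" by linarith
    also have "\<dots> \<le> M * r ^ Suc n / (1 - r) + M * r ^ n + M * r ^ Suc n / (1 - r)"
      using near[of x n] near[of y n] mid x y by (intro add_mono) auto
    also have "\<dots> = M * (1 + 2 * r / (1 - r)) * r ^ n" by (simp add: algebra_simps)
    also have "\<dots> \<le> M * (1 + 2 * r / (1 - r)) * (2 powr \<gamma> * e powr \<gamma>)"
    proof (rule mult_left_mono)
      \<comment> \<open>The factor \<open>2 powr \<gamma>\<close> pays for the shift from
        \<open>n\<close> to \<open>Suc n\<close> in the lower bound on \<open>e\<close>.\<close>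
      have "r ^ n = 2 powr (- \<gamma> * real n)" unfolding r_def by (simp add: powr_power mult.commute)
      also have "\<dots> = 2 powr \<gamma> * (2 powr (- real (Suc n))) powr \<gamma>"
        by (simp add: powr_powr algebra_simps flip: powr_add)
      also have "2 powr (- real (Suc n)) = (1/2) ^ Suc n" by (simp only: powr_minus powr_realpow zero_less_numeral) (simp add: power_one_over divide_simps)
      also have "2 powr \<gamma> * ((1/2) ^ Suc n) powr \<gamma> \<le> 2 powr \<gamma> * e powr \<gamma>"
        using n1 \<gamma> by (intro mult_left_mono powr_mono2) auto
      finally show "r ^ n \<le> 2 powr \<gamma> * e powr \<gamma>" .
      show "0 \<le> M * (1 + 2 * r / (1 - r))" using M r by (intro mult_nonneg_nonneg add_nonneg_nonneg divide_nonneg_nonneg) auto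
    qed
    finally show ?thesis by (simp add: C_def e_def mult_ac)
  qed simp
  then show ?thesis by blast
qed

context prob_space
begin

text \<open>In place of Borel-Cantelli a single random series \<open>S\<close> collects all dyadic
  increments. It has finite expectation, hence is finite almost surely, and its value bounds every
  increment at once.\<close>

lemma kolmogorov_hoelder:
  fixes X :: "real \<Rightarrow> 'a \<Rightarrow> real"
  assumes T: "0 < T" and m: "0 < m" and \<gamma>: "0 < \<gamma>" and b: "2 * real m * \<gamma> < b" and K: "0 \<le> K"
    and [measurable]: "\<And>t. X t \<in> borel_measurable M"
    and cont: "AE \<omega> in M. continuous_on {0..T} (\<lambda>t. X t \<omega>)"
    and int: "\<And>s t. s \<in> {0..T} \<Longrightarrow> t \<in> {0..T} \<Longrightarrow> integrable M (\<lambda>\<omega>. (X t \<omega> - X s \<omega>) ^ (2 * m))"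
    and mom: "\<And>s t. s \<in> {0..T} \<Longrightarrow> t \<in> {0..T} \<Longrightarrow> expectation (\<lambda>\<omega>. (X t \<omega> - X s \<omega>) ^ (2 * m)) \<le> K * \<bar>t - s\<bar> powr (1 + b)"
  shows "AE \<omega> in M. \<exists>C. \<forall>x\<in>{0..T}. \<forall>y\<in>{0..T}. \<bar>X x \<omega> - X y \<omega>\<bar> \<le> C * \<bar>x - y\<bar> powr \<gamma>"
proof -
  define \<Delta> where "\<Delta> n k \<omega> = X (T * (real (Suc k) / 2 ^ n)) \<omega> - X (T * (real k / 2 ^ n)) \<omega>" for n k \<omega>
  have [measurable]: "\<Delta> n k \<in> borel_measurable M" for n k unfolding \<Delta>_def by measurable
  define q :: real where "q = 2 powr (2 * real m * \<gamma>)"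
  have q: "0 < q" by (simp add: q_def)
  have pt: "T * (real k / 2 ^ n) \<in> {0..T}" if "k \<le> 2 ^ n" for k n :: nat
  proof -
    have "real k \<le> real (2 ^ n)" using that by (simp only: of_nat_le_iff)
    then have "real k / 2 ^ n \<le> 1" by simp
    then show ?thesis using T scale_le[of T T "real k / 2 ^ n"] by simp
  qed
  have mom': "(\<integral>\<^sup>+\<omega>. ennreal (\<Delta> n k \<omega> ^ (2 * m)) \<partial>M) \<le> ennreal (K * (T / 2 ^ n) powr (1 + b))" if k: "k < 2 ^ n" for n k
  proof -
    have pts: "T * (real k / 2 ^ n) \<in> {0..T}" "T * (real (Suc k) / 2 ^ n) \<in> {0..T}"
      using pt[of k n] pt[of "Suc k" n] k by simp_all
    have "(\<integral>\<^sup>+\<omega>. ennreal (\<Delta> n k \<omega> ^ (2 * m)) \<partial>M) = ennreal (expectation (\<lambda>\<omega>. \<Delta> n k \<omega> ^ (2 * m)))"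
      unfolding \<Delta>_def by (rule nn_integral_eq_integral[OF int[OF pts]]) auto
    also have "\<dots> \<le> ennreal (K * \<bar>T * (real (Suc k) / 2 ^ n) - T * (real k / 2 ^ n)\<bar> powr (1 + b))"
      unfolding \<Delta>_def by (rule ennreal_leI[OF mom[OF pts]])
    also have "\<bar>T * (real (Suc k) / 2 ^ n) - T * (real k / 2 ^ n)\<bar> = T / 2 ^ n"
      using T by (simp add: field_simps)
    finally show ?thesis .
  qed
  define S where "S \<omega> = (\<Sum>n. ennreal (q ^ n) * (\<Sum>k<2 ^ n. ennreal (\<Delta> n k \<omega> ^ (2 * m))))" for \<omega>
  have [measurable]: "S \<in> borel_measurable M" unfolding S_def by measurable
  define \<rho> where "\<rho> = q * 2 powr (- b)"
  have \<rho>: "0 < \<rho>" "\<rho> < 1"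
  proof -
    have "\<rho> = 2 powr (2 * real m * \<gamma> - b)" by (simp add: \<rho>_def q_def flip: powr_add)
    then show "0 < \<rho>" "\<rho> < 1" using b powr_less_mono[of "2 * real m * \<gamma> - b" 0 2] by auto
  qed
  have "(\<integral>\<^sup>+\<omega>. S \<omega> \<partial>M) = (\<Sum>n. ennreal (q ^ n) * (\<Sum>k<2 ^ n. (\<integral>\<^sup>+\<omega>. ennreal (\<Delta> n k \<omega> ^ (2 * m)) \<partial>M)))"
    unfolding S_def by (simp add: nn_integral_suminf nn_integral_cmult nn_integral_sum del: sum_ennreal)
  also have "\<dots> \<le> (\<Sum>n. ennreal (K * T powr (1 + b) * \<rho> ^ n))"
  proof (rule suminf_le)
    fix n :: nat
    have "(\<Sum>k<2 ^ n. (\<integral>\<^sup>+\<omega>. ennreal (\<Delta> n k \<omega> ^ (2 * m)) \<partial>M)) \<le> (\<Sum>k<2 ^ n :: nat. ennreal (K * (T / 2 ^ n) powr (1 + b)))"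
      by (rule sum_mono) (simp add: mom')
    also have "\<dots> = ennreal (2 ^ n * (K * (T / 2 ^ n) powr (1 + b)))"
      using K by (simp add: ennreal_mult ennreal_power[symmetric])
    finally have "ennreal (q ^ n) * (\<Sum>k<2 ^ n. (\<integral>\<^sup>+\<omega>. ennreal (\<Delta> n k \<omega> ^ (2 * m)) \<partial>M)) \<le> ennreal (q ^ n) * ennreal (2 ^ n * (K * (T / 2 ^ n) powr (1 + b)))"
      by (rule mult_left_mono) simp
    also have "\<dots> = ennreal (K * T powr (1 + b) * \<rho> ^ n)"
    proof -
      have "(T / 2 ^ n) powr (1 + b) = T powr (1 + b) * ((2 ^ n) powr (- 1) * (2 ^ n) powr (- b))"
        using T by (simp add: powr_divide powr_minus_divide powr_add)
      moreover have "(2 ^ n :: real) powr (- b) = (2 powr (- b)) ^ n"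
        by (simp add: powr_realpow[symmetric] powr_powr mult.commute)
      ultimately have "q ^ n * (2 ^ n * (K * (T / 2 ^ n) powr (1 + b))) = K * T powr (1 + b) * \<rho> ^ n * ((2 ^ n) powr (- 1) * 2 ^ n)"
        by (simp only: \<rho>_def power_mult_distrib) (simp only: mult_ac)
      then have "q ^ n * (2 ^ n * (K * (T / 2 ^ n) powr (1 + b))) = K * T powr (1 + b) * \<rho> ^ n"
        by (simp add: powr_minus)
      then show ?thesis unfolding ennreal_mult'[OF zero_le_power[OF less_imp_le[OF q]], symmetric] by (simp only:)
    qed
    finally show "ennreal (q ^ n) * (\<Sum>k<2 ^ n. (\<integral>\<^sup>+\<omega>. ennreal (\<Delta> n k \<omega> ^ (2 * m)) \<partial>M)) \<le> ennreal (K * T powr (1 + b) * \<rho> ^ n)" .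
  qed auto
  also have "\<dots> = ennreal (\<Sum>n. K * T powr (1 + b) * \<rho> ^ n)"
    using K \<rho> by (intro suminf_ennreal2) (auto intro!: summable_mult summable_geometric)
  also have "\<dots> < \<infinity>" by simp
  finally have "AE \<omega> in M. S \<omega> \<noteq> \<infinity>" by (intro nn_integral_PInf_AE) auto
  then show ?thesis using cont
  proof eventually_elim
    case (elim \<omega>)
    \<comment> \<open>At least \<open>1\<close>, so that \<open>s \<le> s ^ (2 * m)\<close> and
      roots of order \<open>2 * m\<close> can be taken at the end.\<close>
    define s where "s = max 1 (enn2real (S \<omega>))"
    have s: "1 \<le> s" "S \<omega> \<le> ennreal s"
    proof -
      show "1 \<le> s" by (simp add: s_def)
      have "S \<omega> = ennreal (enn2real (S \<omega>))" using elim(1) by (simp add: less_top)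
      also have "\<dots> \<le> ennreal s" by (rule ennreal_leI) (simp add: s_def)
      finally show "S \<omega> \<le> ennreal s" .
    qed
    have "\<exists>C. \<forall>x\<in>{0..1}. \<forall>y\<in>{0..1}. \<bar>X (T * x) \<omega> - X (T * y) \<omega>\<bar> \<le> C * \<bar>x - y\<bar> powr \<gamma>"
    proof (rule dyadic_hoelder[OF _ \<gamma>, where M=s])
      show "continuous_on {0..1} (\<lambda>x. X (T * x) \<omega>)"
        by (rule continuous_on_compose2[OF elim(2)]) (use T in \<open>auto intro!: continuous_intros scale_le\<close>)
      fix n k :: nat assume k: "k < 2 ^ n"
      have "ennreal (q ^ n * \<Delta> n k \<omega> ^ (2 * m)) = ennreal (q ^ n) * ennreal (\<Delta> n k \<omega> ^ (2 * m))"
        using q by (intro ennreal_mult) auto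
      also have "\<dots> \<le> ennreal (q ^ n) * (\<Sum>k<2 ^ n. ennreal (\<Delta> n k \<omega> ^ (2 * m)))"
        using k by (intro mult_left_mono member_le_sum) auto
      also have "\<dots> \<le> S \<omega>"
        using sum_le_suminf[of "\<lambda>n. ennreal (q ^ n) * (\<Sum>k<2 ^ n. ennreal (\<Delta> n k \<omega> ^ (2 * m)))" "{n}"]
        by (simp add: S_def)
      also note s(2)
      finally have "q ^ n * \<Delta> n k \<omega> ^ (2 * m) \<le> s" using s(1) by (simp add: ennreal_le_iff)
      also have "s \<le> s ^ (2 * m)" using s(1) m by (simp add: self_le_power)
      finally have 1: "q ^ n * \<Delta> n k \<omega> ^ (2 * m) \<le> s ^ (2 * m)" .
      have "(2 powr - \<gamma>) ^ (2 * m) * q = 1"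
      proof -
        have "(2 powr - \<gamma>) ^ (2 * m) = (2 :: real) powr (- \<gamma> * real (2 * m))" by (simp add: powr_power mult_ac)
        then show ?thesis by (simp add: q_def flip: powr_add)
      qed
      then have "((2 powr - \<gamma>) ^ (2 * m) * q) ^ n = 1" by simp
      then have 2: "((2 powr - \<gamma>) ^ n) ^ (2 * m) * q ^ n = 1"
        by (simp only: power_mult_distrib power_mult[symmetric] mult.commute)
      have "\<bar>\<Delta> n k \<omega>\<bar> ^ (2 * m) = \<Delta> n k \<omega> ^ (2 * m)" by (simp add: power_even_abs)
      also have "\<dots> = ((2 powr - \<gamma>) ^ n) ^ (2 * m) * (q ^ n * \<Delta> n k \<omega> ^ (2 * m))"
        using 2 by (simp only: mult.assoc[symmetric] mult_1)
      also have "\<dots> \<le> ((2 powr - \<gamma>) ^ n) ^ (2 * m) * s ^ (2 * m)"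
        using 1 by (intro mult_left_mono) auto
      also have "\<dots> = (s * (2 powr - \<gamma>) ^ n) ^ (2 * m)" by (simp only: power_mult_distrib mult.commute)
      finally have "\<bar>\<Delta> n k \<omega>\<bar> ^ (2 * m) \<le> (s * (2 powr - \<gamma>) ^ n) ^ (2 * m)" .
      then have "\<bar>\<Delta> n k \<omega>\<bar> \<le> s * (2 powr - \<gamma>) ^ n"
        using s m by (subst (asm) power_mono_iff) auto
      then show "\<bar>X (T * (real (Suc k) / 2 ^ n)) \<omega> - X (T * (real k / 2 ^ n)) \<omega>\<bar> \<le> s * (2 powr - \<gamma>) ^ n"
        by (simp add: \<Delta>_def)
    qed (use s in auto)
    then obtain C where C: "\<And>x y. x \<in> {0..1} \<Longrightarrow> y \<in> {0..1} \<Longrightarrow> \<bar>X (T * x) \<omega> - X (T * y) \<omega>\<bar> \<le> C * \<bar>x - y\<bar> powr \<gamma>" by blast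
    show ?case
    proof (intro exI ballI)
      fix x y assume xy: "x \<in> {0..T}" "y \<in> {0..T}"
      have "\<bar>X (T * (x / T)) \<omega> - X (T * (y / T)) \<omega>\<bar> \<le> C * \<bar>x / T - y / T\<bar> powr \<gamma>"
        using xy T by (intro C) auto
      also have "\<bar>x / T - y / T\<bar> powr \<gamma> = \<bar>x - y\<bar> powr \<gamma> / T powr \<gamma>"
        using T by (simp add: powr_divide flip: diff_divide_distrib)
      finally show "\<bar>X x \<omega> - X y \<omega>\<bar> \<le> (C / T powr \<gamma>) * \<bar>x - y\<bar> powr \<gamma>" using T by simp
    qed
  qed
qed

text \<open>The moment of order \<open>2 * m\<close> of a Gaussian increment is a multiple of
  \<open>\<bar>t - s\<bar> powr (2 * real m * h)\<close>. Kolmogorov's criterion therefore reaches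
  the orders below \<open>h - 1 / (2 * real m)\<close>, and \<open>m\<close> is chosen large enough
  for \<open>\<gamma>\<close>.\<close>

lemma gaussian_hoelder:
  fixes X :: "real \<Rightarrow> 'a \<Rightarrow> real"
  assumes T: "0 < T" and V: "gauss_space V" and X: "\<And>t. X t \<in> V"
    and cont: "\<And>\<omega>. continuous_on UNIV (\<lambda>t. X t \<omega>)"
    and var: "\<And>s t. s \<in> {0..T} \<Longrightarrow> t \<in> {0..T} \<Longrightarrow> expectation (\<lambda>\<omega>. (X t \<omega> - X s \<omega>)\<^sup>2) = \<bar>t - s\<bar> powr (2 * h)"
    and \<gamma>: "0 < \<gamma>" "\<gamma> < h"
  shows "AE \<omega> in M. \<exists>C. \<forall>x\<in>{0..T}. \<forall>y\<in>{0..T}. \<bar>X x \<omega> - X y \<omega>\<bar> \<le> C * \<bar>x - y\<bar> powr \<gamma>"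
proof -
  obtain m where m: "1 / (2 * (h - \<gamma>)) < real m" using reals_Archimedean2 by blast
  then have m': "1 < 2 * real m * (h - \<gamma>)" using \<gamma> by (simp add: divide_less_eq mult_ac)
  have "0 < m" using m' by (cases m) auto
  have d: "cgauss (\<lambda>\<omega>. X t \<omega> - X s \<omega>)" for s t
    using gauss_space_diff[OF V X X] V by (simp add: gauss_space_def)
  have Xm: "X t \<in> borel_measurable M" for t using V X by (auto simp: gauss_space_def intro: cgauss_meas)
  show ?thesis
  proof (rule kolmogorov_hoelder[OF T \<open>0 < m\<close> \<gamma>(1), where b="2 * real m * h - 1" and K="fact (2 * m) / (2 ^ m * fact m)"])
    show "2 * real m * \<gamma> < 2 * real m * h - 1" using m' by (simp add: algebra_simps)
    show "AE \<omega> in M. continuous_on {0..T} (\<lambda>t. X t \<omega>)" using cont by (auto intro: continuous_on_subset)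
    show "integrable M (\<lambda>\<omega>. (X t \<omega> - X s \<omega>) ^ (2 * m))" for s t by (rule cgauss_moments(1)[OF d])
    show "expectation (\<lambda>\<omega>. (X t \<omega> - X s \<omega>) ^ (2 * m)) \<le> fact (2 * m) / (2 ^ m * fact m) * \<bar>t - s\<bar> powr (1 + (2 * real m * h - 1))"
      if "s \<in> {0..T}" "t \<in> {0..T}" for s t
    proof -
      have "(\<bar>t - s\<bar> powr (2 * h)) ^ m = \<bar>t - s\<bar> powr (2 * real m * h)"
      proof (cases "t = s")
        case False
        then show ?thesis by (simp add: powr_realpow[symmetric] powr_powr mult_ac)
      qed (use \<open>0 < m\<close> in auto)
      then show ?thesis using cgauss_moments(2)[OF d, of t s m] var[OF that] by simp
    qed
  qed (use Xm in auto)
qed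

text \<open>The function \<open>m\<close> bounds \<open>W x\<close> in mean square. Only the product
  \<open>v x * m x\<close> has to be integrable, which admits a weight \<open>v\<close> that is
  singular where \<open>W x\<close> is small.\<close>

lemma expectation_LINT:
  fixes W :: "real \<Rightarrow> 'a \<Rightarrow> real" and v m :: "real \<Rightarrow> real"
  assumes [measurable]: "case_prod W \<in> borel_measurable (borel \<Otimes>\<^sub>M M)" "v \<in> borel_measurable borel"
      "Z \<in> borel_measurable M" "m \<in> borel_measurable borel" "S \<in> sets borel"
    and Z2: "integrable M (\<lambda>\<omega>. (Z \<omega>)\<^sup>2)"
    and W2: "\<And>x. x \<in> S \<Longrightarrow> integrable M (\<lambda>\<omega>. (W x \<omega>)\<^sup>2)"
    and m: "\<And>x. x \<in> S \<Longrightarrow> 0 < m x" "\<And>x. x \<in> S \<Longrightarrow> expectation (\<lambda>\<omega>. (W x \<omega>)\<^sup>2) \<le> (m x)\<^sup>2"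
    and vm: "set_integrable lborel S (\<lambda>x. v x * m x)"
  shows "integrable M (\<lambda>\<omega>. (LBINT x:S. v x * W x \<omega>) * Z \<omega>)"
    and "expectation (\<lambda>\<omega>. (LBINT x:S. v x * W x \<omega>) * Z \<omega>) = (LBINT x:S. v x * expectation (\<lambda>\<omega>. W x \<omega> * Z \<omega>))"
proof -
  interpret P: pair_sigma_finite lborel M by (intro pair_sigma_finite.intro sigma_finite_measure_axioms lborel.sigma_finite_measure_axioms)
  define F where "F = (\<lambda>(x, \<omega>). indicator S x * v x * W x \<omega> * Z \<omega>)"
  have [measurable]: "F \<in> borel_measurable (lborel \<Otimes>\<^sub>M M)" unfolding F_def by measurable
  define EZ where "EZ = expectation (\<lambda>\<omega>. (Z \<omega>)\<^sup>2)"
  have EZ0: "0 \<le> EZ" unfolding EZ_def by simp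
  have bound: "(\<integral>\<^sup>+\<omega>. ennreal \<bar>W x \<omega> * Z \<omega>\<bar> \<partial>M) \<le> ennreal (m x * ((1 + EZ) / 2))" if x: "x \<in> S" for x
  proof -
    have [measurable]: "W x \<in> borel_measurable M" by measurable
    \<comment> \<open>An arithmetic-geometric mean inequality in place of Cauchy-Schwarz; balancing
      it with \<open>m x\<close> makes the resulting bound linear in \<open>m x\<close>.\<close>
    have am: "\<bar>W x \<omega> * Z \<omega>\<bar> \<le> ((W x \<omega>)\<^sup>2 / m x + m x * (Z \<omega>)\<^sup>2) / 2" for \<omega>
    proof -
      have "0 \<le> (\<bar>W x \<omega>\<bar> - m x * \<bar>Z \<omega>\<bar>)\<^sup>2" by simp
      also have "\<dots> = (W x \<omega>)\<^sup>2 + m x * (m x * (Z \<omega>)\<^sup>2) - 2 * m x * (\<bar>W x \<omega>\<bar> * \<bar>Z \<omega>\<bar>)"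
        by (simp only: power2_diff power_mult_distrib power2_abs) (simp add: power2_eq_square)
      finally have "2 * m x * (\<bar>W x \<omega>\<bar> * \<bar>Z \<omega>\<bar>) \<le> (W x \<omega>)\<^sup>2 + m x * (m x * (Z \<omega>)\<^sup>2)" by simp
      then show ?thesis using m(1)[OF x] by (simp add: abs_mult field_simps)
    qed
    have i: "integrable M (\<lambda>\<omega>. ((W x \<omega>)\<^sup>2 / m x + m x * (Z \<omega>)\<^sup>2) / 2)" using W2[OF x] Z2 by auto
    have "(\<integral>\<^sup>+\<omega>. ennreal \<bar>W x \<omega> * Z \<omega>\<bar> \<partial>M) \<le> (\<integral>\<^sup>+\<omega>. ennreal (((W x \<omega>)\<^sup>2 / m x + m x * (Z \<omega>)\<^sup>2) / 2) \<partial>M)"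
      using am by (intro nn_integral_mono ennreal_leI) auto
    also have "\<dots> = ennreal (expectation (\<lambda>\<omega>. ((W x \<omega>)\<^sup>2 / m x + m x * (Z \<omega>)\<^sup>2) / 2))"
      using m(1)[OF x] by (intro nn_integral_eq_integral[OF i]) auto
    also have "expectation (\<lambda>\<omega>. ((W x \<omega>)\<^sup>2 / m x + m x * (Z \<omega>)\<^sup>2) / 2) = (expectation (\<lambda>\<omega>. (W x \<omega>)\<^sup>2) / m x + m x * EZ) / 2"
      using W2[OF x] Z2 by (simp add: EZ_def)
    also have "\<dots> \<le> ((m x)\<^sup>2 / m x + m x * EZ) / 2"
      using m[OF x] by (intro divide_right_mono add_right_mono) auto
    also have "\<dots> = m x * ((1 + EZ) / 2)" using m(1)[OF x] by (simp add: power2_eq_square algebra_simps)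
    finally show ?thesis by (simp add: ennreal_leI)
  qed
  have int: "integrable (lborel \<Otimes>\<^sub>M M) F"
  proof (rule integrableI_bounded)
    have "(\<integral>\<^sup>+ z. ennreal (norm (F z)) \<partial>(lborel \<Otimes>\<^sub>M M)) = (\<integral>\<^sup>+ x. \<integral>\<^sup>+ \<omega>. ennreal (norm (F (x, \<omega>))) \<partial>M \<partial>lborel)"
      by (subst nn_integral_fst[symmetric]) auto
    also have "\<dots> \<le> (\<integral>\<^sup>+ x. ennreal ((1 + EZ) / 2) * ennreal (norm (indicator S x *\<^sub>R (v x * m x))) \<partial>lborel)"
    proof (rule nn_integral_mono)
      fix x :: real
      show "(\<integral>\<^sup>+ \<omega>. ennreal (norm (F (x, \<omega>))) \<partial>M) \<le> ennreal ((1 + EZ) / 2) * ennreal (norm (indicator S x *\<^sub>R (v x * m x)))"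
      proof (cases "x \<in> S")
        case True
        have [measurable]: "W x \<in> borel_measurable M" by measurable
        have "(\<integral>\<^sup>+ \<omega>. ennreal (norm (F (x, \<omega>))) \<partial>M) = (\<integral>\<^sup>+ \<omega>. ennreal \<bar>v x\<bar> * ennreal \<bar>W x \<omega> * Z \<omega>\<bar> \<partial>M)"
          using True by (intro nn_integral_cong) (simp add: F_def abs_mult mult.assoc flip: ennreal_mult')
        also have "\<dots> = ennreal \<bar>v x\<bar> * (\<integral>\<^sup>+ \<omega>. ennreal \<bar>W x \<omega> * Z \<omega>\<bar> \<partial>M)" by (rule nn_integral_cmult) simp
        also have "\<dots> \<le> ennreal \<bar>v x\<bar> * ennreal (m x * ((1 + EZ) / 2))" by (intro mult_left_mono bound True) auto
        also have "\<dots> = ennreal (\<bar>v x\<bar> * (m x * ((1 + EZ) / 2)))" by (rule ennreal_mult'[symmetric]) simp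
        also have "\<bar>v x\<bar> * (m x * ((1 + EZ) / 2)) = (1 + EZ) / 2 * norm (indicator S x *\<^sub>R (v x * m x))"
          using True m(1)[OF True] by (simp add: abs_mult)
        also have "ennreal \<dots> = ennreal ((1 + EZ) / 2) * ennreal (norm (indicator S x *\<^sub>R (v x * m x)))"
          using EZ0 by (intro ennreal_mult') auto
        finally show ?thesis .
      qed (simp add: F_def)
    qed
    also have "\<dots> = ennreal ((1 + EZ) / 2) * (\<integral>\<^sup>+ x. ennreal (norm (indicator S x *\<^sub>R (v x * m x))) \<partial>lborel)"
      by (rule nn_integral_cmult) simp
    also have "\<dots> < \<infinity>"
      using vm by (auto simp: set_integrable_def integrable_iff_bounded ennreal_mult_less_top)
    finally show "(\<integral>\<^sup>+ z. ennreal (norm (F z)) \<partial>(lborel \<Otimes>\<^sub>M M)) < \<infinity>" .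
  qed simp
  have int': "integrable (lborel \<Otimes>\<^sub>M M) (case_prod (\<lambda>x \<omega>. F (x, \<omega>)))" using int by simp
  have 1: "(LINT x|lborel. F (x, \<omega>)) = (LBINT x:S. v x * W x \<omega>) * Z \<omega>" for \<omega>
    unfolding F_def set_lebesgue_integral_def by (subst integral_mult_left_zero[symmetric]) (simp add: mult.assoc)
  have 2: "(LINT \<omega>|M. F (x, \<omega>)) = indicator S x *\<^sub>R (v x * expectation (\<lambda>\<omega>. W x \<omega> * Z \<omega>))" for x
    unfolding F_def by (simp add: mult.assoc)
  show "integrable M (\<lambda>\<omega>. (LBINT x:S. v x * W x \<omega>) * Z \<omega>)"
    using P.integrable_snd[OF int'] unfolding 1 .
  show "expectation (\<lambda>\<omega>. (LBINT x:S. v x * W x \<omega>) * Z \<omega>) = (LBINT x:S. v x * expectation (\<lambda>\<omega>. W x \<omega> * Z \<omega>))"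
    using P.Fubini_integral[OF int'] unfolding 1 2 by (simp add: set_lebesgue_integral_def)
qed

text \<open>Only the argument of \<open>X\<close> is discretized, not the weight: with the grid
  points \<open>P n x\<close> the integral becomes a finite linear combination whose coefficients
  are integrals of \<open>v\<close> over the cells. This allows an unbounded \<open>v\<close>, since
  convergence uses only that the paths are continuous and bounded on compact sets.\<close>

lemma gauss_space_LINT:
  fixes X :: "real \<Rightarrow> 'a \<Rightarrow> real" and v :: "real \<Rightarrow> real"
  assumes V: "gauss_space V" and X: "\<And>t. X t \<in> V" and c: "\<And>\<omega>. continuous_on UNIV (\<lambda>t. X t \<omega>)"
    and v: "set_integrable lborel {0<..<1} v" and [measurable]: "v \<in> borel_measurable borel"
  shows "(\<lambda>\<omega>. LBINT x:{0<..<1}. v x * X (t * x) \<omega>) \<in> lim_closure V"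
proof -
  have Xm: "X t \<in> borel_measurable M" for t using V X by (auto simp: gauss_space_def intro: cgauss_meas)
  note [measurable] = continuous_paths_measurable[OF Xm c]
  define P where "P n x = t * (real_of_int \<lfloor>real (Suc n) * x\<rfloor> / real (Suc n))" for n :: nat and x :: real
  define Z where "Z n \<omega> = (LBINT x:{0<..<1}. v x * X (P n x) \<omega>)" for n \<omega>
  have Z: "Z n \<in> V" for n
  proof -
    define w where "w j = (LBINT x:{0<..<1}. v x * indicator {x. \<lfloor>real (Suc n) * x\<rfloor> = int j} x)" for j
    have i: "set_integrable lborel {0<..<1} (\<lambda>x. v x * indicator {x. \<lfloor>real (Suc n) * x\<rfloor> = int j} x)" for j
      by (rule set_integrable_mult_bounded[OF v, where C=1]) (auto simp: set_borel_measurable_def split: split_indicator)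
    have "Z n \<omega> = (\<Sum>j\<le>n. w j * X (t * (real j / real (Suc n))) \<omega>)" for \<omega>
    proof -
      have "Z n \<omega> = (LBINT x:{0<..<1}. \<Sum>j\<le>n. v x * indicator {x. \<lfloor>real (Suc n) * x\<rfloor> = int j} x * X (t * (real j / real (Suc n))) \<omega>)"
        unfolding Z_def
      proof (rule set_lebesgue_integral_cong)
        show "\<forall>x. x \<in> {0<..<1} \<longrightarrow> v x * X (P n x) \<omega> = (\<Sum>j\<le>n. v x * indicator {x. \<lfloor>real (Suc n) * x\<rfloor> = int j} x * X (t * (real j / real (Suc n))) \<omega>)"
        proof (intro allI impI)
          fix x :: real assume x: "x \<in> {0<..<1}"
          define j where "j = nat \<lfloor>real (Suc n) * x\<rfloor>"
          have fl: "0 \<le> \<lfloor>real (Suc n) * x\<rfloor>" using x by simp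
          have "real (Suc n) * x < real (Suc n) * 1" using x by (intro mult_strict_left_mono) auto
          then have "\<lfloor>real (Suc n) * x\<rfloor> < int (Suc n)" by (simp add: floor_less_iff)
          then have j: "j \<le> n" "\<lfloor>real (Suc n) * x\<rfloor> = int j" using fl by (auto simp: j_def)
          have "(\<Sum>i\<le>n. v x * indicator {x. \<lfloor>real (Suc n) * x\<rfloor> = int i} x * X (t * (real i / real (Suc n))) \<omega>)
            = (\<Sum>i\<in>{j}. v x * indicator {x. \<lfloor>real (Suc n) * x\<rfloor> = int i} x * X (t * (real i / real (Suc n))) \<omega>)"
            using j by (intro sum.mono_neutral_right) auto
          then show "v x * X (P n x) \<omega> = (\<Sum>j\<le>n. v x * indicator {x. \<lfloor>real (Suc n) * x\<rfloor> = int j} x * X (t * (real j / real (Suc n))) \<omega>)"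
            using j by (simp add: P_def)
        qed
      qed simp
      also have "\<dots> = (\<Sum>j\<le>n. LBINT x:{0<..<1}. v x * indicator {x. \<lfloor>real (Suc n) * x\<rfloor> = int j} x * X (t * (real j / real (Suc n))) \<omega>)"
        unfolding set_lebesgue_integral_def scaleR_sum_right
      proof (rule Bochner_Integration.integral_sum)
        fix j assume "j \<in> {..n}"
        show "integrable lborel (\<lambda>x. indicator {0<..<1} x *\<^sub>R (v x * indicator {x. \<lfloor>real (Suc n) * x\<rfloor> = int j} x * X (t * (real j / real (Suc n))) \<omega>))"
          using set_integrable_mult_left[of "X (t * (real j / real (Suc n))) \<omega>", OF i[of j]] unfolding set_integrable_def by simp
      qed
      also have "\<dots> = (\<Sum>j\<le>n. w j * X (t * (real j / real (Suc n))) \<omega>)" by (simp add: w_def)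
      finally show ?thesis .
    qed
    then have "Z n = (\<lambda>\<omega>. \<Sum>j\<le>n. w j * X (t * (real j / real (Suc n))) \<omega>)" by (rule ext)
    also have "\<dots> \<in> V" by (rule gauss_space_sum[OF V]) (auto intro: X)
    finally show ?thesis .
  qed
  have "(\<lambda>n. Z n \<omega>) \<longlonglongrightarrow> (LBINT x:{0<..<1}. v x * X (t * x) \<omega>)" for \<omega>
  proof -
    have "bounded ((\<lambda>s. X s \<omega>) ` cball 0 \<bar>t\<bar>)"
      by (intro compact_imp_bounded compact_continuous_image continuous_on_subset[OF c]) auto
    then obtain B where B: "\<And>s. \<bar>s\<bar> \<le> \<bar>t\<bar> \<Longrightarrow> \<bar>X s \<omega>\<bar> \<le> B" by (force simp: bounded_iff)
    have Pb: "\<bar>P n x\<bar> \<le> \<bar>t\<bar>" if "x \<in> {0<..<1}" for n x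
    proof -
      have "0 \<le> real_of_int \<lfloor>real (Suc n) * x\<rfloor>" using that by simp
      moreover have "real_of_int \<lfloor>real (Suc n) * x\<rfloor> \<le> real (Suc n)"
      proof -
        have "real_of_int \<lfloor>real (Suc n) * x\<rfloor> \<le> real (Suc n) * x" by simp
        also have "\<dots> \<le> real (Suc n) * 1" using that by (intro mult_left_mono) auto
        finally show ?thesis by simp
      qed
      ultimately have "\<bar>real_of_int \<lfloor>real (Suc n) * x\<rfloor> / real (Suc n)\<bar> \<le> 1" by simp
      then show ?thesis unfolding P_def abs_mult by (metis abs_ge_zero mult.right_neutral mult_left_mono)
    qed
    have Pl: "(\<lambda>n. P n x) \<longlonglongrightarrow> t * x" for x
    proof -
      have "(\<lambda>n. real_of_int \<lfloor>real (Suc n) * x\<rfloor> / real (Suc n)) \<longlonglongrightarrow> x"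
      proof (rule tendsto_sandwich[of "\<lambda>n. x - inverse (real (Suc n))" _ _ "\<lambda>_. x"])
        show "\<forall>\<^sub>F n in sequentially. x - inverse (real (Suc n)) \<le> real_of_int \<lfloor>real (Suc n) * x\<rfloor> / real (Suc n)"
        proof (rule always_eventually, rule allI)
          fix n
          have "real (Suc n) * x - 1 \<le> real_of_int \<lfloor>real (Suc n) * x\<rfloor>" by linarith
          then have "(real (Suc n) * x - 1) / real (Suc n) \<le> real_of_int \<lfloor>real (Suc n) * x\<rfloor> / real (Suc n)"
            by (intro divide_right_mono) auto
          then show "x - inverse (real (Suc n)) \<le> real_of_int \<lfloor>real (Suc n) * x\<rfloor> / real (Suc n)"
            by (simp add: diff_divide_distrib inverse_eq_divide)
        qed
        show "\<forall>\<^sub>F n in sequentially. real_of_int \<lfloor>real (Suc n) * x\<rfloor> / real (Suc n) \<le> x"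
        proof (rule always_eventually, rule allI)
          fix n
          have "real_of_int \<lfloor>real (Suc n) * x\<rfloor> / real (Suc n) \<le> real (Suc n) * x / real (Suc n)"
            by (intro divide_right_mono) auto
          then show "real_of_int \<lfloor>real (Suc n) * x\<rfloor> / real (Suc n) \<le> x" by simp
        qed
        show "(\<lambda>n. x - inverse (real (Suc n))) \<longlonglongrightarrow> x"
          using tendsto_diff[OF tendsto_const[of x] LIMSEQ_inverse_real_of_nat] by simp
      qed simp
      then show ?thesis unfolding P_def by (intro tendsto_intros)
    qed
    show ?thesis
      unfolding Z_def set_lebesgue_integral_def
    proof (rule integral_dominated_convergence[where w="\<lambda>x. B * \<bar>indicator {0<..<1} x *\<^sub>R v x\<bar>"])
      show "integrable lborel (\<lambda>x. B * \<bar>indicator {0<..<1} x *\<^sub>R v x\<bar>)"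
        using v unfolding set_integrable_def by (intro integrable_mult_right integrable_abs)
      have [measurable]: "(\<lambda>s. X s \<omega>) \<in> borel_measurable borel" using c by (rule borel_measurable_continuous_onI)
      have [measurable]: "P n \<in> borel_measurable borel" for n unfolding P_def by measurable
      show "(\<lambda>x. indicator {0<..<1} x *\<^sub>R (v x * X (t * x) \<omega>)) \<in> borel_measurable lborel"
        "\<And>n. (\<lambda>x. indicator {0<..<1} x *\<^sub>R (v x * X (P n x) \<omega>)) \<in> borel_measurable lborel" by measurable
      show "AE x in lborel. (\<lambda>n. indicator {0<..<1} x *\<^sub>R (v x * X (P n x) \<omega>)) \<longlonglongrightarrow> indicator {0<..<1} x *\<^sub>R (v x * X (t * x) \<omega>)"
        by (intro AE_I2 tendsto_intros continuous_on_tendsto_compose[OF c Pl]) auto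
      show "AE x in lborel. norm (indicator {0<..<1} x *\<^sub>R (v x * X (P n x) \<omega>)) \<le> B * \<bar>indicator {0<..<1} x *\<^sub>R v x\<bar>" for n
        using B[OF Pb] by (intro AE_I2) (auto simp: abs_mult mult.commute[of B] intro!: mult_left_mono split: split_indicator)
    qed
  qed
  moreover have "(\<lambda>\<omega>. LBINT x:{0<..<1}. v x * X (t * x) \<omega>) \<in> borel_measurable M"
    unfolding set_lebesgue_integral_def by measurable
  ultimately show ?thesis using Z by (auto simp: lim_closure_def)
qed

end

section \<open>Wiener integrals\<close>

text \<open>\<open>f\<close> may be unbounded at both ends, as the kernel can be. The ends are cut
  off at the cost of a small part of the square integral; in between \<open>f\<close> is uniformly
  continuous and is replaced by its values at the right ends of the cells.\<close>

lemma step_approximation: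
  fixes f :: "real \<Rightarrow> real"
  assumes t: "0 < t" and cont: "continuous_on {0<..<t} f"
    and [measurable]: "f \<in> borel_measurable borel"
    and fin: "(\<integral>\<^sup>+x\<in>{0<..<t}. ennreal ((f x)\<^sup>2) \<partial>lborel) < \<infinity>" and e: "0 < e"
  shows "\<exists>(k::nat) (a::nat \<Rightarrow> real) (u::nat \<Rightarrow> real). (\<forall>i\<le>k. u i \<in> {0..t}) \<and> (\<forall>i<k. u i \<le> u (Suc i)) \<and>
     (\<integral>\<^sup>+x\<in>{0..t}. ennreal ((f x - (\<Sum>i<k. a i * indicator {u i<..u (Suc i)} x))\<^sup>2) \<partial>lborel) \<le> ennreal e"
proof -
  \<comment> \<open>The offset \<open>3\<close> keeps the middle interval nonempty for every
    \<open>n\<close>.\<close>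
  define out where "out n = {0<..<t} - {t / real (n + 3)<..t - t / real (n + 3)}" for n :: nat
  have [measurable]: "out n \<in> sets borel" for n unfolding out_def by measurable
  have "(\<lambda>n. \<integral>\<^sup>+x\<in>out n. ennreal ((f x)\<^sup>2) \<partial>lborel) \<longlonglongrightarrow> (\<integral>\<^sup>+x. 0 \<partial>(lborel :: real measure))"
  proof (rule nn_integral_dominated_convergence[where w="\<lambda>x. ennreal ((f x)\<^sup>2) * indicator {0<..<t} x"])
    show "(\<integral>\<^sup>+x\<in>{0<..<t}. ennreal ((f x)\<^sup>2) \<partial>lborel) < \<infinity>" by (rule fin)
    show "AE x in lborel. ennreal ((f x)\<^sup>2) * indicator (out n) x \<le> ennreal ((f x)\<^sup>2) * indicator {0<..<t} x" for n
      by (intro AE_I2) (auto simp: out_def split: split_indicator)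
    show "AE x in lborel. (\<lambda>n. ennreal ((f x)\<^sup>2) * indicator (out n) x) \<longlonglongrightarrow> 0"
    proof (rule AE_I2)
      fix x
      show "(\<lambda>n. ennreal ((f x)\<^sup>2) * indicator (out n) x) \<longlonglongrightarrow> 0"
      proof (cases "x \<in> {0<..<t}")
        case True
        define m where "m = min x (t - x)"
        have m: "0 < m" using True by (simp add: m_def)
        have "(\<lambda>n. t * inverse (real (Suc (n + 2)))) \<longlonglongrightarrow> t * 0"
          by (intro tendsto_intros LIMSEQ_ignore_initial_segment[OF LIMSEQ_inverse_real_of_nat, of 2])
        then have "\<forall>\<^sub>F n in sequentially. t * inverse (real (Suc (n + 2))) < m"
          using m by (auto dest: order_tendstoD(2))
        then have "\<forall>\<^sub>F n in sequentially. ennreal ((f x)\<^sup>2) * indicator (out n) x = 0"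
        proof eventually_elim
          case (elim n)
          have "t / real (n + 3) = t * inverse (real (Suc (n + 2)))" by (simp add: divide_inverse add_ac)
          then have "t / real (n + 3) < m" using elim by simp
          then show ?case using True by (auto simp: out_def m_def split: split_indicator)
        qed
        then show ?thesis by (rule tendsto_eventually)
      next
        case False
        then have "x \<notin> out n" for n by (auto simp: out_def)
        then show ?thesis by simp
      qed
    qed
  qed auto
  then have "\<forall>\<^sub>F n in sequentially. (\<integral>\<^sup>+x\<in>out n. ennreal ((f x)\<^sup>2) \<partial>lborel) < ennreal (e / 2)"
    using e by (intro order_tendstoD(2)) auto
  then obtain n where n: "(\<integral>\<^sup>+x\<in>out n. ennreal ((f x)\<^sup>2) \<partial>lborel) < ennreal (e / 2)"
    using eventually_happens' by force
  define p q where "p = t / real (n + 3)" and "q = t - t / real (n + 3)"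
  have "t / real (n + 3) \<le> t / 3" using t by (intro divide_left_mono) auto
  then have pq: "0 < p" "p < q" "q < t" using t by (auto simp: p_def q_def)
  \<comment> \<open>Chosen such that the square of \<open>d\<close> times the length
    \<open>t\<close> is \<open>e / 2\<close>.\<close>
  define d where "d = sqrt (e / (2 * t))"
  have d: "0 < d" using e t by (simp add: d_def)
  have "uniformly_continuous_on {p..q} f"
    using pq by (intro compact_uniformly_continuous continuous_on_subset[OF cont]) auto
  then obtain \<eta> where \<eta>: "0 < \<eta>" "\<And>x y. x \<in> {p..q} \<Longrightarrow> y \<in> {p..q} \<Longrightarrow> \<bar>y - x\<bar> < \<eta> \<Longrightarrow> \<bar>f y - f x\<bar> < d"
    using d unfolding uniformly_continuous_on_def dist_real_def by metis
  obtain N :: nat where N: "(q - p) / \<eta> < real N" using reals_Archimedean2 by blast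
  have N0: "0 < N" using N pq \<eta> by (cases N) (auto simp: divide_less_0_iff)
  define h where "h = (q - p) / real N"
  have h: "0 < h" "h < \<eta>" using N N0 pq \<eta> by (auto simp: h_def field_simps)
  define u where "u i = p + real i * h" for i :: nat
  have uN: "u N = q" using N0 by (simp add: u_def h_def)
  have u_mono: "u i \<le> u j" if "i \<le> j" for i j using that h by (simp add: u_def mult_right_mono)
  have u_in: "u i \<in> {p..q}" if "i \<le> N" for i
    using u_mono[OF that] u_mono[of 0 i] uN by (simp add: u_def)
  define a where "a i = f (u (Suc i))" for i
  define st where "st x = (\<Sum>i<N. a i * indicator {u i<..u (Suc i)} x)" for x :: real
  have [measurable]: "st \<in> borel_measurable borel" unfolding st_def by measurable
  have st_in: "\<bar>f x - st x\<bar> \<le> d" if x: "p < x" "x \<le> q" for x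
  proof -
    \<comment> \<open>The cells are open on the left and closed on the right, hence the ceiling
      minus one.\<close>
    define i where "i = nat (\<lceil>(x - p) / h\<rceil> - 1)"
    have "0 < (x - p) / h" using x h by simp
    then have c: "1 \<le> \<lceil>(x - p) / h\<rceil>" by linarith
    have ri: "real i = real_of_int \<lceil>(x - p) / h\<rceil> - 1" using c by (simp add: i_def of_nat_nat)
    have "real i < (x - p) / h" "(x - p) / h \<le> real i + 1" unfolding ri by linarith+
    then have i: "u i < x" "x \<le> u (Suc i)" using h by (auto simp: u_def field_simps)
    have "i < N"
    proof (rule ccontr)
      assume "\<not> i < N"
      then have "u N \<le> u i" by (intro u_mono) simp
      then show False using i x uN by simp
    qed
    have "st x = (\<Sum>j\<in>{i}. a j * indicator {u j<..u (Suc j)} x)"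
      unfolding st_def
    proof (rule sum.mono_neutral_right)
      show "\<forall>j\<in>{..<N} - {i}. a j * indicator {u j<..u (Suc j)} x = 0"
      proof
        fix j assume "j \<in> {..<N} - {i}"
        then consider "Suc j \<le> i" | "Suc i \<le> j" by force
        then have "x \<notin> {u j<..u (Suc j)}"
        proof cases
          case 1 then show ?thesis using u_mono[OF 1] i by simp
        next
          case 2 then show ?thesis using u_mono[OF 2] i by simp
        qed
        then show "a j * indicator {u j<..u (Suc j)} x = 0" by simp
      qed
    qed (use \<open>i < N\<close> in auto)
    then have "st x = f (u (Suc i))" using i by (simp add: a_def)
    moreover have "\<bar>f x - f (u (Suc i))\<bar> < d"
    proof (rule \<eta>(2))
      show "u (Suc i) \<in> {p..q}" using \<open>i < N\<close> by (intro u_in) simp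
      have "u (Suc i) = u i + h" by (simp add: u_def algebra_simps)
      then show "\<bar>x - u (Suc i)\<bar> < \<eta>" using i h by simp
    qed (use x in auto)
    ultimately show ?thesis by simp
  qed
  have st_out: "st x = 0" if "x \<le> p \<or> q < x" for x
    unfolding st_def
  proof (rule sum.neutral, rule ballI)
    fix i assume "i \<in> {..<N}"
    then have "u i \<in> {p..q}" "u (Suc i) \<in> {p..q}" using u_in[of i] u_in[of "Suc i"] by simp_all
    then show "a i * indicator {u i<..u (Suc i)} x = 0" using that by auto
  qed
  have "(\<integral>\<^sup>+x\<in>{0..t}. ennreal ((f x - st x)\<^sup>2) \<partial>lborel) = (\<integral>\<^sup>+x\<in>{0<..<t}. ennreal ((f x - st x)\<^sup>2) \<partial>lborel)"
    by (rule nn_integral_Icc_Ioo)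
  also have "\<dots> \<le> (\<integral>\<^sup>+x. ennreal ((f x)\<^sup>2) * indicator (out n) x + ennreal (d\<^sup>2) * indicator {0..t} x \<partial>lborel)"
  proof (rule nn_integral_mono)
    fix x
    show "ennreal ((f x - st x)\<^sup>2) * indicator {0<..<t} x \<le> ennreal ((f x)\<^sup>2) * indicator (out n) x + ennreal (d\<^sup>2) * indicator {0..t} x"
    proof (cases "p < x \<and> x \<le> q")
      case True
      have "(f x - st x)\<^sup>2 \<le> d\<^sup>2" using st_in[of x] True d by (simp add: abs_le_square_iff[symmetric])
      then have "ennreal ((f x - st x)\<^sup>2) \<le> ennreal (d\<^sup>2)" by (rule ennreal_leI)
      then have "ennreal ((f x - st x)\<^sup>2) \<le> ennreal ((f x)\<^sup>2) * indicator (out n) x + ennreal (d\<^sup>2)"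
        by (rule order_trans) simp
      then show ?thesis by (auto split: split_indicator)
    next
      case False
      then have "st x = 0" by (intro st_out) auto
      then show ?thesis using False by (auto simp: out_def p_def q_def split: split_indicator)
    qed
  qed
  also have "\<dots> = (\<integral>\<^sup>+x\<in>out n. ennreal ((f x)\<^sup>2) \<partial>lborel) + ennreal (d\<^sup>2) * emeasure lborel {0..t}"
    by (subst nn_integral_add) (auto simp: nn_integral_cmult)
  also have "\<dots> \<le> ennreal (e / 2) + ennreal (d\<^sup>2) * ennreal t"
    using n t by (intro add_mono) (auto simp: emeasure_lborel_Icc)
  also have "\<dots> = ennreal e"
  proof -
    have "d\<^sup>2 * t = e / 2" using e t by (simp add: d_def field_simps)
    then show ?thesis using e t by (simp add: ennreal_mult'[symmetric] ennreal_plus[symmetric] del: ennreal_plus)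
  qed
  finally have "(\<integral>\<^sup>+x\<in>{0..t}. ennreal ((f x - st x)\<^sup>2) \<partial>lborel) \<le> ennreal e" .
  moreover have "\<forall>i\<le>N. u i \<in> {0..t}" using u_in pq by fastforce
  moreover have "\<forall>i<N. u i \<le> u (Suc i)" using u_mono by simp
  ultimately show ?thesis unfolding st_def by blast
qed

text \<open>Young's inequality with a free parameter replaces the triangle inequality of the norm
  and avoids square roots of extended numbers.\<close>

lemma nn_square_split:
  fixes f g :: "'a \<Rightarrow> real"
  assumes [measurable]: "f \<in> borel_measurable M" "g \<in> borel_measurable M" and e: "0 < e"
  shows "(\<integral>\<^sup>+x. ennreal ((f x)\<^sup>2) \<partial>M) \<le> ennreal (1 + e) * (\<integral>\<^sup>+x. ennreal ((g x)\<^sup>2) \<partial>M) +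
     ennreal (1 + 1 / e) * (\<integral>\<^sup>+x. ennreal ((f x - g x)\<^sup>2) \<partial>M)"
proof -
  have "(\<integral>\<^sup>+x. ennreal ((f x)\<^sup>2) \<partial>M) \<le> (\<integral>\<^sup>+x. ennreal (1 + e) * ennreal ((g x)\<^sup>2) + ennreal (1 + 1 / e) * ennreal ((f x - g x)\<^sup>2) \<partial>M)"
  proof (rule nn_integral_mono)
    fix x
    let ?d = "f x - g x"
    have yg: "(b + d)\<^sup>2 \<le> (1 + e) * b\<^sup>2 + (1 + 1 / e) * d\<^sup>2" for b d :: real
    proof -
      have "0 \<le> (e * b - d)\<^sup>2 / e" using e by simp
      also have "(e * b - d)\<^sup>2 / e = e * b\<^sup>2 - 2 * b * d + d\<^sup>2 / e"
        using e by (simp add: power2_diff power2_eq_square field_simps)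
      finally show ?thesis by (simp add: power2_eq_square algebra_simps)
    qed
    have "(f x)\<^sup>2 \<le> (1 + e) * (g x)\<^sup>2 + (1 + 1 / e) * ?d\<^sup>2"
      using yg[of "g x" ?d] by simp
    then have "ennreal ((f x)\<^sup>2) \<le> ennreal ((1 + e) * (g x)\<^sup>2 + (1 + 1 / e) * ?d\<^sup>2)" by (rule ennreal_leI)
    also have "\<dots> = ennreal (1 + e) * ennreal ((g x)\<^sup>2) + ennreal (1 + 1 / e) * ennreal (?d\<^sup>2)"
      using e by (subst ennreal_plus) (auto simp: ennreal_mult simp del: ennreal_plus)
    finally show "ennreal ((f x)\<^sup>2) \<le> ennreal (1 + e) * ennreal ((g x)\<^sup>2) + ennreal (1 + 1 / e) * ennreal (?d\<^sup>2)" .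
  qed
  also have "\<dots> = ennreal (1 + e) * (\<integral>\<^sup>+x. ennreal ((g x)\<^sup>2) \<partial>M) + ennreal (1 + 1 / e) * (\<integral>\<^sup>+x. ennreal ((f x - g x)\<^sup>2) \<partial>M)"
    by (simp add: nn_integral_add nn_integral_cmult)
  finally show ?thesis .
qed

text \<open>Two applications of \<open>nn_square_split\<close>, first \<open>f\<close> against
  \<open>g n\<close>, then \<open>Z n\<close> against \<open>Y\<close>. The error terms vanish with
  \<open>n\<close>, after which \<open>e\<close> tends to \<open>0\<close>. The inequality is
  one-sided so that it can be used with the two roles interchanged.\<close>

lemma L2_norm_le_of_approx:
  fixes f :: "'a \<Rightarrow> real" and Y :: "'b \<Rightarrow> real"
  assumes [measurable]: "f \<in> borel_measurable M" "\<And>n. g n \<in> borel_measurable M" "Y \<in> borel_measurable N" "\<And>n. Z n \<in> borel_measurable N"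
    and eq: "\<And>n. (\<integral>\<^sup>+x. ennreal ((g n x)\<^sup>2) \<partial>M) = (\<integral>\<^sup>+x. ennreal ((Z n x)\<^sup>2) \<partial>N)"
    and f: "(\<lambda>n. \<integral>\<^sup>+x. ennreal ((f x - g n x)\<^sup>2) \<partial>M) \<longlonglongrightarrow> 0"
    and Y: "(\<lambda>n. \<integral>\<^sup>+x. ennreal ((Y x - Z n x)\<^sup>2) \<partial>N) \<longlonglongrightarrow> 0"
    and fin: "(\<integral>\<^sup>+x. ennreal ((Y x)\<^sup>2) \<partial>N) < \<infinity>"
  shows "(\<integral>\<^sup>+x. ennreal ((f x)\<^sup>2) \<partial>M) \<le> (\<integral>\<^sup>+x. ennreal ((Y x)\<^sup>2) \<partial>N)"
proof -
  let ?A = "\<integral>\<^sup>+x. ennreal ((f x)\<^sup>2) \<partial>M" and ?B = "\<integral>\<^sup>+x. ennreal ((Y x)\<^sup>2) \<partial>N"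
  have step: "?A \<le> ennreal ((1 + e) * (1 + e)) * ?B" if e: "0 < e" for e :: real
  proof -
    let ?c = "ennreal (1 + 1 / e)" and ?b = "ennreal (1 + e)"
    have le: "?A \<le> ?b * (?b * ?B + ?c * (\<integral>\<^sup>+x. ennreal ((Y x - Z n x)\<^sup>2) \<partial>N)) + ?c * (\<integral>\<^sup>+x. ennreal ((f x - g n x)\<^sup>2) \<partial>M)" for n
    proof -
      have "?A \<le> ?b * (\<integral>\<^sup>+x. ennreal ((g n x)\<^sup>2) \<partial>M) + ?c * (\<integral>\<^sup>+x. ennreal ((f x - g n x)\<^sup>2) \<partial>M)"
        by (rule nn_square_split[OF _ _ e]) auto
      also have "(\<integral>\<^sup>+x. ennreal ((g n x)\<^sup>2) \<partial>M) \<le> ?b * ?B + ?c * (\<integral>\<^sup>+x. ennreal ((Y x - Z n x)\<^sup>2) \<partial>N)"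
        unfolding eq using nn_square_split[OF _ _ e, of "Z n" N Y] by (simp add: power2_commute)
      finally show ?thesis by (simp add: add_mono mult_left_mono)
    qed
    have "(\<lambda>n. ?b * (?b * ?B + ?c * (\<integral>\<^sup>+x. ennreal ((Y x - Z n x)\<^sup>2) \<partial>N)) + ?c * (\<integral>\<^sup>+x. ennreal ((f x - g n x)\<^sup>2) \<partial>M))
       \<longlonglongrightarrow> ?b * (?b * ?B + ?c * 0) + ?c * 0"
      by (intro tendsto_add ennreal_tendsto_cmult tendsto_const f Y) auto
    then have "?A \<le> ?b * (?b * ?B + ?c * 0) + ?c * 0"
      using le by (intro LIMSEQ_le_const) auto
    also have "\<dots> = ennreal ((1 + e) * (1 + e)) * ?B" using e by (simp add: ennreal_mult mult.assoc)
    finally show ?thesis .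
  qed
  obtain r where r: "?B = ennreal r" "0 \<le> r" using fin by (cases ?B) auto
  have "(\<lambda>n. ennreal ((1 + inverse (real (Suc n))) * (1 + inverse (real (Suc n))) * r)) \<longlonglongrightarrow> ennreal ((1 + 0) * (1 + 0) * r)"
    by (intro tendsto_ennrealI tendsto_intros LIMSEQ_inverse_real_of_nat)
  moreover have "?A \<le> ennreal ((1 + inverse (real (Suc n))) * (1 + inverse (real (Suc n))) * r)" for n
    using step[of "inverse (real (Suc n))"] r by (simp add: ennreal_mult)
  ultimately have "?A \<le> ennreal ((1 + 0) * (1 + 0) * r)" by (intro LIMSEQ_le_const) auto
  then show ?thesis using r by simp
qed

context prob_space
begin

text \<open>Holds if \<open>Y\<close> and \<open>Z\<close> are the Wiener integrals of \<open>\<phi>\<close> and \<open>\<psi>\<close> over \<open>S\<close>.\<close>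

definition pairing_eq :: "real set \<Rightarrow> ('a \<Rightarrow> real) \<Rightarrow> (real \<Rightarrow> real) \<Rightarrow> ('a \<Rightarrow> real) \<Rightarrow> (real \<Rightarrow> real) \<Rightarrow> bool" where
  "pairing_eq S Y \<phi> Z \<psi> \<longleftrightarrow> integrable M (\<lambda>\<omega>. Y \<omega> * Z \<omega>) \<and> set_integrable lborel S (\<lambda>x. \<phi> x * \<psi> x) \<and>
     expectation (\<lambda>\<omega>. Y \<omega> * Z \<omega>) = (LBINT x:S. \<phi> x * \<psi> x)"

lemma pairing_eq_sym: "pairing_eq S Y \<phi> Z \<psi> \<Longrightarrow> pairing_eq S Z \<psi> Y \<phi>"
  by (simp add: pairing_eq_def mult.commute)

lemma pairing_eq_diff:
  assumes "pairing_eq S Y1 \<phi>1 Z \<psi>" "pairing_eq S Y2 \<phi>2 Z \<psi>"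
  shows "pairing_eq S (\<lambda>\<omega>. Y1 \<omega> - Y2 \<omega>) (\<lambda>x. \<phi>1 x - \<phi>2 x) Z \<psi>"
  using assms by (auto simp: pairing_eq_def left_diff_distrib set_integral_diff)

lemma pairing_eq_cmult: "pairing_eq S Y \<phi> Z \<psi> \<Longrightarrow> pairing_eq S (\<lambda>\<omega>. c * Y \<omega>) (\<lambda>x. c * \<phi> x) Z \<psi>"
  by (auto simp: pairing_eq_def mult.assoc)

lemma pairing_eq_sum:
  assumes "finite F" "\<And>i. i \<in> F \<Longrightarrow> pairing_eq S (Y i) (\<phi> i) Z \<psi>"
  shows "pairing_eq S (\<lambda>\<omega>. \<Sum>i\<in>F. Y i \<omega>) (\<lambda>x. \<Sum>i\<in>F. \<phi> i x) Z \<psi>"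
  using assms
proof (induction F rule: finite_induct)
  case empty
  then show ?case by (simp add: pairing_eq_def set_integrable_def set_lebesgue_integral_def)
next
  case (insert i F)
  then have "pairing_eq S (Y i) (\<phi> i) Z \<psi>" "pairing_eq S (\<lambda>\<omega>. \<Sum>i\<in>F. Y i \<omega>) (\<lambda>x. \<Sum>i\<in>F. \<phi> i x) Z \<psi>" by auto
  then show ?case using insert.hyps by (simp add: pairing_eq_def distrib_right set_integral_add)
qed

lemma pairing_eq_square:
  assumes "pairing_eq S Y \<phi> Y \<phi>"
  shows "(\<integral>\<^sup>+\<omega>. ennreal ((Y \<omega>)\<^sup>2) \<partial>M) = (\<integral>\<^sup>+x\<in>S. ennreal ((\<phi> x)\<^sup>2) \<partial>lborel)"
proof -
  have "(\<integral>\<^sup>+\<omega>. ennreal ((Y \<omega>)\<^sup>2) \<partial>M) = ennreal (expectation (\<lambda>\<omega>. (Y \<omega>)\<^sup>2))"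
    using assms by (intro nn_integral_eq_integral) (auto simp: pairing_eq_def power2_eq_square)
  also have "\<dots> = ennreal (LBINT x:S. (\<phi> x)\<^sup>2)" using assms by (simp add: pairing_eq_def power2_eq_square)
  also have "\<dots> = (\<integral>\<^sup>+x\<in>S. ennreal ((\<phi> x)\<^sup>2) \<partial>lborel)"
    using assms by (intro nn_set_integral_eq[symmetric]) (auto simp: pairing_eq_def power2_eq_square)
  finally show ?thesis .
qed

text \<open>The covariance \<open>min s s'\<close> is the length of the intersection of the two
  intervals; the pairings of elementary integrals follow from this case by linearity.\<close>

lemma brownian_pairing_eq:
  assumes sq: "\<And>s. s \<in> {0..t} \<Longrightarrow> B s \<in> borel_measurable M" "\<And>s. s \<in> {0..t} \<Longrightarrow> integrable M (\<lambda>\<omega>. (B s \<omega>)\<^sup>2)"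
    and cov: "\<And>s s'. s \<in> {0..t} \<Longrightarrow> s' \<in> {0..t} \<Longrightarrow> expectation (\<lambda>\<omega>. B s \<omega> * B s' \<omega>) = min s s'"
    and s: "s \<in> {0..t}" "s' \<in> {0..t}"
  shows "pairing_eq {0..t} (B s) (indicator {0<..s}) (B s') (indicator {0<..s'})"
proof -
  have e: "indicator {0..t} x *\<^sub>R (indicator {0<..s} x * indicator {0<..s'} x :: real) = indicator {0<..min s s'} x" for x
    using s by (auto split: split_indicator)
  have "set_integrable lborel {0..t} (\<lambda>x. indicator {0<..s} x * indicator {0<..s'} x :: real)"
    unfolding set_integrable_def e using s by (intro integrable_real_indicator) (auto simp: emeasure_lborel_Ioc)
  moreover have "(LBINT x:{0..t}. indicator {0<..s} x * indicator {0<..s'} x :: real) = min s s'"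
    unfolding set_lebesgue_integral_def e using s by (simp add: measure_def emeasure_lborel_Ioc)
  ultimately show ?thesis using square_integrable_mult sq s cov by (simp add: pairing_eq_def)
qed

lemma wiener_step_pairing_eq:
  fixes k :: nat
  assumes BB: "\<And>s s'. s \<in> {0..t} \<Longrightarrow> s' \<in> {0..t} \<Longrightarrow> pairing_eq {0..t} (B s) (indicator {0<..s}) (B s') (indicator {0<..s'})"
    and u: "\<forall>i\<le>k. u i \<in> {0..t}" "\<forall>i<k. u i \<le> u (Suc i)"
  shows "(\<And>s. s \<in> {0..t} \<Longrightarrow> pairing_eq {0..t} (B s) (indicator {0<..s}) Z \<psi>) \<Longrightarrow>
      pairing_eq {0..t} (\<lambda>\<omega>. \<Sum>i<k. a i * (B (u (Suc i)) \<omega> - B (u i) \<omega>)) (\<lambda>x. \<Sum>i<k. a i * indicator {u i<..u (Suc i)} x) Z \<psi>"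
proof -
  assume BZ: "\<And>s. s \<in> {0..t} \<Longrightarrow> pairing_eq {0..t} (B s) (indicator {0<..s}) Z \<psi>"
  have "(\<Sum>i<k. a i * indicator {u i<..u (Suc i)} x) = (\<Sum>i<k. a i * (indicator {0<..u (Suc i)} x - indicator {0<..u i} x))" for x :: real
  proof (rule sum.cong)
    fix i assume "i \<in> {..<k}"
    then have "0 \<le> u i" "u i \<le> u (Suc i)" using u by auto
    then show "a i * indicator {u i<..u (Suc i)} x = a i * (indicator {0<..u (Suc i)} x - indicator {0<..u i} x)"
      by (auto split: split_indicator)
  qed simp
  then have e: "(\<lambda>x. \<Sum>i<k. a i * indicator {u i<..u (Suc i)} x) = (\<lambda>x. \<Sum>i<k. a i * (indicator {0<..u (Suc i)} x - indicator {0<..u i} x))" by (rule ext)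
  show "pairing_eq {0..t} (\<lambda>\<omega>. \<Sum>i<k. a i * (B (u (Suc i)) \<omega> - B (u i) \<omega>)) (\<lambda>x. \<Sum>i<k. a i * indicator {u i<..u (Suc i)} x) Z \<psi>"
    unfolding e using u by (intro pairing_eq_sum pairing_eq_cmult pairing_eq_diff BZ) auto
qed

text \<open>Covariances alone characterize the Wiener integral: by bilinearity the pairing carries
  over to \<open>Y\<close> minus an elementary integral, so its error in mean square equals the
  error of the corresponding step function, which \<open>step_approximation\<close> makes
  small.\<close>

lemma has_wiener_integralI:
  fixes f :: "real \<Rightarrow> real"
  assumes t: "0 < t" and cont: "continuous_on {0<..<t} f" and [measurable]: "f \<in> borel_measurable borel" "Y \<in> borel_measurable M"
    and BB: "\<And>s s'. s \<in> {0..t} \<Longrightarrow> s' \<in> {0..t} \<Longrightarrow> pairing_eq {0..t} (B s) (indicator {0<..s}) (B s') (indicator {0<..s'})"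
    and YB: "\<And>s. s \<in> {0..t} \<Longrightarrow> pairing_eq {0..t} Y f (B s) (indicator {0<..s})"
    and YY: "pairing_eq {0..t} Y f Y f"
  shows "has_wiener_integral M B t f Y"
proof -
  have "(\<integral>\<^sup>+x\<in>{0..t}. ennreal ((f x)\<^sup>2) \<partial>lborel) = ennreal (expectation (\<lambda>\<omega>. (Y \<omega>)\<^sup>2))"
    unfolding pairing_eq_square[OF YY, symmetric] using YY by (intro nn_integral_eq_integral) (auto simp: pairing_eq_def power2_eq_square)
  then have fin: "(\<integral>\<^sup>+x\<in>{0<..<t}. ennreal ((f x)\<^sup>2) \<partial>lborel) < \<infinity>" by (simp add: nn_integral_Icc_Ioo)
  define Q where "Q n p \<longleftrightarrow> (\<forall>i\<le>fst p. snd (snd p) i \<in> {0..t}) \<and> (\<forall>i<fst p. snd (snd p) i \<le> snd (snd p) (Suc i)) \<and>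
     (\<integral>\<^sup>+x\<in>{0..t}. ennreal ((f x - (\<Sum>i<fst p. fst (snd p) i * indicator {snd (snd p) i<..snd (snd p) (Suc i)} x))\<^sup>2) \<partial>lborel)
       \<le> ennreal (inverse (real (Suc n)))" for n and p :: "nat \<times> (nat \<Rightarrow> real) \<times> (nat \<Rightarrow> real)"
  have "\<exists>p. Q n p" for n
    using step_approximation[OF t cont _ fin, of "inverse (real (Suc n))"] by (auto simp: Q_def)
  then obtain F where F: "\<And>n. Q n (F n)" by metis
  define k a u where "k n = fst (F n)" and "a n = fst (snd (F n))" and "u n = snd (snd (F n))" for n
  have k: "\<forall>i\<le>k n. u n i \<in> {0..t}" "\<forall>i<k n. u n i \<le> u n (Suc i)"
      "(\<integral>\<^sup>+x\<in>{0..t}. ennreal ((f x - (\<Sum>i<k n. a n i * indicator {u n i<..u n (Suc i)} x))\<^sup>2) \<partial>lborel) \<le> ennreal (inverse (real (Suc n)))" for n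
    using F[of n] by (auto simp: Q_def k_def a_def u_def)
  have lim: "(\<lambda>n. \<integral>\<^sup>+x\<in>{0..t}. ennreal ((f x - (\<Sum>i<k n. a n i * indicator {u n i<..u n (Suc i)} x))\<^sup>2) \<partial>lborel) \<longlonglongrightarrow> 0"
  proof (rule tendsto_sandwich[of "\<lambda>_. 0" _ _ "\<lambda>n. ennreal (inverse (real (Suc n)))"])
    show "(\<lambda>n. ennreal (inverse (real (Suc n)))) \<longlonglongrightarrow> 0"
      using tendsto_ennrealI[OF LIMSEQ_inverse_real_of_nat] by simp
  qed (use k(3) in auto)
  have "(\<integral>\<^sup>+\<omega>. ennreal ((Y \<omega> - (\<Sum>i<k n. a n i * (B (u n (Suc i)) \<omega> - B (u n i) \<omega>)))\<^sup>2) \<partial>M) =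
    (\<integral>\<^sup>+x\<in>{0..t}. ennreal ((f x - (\<Sum>i<k n. a n i * indicator {u n i<..u n (Suc i)} x))\<^sup>2) \<partial>lborel)" for n
  proof (rule pairing_eq_square)
    note st = wiener_step_pairing_eq[OF BB k(1,2)]
    let ?D = "\<lambda>\<omega>. Y \<omega> - (\<Sum>i<k n. a n i * (B (u n (Suc i)) \<omega> - B (u n i) \<omega>))"
    let ?\<phi> = "\<lambda>x. f x - (\<Sum>i<k n. a n i * indicator {u n i<..u n (Suc i)} x)"
    have DB: "pairing_eq {0..t} ?D ?\<phi> (B s) (indicator {0<..s})" if s: "s \<in> {0..t}" for s
      by (rule pairing_eq_diff[OF YB[OF s] st]) (use BB s in auto)
    have DY: "pairing_eq {0..t} ?D ?\<phi> Y f"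
      by (rule pairing_eq_diff[OF YY st]) (use YB pairing_eq_sym in auto)
    show "pairing_eq {0..t} ?D ?\<phi> ?D ?\<phi>"
      by (rule pairing_eq_diff[OF pairing_eq_sym[OF DY] st]) (use DB pairing_eq_sym in auto)
  qed
  with lim show ?thesis
    unfolding has_wiener_integral_def using k(1,2)
    by (intro conjI exI[of _ k] exI[of _ a] exI[of _ u]) (auto simp: set_borel_measurable_def)
qed

text \<open>Intended for a \<open>Y\<close> known only through some approximating sequence. For
  elementary integrals the norms agree, and \<open>L2_norm_le_of_approx\<close> is applied in both
  directions.\<close>

lemma wiener_isometry:
  fixes f :: "real \<Rightarrow> real"
  assumes W: "has_wiener_integral M B t f Y"
    and BB: "\<And>s s'. s \<in> {0..t} \<Longrightarrow> s' \<in> {0..t} \<Longrightarrow> pairing_eq {0..t} (B s) (indicator {0<..s}) (B s') (indicator {0<..s'})"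
    and Bm: "\<And>s. s \<in> {0..t} \<Longrightarrow> B s \<in> borel_measurable M"
    and fin: "(\<integral>\<^sup>+x\<in>{0..t}. ennreal ((f x)\<^sup>2) \<partial>lborel) < \<infinity>" "(\<integral>\<^sup>+\<omega>. ennreal ((Y \<omega>)\<^sup>2) \<partial>M) < \<infinity>"
  shows "(\<integral>\<^sup>+\<omega>. ennreal ((Y \<omega>)\<^sup>2) \<partial>M) = (\<integral>\<^sup>+x\<in>{0..t}. ennreal ((f x)\<^sup>2) \<partial>lborel)"
proof -
  obtain k :: "nat \<Rightarrow> nat" and a u :: "nat \<Rightarrow> nat \<Rightarrow> real" where
    k: "\<And>n. \<forall>i\<le>k n. u n i \<in> {0..t}" "\<And>n. \<forall>i<k n. u n i \<le> u n (Suc i)"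
      and lf: "(\<lambda>n. \<integral>\<^sup>+ s\<in>{0..t}. ennreal ((f s - (\<Sum>i<k n. a n i * indicator {u n i<..u n (Suc i)} s))\<^sup>2) \<partial>lborel) \<longlonglongrightarrow> 0"
      and lY: "(\<lambda>n. \<integral>\<^sup>+ \<omega>. ennreal ((Y \<omega> - (\<Sum>i<k n. a n i * (B (u n (Suc i)) \<omega> - B (u n i) \<omega>)))\<^sup>2) \<partial>M) \<longlonglongrightarrow> 0"
    using W unfolding has_wiener_integral_def by blast
  have [measurable]: "Y \<in> borel_measurable M" and fm: "(\<lambda>x. indicator {0..t} x * f x) \<in> borel_measurable lborel"
    using W by (auto simp: has_wiener_integral_def set_borel_measurable_def)
  define g where "g n x = (\<Sum>i<k n. a n i * indicator {u n i<..u n (Suc i)} x)" for n and x :: real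
  define Z where "Z n \<omega> = (\<Sum>i<k n. a n i * (B (u n (Suc i)) \<omega> - B (u n i) \<omega>))" for n \<omega>
  have [measurable]: "g n \<in> borel_measurable borel" for n unfolding g_def by measurable
  have [measurable]: "Z n \<in> borel_measurable M" for n
    unfolding Z_def using k(1)[of n] by (intro borel_measurable_sum borel_measurable_times borel_measurable_diff Bm) auto
  have sq: "(indicator {0..t} x * v)\<^sup>2 = v\<^sup>2 * indicator {0..t} x" for x v :: real by (auto split: split_indicator)
  have ei: "ennreal (v * indicator {0..t} x) = ennreal v * indicator {0..t} x" for x v :: real by (auto split: split_indicator)
  have eq: "(\<integral>\<^sup>+x. ennreal ((indicator {0..t} x * g n x)\<^sup>2) \<partial>lborel) = (\<integral>\<^sup>+\<omega>. ennreal ((Z n \<omega>)\<^sup>2) \<partial>M)" for n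
  proof -
    have st: "pairing_eq {0..t} (Z n) (g n) Z' \<psi>" if "\<And>s. s \<in> {0..t} \<Longrightarrow> pairing_eq {0..t} (B s) (indicator {0<..s}) Z' \<psi>" for Z' \<psi>
      unfolding Z_def g_def by (rule wiener_step_pairing_eq[OF _ k(1,2)]) (use BB that in auto)
    have "pairing_eq {0..t} (Z n) (g n) (Z n) (g n)"
      by (rule st, rule pairing_eq_sym, rule st) (rule BB)
    from pairing_eq_square[OF this] show ?thesis by (simp add: sq ei)
  qed
  have lf': "(\<lambda>n. \<integral>\<^sup>+x. ennreal ((indicator {0..t} x * f x - indicator {0..t} x * g n x)\<^sup>2) \<partial>lborel) \<longlonglongrightarrow> 0"
    using lf unfolding right_diff_distrib[symmetric] sq ei g_def .
  have F: "(\<integral>\<^sup>+x. ennreal ((indicator {0..t} x * f x)\<^sup>2) \<partial>lborel) = (\<integral>\<^sup>+x\<in>{0..t}. ennreal ((f x)\<^sup>2) \<partial>lborel)"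
    by (simp add: sq ei)
  have "(\<integral>\<^sup>+x. ennreal ((indicator {0..t} x * f x)\<^sup>2) \<partial>lborel) \<le> (\<integral>\<^sup>+\<omega>. ennreal ((Y \<omega>)\<^sup>2) \<partial>M)"
    by (rule L2_norm_le_of_approx[OF fm _ _ _ eq lf' lY[folded Z_def] fin(2)]) measurable
  moreover have "(\<integral>\<^sup>+\<omega>. ennreal ((Y \<omega>)\<^sup>2) \<partial>M) \<le> (\<integral>\<^sup>+x. ennreal ((indicator {0..t} x * f x)\<^sup>2) \<partial>lborel)"
    by (rule L2_norm_le_of_approx[OF _ _ fm _ eq[symmetric] lY[folded Z_def] lf']) (use fin(1) F in auto)
  ultimately show ?thesis unfolding F by (rule antisym[rotated])
qed

end

lemma has_wiener_integral_cong:
  assumes W: "has_wiener_integral M B t f Y" and eq: "\<And>s. s \<in> {0..t} \<Longrightarrow> f s = g s"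
    and B: "\<And>s. s \<in> {0..t} \<Longrightarrow> AE \<omega> in M. B s \<omega> = B' s \<omega>"
  shows "has_wiener_integral M B' t g Y"
proof -
  have e: "indicator {0..t} s *\<^sub>R f s = indicator {0..t} s *\<^sub>R g s" for s
    using eq by (auto split: split_indicator)
  have 1: "(\<integral>\<^sup>+ s\<in>{0..t}. ennreal ((g s - v s)\<^sup>2) \<partial>lborel) = (\<integral>\<^sup>+ s\<in>{0..t}. ennreal ((f s - v s)\<^sup>2) \<partial>lborel)" for v
    using eq by (intro set_nn_cong) auto
  have 2: "(\<integral>\<^sup>+ \<omega>. ennreal ((Y \<omega> - (\<Sum>i<k. a i * (B' (u (Suc i)) \<omega> - B' (u i) \<omega>)))\<^sup>2) \<partial>M)
     = (\<integral>\<^sup>+ \<omega>. ennreal ((Y \<omega> - (\<Sum>i<k. a i * (B (u (Suc i)) \<omega> - B (u i) \<omega>)))\<^sup>2) \<partial>M)"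
    if u: "\<forall>i\<le>k. u i \<in> {0..t}" for k :: nat and a u :: "nat \<Rightarrow> real"
  proof (rule nn_integral_cong_AE)
    have "AE \<omega> in M. \<forall>i\<in>{..k}. B (u i) \<omega> = B' (u i) \<omega>"
      using u B by (subst AE_ball_countable) auto
    then show "AE \<omega> in M. ennreal ((Y \<omega> - (\<Sum>i<k. a i * (B' (u (Suc i)) \<omega> - B' (u i) \<omega>)))\<^sup>2)
      = ennreal ((Y \<omega> - (\<Sum>i<k. a i * (B (u (Suc i)) \<omega> - B (u i) \<omega>)))\<^sup>2)"
      by eventually_elim (auto intro!: arg_cong[where f="\<lambda>x. ennreal ((Y _ - x)\<^sup>2)"] sum.cong)
  qed
  obtain k :: "nat \<Rightarrow> nat" and a u :: "nat \<Rightarrow> nat \<Rightarrow> real" where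
    k: "\<And>n. \<forall>i\<le>k n. u n i \<in> {0..t}" "\<And>n. \<forall>i<k n. u n i \<le> u n (Suc i)"
      and lf: "(\<lambda>n. \<integral>\<^sup>+ s\<in>{0..t}. ennreal ((f s - (\<Sum>i<k n. a n i * indicator {u n i<..u n (Suc i)} s))\<^sup>2) \<partial>lborel) \<longlonglongrightarrow> 0"
      and lY: "(\<lambda>n. \<integral>\<^sup>+ \<omega>. ennreal ((Y \<omega> - (\<Sum>i<k n. a n i * (B (u n (Suc i)) \<omega> - B (u n i) \<omega>)))\<^sup>2) \<partial>M) \<longlonglongrightarrow> 0"
    using W unfolding has_wiener_integral_def by blast
  have "set_borel_measurable lborel {0..t} g"
    using W unfolding has_wiener_integral_def set_borel_measurable_def e by (rule conjunct1)
  moreover have "(\<lambda>n. \<integral>\<^sup>+ s\<in>{0..t}. ennreal ((g s - (\<Sum>i<k n. a n i * indicator {u n i<..u n (Suc i)} s))\<^sup>2) \<partial>lborel) \<longlonglongrightarrow> 0"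
    unfolding 1 by (rule lf)
  moreover have "(\<lambda>n. \<integral>\<^sup>+ \<omega>. ennreal ((Y \<omega> - (\<Sum>i<k n. a n i * (B' (u n (Suc i)) \<omega> - B' (u n i) \<omega>)))\<^sup>2) \<partial>M) \<longlonglongrightarrow> 0"
    unfolding 2[OF k(1)] by (rule lY)
  moreover have "Y \<in> borel_measurable M" using W by (simp add: has_wiener_integral_def)
  ultimately show ?thesis unfolding has_wiener_integral_def using k by blast
qed

lemma has_wiener_integral_at_0:
  assumes [measurable]: "Y \<in> borel_measurable M" and Y: "AE \<omega> in M. Y \<omega> = 0"
  shows "has_wiener_integral M B 0 f Y"
proof -
  have "(\<lambda>x. indicator {0..0} x *\<^sub>R f x) = (\<lambda>x. indicator {0::real} x * f 0)" by (auto split: split_indicator)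
  then have m: "set_borel_measurable lborel {0..0} f" by (simp add: set_borel_measurable_def)
  have z: "(\<integral>\<^sup>+ s\<in>{0..0::real}. h s \<partial>lborel) = 0" for h :: "real \<Rightarrow> ennreal"
    using nn_integral_Icc_Ioo[of h 0 0] by simp
  have "(\<integral>\<^sup>+ \<omega>. ennreal ((Y \<omega>)\<^sup>2) \<partial>M) = (\<integral>\<^sup>+ \<omega>. 0 \<partial>M)"
    using Y by (intro nn_integral_cong_AE) (auto elim: eventually_mono)
  then show ?thesis unfolding has_wiener_integral_def
    using m z by (intro conjI exI[of _ "\<lambda>_. 0"] exI[of _ "\<lambda>_ _. 0"]) auto
qed

lemma (in prob_space) increment_square:
  assumes "integrable M (\<lambda>\<omega>. (Y \<omega>)\<^sup>2)" "integrable M (\<lambda>\<omega>. (Z \<omega>)\<^sup>2)" "Y \<in> borel_measurable M" "Z \<in> borel_measurable M"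
  shows "expectation (\<lambda>\<omega>. (Y \<omega> - Z \<omega>)\<^sup>2) =
    expectation (\<lambda>\<omega>. Y \<omega> * Y \<omega>) - 2 * expectation (\<lambda>\<omega>. Y \<omega> * Z \<omega>) + expectation (\<lambda>\<omega>. Z \<omega> * Z \<omega> :: real)"
proof -
  have i: "integrable M (\<lambda>\<omega>. Y \<omega> * Z \<omega>)" "integrable M (\<lambda>\<omega>. Y \<omega> * Y \<omega>)" "integrable M (\<lambda>\<omega>. Z \<omega> * Z \<omega>)"
    using assms square_integrable_mult[OF assms(3,4,1,2)] by (auto simp: power2_eq_square)
  have "(\<lambda>\<omega>. (Y \<omega> - Z \<omega>)\<^sup>2) = (\<lambda>\<omega>. Y \<omega> * Y \<omega> - 2 * (Y \<omega> * Z \<omega>) + Z \<omega> * Z \<omega>)"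
    by (auto simp: power2_eq_square algebra_simps)
  then show ?thesis using i by simp
qed

lemma (in prob_space) process_to_sequence_space:
  fixes X :: "real \<Rightarrow> 'a \<Rightarrow> real"
  assumes X: "centered_gaussian_process M T R X" and m: "\<And>t. X t \<in> borel_measurable M"
    and c: "\<And>\<omega>. continuous_on UNIV (\<lambda>t. X t \<omega>)"
  shows "\<exists>(N :: (nat \<Rightarrow> real) measure) X'. prob_space N \<and> centered_gaussian_process N T R X'"
proof -
  define q :: "nat \<Rightarrow> real" where "q n = real_of_rat (nat_to_rat_surj n)" for n
  define \<Phi> where "\<Phi> \<omega> n = X (q n) \<omega>" for \<omega> n
  have inj: "X t \<omega> = X t \<omega>'" if "\<Phi> \<omega> = \<Phi> \<omega>'" for t \<omega> \<omega>'
  proof -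
    have "closed {t. X t \<omega> = X t \<omega>'}"
      by (rule closed_Collect_eq) (rule c)+
    moreover have "\<rat> \<subseteq> {t. X t \<omega> = X t \<omega>'}"
    proof
      fix t :: real assume "t \<in> \<rat>"
      then obtain r where r: "t = real_of_rat r" by (auto elim: Rats_cases)
      obtain n where "r = nat_to_rat_surj n" using surj_nat_to_rat_surj by (auto simp: surj_def)
      then have "t = q n" by (simp add: q_def r)
      then show "t \<in> {t. X t \<omega> = X t \<omega>'}" using fun_cong[OF that, of n] by (simp add: \<Phi>_def)
    qed
    ultimately have "closure \<rat> \<subseteq> {t. X t \<omega> = X t \<omega>'}" by (rule closure_minimal[rotated])
    then show ?thesis by (auto simp: Rats_closure_real)
  qed
  \<comment> \<open>The largest sigma-algebra that makes \<open>\<Phi>\<close> measurable. A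
    function on the sequence space is measurable as soon as its composition with
    \<open>\<Phi>\<close> is, and the event that a path is continuous is measurable as well.\<close>
  define \<A> where "\<A> = {S. \<Phi> -` S \<inter> space M \<in> sets M}"
  have sa: "sigma_algebra UNIV \<A>"
  proof (rule sigma_algebra_iff2[THEN iffD2], intro conjI ballI allI impI)
    show "UNIV - S \<in> \<A>" if "S \<in> \<A>" for S
    proof -
      have "\<Phi> -` (UNIV - S) \<inter> space M = space M - (\<Phi> -` S \<inter> space M)" by auto
      then show ?thesis using that by (auto simp: \<A>_def)
    qed
    show "(\<Union>i::nat. A i) \<in> \<A>" if "range A \<subseteq> \<A>" for A
    proof -
      have "\<Phi> -` (\<Union>i. A i) \<inter> space M = (\<Union>i. \<Phi> -` A i \<inter> space M)" by auto
      moreover have "(\<Union>i. \<Phi> -` A i \<inter> space M) \<in> sets M"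
        using that by (intro sets.countable_UN) (auto simp: \<A>_def)
      ultimately show ?thesis unfolding \<A>_def mem_Collect_eq by (simp only:)
    qed
  qed (auto simp: \<A>_def)
  define N0 :: "(nat \<Rightarrow> real) measure" where "N0 = measure_of UNIV \<A> (\<lambda>_. 0)"
  have N0: "sets N0 = \<A>" "space N0 = UNIV"
    using sigma_algebra.sets_measure_of_eq[OF sa] by (auto simp: N0_def space_measure_of_conv)
  have \<Phi>m: "\<Phi> \<in> measurable M N0" by (rule measurableI) (auto simp: N0 \<A>_def)
  define N where "N = distr M N0 \<Phi>"
  interpret N: prob_space N unfolding N_def by (rule prob_space_distr[OF \<Phi>m])
  \<comment> \<open>By \<open>inj\<close> the value does not depend on the chosen
    \<open>\<omega>\<close> on the range of \<open>\<Phi>\<close>; off the range, which the image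
    measure does not see, it is arbitrary.\<close>
  define X' where "X' t x = X t (SOME \<omega>. \<Phi> \<omega> = x)" for t and x :: "nat \<Rightarrow> real"
  have X': "X' t (\<Phi> \<omega>) = X t \<omega>" for t \<omega>
    unfolding X'_def by (rule inj) (rule someI[of "\<lambda>\<omega>'. \<Phi> \<omega>' = \<Phi> \<omega>" \<omega>], simp)
  have meas: "Y \<in> borel_measurable N0" if "(\<lambda>\<omega>. Y (\<Phi> \<omega>)) \<in> borel_measurable M" for Y :: "(nat \<Rightarrow> real) \<Rightarrow> real"
  proof (rule measurableI)
    fix S :: "real set" assume "S \<in> sets borel"
    then have "(\<lambda>\<omega>. Y (\<Phi> \<omega>)) -` S \<inter> space M \<in> sets M" using that by (rule measurable_sets[rotated])
    then show "Y -` S \<inter> space N0 \<in> sets N0" by (simp add: N0 \<A>_def vimage_def)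
  qed simp
  have cg: "N.cgauss Y" if "cgauss (\<lambda>\<omega>. Y (\<Phi> \<omega>))" for Y
  proof -
    have [measurable]: "Y \<in> borel_measurable N0" using that by (intro meas cgauss_meas)
    have "distr N borel Y = distr M borel (\<lambda>\<omega>. Y (\<Phi> \<omega>))"
      unfolding N_def using \<Phi>m by (subst distr_distr) (auto simp: comp_def)
    then show ?thesis using that meas[OF cgauss_meas[OF that]]
      unfolding cgauss_iff N.cgauss_iff centered_gaussian_def by (auto simp: N_def)
  qed
  have gp: "gaussian_process M {0..T} X" and E0: "\<And>t. t \<in> {0..T} \<Longrightarrow> expectation (X t) = 0"
    and cov: "\<And>s t. s \<in> {0..T} \<Longrightarrow> t \<in> {0..T} \<Longrightarrow> (LINT \<omega>|M. X t \<omega> * X s \<omega>) = R t s"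
    using X by (auto simp: centered_gaussian_process_def)
  have V: "gauss_space (lin_span {0..T} X)" "\<And>t. t \<in> {0..T} \<Longrightarrow> X t \<in> lin_span {0..T} X"
    using gauss_space_lin_span[OF gp] E0 by auto
  have "centered_gaussian_process N T R X'"
    unfolding centered_gaussian_process_def
  proof (intro conjI ballI)
    show "gaussian_process N {0..T} X'"
      unfolding gaussian_process_def
    proof (intro allI impI)
      fix F and b :: "real \<Rightarrow> real" assume F: "finite F" "F \<subseteq> {0..T}"
      have "(\<lambda>\<omega>. \<Sum>t\<in>F. b t * X t \<omega>) \<in> lin_span {0..T} X"
        by (rule gauss_space_sum[OF V(1) F(1)]) (use V(2) F in auto)
      then have "cgauss (\<lambda>\<omega>. \<Sum>t\<in>F. b t * X t \<omega>)" using V(1) by (simp add: gauss_space_def)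
      then have "N.cgauss (\<lambda>x. \<Sum>t\<in>F. b t * X' t x)" by (intro cg) (simp add: X')
      then show "gaussian_rv N (\<lambda>x. \<Sum>t\<in>F. b t * X' t x)" by (simp add: N.cgauss_def)
    qed
    have "{x. continuous_on {0..T} (\<lambda>t. X' t x)} \<in> sets N0"
    proof -
      have "continuous_on {0..T} (\<lambda>t. X t \<omega>)" for \<omega> by (rule continuous_on_subset[OF c]) simp
      then show ?thesis by (simp add: N0 \<A>_def vimage_def X')
    qed
    then show "AE x in N. continuous_on {0..T} (\<lambda>t. X' t x)"
      unfolding N_def using \<Phi>m c by (subst AE_distr_iff) (auto simp: N0 X' intro!: continuous_on_subset[OF c])
    have "X' t \<in> borel_measurable N0" for t using m by (intro meas) (simp add: X')
    note [measurable] = this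
    show "N.expectation (X' t) = 0" if "t \<in> {0..T}" for t
      unfolding N_def using E0[OF that] \<Phi>m by (subst integral_distr) (auto simp: X')
    show "N.expectation (\<lambda>x. X' t x * X' s x) = R t s" if "s \<in> {0..T}" "t \<in> {0..T}" for s t
      unfolding N_def using cov[OF that] \<Phi>m by (subst integral_distr) (auto simp: X')
  qed
  then show ?thesis using N.prob_space_axioms by blast
qed

section \<open>Action of the operators on covariance functions\<close>

context fbm_kernel
begin

lemma R_props: "R s t = R t s" "0 \<le> t \<Longrightarrow> R t 0 = 0" "0 \<le> t \<Longrightarrow> R 0 t = 0" "0 \<le> t \<Longrightarrow> R t t = t powr (1 - 2 * a)"
  using a1 by (auto simp: R_def abs_minus_commute)

lemma R_increment: "R t t - 2 * R t s + R s s = \<bar>t - s\<bar> powr (1 - 2 * a)"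
  using a1 by (simp add: R_def field_simps)

lemma L_cong: "0 \<le> t \<Longrightarrow> (\<And>s. 0 < s \<Longrightarrow> s \<le> t \<Longrightarrow> f s = g s) \<Longrightarrow> L f t = L g t"
  unfolding L_def by (cases "t = 0") (auto intro!: arg_cong2[where f="(+)"] set_lebesgue_integral_cong)

lemma L_cmult: "L (\<lambda>s. c * f s) t = c * L f t"
  unfolding L_def
  by (simp add: distrib_left mult.assoc flip: right_diff_distrib set_integral_mult_right)

lemma isCont_k:
  assumes "0 < s" "s < t"
  shows "isCont (k t) s"
  unfolding k_def using ka_deriv2[OF assms] kb_deriv2[OF assms] by (intro continuous_intros) (auto intro: DERIV_isCont)

lemma kk_integral:
  assumes s: "0 < s" "s \<le> t"
  shows "set_integrable lborel {0<..<s} (\<lambda>u. k s u * k t u)" "(LBINT u:{0<..<s}. k s u * k t u) = kappa * R t s"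
proof -
  have "0 \<le> R t s"
  proof -
    have "0 \<le> t powr (1 - 2 * a) - (t - s) powr (1 - 2 * a)" using s a1 by (simp add: powr_mono2)
    moreover have "0 \<le> s powr (1 - 2 * a)" by simp
    ultimately have "0 \<le> s powr (1 - 2 * a) + t powr (1 - 2 * a) - (t - s) powr (1 - 2 * a)" by linarith
    then show ?thesis using s by (simp add: R_def)
  qed
  then have R0: "0 \<le> kappa * R t s" using kappa_pos by simp
  show "set_integrable lborel {0<..<s} (\<lambda>u. k s u * k t u)" "(LBINT u:{0<..<s}. k s u * k t u) = kappa * R t s"
    using set_integral_eq_nn[OF _ _ nn_k_k[OF s] R0] k_nonneg by auto
qed

lemma R_nonneg:
  assumes "0 \<le> s" "0 \<le> t" shows "0 \<le> R t s"
proof -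
  have *: "0 \<le> R t s" if "0 \<le> s" "s \<le> t" for s t
  proof -
    have "0 \<le> t powr (1 - 2 * a) - (t - s) powr (1 - 2 * a)" using that a1 by (simp add: powr_mono2)
    moreover have "0 \<le> s powr (1 - 2 * a)" by simp
    ultimately have "0 \<le> s powr (1 - 2 * a) + t powr (1 - 2 * a) - (t - s) powr (1 - 2 * a)" by linarith
    then show ?thesis using that by (simp add: R_def)
  qed
  show ?thesis using *[of s t] *[of t s] assms R_props(1)[of s t] by (cases "s \<le> t") auto
qed

lemma nn_k_k_full:
  assumes "0 \<le> s" "0 \<le> t"
  shows "(\<integral>\<^sup>+u\<in>{0<..}. ennreal (k s u * k t u) \<partial>lborel) = ennreal (kappa * R t s)"
proof -
  have *: "(\<integral>\<^sup>+u\<in>{0<..}. ennreal (k s u * k t u) \<partial>lborel) = ennreal (kappa * R t s)" if "0 \<le> s" "s \<le> t" for s t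
  proof -
    have "(\<integral>\<^sup>+u\<in>{0<..}. ennreal (k s u * k t u) \<partial>lborel) = (\<integral>\<^sup>+u\<in>{0<..<s}. ennreal (k s u * k t u) \<partial>lborel)"
      by (intro nn_integral_cong) (auto simp: k_outside split: split_indicator)
    also have "\<dots> = ennreal (kappa * R t s)"
      using nn_k_k[of s t] that R_props(2)[of t] by (cases "s = 0") auto
    finally show ?thesis .
  qed
  show ?thesis
  proof (cases "s \<le> t")
    case False
    then show ?thesis using *[of t s] assms R_props(1)[of s t] by (simp add: mult.commute)
  qed (use * assms in auto)
qed

text \<open>Square integrability is known from the covariance identity and suffices on a bounded
  interval because of \<open>k \<le> 1 + k * k\<close>. Beyond \<open>t\<close> the kernel vanishes,
  which admits any right end \<open>s\<close>.\<close>

lemma k_integrable: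
  assumes "0 \<le> t"
  shows "set_integrable lborel {0<..<s} (k t)"
proof (cases "t = 0")
  case True
  then have "k t = (\<lambda>_. 0)" using a0 by (auto simp: k_def ka_def kb_def)
  then show ?thesis by (simp add: set_integrable_def)
next
  case False
  with assms have t: "0 < t" by simp
  have "set_integrable lborel {0<..<t} (\<lambda>u. 1 + k t u * k t u)"
    by (intro set_integral_add kk_integral t)
       (auto simp: set_integrable_def t less_imp_le intro!: integrable_real_indicator)
  then have "set_integrable lborel {0<..<t} (k t)"
  proof (rule set_integrable_bound)
    show "set_borel_measurable lborel {0<..<t} (k t)" by (simp add: set_borel_measurable_def)
    show "AE x in lborel. x \<in> {0<..<t} \<longrightarrow> norm (k t x) \<le> norm (1 + k t x * k t x)"
    proof (intro AE_I2 impI)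
      fix x
      have "0 \<le> (k t x - 1/2)\<^sup>2" by simp
      then have "k t x \<le> 1 + k t x * k t x" by (simp add: power2_eq_square algebra_simps)
      then show "norm (k t x) \<le> norm (1 + k t x * k t x)" using k_nonneg[of t x] by simp
    qed
  qed
  then have "integrable lborel (\<lambda>u. indicator {0<..<s} u *\<^sub>R (indicator {0<..<t} u *\<^sub>R k t u))"
    unfolding set_integrable_def by (intro integrable_mult_indicator[of "{0<..<s}"]) auto
  moreover have "indicator {0<..<s} u *\<^sub>R (indicator {0<..<t} u *\<^sub>R k t u) = indicator {0<..<s} u *\<^sub>R k t u" for u
    using k_outside[of u t] by (auto split: split_indicator)
  ultimately show ?thesis by (simp only: set_integrable_def)
qed

text \<open>As a function of \<open>u\<close>, \<open>min u s\<close> is the covariance of Brownian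
  motion with its value at \<open>s\<close>, and its density is an indicator. The result is, up to
  the factor \<open>cst\<close>, the covariance of \<open>X t\<close> with \<open>B s\<close> in
  \<open>fbm_of_brownian\<close>.\<close>

lemma L_min:
  assumes t: "0 < t" and s: "0 \<le> s"
  shows "L (\<lambda>u. min u s) t = (LBINT u:{0<..<s}. k t u)"
proof -
  have i: "set_integrable lborel {0<..<t} (indicator {0<..<s} :: real \<Rightarrow> real)"
    unfolding set_integrable_def using t
    by (intro integrable_mult_indicator integrable_real_indicator) (auto simp: s)
  have ik: "set_integrable lborel {0<..<t} (\<lambda>u. indicator {0<..<s} u * k t u)"
  proof -
    have "integrable lborel (\<lambda>u. indicator {0<..<s} u *\<^sub>R (indicator {0<..<t} u *\<^sub>R k t u))"
      using k_integrable[of t t] t unfolding set_integrable_def by (intro integrable_mult_indicator[of "{0<..<s}"]) auto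
    then show ?thesis by (simp add: set_integrable_def mult.left_commute)
  qed
  have "min u s = (LBINT v:{0<..<u}. indicator {0<..<s} v)" if "0 < u" "u \<le> t" for u
  proof -
    have "indicator {0<..<u} v *\<^sub>R (indicator {0<..<s} v :: real) = indicator {0<..<min u s} v" for v
      by (auto split: split_indicator)
    then show ?thesis using that s by (simp add: set_lebesgue_integral_def measure_def emeasure_lborel_Ioo)
  qed
  from L_by_parts(3)[OF t _ _ i ik this]
  have "L (\<lambda>u. min u s) t = (LBINT u:{0<..<t}. indicator {0<..<s} u * k t u)" by simp
  also have "\<dots> = (LBINT u:{0<..<s}. k t u)"
    unfolding set_lebesgue_integral_def
    using k_outside by (intro Bochner_Integration.integral_cong) (auto split: split_indicator)
  finally show ?thesis .
qed

text \<open>The second half of the covariance computation: \<open>L\<close> is applied in the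
  remaining variable to the function that \<open>L_min\<close> produced.\<close>

lemma L_k_primitive:
  assumes s: "0 < s" "s \<le> t"
  shows "L (\<lambda>u. LBINT v:{0<..<u}. k t v) s = kappa * R t s"
proof -
  have "L (\<lambda>u. LBINT v:{0<..<u}. k t v) s = (LBINT u:{0<..<s}. k t u * k s u)"
    using s kk_integral(1)[OF s]
    by (intro L_by_parts(3) k_integrable) (auto simp: k_nonneg mult.commute)
  then show ?thesis using kk_integral(2)[OF s] by (simp add: mult.commute)
qed

text \<open>The bounds on \<open>F\<close> make both weighted integrals finite, so that the
  \<open>w2\<close> term of \<open>nn_w_transform\<close> can be subtracted; the factor
  \<open>betaa * t powr (- a)\<close> is cancelled by the normalization in
  \<open>A0\<close>.\<close>

lemma A0_transform:
  fixes F \<phi> :: "real \<Rightarrow> real"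
  assumes t: "0 < t" and [measurable]: "F \<in> borel_measurable borel" "\<phi> \<in> borel_measurable borel"
    and F: "\<And>s. 0 < s \<Longrightarrow> s < t \<Longrightarrow> 0 \<le> F s" "\<And>s. 0 < s \<Longrightarrow> s < t \<Longrightarrow> F s \<le> C"
    and FF: "\<And>s. 0 < s \<Longrightarrow> s < t \<Longrightarrow> ennreal (F s) = (\<integral>\<^sup>+u\<in>{0<..}. ennreal (k s u) * ennreal (\<phi> u) \<partial>lborel)"
    and r: "(\<integral>\<^sup>+u\<in>{0<..<t}. ennreal (\<phi> u) \<partial>lborel) = ennreal r" "0 \<le> r"
  shows "A0 F t = r"
proof -
  have tx: "0 < t * x" "t * x < t" if "x \<in> {0<..<1}" for x using t that by auto
  have W: "(\<integral>\<^sup>+x\<in>{0<..<1}. ennreal (w x) * (\<integral>\<^sup>+u\<in>{0<..}. ennreal (k (t * x) u) * ennreal (\<phi> u) \<partial>lborel) \<partial>lborel)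
      = ennreal (LBINT x:{0<..<1}. w x * F (t * x))" "0 \<le> (LBINT x:{0<..<1}. w x * F (t * x))"
    if w: "set_integrable lborel {0<..<1} w" and [measurable]: "w \<in> borel_measurable borel" and w0: "\<And>x. 0 \<le> w x" for w
  proof -
    have i: "set_integrable lborel {0<..<1} (\<lambda>x. w x * F (t * x))"
      by (rule set_integrable_mult_bounded[OF w, where C=C]) (use tx F in \<open>auto simp: set_borel_measurable_def\<close>)
    have "(\<integral>\<^sup>+x\<in>{0<..<1}. ennreal (w x) * (\<integral>\<^sup>+u\<in>{0<..}. ennreal (k (t * x) u) * ennreal (\<phi> u) \<partial>lborel) \<partial>lborel)
      = (\<integral>\<^sup>+x\<in>{0<..<1}. ennreal (w x * F (t * x)) \<partial>lborel)"
    proof (rule set_nn_cong)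
      fix x :: real assume x: "x \<in> {0<..<1}"
      show "ennreal (w x) * (\<integral>\<^sup>+u\<in>{0<..}. ennreal (k (t * x) u) * ennreal (\<phi> u) \<partial>lborel) = ennreal (w x * F (t * x))"
        unfolding FF[OF tx[OF x], symmetric] by (rule ennreal_mult'[symmetric, OF w0])
    qed
    also have "\<dots> = ennreal (LBINT x:{0<..<1}. w x * F (t * x))"
      using w0 F tx by (intro nn_set_integral_eq[OF i]) auto
    finally show "(\<integral>\<^sup>+x\<in>{0<..<1}. ennreal (w x) * (\<integral>\<^sup>+u\<in>{0<..}. ennreal (k (t * x) u) * ennreal (\<phi> u) \<partial>lborel) \<partial>lborel)
      = ennreal (LBINT x:{0<..<1}. w x * F (t * x))" .
    show "0 \<le> (LBINT x:{0<..<1}. w x * F (t * x))"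
      unfolding set_lebesgue_integral_def using w0 F tx
      by (intro Bochner_Integration.integral_nonneg) (auto split: split_indicator)
  qed
  note W1 = W[OF w_integrable(1) w_meas(1) w_nonneg(1)] and W2 = W[OF w_integrable(2) w_meas(2) w_nonneg(2)]
  have tb: "0 \<le> betaa * t powr (- a)" using betaa_pos by simp
  have "ennreal (LBINT x:{0<..<1}. w1 x * F (t * x)) = ennreal (betaa * t powr (- a)) * ennreal r + ennreal (LBINT x:{0<..<1}. w2 x * F (t * x))"
    using nn_w_transform[of "\<lambda>u. ennreal (\<phi> u)" t] t unfolding W1(1) W2(1) r(1) by simp
  also have "\<dots> = ennreal (betaa * t powr (- a) * r + (LBINT x:{0<..<1}. w2 x * F (t * x)))"
    using r(2) tb W2(2) by (simp add: ennreal_mult'[symmetric] ennreal_plus[symmetric] del: ennreal_plus)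
  finally have "(LBINT x:{0<..<1}. w1 x * F (t * x)) = betaa * t powr (- a) * r + (LBINT x:{0<..<1}. w2 x * F (t * x))"
    using r(2) tb W1(2) W2(2) by (subst (asm) ennreal_inj) auto
  then have "(LBINT x:{0<..<1}. w1 x * F (t * x)) - (LBINT x:{0<..<1}. w2 x * F (t * x)) = betaa * t powr (- a) * r" by simp
  moreover have "t powr a * t powr (- a) = 1" using t by (simp flip: powr_add)
  ultimately show ?thesis unfolding A0_def using betaa_pos by simp
qed

lemma A0_continuous:
  fixes g :: "real \<Rightarrow> real"
  assumes g: "continuous_on UNIV g"
  shows "continuous_on {0..T} (A0 g)"
proof -
  have [measurable]: "g \<in> borel_measurable borel" using g by (rule borel_measurable_continuous_onI)
  have "bounded (g ` {0..T})" by (intro compact_imp_bounded compact_continuous_image continuous_on_subset[OF g]) auto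
  then obtain C where C: "\<And>s. 0 \<le> s \<Longrightarrow> s \<le> T \<Longrightarrow> \<bar>g s\<bar> \<le> C" by (force simp: bounded_iff)
  have "continuous_on {0..T} (\<lambda>t. LBINT x:{0<..<1}. w x * g (t * x))"
    if w: "set_integrable lborel {0<..<1} w" and [measurable]: "w \<in> borel_measurable borel" and w0: "\<And>x. 0 \<le> w x" for w :: "real \<Rightarrow> real"
  proof (rule continuous_on_set_LINT[where G="\<lambda>x. C * w x"])
    show "set_integrable lborel {0<..<1} (\<lambda>x. C * w x)" using w by (rule set_integrable_mult_right)
    show "continuous_on {0..T} (\<lambda>t. w x * g (t * x))" for x
      by (intro continuous_intros continuous_on_compose2[OF g]) auto
    show "\<bar>w x * g (t * x)\<bar> \<le> C * w x" if "t \<in> {0..T}" "x \<in> {0<..<1}" for t x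
      using C[of "t * x"] that w0[of x] by (auto simp: abs_mult mult.commute[of C] scale_le intro!: mult_left_mono)
  qed (simp add: set_borel_measurable_def)
  from this[OF w_integrable(1) w_meas(1) w_nonneg(1)] this[OF w_integrable(2) w_meas(2) w_nonneg(2)]
  show ?thesis unfolding A0_def using a0 betaa_pos by (intro continuous_intros continuous_on_powr') auto
qed

end

section \<open>Brownian motion and fractional Brownian motion\<close>

context prob_space
begin

lemma centered_gaussian_process_space:
  assumes X: "centered_gaussian_process M T R X" and clamp: "\<And>t \<omega>. X t \<omega> = X (max 0 (min T t)) \<omega>" and T: "0 \<le> T"
  shows "gauss_space (lin_span {0..T} X)" "X t \<in> lin_span {0..T} X"
proof -
  have gp: "gaussian_process M {0..T} X" and E0: "\<And>t. t \<in> {0..T} \<Longrightarrow> expectation (X t) = 0"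
    using X by (auto simp: centered_gaussian_process_def)
  show "gauss_space (lin_span {0..T} X)" by (rule gauss_space_lin_span[OF gp]) (rule E0)
  have "X (max 0 (min T t)) \<in> lin_span {0..T} X" by (rule gauss_space_lin_span(2)[OF gp]) (use E0 T in auto)
  moreover have "X t = X (max 0 (min T t))" using clamp by (intro ext)
  ultimately show "X t \<in> lin_span {0..T} X" by metis
qed

lemma centered_gaussian_process_hoelder:
  assumes X: "centered_gaussian_process M T R X" and clamp: "\<And>t \<omega>. X t \<omega> = X (max 0 (min T t)) \<omega>" and T: "0 < T"
    and cont: "\<And>\<omega>. continuous_on UNIV (\<lambda>t. X t \<omega>)"
    and R: "\<And>s t. R t t - 2 * R t s + R s s = \<bar>t - s\<bar> powr (2 * h)" and \<gamma>: "0 < \<gamma>" "\<gamma> < h"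
  shows "AE \<omega> in M. \<exists>C. \<forall>x\<in>{0..T}. \<forall>y\<in>{0..T}. \<bar>X x \<omega> - X y \<omega>\<bar> \<le> C * \<bar>x - y\<bar> powr \<gamma>"
proof -
  note V = centered_gaussian_process_space[OF X clamp less_imp_le[OF T]]
  have cg: "cgauss (X t)" for t using V by (auto simp: gauss_space_def)
  have cov: "expectation (\<lambda>\<omega>. X t \<omega> * X s \<omega>) = R t s" if "s \<in> {0..T}" "t \<in> {0..T}" for s t
    using X that by (auto simp: centered_gaussian_process_def)
  show ?thesis
  proof (rule gaussian_hoelder[OF T V cont _ \<gamma>])
    fix s t assume "s \<in> {0..T}" "t \<in> {0..T}"
    then show "expectation (\<lambda>\<omega>. (X t \<omega> - X s \<omega>)\<^sup>2) = \<bar>t - s\<bar> powr (2 * h)"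
      using cov R by (subst increment_square) (auto intro: cgauss_square_integrable cgauss_meas cg)
  qed
qed

lemma centered_gaussian_process_zero:
  assumes X: "centered_gaussian_process M T R X" and t: "t \<in> {0..T}" "R t t = 0"
  shows "AE \<omega> in M. X t \<omega> = 0"
proof -
  have gp: "gaussian_process M {0..T} X" and E0: "\<And>t. t \<in> {0..T} \<Longrightarrow> expectation (X t) = 0"
    using X by (auto simp: centered_gaussian_process_def)
  have "cgauss (X t)"
    using gauss_space_lin_span[OF gp] E0 t by (auto simp: gauss_space_def)
  then have "integrable M (\<lambda>\<omega>. (X t \<omega>)\<^sup>2)" by (rule cgauss_square_integrable)
  moreover have "expectation (\<lambda>\<omega>. (X t \<omega>)\<^sup>2) = 0"
    using X t by (auto simp: centered_gaussian_process_def power2_eq_square)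
  ultimately have "AE \<omega> in M. (X t \<omega>)\<^sup>2 = 0" by (subst (asm) integral_nonneg_eq_0_iff_AE) auto
  then show ?thesis by simp
qed

end

text \<open>\<open>D1 1\<close> and \<open>D2 1\<close> are not integrable and hence lie outside the
  scope of \<open>gauss_space_LINT\<close>. Cutting them off near the singular end point, whose
  distance is \<open>h x\<close>, gives integrable weights, and for a path with a bound of order
  \<open>\<alpha>\<close> the truncated averages converge.\<close>

lemma weight_truncation:
  fixes D h f :: "real \<Rightarrow> real"
  assumes int: "set_integrable lborel S (\<lambda>x. h x powr \<alpha> * D x)" and \<alpha>: "0 \<le> \<alpha>" and D: "\<And>x. 0 \<le> D x"
    and h: "\<And>x. x \<in> S \<Longrightarrow> 0 < h x"
    and [measurable]: "D \<in> borel_measurable borel" "h \<in> borel_measurable borel" "S \<in> sets borel"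
  shows "set_integrable lborel S (\<lambda>x. indicator {x. 1 / real (Suc n) \<le> h x} x * D x)"
    and "f \<in> borel_measurable borel \<Longrightarrow> (\<And>x. x \<in> S \<Longrightarrow> \<bar>f x\<bar> \<le> C * h x powr \<alpha>) \<Longrightarrow>
      (\<lambda>n. LBINT x:S. indicator {x. 1 / real (Suc n) \<le> h x} x * D x * f x) \<longlonglongrightarrow> (LBINT x:S. D x * f x)"
proof -
  let ?v = "\<lambda>n x. indicator {x. 1 / real (Suc n) \<le> h x} x * D x"
  show "set_integrable lborel S (?v n)" for n
  proof (rule set_integrable_bound[OF set_integrable_mult_right[OF int, of "real (Suc n) powr \<alpha>"]])
    have "\<bar>?v n x\<bar> \<le> \<bar>real (Suc n) powr \<alpha> * (h x powr \<alpha> * D x)\<bar>" if x: "x \<in> S" for x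
    proof (cases "1 / real (Suc n) \<le> h x")
      case True
      then have "1 \<le> (real (Suc n) * h x) powr \<alpha>" using \<alpha> by (intro ge_one_powr_ge_zero) (auto simp: field_simps)
      then have "1 \<le> real (Suc n) powr \<alpha> * h x powr \<alpha>" using h[OF x] by (simp add: powr_mult)
      then have "1 * D x \<le> (real (Suc n) powr \<alpha> * h x powr \<alpha>) * D x" by (rule mult_right_mono) (rule D)
      then show ?thesis using D[of x] True by (simp add: abs_mult mult.assoc)
    qed simp
    then show "AE x in lborel. x \<in> S \<longrightarrow> norm (?v n x) \<le> norm (real (Suc n) powr \<alpha> * (h x powr \<alpha> * D x))" by simp
  qed (simp add: set_borel_measurable_def)
  assume [measurable]: "f \<in> borel_measurable borel" and f: "\<And>x. x \<in> S \<Longrightarrow> \<bar>f x\<bar> \<le> C * h x powr \<alpha>"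
  show "(\<lambda>n. LBINT x:S. ?v n x * f x) \<longlonglongrightarrow> (LBINT x:S. D x * f x)"
    unfolding set_lebesgue_integral_def
  proof (rule integral_dominated_convergence[where w="\<lambda>x. indicator S x *\<^sub>R (C * (h x powr \<alpha> * D x))"])
    show "integrable lborel (\<lambda>x. indicator S x *\<^sub>R (C * (h x powr \<alpha> * D x)))"
      using set_integrable_mult_right[OF int, of C] by (simp add: set_integrable_def)
    have "(\<lambda>n. ?v n x) \<longlonglongrightarrow> D x" if "x \<in> S" for x
    proof (rule tendsto_eventually)
      have "\<forall>\<^sub>F n in sequentially. inverse (real (Suc n)) < h x"
        using LIMSEQ_inverse_real_of_nat h[OF that] by (rule order_tendstoD(2))
      then show "\<forall>\<^sub>F n in sequentially. ?v n x = D x" by eventually_elim (simp add: inverse_eq_divide)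
    qed
    then show "AE x in lborel. (\<lambda>n. indicator S x *\<^sub>R (?v n x * f x)) \<longlonglongrightarrow> indicator S x *\<^sub>R (D x * f x)"
      by (intro AE_I2) (auto split: split_indicator intro!: tendsto_intros)
    show "AE x in lborel. norm (indicator S x *\<^sub>R (?v n x * f x)) \<le> indicator S x *\<^sub>R (C * (h x powr \<alpha> * D x))" for n
    proof (rule AE_I2)
      fix x
      have "\<bar>?v n x\<bar> * \<bar>f x\<bar> \<le> D x * (C * h x powr \<alpha>)" if "x \<in> S"
        using D[of x] by (intro mult_mono f that) (auto split: split_indicator)
      then show "norm (indicator S x *\<^sub>R (?v n x * f x)) \<le> indicator S x *\<^sub>R (C * (h x powr \<alpha> * D x))"
        by (auto simp: abs_mult mult_ac split: split_indicator)
    qed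
  qed measurable
qed

section \<open>Passing between the two processes, and the value of the constant\<close>

context fbm_kernel
begin

definition cst :: real where "cst = 1 / sqrt kappa"

lemma cst: "0 < cst" "cst * cst * kappa = 1" "sqrt kappa * cst = 1"
  using kappa_pos by (auto simp: cst_def)

text \<open>Covariances are found by carrying the expectation through \<open>L\<close> in one
  variable at a time: testing against \<open>B s\<close> leads to \<open>L_min\<close>, testing
  against \<open>X t\<close> to \<open>L_k_primitive\<close>. The same covariances identify
  \<open>X t\<close> as the Wiener integral by \<open>has_wiener_integralI\<close>.\<close>

lemma fbm_of_brownian:
  fixes M :: "'a measure"
  assumes M: "prob_space M" and T: "0 < T" and B: "centered_gaussian_process M T (\<lambda>t s. min t s) B"
    and Bm: "\<And>t. B t \<in> borel_measurable M" and Bc: "\<And>\<omega>. continuous_on UNIV (\<lambda>t. B t \<omega>)"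
    and clamp: "\<And>t \<omega>. B t \<omega> = B (max 0 (min T t)) \<omega>"
  defines "X \<equiv> \<lambda>t \<omega>. cst * L (\<lambda>s. B s \<omega>) t"
  shows "centered_gaussian_process M T R X"
    and "\<And>t. t \<in> {0..T} \<Longrightarrow> has_wiener_integral M B t (\<lambda>s. cst * k t s) (X t)"
proof -
  interpret prob_space M by (rule M)
  define V where "V = lin_span {0..T} B"
  have GS: "gauss_space V" and BV: "B t \<in> V" for t
    unfolding V_def using centered_gaussian_process_space[OF B clamp] T by auto
  have cgB: "cgauss (B t)" for t using GS BV by (auto simp: gauss_space_def)
  have Bsq: "integrable M (\<lambda>\<omega>. (B t \<omega>)\<^sup>2)" for t by (rule cgauss_square_integrable[OF cgB])
  have cov: "expectation (\<lambda>\<omega>. B t \<omega> * B s \<omega>) = min t s" if "s \<in> {0..T}" "t \<in> {0..T}" for s t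
    using B that by (auto simp: centered_gaussian_process_def)
  have incr: "expectation (\<lambda>\<omega>. (B t \<omega> - B s \<omega>)\<^sup>2) = \<bar>t - s\<bar>" if "s \<in> {0..T}" "t \<in> {0..T}" for s t
    using cov that by (subst increment_square[OF Bsq Bsq Bm Bm]) (auto simp: min_def)
  note [measurable] = Bm continuous_paths_measurable[OF Bm Bc]
  \<comment> \<open>Midway between \<open>a\<close>, which the order has to exceed for
    \<open>L\<close>, and \<open>1/2\<close>, below which it has to stay for Brownian paths.\<close>
  define \<alpha> where "\<alpha> = (a + 1/2) / 2"
  have \<alpha>: "a < \<alpha>" "\<alpha> < 1/2" using a1 by (auto simp: \<alpha>_def)
  have Bmeas: "(\<lambda>t. B t \<omega>) \<in> borel_measurable borel" for \<omega> using Bc by (rule borel_measurable_continuous_onI)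
  have hol: "AE \<omega> in M. \<exists>C. \<forall>x\<in>{0..T}. \<forall>y\<in>{0..T}. \<bar>B x \<omega> - B y \<omega>\<bar> \<le> C * \<bar>x - y\<bar> powr \<alpha>"
    by (rule centered_gaussian_process_hoelder[OF B clamp T Bc, where h="1/2"]) (use \<alpha> a0 in \<open>auto simp: min_def\<close>)
  have B0: "AE \<omega> in M. B 0 \<omega> = 0" using centered_gaussian_process_zero[OF B, of 0] T by auto
  have Xm [measurable]: "X t \<in> borel_measurable M" for t
    unfolding X_def L_def set_lebesgue_integral_def by measurable
  have X0: "X 0 \<omega> = 0" for \<omega> by (simp add: X_def L_def set_lebesgue_integral_def)
  have Xc: "AE \<omega> in M. continuous_on {0..T} (\<lambda>t. X t \<omega>)"
    using hol B0
  proof eventually_elim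
    case (elim \<omega>)
    then obtain C where "\<And>x y. x \<in> {0..T} \<Longrightarrow> y \<in> {0..T} \<Longrightarrow> \<bar>B x \<omega> - B y \<omega>\<bar> \<le> C * \<bar>x - y\<bar> powr \<alpha>" by blast
    from L_continuous[OF \<alpha>(1) Bmeas this elim(2) T]
    show ?case unfolding X_def by (rule continuous_on_mult_left)
  qed
  define W where "W = lim_closure V"
  have GW: "gauss_space W" unfolding W_def by (rule gauss_space_lim_closure[OF GS])
  have BW: "B t \<in> W" for t unfolding W_def by (rule lim_closure_superset[OF GS BV])
  have D1m: "(\<lambda>x. D1 1 x) \<in> borel_measurable borel" and D2m: "(\<lambda>x. D2 1 x) \<in> borel_measurable borel" by measurable
  \<comment> \<open>Two limits are involved: Riemann sums for the truncated weights lead into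
    \<open>W\<close>, and removing the truncation leads into the closure of
    \<open>W\<close>.\<close>
  have XW: "X t \<in> lim_closure W" if t: "t \<in> {0..T}" for t
  proof -
    define v1 where "v1 n x = indicator {x. 1 / real (Suc n) \<le> 1 - x} x * D1 1 x" for n and x :: real
    define v2 where "v2 n x = indicator {x. 1 / real (Suc n) \<le> x} x * D2 1 x" for n and x :: real
    have vm [measurable]: "v1 n \<in> borel_measurable borel" "v2 n \<in> borel_measurable borel" for n
      unfolding v1_def v2_def by measurable
    have \<alpha>0: "0 \<le> \<alpha>" using \<alpha> a0 by simp
    note t1 = weight_truncation[OF D1_weight_integrable[OF \<alpha>(1)] \<alpha>0 D_nonneg(1) _ D1m, folded v1_def]
    note t2 = weight_truncation[OF D2_weight_integrable[OF \<alpha>(1)] \<alpha>0 D_nonneg(2) _ D2m, folded v2_def]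
    have i1: "set_integrable lborel {0<..<1} (v1 n)" and i2: "set_integrable lborel {0<..<1} (v2 n)" for n
      by (rule t1(1) t2(1); simp)+
    define Y where "Y n \<omega> = cst * t powr (- a) * (((LBINT x:{0<..<1}. v1 n x) * B t \<omega> - (LBINT x:{0<..<1}. v1 n x * B (t * x) \<omega>))
        + (LBINT x:{0<..<1}. v2 n x * B (t * x) \<omega>))" for n \<omega>
    have YW: "Y n \<in> W" for n
    proof -
      have a1: "(\<lambda>\<omega>. LBINT x:{0<..<1}. v1 n x * B (t * x) \<omega>) \<in> W"
        unfolding W_def by (rule gauss_space_LINT[OF GS BV Bc i1]) simp
      have a2: "(\<lambda>\<omega>. LBINT x:{0<..<1}. v2 n x * B (t * x) \<omega>) \<in> W"
        unfolding W_def by (rule gauss_space_LINT[OF GS BV Bc i2]) simp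
      have "(\<lambda>\<omega>. (LBINT x:{0<..<1}. v1 n x) * B t \<omega> - (LBINT x:{0<..<1}. v1 n x * B (t * x) \<omega>)) \<in> W"
        by (intro gauss_space_diff[OF GW] gauss_space_cmult[OF GW] BW a1)
      from gauss_space_lin[OF GW this a2, of 1 1]
      show ?thesis unfolding Y_def by (intro gauss_space_cmult[OF GW]) simp
    qed
    have "AE \<omega> in M. (\<lambda>n. Y n \<omega>) \<longlonglongrightarrow> X t \<omega>"
      using hol B0
    proof eventually_elim
      case (elim \<omega>)
      then obtain C where C: "\<And>x y. x \<in> {0..T} \<Longrightarrow> y \<in> {0..T} \<Longrightarrow> \<bar>B x \<omega> - B y \<omega>\<bar> \<le> C * \<bar>x - y\<bar> powr \<alpha>" by blast
      note [measurable] = Bmeas[of \<omega>]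
      have tx: "0 \<le> t * x" "t * x \<le> T" "\<bar>t - t * x\<bar> = t * (1 - x)" if "x \<in> {0<..<1}" for x
        using that t scale_le[of t T x] scale_le[of t t x] by (auto simp: algebra_simps)
      have b1: "\<bar>B t \<omega> - B (t * x) \<omega>\<bar> \<le> C * t powr \<alpha> * (1 - x) powr \<alpha>" if "x \<in> {0<..<1}" for x
        using C[of t "t * x"] tx[OF that] t that by (simp add: powr_mult mult.assoc)
      have b2: "\<bar>B (t * x) \<omega>\<bar> \<le> C * t powr \<alpha> * x powr \<alpha>" if "x \<in> {0<..<1}" for x
        using C[of "t * x" 0] tx[OF that] t that elim(2) T by (simp add: powr_mult mult.assoc)
      have l1: "(\<lambda>n. LBINT x:{0<..<1}. v1 n x * (B t \<omega> - B (t * x) \<omega>)) \<longlonglongrightarrow> (LBINT x:{0<..<1}. D1 1 x * (B t \<omega> - B (t * x) \<omega>))"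
        by (rule t1(2)[OF _ _ _ _ b1]) auto
      have l2: "(\<lambda>n. LBINT x:{0<..<1}. v2 n x * B (t * x) \<omega>) \<longlonglongrightarrow> (LBINT x:{0<..<1}. D2 1 x * B (t * x) \<omega>)"
        by (rule t2(2)[OF _ _ _ _ b2]) auto
      have vi: "set_integrable lborel {0<..<1} (\<lambda>x. v1 n x * B (t * x) \<omega>)" for n
      proof (rule set_integrable_mult_bounded[OF i1])
        show "set_borel_measurable borel {0<..<1} (\<lambda>x. B (t * x) \<omega>)" by (simp add: set_borel_measurable_def)
        fix x :: real assume x: "0 < x" "x < 1"
        have "\<bar>B (t * x) \<omega>\<bar> \<le> \<bar>C * t powr \<alpha>\<bar> * x powr \<alpha>" using b2[of x] x by (auto intro: order_trans[OF _ mult_right_mono])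
        also have "\<dots> \<le> \<bar>C * t powr \<alpha>\<bar> * 1" using x \<alpha> a0 by (intro mult_left_mono powr_le1) auto
        finally show "\<bar>B (t * x) \<omega>\<bar> \<le> \<bar>C * t powr \<alpha>\<bar>" by simp
      qed simp
      have "(LBINT x:{0<..<1}. v1 n x) * B t \<omega> - (LBINT x:{0<..<1}. v1 n x * B (t * x) \<omega>) = (LBINT x:{0<..<1}. v1 n x * (B t \<omega> - B (t * x) \<omega>))" for n
        using set_integral_diff(2)[OF set_integrable_mult_left[OF i1[of n], of "B t \<omega>"] vi[of n]]
        by (simp add: right_diff_distrib)
      then have Ye: "Y n \<omega> = cst * t powr (- a) * ((LBINT x:{0<..<1}. v1 n x * (B t \<omega> - B (t * x) \<omega>)) + (LBINT x:{0<..<1}. v2 n x * B (t * x) \<omega>))" for n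
        by (simp add: Y_def)
      have "X t \<omega> = cst * t powr (- a) * ((LBINT x:{0<..<1}. D1 1 x * (B t \<omega> - B (t * x) \<omega>)) + (LBINT x:{0<..<1}. D2 1 x * B (t * x) \<omega>))"
        using t by (simp add: X_def L_scaled mult.commute mult.left_commute)
      then show ?case unfolding Ye by (simp only:) (intro tendsto_intros l1 l2)
    qed
    then show ?thesis using YW Xm by (auto simp: lim_closure_def)
  qed
  have GX: "gauss_space (lim_closure W)" by (rule gauss_space_lim_closure[OF GW])
  have cgX: "cgauss (X t)" if "t \<in> {0..T}" for t using GX XW[OF that] by (auto simp: gauss_space_def)
  have Xsq: "integrable M (\<lambda>\<omega>. (X t \<omega>)\<^sup>2)" if "t \<in> {0..T}" for t by (rule cgauss_square_integrable[OF cgX[OF that]])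
  \<comment> \<open>In mean square the increments of \<open>B\<close> have order
    \<open>1/2 > a\<close>. The bounds \<open>sqrt (t * (1 - x))\<close> and
    \<open>sqrt (t * x)\<close> therefore compensate the singular weights \<open>D1 1\<close> and
    \<open>D2 1\<close>, and the expectation can be taken inside \<open>L\<close> without any
    pathwise Hoelder constant.\<close>
  have EX: "integrable M (\<lambda>\<omega>. X t \<omega> * Z \<omega>) \<and> expectation (\<lambda>\<omega>. X t \<omega> * Z \<omega>) = cst * L (\<lambda>u. expectation (\<lambda>\<omega>. B u \<omega> * Z \<omega>)) t"
    if t: "t \<in> {0..T}" and Zm [measurable]: "Z \<in> borel_measurable M" and Z2: "integrable M (\<lambda>\<omega>. (Z \<omega>)\<^sup>2)" for t Z
  proof (cases "t = 0")
    case True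
    then show ?thesis by (simp add: X0 L_def set_lebesgue_integral_def)
  next
    case False
    with t have t0: "0 < t" by simp
    have tx: "t * x \<in> {0..T}" "t * x \<le> t" if "x \<in> {0<..<1}" for x
      using that t scale_le[of t T x] scale_le[of t t x] by auto
    have BZ: "integrable M (\<lambda>\<omega>. B u \<omega> * Z \<omega>)" for u by (rule square_integrable_mult[OF Bm Zm Bsq Z2])
    have sq: "integrable M (\<lambda>\<omega>. (B s \<omega> - B u \<omega>)\<^sup>2)" for s u
      using gauss_space_diff[OF GS BV BV, of s u] GS by (auto simp: gauss_space_def intro!: cgauss_square_integrable)
    define I1 where "I1 \<omega> = (LBINT x:{0<..<1}. D1 1 x * (B t \<omega> - B (t * x) \<omega>))" for \<omega>
    define I2 where "I2 \<omega> = (LBINT x:{0<..<1}. D2 1 x * B (t * x) \<omega>)" for \<omega>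
    have 1: "integrable M (\<lambda>\<omega>. I1 \<omega> * Z \<omega>)"
        "expectation (\<lambda>\<omega>. I1 \<omega> * Z \<omega>) = (LBINT x:{0<..<1}. D1 1 x * expectation (\<lambda>\<omega>. (B t \<omega> - B (t * x) \<omega>) * Z \<omega>))"
    proof -
      have "set_integrable lborel {0<..<1} (\<lambda>x. sqrt t * ((1 - x) powr (1/2) * D1 1 x))"
        using a1 by (intro set_integrable_mult_right D1_weight_integrable)
      then have vm: "set_integrable lborel {0<..<1} (\<lambda>x. D1 1 x * sqrt (t * (1 - x)))"
        by (rule set_integrable_cong[THEN iffD1, rotated -1]) (auto simp: real_sqrt_mult powr_half_sqrt)
      have m: "expectation (\<lambda>\<omega>. (B t \<omega> - B (t * x) \<omega>)\<^sup>2) \<le> (sqrt (t * (1 - x)))\<^sup>2" if "x \<in> {0<..<1}" for x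
        using incr[of "t * x" t] tx[OF that] t that by (simp add: algebra_simps)
      show "integrable M (\<lambda>\<omega>. I1 \<omega> * Z \<omega>)"
        unfolding I1_def by (rule expectation_LINT(1)[OF _ D1m Zm _ _ Z2 _ _ m vm]) (use t0 sq in \<open>auto, measurable\<close>)
      show "expectation (\<lambda>\<omega>. I1 \<omega> * Z \<omega>) = (LBINT x:{0<..<1}. D1 1 x * expectation (\<lambda>\<omega>. (B t \<omega> - B (t * x) \<omega>) * Z \<omega>))"
        unfolding I1_def by (rule expectation_LINT(2)[OF _ D1m Zm _ _ Z2 _ _ m vm]) (use t0 sq in \<open>auto, measurable\<close>)
    qed
    have 2: "integrable M (\<lambda>\<omega>. I2 \<omega> * Z \<omega>)"
        "expectation (\<lambda>\<omega>. I2 \<omega> * Z \<omega>) = (LBINT x:{0<..<1}. D2 1 x * expectation (\<lambda>\<omega>. B (t * x) \<omega> * Z \<omega>))"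
    proof -
      have "set_integrable lborel {0<..<1} (\<lambda>x. sqrt t * (x powr (1/2) * D2 1 x))"
        using a1 by (intro set_integrable_mult_right D2_weight_integrable)
      then have vm: "set_integrable lborel {0<..<1} (\<lambda>x. D2 1 x * sqrt (t * x))"
        by (rule set_integrable_cong[THEN iffD1, rotated -1]) (auto simp: real_sqrt_mult powr_half_sqrt)
      have m: "expectation (\<lambda>\<omega>. (B (t * x) \<omega>)\<^sup>2) \<le> (sqrt (t * x))\<^sup>2" if "x \<in> {0<..<1}" for x
        using cov[of "t * x" "t * x"] tx[OF that] by (simp add: power2_eq_square)
      show "integrable M (\<lambda>\<omega>. I2 \<omega> * Z \<omega>)"
        unfolding I2_def by (rule expectation_LINT(1)[OF _ D2m Zm _ _ Z2 _ _ m vm]) (use t0 Bsq in \<open>auto, measurable\<close>)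
      show "expectation (\<lambda>\<omega>. I2 \<omega> * Z \<omega>) = (LBINT x:{0<..<1}. D2 1 x * expectation (\<lambda>\<omega>. B (t * x) \<omega> * Z \<omega>))"
        unfolding I2_def by (rule expectation_LINT(2)[OF _ D2m Zm _ _ Z2 _ _ m vm]) (use t0 Bsq in \<open>auto, measurable\<close>)
    qed
    have Ls: "L f t = t powr (- a) * ((LBINT x:{0<..<1}. D1 1 x * (f t - f (t * x))) + (LBINT x:{0<..<1}. D2 1 x * f (t * x)))" for f
      using L_scaled[of t f] t by (simp add: mult.commute)
    have Xe: "X t \<omega> * Z \<omega> = cst * (t powr (- a) * (I1 \<omega> * Z \<omega> + I2 \<omega> * Z \<omega>))" for \<omega>
      unfolding X_def I1_def I2_def Ls[of "\<lambda>s. B s \<omega>"] by (simp only: distrib_right mult.assoc)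
    have "L (\<lambda>u. expectation (\<lambda>\<omega>. B u \<omega> * Z \<omega>)) t = t powr (- a) * (expectation (\<lambda>\<omega>. I1 \<omega> * Z \<omega>) + expectation (\<lambda>\<omega>. I2 \<omega> * Z \<omega>))"
      using BZ unfolding 1(2) 2(2) Ls by (simp add: left_diff_distrib)
    then show ?thesis unfolding Xe using 1(1) 2(1) by simp
  qed
  have XB: "expectation (\<lambda>\<omega>. X t \<omega> * B s \<omega>) = cst * (LBINT u:{0<..<s}. k t u)" if t: "t \<in> {0..T}" and s: "s \<in> {0..T}" for s t
  proof (cases "t = 0")
    case True
    have "k 0 u = 0" for u by (simp add: k_def ka_def kb_def)
    then show ?thesis using True by (simp add: X0)
  next
    case False
    have "L (\<lambda>u. expectation (\<lambda>\<omega>. B u \<omega> * B s \<omega>)) t = L (\<lambda>u. min u s) t"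
      using t s cov by (intro L_cong) auto
    then show ?thesis using EX[OF t Bm Bsq] L_min[of t s] t s False by simp
  qed
  have XX: "expectation (\<lambda>\<omega>. X s \<omega> * X t \<omega>) = R t s" if st: "0 \<le> s" "s \<le> t" "t \<le> T" for s t
  proof (cases "s = 0")
    case True
    then show ?thesis using st R_props(2)[of t] by (simp add: X0)
  next
    case False
    have "L (\<lambda>u. expectation (\<lambda>\<omega>. B u \<omega> * X t \<omega>)) s = L (\<lambda>u. cst * (LBINT v:{0<..<u}. k t v)) s"
      using st XB[of t] by (intro L_cong) (auto simp: mult.commute)
    also have "\<dots> = cst * (kappa * R t s)" using L_k_primitive[of s t] st False by (simp add: L_cmult)
    finally have "expectation (\<lambda>\<omega>. X s \<omega> * X t \<omega>) = cst * (cst * (kappa * R t s))" using EX[of s "X t"] Xsq[of t] st by simp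
    also have "\<dots> = (cst * cst * kappa) * R t s" by (simp only: mult.assoc)
    finally show ?thesis by (simp add: cst)
  qed
  have covX: "expectation (\<lambda>\<omega>. X t \<omega> * X s \<omega>) = R t s" if "s \<in> {0..T}" "t \<in> {0..T}" for s t
    using XX[of s t] XX[of t s] that R_props(1)[of s t] by (cases "s \<le> t") (auto simp: mult.commute)
  show "centered_gaussian_process M T R X"
    unfolding centered_gaussian_process_def
    using gauss_space_process[OF GX XW, of "{0..T}" "\<lambda>t. t"] Xc covX by auto
  fix t assume t: "t \<in> {0..T}"
  show "has_wiener_integral M B t (\<lambda>s. cst * k t s) (X t)"
  proof (cases "t = 0")
    case True
    then show ?thesis using has_wiener_integral_at_0[OF Xm[of 0]] X0 by auto
  next
    case False
    with t have t0: "0 < t" by simp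
    have sub: "s \<in> {0..T}" if "s \<in> {0..t}" for s using that t by auto
    have BB: "pairing_eq {0..t} (B s) (indicator {0<..s}) (B s') (indicator {0<..s'})" if "s \<in> {0..t}" "s' \<in> {0..t}" for s s'
      using that by (intro brownian_pairing_eq Bm Bsq cov sub) auto
    have YB: "pairing_eq {0..t} (X t) (\<lambda>s. cst * k t s) (B s) (indicator {0<..s})" if s: "s \<in> {0..t}" for s
    proof -
      have e: "AE x in lborel. indicator {0..t} x *\<^sub>R (cst * k t x * indicator {0<..s} x) = indicator {0<..<s} x *\<^sub>R (cst * k t x)"
        using AE_lborel_singleton[of s] by eventually_elim (use s in \<open>auto split: split_indicator\<close>)
      have i: "set_integrable lborel {0<..<s} (\<lambda>x. cst * k t x)" using t by (intro set_integrable_mult_right k_integrable) auto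
      have "set_integrable lborel {0..t} (\<lambda>x. cst * k t x * indicator {0<..s} x)"
        using i unfolding set_integrable_def by (subst integrable_cong_AE[OF _ _ e]) auto
      moreover have "(LBINT x:{0..t}. cst * k t x * indicator {0<..s} x) = cst * (LBINT u:{0<..<s}. k t u)"
      proof -
        have "(LBINT x:{0..t}. cst * k t x * indicator {0<..s} x) = (LBINT x:{0<..<s}. cst * k t x)"
          unfolding set_lebesgue_integral_def by (rule integral_cong_AE[OF _ _ e]) auto
        then show ?thesis by simp
      qed
      ultimately show ?thesis unfolding pairing_eq_def using EX[OF t Bm Bsq, of s] XB[OF t sub[OF s]] by auto
    qed
    have YY: "pairing_eq {0..t} (X t) (\<lambda>s. cst * k t s) (X t) (\<lambda>s. cst * k t s)"
    proof -
      have e: "indicator {0..t} x *\<^sub>R (cst * k t x * (cst * k t x)) = indicator {0<..<t} x *\<^sub>R (cst * cst * (k t x * k t x))" for x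
        using k_outside[of x t] by (cases "x = 0 \<or> x = t") (auto split: split_indicator)
      have "set_integrable lborel {0<..<t} (\<lambda>x. cst * cst * (k t x * k t x))"
        using t0 by (intro set_integrable_mult_right kk_integral) auto
      moreover have "(LBINT x:{0<..<t}. cst * cst * (k t x * k t x)) = R t t"
      proof -
        have "(LBINT x:{0<..<t}. cst * cst * (k t x * k t x)) = cst * cst * (kappa * R t t)"
          using kk_integral(2)[of t t] t0 by simp
        also have "\<dots> = (cst * cst * kappa) * R t t" by (simp only: mult.assoc)
        finally show ?thesis by (simp only: cst mult_1)
      qed
      ultimately show ?thesis
        unfolding pairing_eq_def set_integrable_def set_lebesgue_integral_def e using EX[OF t Xm Xsq[OF t]] covX[OF t t] by auto
    qed
    show ?thesis
    proof (rule has_wiener_integralI[OF t0 _ _ Xm BB YB YY])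
      show "continuous_on {0<..<t} (\<lambda>s. cst * k t s)"
        by (intro continuous_at_imp_continuous_on ballI continuous_intros isCont_k) auto
    qed auto
  qed
qed

lemma A0_cong:
  assumes "0 \<le> t" "\<And>s. 0 < s \<Longrightarrow> s \<le> t \<Longrightarrow> f s = g s"
  shows "A0 f t = A0 g t"
proof (cases "t = 0")
  case False
  have "f (t * x) = g (t * x)" if "x \<in> {0<..<1}" for x
    using assms False that scale_le[of t t x] by auto
  then have "(LBINT x:{0<..<1}. w x * f (t * x)) = (LBINT x:{0<..<1}. w x * g (t * x))" for w :: "real \<Rightarrow> real"
    by (intro set_lebesgue_integral_cong) auto
  then show ?thesis by (simp add: A0_def)
qed (simp add: A0_def)

text \<open>Gaussianity passes through \<open>A0\<close> because its weights are integrable. The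
  covariance is computed by two uses of \<open>A0_transform\<close>: \<open>R u r\<close> is an
  integral of \<open>k u\<close> against \<open>k r / kappa\<close>, and the covariance of
  \<open>X r\<close> with \<open>B s\<close> obtained from it is an integral of \<open>k r\<close>
  against \<open>cst\<close> times an indicator.\<close>

lemma brownian_of_fbm:
  fixes M :: "'a measure"
  assumes M: "prob_space M" and T: "0 < T" and X: "centered_gaussian_process M T R X"
    and Xm: "\<And>t. X t \<in> borel_measurable M" and Xc: "\<And>\<omega>. continuous_on UNIV (\<lambda>t. X t \<omega>)"
    and clamp: "\<And>t \<omega>. X t \<omega> = X (max 0 (min T t)) \<omega>"
  defines "B \<equiv> \<lambda>t \<omega>. sqrt kappa * A0 (\<lambda>s. X s \<omega>) (max 0 (min T t))"
  shows "centered_gaussian_process M T (\<lambda>t s. min t s) B"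
    and "\<And>t. B t \<in> borel_measurable M" and "\<And>\<omega>. continuous_on UNIV (\<lambda>t. B t \<omega>)"
proof -
  interpret prob_space M by (rule M)
  define V where "V = lin_span {0..T} X"
  have GS: "gauss_space V" and XV: "X t \<in> V" for t
    unfolding V_def using centered_gaussian_process_space[OF X clamp] T by auto
  have Xsq: "integrable M (\<lambda>\<omega>. (X t \<omega>)\<^sup>2)" for t
    using GS XV by (auto simp: gauss_space_def intro!: cgauss_square_integrable)
  have cov: "expectation (\<lambda>\<omega>. X t \<omega> * X s \<omega>) = R t s" if "s \<in> {0..T}" "t \<in> {0..T}" for s t
    using X that by (auto simp: centered_gaussian_process_def)
  note [measurable] = Xm continuous_paths_measurable[OF Xm Xc]
  define W where "W = lim_closure V"
  have GW: "gauss_space W" unfolding W_def by (rule gauss_space_lim_closure[OF GS])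
  have BW: "B t \<in> W" for t
  proof -
    have 1: "(\<lambda>\<omega>. LBINT x:{0<..<1}. w1 x * X (max 0 (min T t) * x) \<omega>) \<in> W"
      unfolding W_def by (rule gauss_space_LINT[OF GS XV Xc w_integrable(1) w_meas(1)])
    have 2: "(\<lambda>\<omega>. LBINT x:{0<..<1}. w2 x * X (max 0 (min T t) * x) \<omega>) \<in> W"
      unfolding W_def by (rule gauss_space_LINT[OF GS XV Xc w_integrable(2) w_meas(2)])
    show ?thesis unfolding B_def A0_def by (intro gauss_space_cmult[OF GW] gauss_space_diff[OF GW] 1 2)
  qed
  have cgB: "cgauss (B t)" for t using GW BW by (auto simp: gauss_space_def)
  show Bm: "B t \<in> borel_measurable M" for t by (rule cgauss_meas[OF cgB])
  have Bsq: "integrable M (\<lambda>\<omega>. (B t \<omega>)\<^sup>2)" for t by (rule cgauss_square_integrable[OF cgB])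
  show Bc: "continuous_on UNIV (\<lambda>t. B t \<omega>)" for \<omega>
    unfolding B_def using T
    by (intro continuous_on_mult_left continuous_on_compose2[OF A0_continuous[OF Xc, of T], where f="\<lambda>t. max 0 (min T t)"] continuous_intros) auto
  have Bt: "B t \<omega> = sqrt kappa * A0 (\<lambda>s. X s \<omega>) t" if "t \<in> {0..T}" for t \<omega>
    using that by (simp add: B_def)
  have BZ: "expectation (\<lambda>\<omega>. B t \<omega> * Z \<omega>) = sqrt kappa * A0 (\<lambda>u. expectation (\<lambda>\<omega>. X u \<omega> * Z \<omega>)) t"
    if t: "t \<in> {0..T}" and Zm [measurable]: "Z \<in> borel_measurable M" and Z2: "integrable M (\<lambda>\<omega>. (Z \<omega>)\<^sup>2)" for t Z
  proof -
    have m: "expectation (\<lambda>\<omega>. (X (t * x) \<omega>)\<^sup>2) \<le> (T powr (1/2 - a))\<^sup>2" if "x \<in> {0<..<1}" for x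
    proof -
      have tx: "0 \<le> t * x" "t * x \<le> T" using that t scale_le[of t T x] by auto
      then have "expectation (\<lambda>\<omega>. (X (t * x) \<omega>)\<^sup>2) = (t * x) powr (1 - 2 * a)"
        using cov[of "t * x" "t * x"] R_props(4)[of "t * x"] by (simp add: power2_eq_square)
      also have "\<dots> \<le> T powr (1 - 2 * a)" using tx a1 by (intro powr_mono2) auto
      also have "\<dots> = (T powr (1/2 - a))\<^sup>2" by (simp add: power2_eq_square flip: powr_add)
      finally show ?thesis .
    qed
    have *: "integrable M (\<lambda>\<omega>. (LBINT x:{0<..<1}. w x * X (t * x) \<omega>) * Z \<omega>)"
        "expectation (\<lambda>\<omega>. (LBINT x:{0<..<1}. w x * X (t * x) \<omega>) * Z \<omega>) = (LBINT x:{0<..<1}. w x * expectation (\<lambda>\<omega>. X (t * x) \<omega> * Z \<omega>))"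
      if w: "set_integrable lborel {0<..<1} w" and wm [measurable]: "w \<in> borel_measurable borel" for w :: "real \<Rightarrow> real"
    proof -
      have vm: "set_integrable lborel {0<..<1} (\<lambda>x. w x * T powr (1/2 - a))" using w by (rule set_integrable_mult_left)
      show "integrable M (\<lambda>\<omega>. (LBINT x:{0<..<1}. w x * X (t * x) \<omega>) * Z \<omega>)"
        by (rule expectation_LINT(1)[OF _ wm Zm _ _ Z2 _ _ m vm]) (use T Xsq in \<open>auto, measurable\<close>)
      show "expectation (\<lambda>\<omega>. (LBINT x:{0<..<1}. w x * X (t * x) \<omega>) * Z \<omega>) = (LBINT x:{0<..<1}. w x * expectation (\<lambda>\<omega>. X (t * x) \<omega> * Z \<omega>))"
        by (rule expectation_LINT(2)[OF _ wm Zm _ _ Z2 _ _ m vm]) (use T Xsq in \<open>auto, measurable\<close>)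
    qed
    note 1 = *[OF w_integrable(1) w_meas(1)] and 2 = *[OF w_integrable(2) w_meas(2)]
    have "B t \<omega> * Z \<omega> = sqrt kappa * (t powr a / betaa * ((LBINT x:{0<..<1}. w1 x * X (t * x) \<omega>) * Z \<omega> - (LBINT x:{0<..<1}. w2 x * X (t * x) \<omega>) * Z \<omega>))" for \<omega>
      unfolding Bt[OF t] A0_def by (simp only: left_diff_distrib mult.assoc)
    then show ?thesis unfolding A0_def 1(2)[symmetric] 2(2)[symmetric] using 1(1) 2(1) by simp
  qed
  have ik: "set_integrable lborel {0<..<t} (k r)" "0 \<le> (LBINT u:{0<..<t}. k r u)"
      "(\<integral>\<^sup>+u\<in>{0<..<t}. ennreal (k r u) \<partial>lborel) = ennreal (LBINT u:{0<..<t}. k r u)" if "0 \<le> r" for r t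
  proof -
    show i: "set_integrable lborel {0<..<t} (k r)" by (rule k_integrable[OF that])
    show "0 \<le> (LBINT u:{0<..<t}. k r u)"
      unfolding set_lebesgue_integral_def by (rule Bochner_Integration.integral_nonneg) (simp add: k_nonneg)
    show "(\<integral>\<^sup>+u\<in>{0<..<t}. ennreal (k r u) \<partial>lborel) = ennreal (LBINT u:{0<..<t}. k r u)"
      by (rule nn_set_integral_eq[OF i]) (simp add: k_nonneg)
  qed
  have XB: "expectation (\<lambda>\<omega>. X r \<omega> * B t \<omega>) = cst * (LBINT u:{0<..<t}. k r u)" if r: "r \<in> {0..T}" and t: "t \<in> {0..T}" for r t
  proof (cases "t = 0")
    case True
    then show ?thesis using T by (simp add: Bt A0_def set_lebesgue_integral_def)
  next
    case False
    with t have t0: "0 < t" by simp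
    have "A0 (\<lambda>u. expectation (\<lambda>\<omega>. X u \<omega> * X r \<omega>)) t = A0 (\<lambda>u. R u r) t"
      using t r cov by (intro A0_cong) auto
    also have "\<dots> = (LBINT u:{0<..<t}. k r u) / kappa"
    proof (rule A0_transform[where \<phi>="\<lambda>u. k r u / kappa" and C="T powr (1 - 2 * a)"])
      show "(\<lambda>u. R u r) \<in> borel_measurable borel" unfolding R_def by measurable
      fix s assume s: "0 < s" "s < t"
      show "0 \<le> R s r" using s r by (intro R_nonneg) auto
      \<comment> \<open>The uniform bound demanded by \<open>A0_transform\<close>, obtained from the
        variances.\<close>
      have "expectation (\<lambda>\<omega>. X s \<omega> * X r \<omega>) \<le> expectation (\<lambda>\<omega>. ((X s \<omega>)\<^sup>2 + (X r \<omega>)\<^sup>2) / 2)"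
      proof (rule integral_mono)
        show "X s \<omega> * X r \<omega> \<le> ((X s \<omega>)\<^sup>2 + (X r \<omega>)\<^sup>2) / 2" for \<omega>
          using sum_squares_bound[of "X s \<omega>" "X r \<omega>"] by simp
      qed (use Xsq square_integrable_mult[OF Xm Xm Xsq Xsq] in auto)
      also have "\<dots> = (R s s + R r r) / 2" using cov[of s s] cov[of r r] s r t Xsq by (simp add: power2_eq_square)
      also have "\<dots> \<le> T powr (1 - 2 * a)"
        using s r t a1 powr_mono2[of "1 - 2 * a" s T] powr_mono2[of "1 - 2 * a" r T] by (simp add: R_props)
      finally show "R s r \<le> T powr (1 - 2 * a)" using cov[of r s] s r t by simp
      have "(\<integral>\<^sup>+u\<in>{0<..}. ennreal (k s u) * ennreal (k r u / kappa) \<partial>lborel) = (\<integral>\<^sup>+u\<in>{0<..}. ennreal (1 / kappa) * ennreal (k s u * k r u) \<partial>lborel)"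
        using kappa_pos by (intro set_nn_cong) (auto simp: k_nonneg simp flip: ennreal_mult)
      also have "\<dots> = ennreal (1 / kappa) * ennreal (kappa * R r s)"
        using s r by (subst set_nn_cmult) (auto simp: nn_k_k_full)
      also have "\<dots> = ennreal (R s r)"
        using kappa_pos R_nonneg[of s r] s r R_props(1)[of s r] by (simp flip: ennreal_mult)
      finally show "ennreal (R s r) = (\<integral>\<^sup>+u\<in>{0<..}. ennreal (k s u) * ennreal (k r u / kappa) \<partial>lborel)" by simp
    next
      have "(\<integral>\<^sup>+u\<in>{0<..<t}. ennreal (k r u / kappa) \<partial>lborel) = (\<integral>\<^sup>+u\<in>{0<..<t}. ennreal (1 / kappa) * ennreal (k r u) \<partial>lborel)"
        using kappa_pos by (intro set_nn_cong) (auto simp: k_nonneg simp flip: ennreal_mult)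
      also have "\<dots> = ennreal (1 / kappa) * ennreal (LBINT u:{0<..<t}. k r u)"
        using ik(3)[of r t] r by (subst set_nn_cmult) auto
      also have "\<dots> = ennreal ((LBINT u:{0<..<t}. k r u) / kappa)"
        using kappa_pos ik(2)[of r t] r by (simp flip: ennreal_mult)
      finally show "(\<integral>\<^sup>+u\<in>{0<..<t}. ennreal (k r u / kappa) \<partial>lborel) = ennreal ((LBINT u:{0<..<t}. k r u) / kappa)" .
      show "0 \<le> (LBINT u:{0<..<t}. k r u) / kappa" using kappa_pos ik(2)[of r t] r by simp
    qed (use t0 in auto)
    finally have "expectation (\<lambda>\<omega>. B t \<omega> * X r \<omega>) = sqrt kappa * ((LBINT u:{0<..<t}. k r u) / kappa)"
      using BZ[OF t Xm Xsq, of r] by simp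
    also have "\<dots> = cst * (LBINT u:{0<..<t}. k r u)"
      using kappa_pos by (simp add: cst_def field_simps)
    finally show ?thesis by (simp add: mult.commute)
  qed
  have BB: "expectation (\<lambda>\<omega>. B t \<omega> * B s \<omega>) = min t s" if s: "s \<in> {0..T}" and t: "t \<in> {0..T}" for s t
  proof (cases "t = 0")
    case True
    then show ?thesis using T s by (simp add: Bt A0_def)
  next
    case False
    with t have t0: "0 < t" by simp
    define F where "F u = cst * (LBINT v:{0<..<s}. k u v)" for u
    have "A0 (\<lambda>u. expectation (\<lambda>\<omega>. X u \<omega> * B s \<omega>)) t = A0 F t"
      using t s XB by (intro A0_cong) (auto simp: F_def)
    also have "A0 F t = cst * min t s"
    proof (rule A0_transform[where \<phi>="\<lambda>u. cst * indicator {0<..<s} u" and C="(T powr (1 - 2 * a) + expectation (\<lambda>\<omega>. (B s \<omega>)\<^sup>2)) / 2"])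
      show "F \<in> borel_measurable borel" unfolding F_def set_lebesgue_integral_def by measurable
      fix r assume r: "0 < r" "r < t"
      show "0 \<le> F r" using ik(2)[of r s] r cst(1) by (simp add: F_def)
      have "F r = expectation (\<lambda>\<omega>. X r \<omega> * B s \<omega>)" using XB[of r s] r s t by (simp add: F_def)
      also have "\<dots> \<le> expectation (\<lambda>\<omega>. ((X r \<omega>)\<^sup>2 + (B s \<omega>)\<^sup>2) / 2)"
      proof (rule integral_mono)
        show "X r \<omega> * B s \<omega> \<le> ((X r \<omega>)\<^sup>2 + (B s \<omega>)\<^sup>2) / 2" for \<omega>
          using sum_squares_bound[of "X r \<omega>" "B s \<omega>"] by simp
      qed (use Xsq Bsq square_integrable_mult[OF Xm Bm Xsq Bsq] in auto)
      also have "\<dots> = (R r r + expectation (\<lambda>\<omega>. (B s \<omega>)\<^sup>2)) / 2"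
        using cov[of r r] r t Xsq Bsq by (simp add: power2_eq_square)
      also have "\<dots> \<le> (T powr (1 - 2 * a) + expectation (\<lambda>\<omega>. (B s \<omega>)\<^sup>2)) / 2"
        using r t a1 powr_mono2[of "1 - 2 * a" r T] by (simp add: R_props)
      finally show "F r \<le> (T powr (1 - 2 * a) + expectation (\<lambda>\<omega>. (B s \<omega>)\<^sup>2)) / 2" .
      have "(\<integral>\<^sup>+u\<in>{0<..}. ennreal (k r u) * ennreal (cst * indicator {0<..<s} u) \<partial>lborel) = (\<integral>\<^sup>+u\<in>{0<..<s}. ennreal cst * ennreal (k r u) \<partial>lborel)"
        by (intro nn_integral_cong) (auto simp: mult.commute split: split_indicator)
      also have "\<dots> = ennreal cst * ennreal (LBINT u:{0<..<s}. k r u)"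
        using ik(3)[of r s] r by (subst set_nn_cmult) auto
      also have "\<dots> = ennreal (F r)"
        using cst(1) ik(2)[of r s] r by (simp add: F_def flip: ennreal_mult)
      finally show "ennreal (F r) = (\<integral>\<^sup>+u\<in>{0<..}. ennreal (k r u) * ennreal (cst * indicator {0<..<s} u) \<partial>lborel)" by simp
    next
      have "(\<integral>\<^sup>+u\<in>{0<..<t}. ennreal (cst * indicator {0<..<s} u) \<partial>lborel) = (\<integral>\<^sup>+u. ennreal cst * indicator {0<..<min t s} u \<partial>lborel)"
        by (intro nn_integral_cong) (auto split: split_indicator)
      also have "\<dots> = ennreal cst * ennreal (min t s)"
        using t s by (subst nn_integral_cmult_indicator) auto
      also have "\<dots> = ennreal (cst * min t s)" using cst(1) t s by (simp add: ennreal_mult)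
      finally show "(\<integral>\<^sup>+u\<in>{0<..<t}. ennreal (cst * indicator {0<..<s} u) \<partial>lborel) = ennreal (cst * min t s)" .
      show "0 \<le> cst * min t s" using cst(1) t s by simp
    qed (use t0 in auto)
    finally have "expectation (\<lambda>\<omega>. B t \<omega> * B s \<omega>) = sqrt kappa * (cst * min t s)"
      using BZ[OF t Bm Bsq, of s] by simp
    also have "\<dots> = (sqrt kappa * cst) * min t s" by (simp only: mult.assoc)
    finally show ?thesis by (simp only: cst mult_1)
  qed
  show "centered_gaussian_process M T (\<lambda>t s. min t s) B"
    unfolding centered_gaussian_process_def
  proof (intro conjI ballI)
    show "gaussian_process M {0..T} B" by (rule gauss_space_process(1)[OF GW BW])
    show "expectation (B t) = 0" if "t \<in> {0..T}" for t by (rule gauss_space_process(2)[OF GW BW that])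
  qed (use BB continuous_on_subset[OF Bc] in auto)
qed

lemma fractional_brownian_motion_iff:
  "fractional_brownian_motion M (1/2 - a) T X \<longleftrightarrow> centered_gaussian_process M T R X"
proof -
  have "2 * (1/2 - a) = 1 - 2 * a" by simp
  then have "(\<lambda>t s. (s powr (2 * (1/2 - a)) + t powr (2 * (1/2 - a)) - \<bar>t - s\<bar> powr (2 * (1/2 - a))) / 2) = R"
    unfolding R_def by (intro ext) (simp only:)
  then show ?thesis by (simp only: fractional_brownian_motion_def)
qed

text \<open>The sequence space carries a Brownian motion because \<open>M\<close> carries a fractional one.\<close>

lemma fbm_const_eq:
  fixes M :: "'a measure"
  assumes M: "prob_space M" and T0: "0 < T0" and X0: "centered_gaussian_process M T0 R X0"
  shows "fbm_const (1/2 - a) = cst"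
  unfolding fbm_const_def
proof (rule the_equality, safe)
  show "0 < cst" by (rule cst)
next
  fix T and N :: "(nat \<Rightarrow> real) measure" and B
  assume T: "0 < T" and N: "prob_space N" and B: "standard_brownian_motion N T B"
  interpret N: prob_space N by (rule N)
  obtain B' where B': "\<And>t. B' t \<in> borel_measurable N" "\<And>\<omega>. continuous_on UNIV (\<lambda>t. B' t \<omega>)"
    "AE \<omega> in N. \<forall>t\<in>{0..T}. B' t \<omega> = B t \<omega>" "\<And>t \<omega>. B' t \<omega> = B' (max 0 (min T t)) \<omega>"
    "centered_gaussian_process N T (\<lambda>t s. min t s) B'"
    using N.continuous_modification[OF B[unfolded standard_brownian_motion_def]] T by auto
  note X = fbm_of_brownian[OF N T B'(5,1,2,4)]
  show "\<exists>X. fractional_brownian_motion N (1/2 - a) T X \<and>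
      (\<forall>t\<in>{0..T}. has_wiener_integral N B t (\<lambda>s. kernel1 cst (1/2 - a) t s + kernel2 cst (1/2 - a) t s) (X t))"
  proof (intro exI conjI ballI)
    show "fractional_brownian_motion N (1/2 - a) T (\<lambda>t \<omega>. cst * L (\<lambda>s. B' s \<omega>) t)"
      unfolding fractional_brownian_motion_iff by (rule X(1))
    fix t assume t: "t \<in> {0..T}"
    show "has_wiener_integral N B t (\<lambda>s. kernel1 cst (1/2 - a) t s + kernel2 cst (1/2 - a) t s) (\<lambda>\<omega>. cst * L (\<lambda>s. B' s \<omega>) t)"
    proof (rule has_wiener_integral_cong[OF X(2)[OF t]])
      show "cst * k t s = kernel1 cst (1/2 - a) t s + kernel2 cst (1/2 - a) t s" if "s \<in> {0..t}" for s
        using that by (simp only: kernel1_eq kernel2_eq k_def distrib_left atLeastAtMost_iff)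
      show "AE \<omega> in N. B' s \<omega> = B s \<omega>" if "s \<in> {0..t}" for s
        using B'(3) by eventually_elim (use that t in auto)
    qed
  qed
next
  fix c :: real
  assume c: "0 < c" and *: "\<forall>T>0. \<forall>(M :: (nat \<Rightarrow> real) measure) B.
        prob_space M \<longrightarrow> standard_brownian_motion M T B \<longrightarrow>
        (\<exists>X. fractional_brownian_motion M (1/2 - a) T X \<and>
             (\<forall>t\<in>{0..T}. has_wiener_integral M B t (\<lambda>s. kernel1 c (1/2 - a) t s + kernel2 c (1/2 - a) t s) (X t)))"
  interpret M: prob_space M by (rule M)
  obtain X' where X': "\<And>t. X' t \<in> borel_measurable M" "\<And>\<omega>. continuous_on UNIV (\<lambda>t. X' t \<omega>)"
    "AE \<omega> in M. \<forall>t\<in>{0..T0}. X' t \<omega> = X0 t \<omega>" "\<And>t \<omega>. X' t \<omega> = X' (max 0 (min T0 t)) \<omega>"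
    "centered_gaussian_process M T0 R X'"
    using M.continuous_modification[OF X0] T0 by auto
  from M.process_to_sequence_space[OF brownian_of_fbm(1-3)[OF M T0 X'(5,1,2,4)]]
  obtain N :: "(nat \<Rightarrow> real) measure" and B where N: "prob_space N" and B: "centered_gaussian_process N T0 (\<lambda>t s. min t s) B" by auto
  interpret N: prob_space N by (rule N)
  obtain X where X: "fractional_brownian_motion N (1/2 - a) T0 X"
    and W: "\<And>t. t \<in> {0..T0} \<Longrightarrow> has_wiener_integral N B t (\<lambda>s. kernel1 c (1/2 - a) t s + kernel2 c (1/2 - a) t s) (X t)"
    using *[rule_format, OF T0 N, of B] B unfolding standard_brownian_motion_def by blast
  have T: "T0 \<in> {0..T0}" using T0 by simp
  have sq: "Y t \<in> borel_measurable N \<and> integrable N (\<lambda>\<omega>. (Y t \<omega>)\<^sup>2)"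
    if "centered_gaussian_process N T0 S Y" "t \<in> {0..T0}" for S Y t
  proof -
    have gp: "gaussian_process N {0..T0} Y" and E0: "\<And>t. t \<in> {0..T0} \<Longrightarrow> N.expectation (Y t) = 0"
      using that by (auto simp: centered_gaussian_process_def)
    have "N.cgauss (Y t)"
      using N.gauss_space_lin_span[OF gp] E0 that(2) by (auto simp: N.gauss_space_def)
    then show ?thesis by (auto intro: N.cgauss_square_integrable N.cgauss_meas)
  qed
  note XR = X[unfolded fractional_brownian_motion_iff]
  have cov: "N.expectation (\<lambda>\<omega>. B t \<omega> * B s \<omega>) = min t s" if "s \<in> {0..T0}" "t \<in> {0..T0}" for s t
    using B that by (auto simp: centered_gaussian_process_def)
  have W': "has_wiener_integral N B T0 (\<lambda>s. c * k T0 s) (X T0)"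
  proof (rule has_wiener_integral_cong[OF W[OF T]])
    show "kernel1 c (1/2 - a) T0 s + kernel2 c (1/2 - a) T0 s = c * k T0 s" if "s \<in> {0..T0}" for s
      using that by (simp only: kernel1_eq kernel2_eq k_def distrib_left atLeastAtMost_iff)
  qed simp
  have RT: "0 < R T0 T0" using T0 by (simp add: R_props)
  have "(\<integral>\<^sup>+s\<in>{0..T0}. ennreal ((c * k T0 s)\<^sup>2) \<partial>lborel) = (\<integral>\<^sup>+s\<in>{0<..}. ennreal (c * c) * ennreal (k T0 s * k T0 s) \<partial>lborel)"
  proof (intro nn_integral_cong)
    fix s
    show "ennreal ((c * k T0 s)\<^sup>2) * indicator {0..T0} s = ennreal (c * c) * ennreal (k T0 s * k T0 s) * indicator {0<..} s"
      using k_outside[of s T0] k_nonneg[of T0 s]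
      by (cases "0 < s \<and> s < T0") (auto simp: power2_eq_square mult_ac split: split_indicator simp flip: ennreal_mult)
  qed
  also have "\<dots> = ennreal (c * c) * ennreal (kappa * R T0 T0)"
    using T0 by (subst set_nn_cmult) (auto simp: nn_k_k_full)
  also have "\<dots> = ennreal (c * c * (kappa * R T0 T0))" using kappa_pos RT by (simp add: ennreal_mult)
  finally have k2: "(\<integral>\<^sup>+s\<in>{0..T0}. ennreal ((c * k T0 s)\<^sup>2) \<partial>lborel) = ennreal (c * c * (kappa * R T0 T0))" .
  have X2: "(\<integral>\<^sup>+\<omega>. ennreal ((X T0 \<omega>)\<^sup>2) \<partial>N) = ennreal (R T0 T0)"
  proof -
    have "(\<integral>\<^sup>+\<omega>. ennreal ((X T0 \<omega>)\<^sup>2) \<partial>N) = ennreal (N.expectation (\<lambda>\<omega>. (X T0 \<omega>)\<^sup>2))"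
      using sq[OF XR T] by (intro nn_integral_eq_integral) auto
    then show ?thesis using XR T by (auto simp: centered_gaussian_process_def power2_eq_square)
  qed
  \<comment> \<open>The variance at the single time \<open>T0\<close> determines the square of
    \<open>c\<close>, because \<open>R T0 T0\<close> is positive.\<close>
  have "(\<integral>\<^sup>+\<omega>. ennreal ((X T0 \<omega>)\<^sup>2) \<partial>N) = (\<integral>\<^sup>+s\<in>{0..T0}. ennreal ((c * k T0 s)\<^sup>2) \<partial>lborel)"
  proof (rule N.wiener_isometry[OF W'])
    show "N.pairing_eq {0..T0} (B s) (indicator {0<..s}) (B s') (indicator {0<..s'})" if "s \<in> {0..T0}" "s' \<in> {0..T0}" for s s'
      using sq[OF B] cov that by (intro N.brownian_pairing_eq) auto
  qed (use sq[OF B] k2 X2 in auto)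
  then have "c * c * (kappa * R T0 T0) = R T0 T0"
    using k2 X2 kappa_pos RT by (simp add: ennreal_inj)
  then have "c * c * kappa * R T0 T0 = 1 * R T0 T0" by (simp only: mult.assoc mult_1)
  then have "c * c * kappa = 1" using RT by (simp only: mult_cancel_right) auto
  then have "c * c * kappa = cst * cst * kappa" using cst(2) by simp
  then have "c\<^sup>2 = cst\<^sup>2" using kappa_pos by (simp add: power2_eq_square)
  then show "c = cst" using c cst(1) by (simp add: power2_eq_iff_nonneg)
qed

text \<open>\<open>D2\<close> is minus the derivative of \<open>kb\<close>, which turns the minus
  sign between the two integrals of \<open>Lambda\<close> into the plus sign in
  \<open>L\<close>.\<close>

lemma Lambda_eq:
  assumes c: "fbm_const (1/2 - a) = cst"
  shows "Lambda (1/2 - a) f t = cst * L f t"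
proof -
  have d1: "deriv (\<lambda>s. K1 (1/2 - a) t s) s = cst * D1 t s" if "s \<in> {0<..<t}" for s
  proof (rule DERIV_imp_deriv)
    have "\<forall>\<^sub>F u in nhds s. u \<in> {0<..<t}" using that by (intro eventually_nhds_in_open) auto
    then have "\<forall>\<^sub>F u in nhds s. cst * ka t u = K1 (1/2 - a) t u"
      by eventually_elim (simp add: K1_def c kernel1_eq)
    moreover have "((\<lambda>s. cst * ka t s) has_real_derivative cst * D1 t s) (at s)"
      using that by (intro DERIV_cmult ka_deriv2) auto
    ultimately show "((\<lambda>s. K1 (1/2 - a) t s) has_real_derivative cst * D1 t s) (at s)"
      by (subst (asm) DERIV_cong_ev[OF refl _ refl])
  qed
  have d2: "deriv (\<lambda>s. K2 (1/2 - a) t s) s = cst * - D2 t s" if "s \<in> {0<..<t}" for s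
  proof (rule DERIV_imp_deriv)
    have "\<forall>\<^sub>F u in nhds s. u \<in> {0<..<t}" using that by (intro eventually_nhds_in_open) auto
    then have "\<forall>\<^sub>F u in nhds s. cst * kb t u = K2 (1/2 - a) t u"
      by eventually_elim (simp add: K2_def c kernel2_eq)
    moreover have "((\<lambda>s. cst * kb t s) has_real_derivative cst * - D2 t s) (at s)"
      using that by (intro DERIV_cmult kb_deriv2) auto
    ultimately show "((\<lambda>s. K2 (1/2 - a) t s) has_real_derivative cst * - D2 t s) (at s)"
      by (subst (asm) DERIV_cong_ev[OF refl _ refl])
  qed
  have "(LBINT s:{0<..<t}. (f t - f s) * deriv (\<lambda>s. K1 (1/2 - a) t s) s) = (LBINT s:{0<..<t}. cst * ((f t - f s) * D1 t s))"
    by (intro set_lebesgue_integral_cong) (auto simp: d1 simp del: set_integral_mult_right)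
  moreover have "(LBINT s:{0<..<t}. deriv (\<lambda>s. K2 (1/2 - a) t s) s * f s) = (LBINT s:{0<..<t}. (- cst) * (f s * D2 t s))"
    by (intro set_lebesgue_integral_cong) (auto simp: d2 simp del: set_integral_mult_right)
  ultimately show ?thesis unfolding Lambda_def L_def by (simp only: set_integral_mult_right) (simp add: algebra_simps)
qed

end

theorem theorem2p1:
  fixes M :: "'a measure" and H T :: real and BH :: "real \<Rightarrow> 'a \<Rightarrow> real"
  assumes "prob_space M"
    and "0 < H" and "H < 1/2" and "0 < T"
    and "fractional_brownian_motion M H T BH"
  shows "\<exists>B. standard_brownian_motion M T B \<and>
    (AE \<omega> in M. (\<lambda>t. B t \<omega>) \<in> Lambda_dom H T \<and>
       (\<forall>t\<in>{0..T}. BH t \<omega> = Lambda H (\<lambda>s. B s \<omega>) t))"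
proof -
  define a where "a = 1/2 - H"
  have H: "H = 1/2 - a" by (simp add: a_def)
  interpret fbm_kernel a using assms by unfold_locales (auto simp: a_def)
  interpret prob_space M by (rule assms)
  have BH: "centered_gaussian_process M T R BH" using assms(5) unfolding H fractional_brownian_motion_iff .
  obtain X where X: "\<And>t. X t \<in> borel_measurable M" "\<And>\<omega>. continuous_on UNIV (\<lambda>t. X t \<omega>)"
    "AE \<omega> in M. \<forall>t\<in>{0..T}. X t \<omega> = BH t \<omega>" "\<And>t \<omega>. X t \<omega> = X (max 0 (min T t)) \<omega>"
    "centered_gaussian_process M T R X"
    using continuous_modification[OF BH] assms(4) by auto
  \<comment> \<open>The factor \<open>sqrt kappa\<close> is the reciprocal of the constant in
    \<open>Lambda\<close>; clamping the time extends the paths continuously to the whole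
    line.\<close>
  define B where "B t \<omega> = sqrt kappa * A0 (\<lambda>s. X s \<omega>) (max 0 (min T t))" for t \<omega>
  note bm = brownian_of_fbm[OF assms(1,4) X(5,1,2,4), folded B_def]
  have clampB: "B t \<omega> = B (max 0 (min T t)) \<omega>" for t \<omega> using assms(4) by (simp add: B_def)
  define \<alpha> where "\<alpha> = (a + 1/2) / 2"
  have \<alpha>: "a < \<alpha>" "0 < \<alpha>" "\<alpha> < 1/2" using a0 a1 by (auto simp: \<alpha>_def)
  have holB: "AE \<omega> in M. \<exists>C. \<forall>x\<in>{0..T}. \<forall>y\<in>{0..T}. \<bar>B x \<omega> - B y \<omega>\<bar> \<le> C * \<bar>x - y\<bar> powr \<alpha>"
    by (rule centered_gaussian_process_hoelder[OF bm(1) clampB assms(4) bm(3), where h="1/2"]) (use \<alpha> in \<open>auto simp: min_def\<close>)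
  \<comment> \<open>The order \<open>H / 2\<close> serves only to give a bound
    \<open>O(s powr \<delta>)\<close> at \<open>0\<close> with some positive
    \<open>\<delta>\<close>; regularity above \<open>a\<close> is required of \<open>B\<close>
    alone.\<close>
  have holX: "AE \<omega> in M. \<exists>C. \<forall>x\<in>{0..T}. \<forall>y\<in>{0..T}. \<bar>X x \<omega> - X y \<omega>\<bar> \<le> C * \<bar>x - y\<bar> powr (H / 2)"
  proof (rule centered_gaussian_process_hoelder[OF X(5,4) assms(4) X(2), where h=H])
    have "2 * H = 1 - 2 * a" by (simp add: H)
    then show "R t t - 2 * R t s + R s s = \<bar>t - s\<bar> powr (2 * H)" for s t by (simp only: R_increment)
  qed (use assms in auto)
  have X0: "AE \<omega> in M. X 0 \<omega> = 0"
    using centered_gaussian_process_zero[OF X(5), of 0] assms(4) R_props(2)[of 0] by auto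
  have "fbm_const (1/2 - a) = cst" by (rule fbm_const_eq[OF assms(1,4) BH])
  note Lambda = Lambda_eq[OF this]
  have "AE \<omega> in M. (\<lambda>t. B t \<omega>) \<in> Lambda_dom H T \<and> (\<forall>t\<in>{0..T}. BH t \<omega> = Lambda H (\<lambda>s. B s \<omega>) t)"
    using holB holX X0 X(3)
  proof eventually_elim
    case (elim \<omega>)
    let ?g = "\<lambda>s. X s \<omega>"
    obtain C where C: "\<And>x y. x \<in> {0..T} \<Longrightarrow> y \<in> {0..T} \<Longrightarrow> \<bar>B x \<omega> - B y \<omega>\<bar> \<le> C * \<bar>x - y\<bar> powr \<alpha>"
      using elim(1) by blast
    obtain C' where C': "\<And>x y. x \<in> {0..T} \<Longrightarrow> y \<in> {0..T} \<Longrightarrow> \<bar>X x \<omega> - X y \<omega>\<bar> \<le> C' * \<bar>x - y\<bar> powr (H / 2)"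
      using elim(2) by blast
    have B: "B t \<omega> = sqrt kappa * A0 ?g t" if "t \<in> {0..T}" for t
      using that by (simp add: B_def)
    have "(\<lambda>t. B t \<omega>) \<in> Lambda_dom H T"
      unfolding Lambda_dom_def holder_on_def mem_Collect_eq
    proof (intro conjI exI ballI)
      show "B 0 \<omega> = 0" using assms(4) by (simp add: B_def A0_def)
      show "1/2 - H < \<alpha>" "\<alpha> < 1/2" using \<alpha> by (auto simp: H)
    qed (rule C)
    moreover have "BH t \<omega> = Lambda H (\<lambda>s. B s \<omega>) t" if t: "t \<in> {0..T}" for t
    proof -
      have "L (A0 ?g) t = ?g t"
      proof (rule L_A0_path[OF X(2), where \<delta>="H / 2" and \<alpha>=\<alpha> and C=C' and C'="cst * C" and T=T])
        show "\<bar>X s \<omega>\<bar> \<le> C' * s powr (H / 2)" if "0 \<le> s" "s \<le> T" for s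
          using C'[of s 0] that elim(3) by simp
        fix x y assume xy: "x \<in> {0..T}" "y \<in> {0..T}"
        have A: "A0 ?g x = cst * B x \<omega>" if "x \<in> {0..T}" for x
        proof -
          have "A0 ?g x = (sqrt kappa * cst) * A0 ?g x" by (simp only: cst mult_1)
          then show ?thesis using B[OF that] by (simp only: mult_ac)
        qed
        have "\<bar>A0 ?g x - A0 ?g y\<bar> = cst * \<bar>B x \<omega> - B y \<omega>\<bar>"
          unfolding A[OF xy(1)] A[OF xy(2)] using cst(1) by (simp add: abs_mult flip: right_diff_distrib)
        also have "\<dots> \<le> cst * (C * \<bar>x - y\<bar> powr \<alpha>)" using C[OF xy] cst(1) by (intro mult_left_mono) auto
        finally show "\<bar>A0 ?g x - A0 ?g y\<bar> \<le> cst * C * \<bar>x - y\<bar> powr \<alpha>" by (simp only: mult.assoc)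
      qed (use assms \<alpha> t in auto)
      then have "X t \<omega> = (sqrt kappa * cst) * L (A0 ?g) t" by (simp only: cst mult_1)
      also have "\<dots> = cst * L (\<lambda>s. sqrt kappa * A0 ?g s) t" by (simp only: L_cmult mult_ac)
      also have "L (\<lambda>s. sqrt kappa * A0 ?g s) t = L (\<lambda>s. B s \<omega>) t"
        using t B by (intro L_cong) auto
      finally show ?thesis using elim(4) t unfolding H Lambda by auto
    qed
    ultimately show ?case by blast
  qed
  with bm(1) show ?thesis unfolding standard_brownian_motion_def by blast
qed

end
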